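(* For every integer $N\ge 1$, the map $$\chi_N=(I_1,\dots,I_N,L_1,\dots,L_N;\varphi_1,\dots,\varphi_N,\theta_1,\dots,\theta_N)$$ is a diffeomorphism from $\mathcal M(N)_{\rm gen}$ onto $\Omega_N\times\mathbb T^{2N}$, where $$\Omega_N=\{(I_1,\dots,I_N,L_1,\dots,L_N)\in\mathbb R^{2N}:\ I_1>L_1>I_2>L_2>\dots>I_N>L_N>0\},$$ and it is symplectic in the sense that $$\chi_{N*}\omega=\sum_{j=1}^N dI_j\wedge d\varphi_j+\sum_{m=1}^N dL_m\wedge d\theta_m .$$
   Context: $L^2_+$ is the Hardy space of the circle: functions $u=\sum_{k\ge0}\hat u(k)e^{ik\theta}$ with $\sum_k|\hat u(k)|^2<\infty$, identified with holomorphic functions $u(z)=\sum_{k\ge0}\hat u(k)z^k$ on the unit disc; $(u|v)=\int_0^{2\pi}u\bar v\,\frac{d\theta}{2\pi}$; $H^s_+=H^s(\mathbb S^1)\cap L^2_+$. $\Pi$ is the Szegő projector (orthogonal projection of $L^2(\mathbb S^1)$ onto $L^2_+$). For $u\in H^{1/2}_+$, the Hankel operator is the antilinear operator $H_u(h)=\Pi(u\bar h)$ on $L^2_+$; $T_z$ denotes multiplication by $z$ on $L^2_+$ and $K_u=H_uT_z$. The operators $H_u^2$ and $K_u^2=H_u^2-(\cdot|u)u$ are $\mathbb C$-linear, positive, self-adjoint and trace class. $L^2_+$ carries the symplectic form $\omega(u,v)=4\,\mathrm{Im}(u|v)$. $\mathcal M(N)$ is the set of rational functions $u=A/B$ with $A\in\mathbb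 C_{N-1}[z]$, $B\in\mathbb C_N[z]$, $B(0)=1$, $\deg A=N-1$ or $\deg B=N$, $A,B$ coprime, $B(z)\ne0$ for $|z|\le1$ (equivalently, $H_u$ has rank $N$); it is a $2N$-dimensional complex submanifold of $L^2_+$, symplectic for (the restriction of) $\omega$. $\mathcal M(N)_{\rm gen}$ is the set of $u\in\mathcal M(N)$ such that $1\notin\mathrm{Ran}\,H_u$ and $H_u^{2k}(1)$, $k=1,\dots,N$, are linearly independent; equivalently, $H_u^2$ has $N$ simple positive eigenvalues $\lambda_1^2>\dots>\lambda_N^2$ ($\lambda_j>0$) and, with $P_j$ the orthogonal projector on the eigenspace of $\lambda_j^2$ and $\nu_j:=\|P_j(1)\|$, one has $\nu_j>0$ for all $j$ and $\sum_j\nu_j^2<1$. For $u\in\mathcal M(N)_{\rm gen}$: $(e_1,\dots,e_N)$ is an orthonormal basis of $\mathrm{Ran}\,H_u$ with $H_u(e_j)=\lambda_je_j$ (unique up to signs), and $\varphi_j:=\arg\,(1|e_j)^2$. The operator $K_u^2$ has exactly $N$ positive eigenvalues, all simple, $\mu_1^2>\dots>\mu_N^2$ ($\mu_m>0$), with $\mathrm{Ran}\,K_u=\mathrm{Ran}\,H_u$; $(f_1,\dots,f_N)$ is an orthonormal basis of $\mathrm{Ran}\,K_u$ with $K_u(f_m)=\mu_mf_m$ (unique up to signs), and $\theta_m:=\arg\,(u|f_m)^2$. Finally $I_j:=2\lambda_j^2$, $L_m:=2\mu_m^2$. *)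

theory Defs
  imports "HOL-Analysis.Analysis" "HOL-Computational_Algebra.Computational_Algebra"
begin

fun iter_dd :: "'a::real_normed_vector list \<Rightarrow> ('a \<Rightarrow> 'b::real_normed_vector) \<Rightarrow> ('a \<Rightarrow> 'b)" where
  "iter_dd [] f = f"
| "iter_dd (v # vs) f = (\<lambda>x. frechet_derivative (iter_dd vs f) (at x) v)"

definition smooth_on :: "'a::real_normed_vector set \<Rightarrow> ('a \<Rightarrow> 'b::real_normed_vector) \<Rightarrow> bool" where
  "smooth_on S f \<longleftrightarrow> (\<forall>vs. \<forall>x\<in>S. iter_dd vs f differentiable (at x))"

text \<open>An element u of L2_+ is represented by its sequence of Fourier
  coefficients (u hat k), k \<ge> 0.\<close>
definition l2p :: "(nat \<Rightarrow> complex) set" where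
  "l2p = {h. summable (\<lambda>k. (cmod (h k))\<^sup>2)}"

definition hinner :: "(nat \<Rightarrow> complex) \<Rightarrow> (nat \<Rightarrow> complex) \<Rightarrow> complex" where
  "hinner u v = (\<Sum>k. u k * cnj (v k))"

definition hsqnorm :: "(nat \<Rightarrow> complex) \<Rightarrow> real" where
  "hsqnorm h = (\<Sum>k. (cmod (h k))\<^sup>2)"

definition one_l2 :: "nat \<Rightarrow> complex" where
  "one_l2 = (\<lambda>k. if k = 0 then 1 else 0)"

text \<open>Hankel operator: the n-th coefficient of Pi(u conj h) is
  sum over k of u hat (n+k) times conj (h hat k).\<close>
definition hankel :: "(nat \<Rightarrow> complex) \<Rightarrow> (nat \<Rightarrow> complex) \<Rightarrow> (nat \<Rightarrow> complex)" where
  "hankel u h = (\<lambda>n. \<Sum>k. u (n + k) * cnj (h k))"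

definition shiftz :: "(nat \<Rightarrow> complex) \<Rightarrow> (nat \<Rightarrow> complex)" where
  "shiftz h = (\<lambda>n. if n = 0 then 0 else h (n - 1))"

definition kop :: "(nat \<Rightarrow> complex) \<Rightarrow> (nat \<Rightarrow> complex) \<Rightarrow> (nat \<Rightarrow> complex)" where
  "kop u h = hankel u (shiftz h)"

text \<open>Parametrisation: N = CARD('n), ix is a fixed enumeration of 'n by {0..<N}.
  a gives the coefficients of A (a \$ i is the coefficient of z^(ix i)), b those of
  B (b \$ i is the coefficient of z^(ix i + 1)), constant coefficient of B is 1.\<close>
definition polyA :: "('n::finite \<Rightarrow> nat) \<Rightarrow> complex^'n \<Rightarrow> complex poly" where
  "polyA ix a = (\<Sum>i\<in>UNIV. monom (a $ i) (ix i))"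

definition polyB :: "('n::finite \<Rightarrow> nat) \<Rightarrow> complex^'n \<Rightarrow> complex poly" where
  "polyB ix b = 1 + (\<Sum>i\<in>UNIV. monom (b $ i) (ix i + 1))"

definition ratfun :: "('n::finite \<Rightarrow> nat) \<Rightarrow> (complex^'n) \<times> (complex^'n) \<Rightarrow> (nat \<Rightarrow> complex)" where
  "ratfun ix p = (\<lambda>n. fps_nth (fps_of_poly (polyA ix (fst p)) / fps_of_poly (polyB ix (snd p))) n)"

definition paramsM :: "('n::finite \<Rightarrow> nat) \<Rightarrow> ((complex^'n) \<times> (complex^'n)) set" where
  "paramsM ix = {(a, b).
     (degree (polyA ix a) = CARD('n) - 1 \<or> degree (polyB ix b) = CARD('n)) \<and>
     coprime (polyA ix a) (polyB ix b) \<and>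
     (\<forall>z. cmod z \<le> 1 \<longrightarrow> poly (polyB ix b) z \<noteq> 0)}"

definition generic :: "nat \<Rightarrow> (nat \<Rightarrow> complex) \<Rightarrow> bool" where
  "generic N u \<longleftrightarrow>
     one_l2 \<notin> hankel u ` l2p \<and>
     (\<forall>c :: nat \<Rightarrow> complex.
        (\<forall>n. (\<Sum>k\<in>{1..N}. c k * (((hankel u) ^^ (2 * k)) one_l2) n) = 0)
        \<longrightarrow> (\<forall>k\<in>{1..N}. c k = 0))"

definition gen_params :: "('n::finite \<Rightarrow> nat) \<Rightarrow> ((complex^'n) \<times> (complex^'n)) set" where
  "gen_params ix = {p \<in> paramsM ix. generic CARD('n) (ratfun ix p)}"

definition eigsH :: "(nat \<Rightarrow> complex) \<Rightarrow> real set" where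
  "eigsH u = {s. s > 0 \<and> (\<exists>h\<in>l2p. h \<noteq> (\<lambda>_. 0) \<and>
                 hankel u (hankel u h) = (\<lambda>n. complex_of_real s * h n))}"

definition eigsK :: "(nat \<Rightarrow> complex) \<Rightarrow> real set" where
  "eigsK u = {s. s > 0 \<and> (\<exists>h\<in>l2p. h \<noteq> (\<lambda>_. 0) \<and>
                 kop u (kop u h) = (\<lambda>n. complex_of_real s * h n))}"

text \<open>lamsq u j = lambda_(j+1)^2, the (j+1)-th largest eigenvalue (0-based j).\<close>
definition lamsq :: "(nat \<Rightarrow> complex) \<Rightarrow> nat \<Rightarrow> real" where
  "lamsq u j = rev (sorted_list_of_set (eigsH u)) ! j"

definition musq :: "(nat \<Rightarrow> complex) \<Rightarrow> nat \<Rightarrow> real" where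
  "musq u j = rev (sorted_list_of_set (eigsK u)) ! j"

text \<open>exp(i phi_(j+1)) where phi = arg (1|e)^2, with H_u e = lambda e, norm e = 1;
  (1|e) = conj (e hat 0).\<close>
definition phase_phi :: "(nat \<Rightarrow> complex) \<Rightarrow> nat \<Rightarrow> complex" where
  "phase_phi u j = (SOME w. \<exists>e\<in>l2p. hsqnorm e = 1 \<and>
      hankel u e = (\<lambda>n. complex_of_real (sqrt (lamsq u j)) * e n) \<and>
      w = sgn ((hinner one_l2 e)\<^sup>2))"

text \<open>exp(i theta_(m+1)) where theta = arg (u|f)^2, K_u f = mu f, norm f = 1.\<close>
definition phase_theta :: "(nat \<Rightarrow> complex) \<Rightarrow> nat \<Rightarrow> complex" where
  "phase_theta u j = (SOME w. \<exists>f\<in>l2p. hsqnorm f = 1 \<and>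
      kop u f = (\<lambda>n. complex_of_real (sqrt (musq u j)) * f n) \<and>
      w = sgn ((hinner u f)\<^sup>2))"

text \<open>The map chi_N in the coordinates (a,b) on M(N), with the torus
  T^(2N) realised as (S^1)^(2N) inside C^(2N):
  ((I, L), (exp(i phi), exp(i theta))).\<close>
definition chi_coord :: "('n::finite \<Rightarrow> nat) \<Rightarrow> (complex^'n) \<times> (complex^'n)
     \<Rightarrow> ((real^'n) \<times> (real^'n)) \<times> ((complex^'n) \<times> (complex^'n))" where
  "chi_coord ix p =
     (let u = ratfun ix p in
      ((\<chi> i. 2 * lamsq u (ix i), \<chi> i. 2 * musq u (ix i)),
       (\<chi> i. phase_phi u (ix i), \<chi> i. phase_theta u (ix i))))"

definition OmegaN :: "('n::finite \<Rightarrow> nat) \<Rightarrow> ((real^'n) \<times> (real^'n)) set" where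
  "OmegaN ix = {(I, L). (\<forall>i. I $ i > L $ i \<and> L $ i > 0) \<and>
                        (\<forall>i i'. ix i' = Suc (ix i) \<longrightarrow> L $ i > I $ i')}"

definition torusN :: "((complex^'n) \<times> (complex^'n)) set" where
  "torusN = {(w, z). \<forall>i. cmod (w $ i) = 1 \<and> cmod (z $ i) = 1}"

definition cover :: "((real^'n) \<times> (real^'n)) \<times> ((real^'n) \<times> (real^'n))
     \<Rightarrow> ((real^'n) \<times> (real^'n)) \<times> ((complex^'n) \<times> (complex^'n))" where
  "cover x = (fst x, ((\<chi> i. cis (fst (snd x) $ i)), (\<chi> i. cis (snd (snd x) $ i))))"

text \<open>omega(u,v) = 4 Im (u|v) on tangent vectors, pulled back by the
  parametrisation p \<mapsto> ratfun ix p (tangent vectors computed coefficientwise).\<close>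
definition omega_pull :: "('n::finite \<Rightarrow> nat) \<Rightarrow> (complex^'n) \<times> (complex^'n)
     \<Rightarrow> (complex^'n) \<times> (complex^'n) \<Rightarrow> (complex^'n) \<times> (complex^'n) \<Rightarrow> real" where
  "omega_pull ix p h k =
     4 * Im (hinner (\<lambda>n. frechet_derivative (\<lambda>q. ratfun ix q n) (at p) h)
                    (\<lambda>n. frechet_derivative (\<lambda>q. ratfun ix q n) (at p) k))"

text \<open>Differential of a real coordinate, and of an angle coordinate given by
  its unit complex number w = exp(i phi): d phi = Im (dw / w).\<close>
definition dreal :: "('a::real_normed_vector \<Rightarrow> real) \<Rightarrow> 'a \<Rightarrow> 'a \<Rightarrow> real" where
  "dreal f p h = frechet_derivative f (at p) h"

definition dangle :: "('a::real_normed_vector \<Rightarrow> complex) \<Rightarrow> 'a \<Rightarrow> 'a \<Rightarrow> real" where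
  "dangle w p h = Im (frechet_derivative w (at p) h / w p)"

text \<open>Pull-back by chi_N of sum_j dI_j /\ dphi_j + sum_m dL_m /\ dtheta_m,
  with (alpha /\ beta)(h,k) = alpha(h) beta(k) - alpha(k) beta(h).\<close>
definition sympl_pull :: "('n::finite \<Rightarrow> nat) \<Rightarrow> (complex^'n) \<times> (complex^'n)
     \<Rightarrow> (complex^'n) \<times> (complex^'n) \<Rightarrow> (complex^'n) \<times> (complex^'n) \<Rightarrow> real" where
  "sympl_pull ix p h k =
     (\<Sum>i\<in>UNIV.
        let I = (\<lambda>q. fst (fst (chi_coord ix q)) $ i);
            L = (\<lambda>q. snd (fst (chi_coord ix q)) $ i);
            P = (\<lambda>q. fst (snd (chi_coord ix q)) $ i);
            T = (\<lambda>q. snd (snd (chi_coord ix q)) $ i)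
        in (dreal I p h * dangle P p k - dreal I p k * dangle P p h)
         + (dreal L p h * dangle T p k - dreal L p k * dangle T p h))"

end

theory Submission
  imports Defs "HOL-Computational_Algebra.Field_as_Ring"
begin

text \<open>
  The inverse of \<open>\<chi>\<^sub>N\<close> is explicit. With \<open>\<alpha>\<^sub>j = \<lambda>\<^sub>j exp(i \<phi>\<^sub>j)\<close>, \<open>\<beta>\<^sub>m = \<mu>\<^sub>m exp(-i \<theta>\<^sub>m)\<close> and the
  \<open>N \<times> N\<close> matrix \<open>D(z)\<close> with entries \<open>(\<alpha>\<^sub>j - z \<beta>\<^sub>m) / (\<lambda>\<^sub>j\<^sup>2 - \<mu>\<^sub>m\<^sup>2)\<close>, the symbol is the sum of the
  components \<open>\<eta>\<^sub>m(z)\<close> of the solution of \<open>D(z) \<eta>(z) = (1, \<dots>, 1)\<close>. Orthogonality relations for Cauchy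
  matrices of interlacing sequences show that \<open>\<eta>\<^sub>m\<close> and \<open>\<epsilon>\<^sub>j = \<Sum>\<^sub>m \<eta>\<^sub>m / (\<lambda>\<^sub>j\<^sup>2 - \<mu>\<^sub>m\<^sup>2)\<close> are orthogonal
  systems in which \<open>K\<^sub>u\<close> and \<open>H\<^sub>u\<close> are diagonal (as antilinear operators), with entries \<open>\<beta>\<^sub>m\<close> and
  \<open>\<alpha>\<^sub>j\<close>. Conversely, diagonalising \<open>H\<^sub>u\<close> and the rank one perturbation \<open>K\<^sub>u\<^sup>2\<close> of \<open>H\<^sub>u\<^sup>2\<close> for a generic
  \<open>u\<close> produces such a system, and the identity \<open>H\<^sub>u e = (u|e) + z K\<^sub>u e\<close> recovers \<open>D(z) \<eta>(z) = 1\<close>.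

  Differentiating \<open>D \<eta> = 1\<close> gives \<open>\<partial>u/\<partial>\<phi>\<^sub>j\<close> as a multiple of \<open>\<epsilon>\<^sub>j\<^sup>2\<close> and \<open>\<partial>u/\<partial>\<theta>\<^sub>m\<close> as a multiple of
  \<open>z \<eta>\<^sub>m\<^sup>2\<close>. Pairing with these is evaluating a Hankel form at an eigenvector, so that first order
  perturbation theory yields \<open>\<omega>(\<cdot>, \<partial>\<^sub>\<phi>\<^sub>j) = dI\<^sub>j\<close> and \<open>\<omega>(\<cdot>, \<partial>\<^sub>\<theta>\<^sub>m) = dL\<^sub>m\<close>. As \<open>\<omega>\<close> is closed, its values on
  pairs of action directions do not depend on the angles, and at zero angles they vanish since \<open>u\<close>
  then has real coefficients. In particular the inverse map is an immersion; it is locally injective,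
  hence open by invariance of domain, and \<open>\<chi>\<^sub>N\<close> inherits its smoothness.\<close>

text \<open>The definition of \<open>chi_coord\<close> goes through sorted eigenvalues and a choice
  of eigenvectors, so its smoothness has to come from an inverse map that is explicit enough to
  differentiate. The matrix D(z) is forced: K^2 being a rank one perturbation of H^2, the
  eigenvector \<open>et j\<close> of H^2 has Cauchy coordinates 1/(s_j - t_m) in an eigenbasis of
  K^2, and then H e = (u|e) + z K e becomes a linear system whose entries only involve
  \<open>al j\<close> and \<open>be m\<close>. The delicate point is the invertibility of D(z) up to
  the boundary of the disc: inside, a weighted norm contracts; on the circle the same identity only
  makes a coordinate sum vanish, and the simplicity of the spectrum enters through a Vandermonde
  argument. Invertibility on the closed disc yields coefficients with geometric decay. Almost all
  the analysis stays within such series, where products, inverses and termwise differentiation can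
  be controlled. The torus is handled through its universal cover, so that the angles are real
  coordinates and local injectivity is that of \<open>cis\<close>.\<close>

no_notation fps_nth (infixl "$" 75)

section \<open>Smooth maps\<close>

lemma has_derivative_cong_open:
  assumes "open S" "x \<in> S" "\<And>y. y \<in> S \<Longrightarrow> f y = g y"
  shows "(f has_derivative D) (at x) \<longleftrightarrow> (g has_derivative D) (at x)"
  using assms has_derivative_transform_within_open[of f D x UNIV S g]
    has_derivative_transform_within_open[of g D x UNIV S f] by auto

lemma frechet_derivative_cong_open:
  assumes "open S" "x \<in> S" "\<And>y. y \<in> S \<Longrightarrow> f y = g y"
  shows "frechet_derivative f (at x) = frechet_derivative g (at x)"
  using has_derivative_cong_open[OF assms] by (simp add: frechet_derivative_def)

lemma differentiable_cong_open:
  assumes "open S" "x \<in> S" "\<And>y. y \<in> S \<Longrightarrow> f y = g y"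
  shows "f differentiable (at x) \<longleftrightarrow> g differentiable (at x)"
  using has_derivative_cong_open[OF assms] by (simp add: differentiable_def)

text \<open>It suffices to exhibit a class of functions stable under directional derivatives: by
  induction on the list of directions, every iterated derivative agrees on \<open>S\<close> with a
  member of the class. Agreement on \<open>S\<close> is enough because \<open>S\<close> is open. The
  basic smoothness proofs below consist in choosing such a class.\<close>

lemma smooth_on_coinduct:
  assumes S: "open S" and Pf: "P f"
    and step: "\<And>f. P f \<Longrightarrow> (\<forall>x\<in>S. f differentiable (at x)) \<and>
          (\<forall>v. \<exists>g. P g \<and> (\<forall>x\<in>S. frechet_derivative f (at x) v = g x))"
  shows "smooth_on S f"
proof -
  have *: "\<exists>g. P g \<and> (\<forall>x\<in>S. iter_dd vs f x = g x)" for vs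
  proof (induction vs)
    case Nil
    show ?case using Pf by auto
  next
    case (Cons v vs)
    then obtain g where g: "P g" "\<forall>x\<in>S. iter_dd vs f x = g x" by blast
    from step[OF g(1)] obtain h where h: "P h" "\<forall>x\<in>S. frechet_derivative g (at x) v = h x" by blast
    have "iter_dd (v # vs) f x = h x" if "x \<in> S" for x
      using frechet_derivative_cong_open[OF S that, of "iter_dd vs f" g] g(2) h(2) that by simp
    with h(1) show ?case by blast
  qed
  show ?thesis unfolding smooth_on_def
  proof (intro allI ballI)
    fix vs x assume x: "x \<in> S"
    from *[of vs] obtain g where g: "P g" "\<forall>x\<in>S. iter_dd vs f x = g x" by blast
    with step[OF g(1)] x show "iter_dd vs f differentiable (at x)"
      using differentiable_cong_open[OF S x, of "iter_dd vs f" g] by simp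
  qed
qed

text \<open>The head of the list is the outermost derivative; peeling off the last direction instead
  exhibits an iterated derivative of a first derivative.\<close>

lemma iter_dd_snoc: "iter_dd (vs @ [v]) f = iter_dd vs (\<lambda>x. frechet_derivative f (at x) v)"
  by (induction vs) auto

lemma smooth_on_frechet_derivative:
  "smooth_on S f \<Longrightarrow> smooth_on S (\<lambda>x. frechet_derivative f (at x) v)"
  unfolding smooth_on_def by (metis iter_dd_snoc)

lemma smooth_on_imp_differentiable: "smooth_on S f \<Longrightarrow> x \<in> S \<Longrightarrow> f differentiable (at x)"
  unfolding smooth_on_def by (metis iter_dd.simps(1))

lemma smooth_on_subset: "smooth_on S f \<Longrightarrow> T \<subseteq> S \<Longrightarrow> smooth_on T f"
  unfolding smooth_on_def by blast

lemma smooth_on_imp_has_derivative: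
  "smooth_on S f \<Longrightarrow> x \<in> S \<Longrightarrow> (f has_derivative frechet_derivative f (at x)) (at x)"
  using smooth_on_imp_differentiable frechet_derivative_works by blast

lemma smooth_on_imp_continuous_on: "smooth_on S f \<Longrightarrow> continuous_on S f"
  by (intro continuous_at_imp_continuous_on ballI differentiable_imp_continuous_within)
    (rule smooth_on_imp_differentiable)

lemma frechet_derivative_eqI: "(f has_derivative f') (at x) \<Longrightarrow> frechet_derivative f (at x) v = f' v"
  using frechet_derivative_at by fastforce

lemma smooth_on_cong:
  assumes "open S" "smooth_on S f" "\<And>x. x \<in> S \<Longrightarrow> f x = g x"
  shows "smooth_on S g"
proof (rule smooth_on_coinduct[where P="\<lambda>h. \<exists>k. smooth_on S k \<and> (\<forall>x\<in>S. k x = h x)"])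
  show "open S" by fact
  show "\<exists>k. smooth_on S k \<and> (\<forall>x\<in>S. k x = g x)" using assms by blast
  fix h assume "\<exists>k. smooth_on S k \<and> (\<forall>x\<in>S. k x = h x)"
  then obtain k where k: "smooth_on S k" "\<forall>x\<in>S. k x = h x" by blast
  show "(\<forall>x\<in>S. h differentiable at x) \<and> (\<forall>v. \<exists>g. (\<exists>k. smooth_on S k \<and> (\<forall>x\<in>S. k x = g x)) \<and>
            (\<forall>x\<in>S. frechet_derivative h (at x) v = g x))"
  proof (intro conjI ballI allI)
    fix x assume "x \<in> S"
    then show "h differentiable at x"
      using k differentiable_cong_open[OF assms(1), of x k h] smooth_on_imp_differentiable by auto
  next
    fix v
    show "\<exists>g. (\<exists>k. smooth_on S k \<and> (\<forall>x\<in>S. k x = g x)) \<and> (\<forall>x\<in>S. frechet_derivative h (at x) v = g x)"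
      using frechet_derivative_cong_open[OF assms(1), of _ k h] smooth_on_frechet_derivative[OF k(1), of v]  k(2)
      by (intro exI[of _ "\<lambda>x. frechet_derivative k (at x) v"]) auto
  qed
qed

text \<open>\<open>smooth_on\<close> asks at each point for derivatives in the full space, so it is
  a pointwise condition and may be checked on a neighbourhood chosen for each point.\<close>

lemma smooth_on_local:
  assumes "\<And>x. x \<in> S \<Longrightarrow> \<exists>T. x \<in> T \<and> smooth_on T f"
  shows "smooth_on S f"
  using assms unfolding smooth_on_def by blast

lemma smooth_on_const: "open S \<Longrightarrow> smooth_on S (\<lambda>x. c)"
  by (rule smooth_on_coinduct[where P="\<lambda>f. \<exists>c. f = (\<lambda>x. c)"])
    (auto simp: frechet_derivative_const)

lemma smooth_on_bounded_linear_comp: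
  assumes S: "open S" and L: "bounded_linear L" and f: "smooth_on S f"
  shows "smooth_on S (\<lambda>x. L (f x))"
proof (rule smooth_on_coinduct[where P="\<lambda>h. \<exists>f. smooth_on S f \<and> h = (\<lambda>x. L (f x))"])
  show "\<exists>fa. smooth_on S fa \<and> (\<lambda>x. L (f x)) = (\<lambda>x. L (fa x))" using f by blast
  fix h assume "\<exists>f. smooth_on S f \<and> h = (\<lambda>x. L (f x))"
  then obtain f where f: "smooth_on S f" "h = (\<lambda>x. L (f x))" by blast
  have d: "(h has_derivative (\<lambda>v. L (frechet_derivative f (at x) v))) (at x)" if "x \<in> S" for x
    unfolding f(2) by (rule bounded_linear.has_derivative[OF L smooth_on_imp_has_derivative[OF f(1) that]])
  show "(\<forall>x\<in>S. h differentiable at x) \<and> (\<forall>v. \<exists>g. (\<exists>f. smooth_on S f \<and> g = (\<lambda>x. L (f x))) \<and>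
      (\<forall>x\<in>S. frechet_derivative h (at x) v = g x))"
  proof (intro conjI ballI allI)
    fix x assume "x \<in> S" then show "h differentiable at x" using d differentiable_def by blast
  next
    fix v
    show "\<exists>g. (\<exists>f. smooth_on S f \<and> g = (\<lambda>x. L (f x))) \<and> (\<forall>x\<in>S. frechet_derivative h (at x) v = g x)"
      using smooth_on_frechet_derivative[OF f(1), of v] frechet_derivative_eqI[OF d]
      by (intro exI[of _ "\<lambda>x. L (frechet_derivative f (at x) v)"]) auto
  qed
qed fact

lemma smooth_on_id: "open S \<Longrightarrow> smooth_on S (\<lambda>x. x)"
  by (rule smooth_on_coinduct[where P="\<lambda>f. f = (\<lambda>x. x) \<or> (\<exists>c. f = (\<lambda>x. c))"])
    (auto simp: frechet_derivative_const frechet_derivative_ident)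

lemma smooth_on_bounded_linear: "open S \<Longrightarrow> bounded_linear L \<Longrightarrow> smooth_on S L"
  using smooth_on_bounded_linear_comp[OF _ _ smooth_on_id] by auto

lemma smooth_on_add:
  assumes S: "open S" and fg: "smooth_on S f" "smooth_on S g"
  shows "smooth_on S (\<lambda>x. f x + g x)"
proof (rule smooth_on_coinduct[where P="\<lambda>h. \<exists>f g. smooth_on S f \<and> smooth_on S g \<and> h = (\<lambda>x. f x + g x)"])
  show "\<exists>fa ga. smooth_on S fa \<and> smooth_on S ga \<and> (\<lambda>x. f x + g x) = (\<lambda>x. fa x + ga x)" using fg by blast
  fix h :: "'a \<Rightarrow> 'b" assume "\<exists>f g. smooth_on S f \<and> smooth_on S g \<and> h = (\<lambda>x. f x + g x)"
  then obtain f g where f: "smooth_on S f" "smooth_on S g" "h = (\<lambda>x. f x + g x)" by blast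
  have d: "(h has_derivative (\<lambda>v. frechet_derivative f (at x) v + frechet_derivative g (at x) v)) (at x)"
    if "x \<in> S" for x
    unfolding f(3) by (intro has_derivative_add smooth_on_imp_has_derivative[where S=S] f that)
  show "(\<forall>x\<in>S. h differentiable at x) \<and> (\<forall>v. \<exists>k. (\<exists>f g. smooth_on S f \<and> smooth_on S g \<and> k = (\<lambda>x. f x + g x)) \<and>
      (\<forall>x\<in>S. frechet_derivative h (at x) v = k x))"
  proof (intro conjI ballI allI)
    fix x assume "x \<in> S" then show "h differentiable at x" using d differentiable_def by blast
  next
    fix v
    show "\<exists>k. (\<exists>f g. smooth_on S f \<and> smooth_on S g \<and> k = (\<lambda>x. f x + g x)) \<and>
      (\<forall>x\<in>S. frechet_derivative h (at x) v = k x)"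
      using smooth_on_frechet_derivative[OF f(1), of v] smooth_on_frechet_derivative[OF f(2), of v]
        frechet_derivative_eqI[OF d]
      by (intro exI[of _ "\<lambda>x. frechet_derivative f (at x) v + frechet_derivative g (at x) v"]) blast
  qed
qed fact

lemma smooth_on_sum:
  assumes "open S" "\<And>i. i \<in> A \<Longrightarrow> smooth_on S (f i)"
  shows "smooth_on S (\<lambda>x. \<Sum>i\<in>A. f i x)"
  using assms(2)
  by (induction A rule: infinite_finite_induct) (auto intro: smooth_on_const smooth_on_add assms(1))

text \<open>By the Leibniz rule this class is stable under directional derivatives, as required for
  \<open>smooth_on_coinduct\<close>.\<close>

inductive prod_closure :: "('b::real_normed_vector \<Rightarrow> 'c::real_normed_vector \<Rightarrow> 'd::real_normed_vector) \<Rightarrow> 'a::real_normed_vector set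
    \<Rightarrow> ('a \<Rightarrow> 'd) \<Rightarrow> bool"
  for p and S where
  base: "smooth_on S f \<Longrightarrow> smooth_on S g \<Longrightarrow> prod_closure p S (\<lambda>x. p (f x) (g x))"
| add: "prod_closure p S f \<Longrightarrow> prod_closure p S g \<Longrightarrow> prod_closure p S (\<lambda>x. f x + g x)"

lemma smooth_on_bilinear:
  assumes S: "open S" and p: "bounded_bilinear p" and fg: "smooth_on S f" "smooth_on S g"
  shows "smooth_on S (\<lambda>x. p (f x) (g x))"
proof (rule smooth_on_coinduct[where P="prod_closure p S"])
  show "prod_closure p S (\<lambda>x. p (f x) (g x))" using fg by (rule prod_closure.base)
  fix h assume "prod_closure p S h"
  then show "(\<forall>x\<in>S. h differentiable at x) \<and>
         (\<forall>v. \<exists>g. prod_closure p S g \<and> (\<forall>x\<in>S. frechet_derivative h (at x) v = g x))"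
  proof induction
    case (base f g)
    have d: "((\<lambda>x. p (f x) (g x)) has_derivative
        (\<lambda>v. p (f x) (frechet_derivative g (at x) v) + p (frechet_derivative f (at x) v) (g x))) (at x)"
      if "x \<in> S" for x
      by (intro bounded_bilinear.FDERIV[OF p] smooth_on_imp_has_derivative[where S=S] base that)
    show ?case
    proof (intro conjI ballI allI)
      fix x assume "x \<in> S" then show "(\<lambda>x. p (f x) (g x)) differentiable at x"
        using d differentiable_def by blast
    next
      fix v
      have "prod_closure p S (\<lambda>x. p (f x) (frechet_derivative g (at x) v) + p (frechet_derivative f (at x) v) (g x))"
        by (intro prod_closure.add prod_closure.base base smooth_on_frechet_derivative)
      then show "\<exists>k. prod_closure p S k \<and> (\<forall>x\<in>S. frechet_derivative (\<lambda>x. p (f x) (g x)) (at x) v = k x)"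
        using frechet_derivative_eqI[OF d] by blast
    qed
  next
    case (add f g)
    have d: "((\<lambda>x. f x + g x) has_derivative
        (\<lambda>v. frechet_derivative f (at x) v + frechet_derivative g (at x) v)) (at x)"
      if "x \<in> S" for x
      using that add.IH by (intro has_derivative_add) (auto simp flip: frechet_derivative_works)
    show ?case
    proof (intro conjI ballI allI)
      fix x assume "x \<in> S" then show "(\<lambda>x. f x + g x) differentiable at x"
        using d differentiable_def by blast
    next
      fix v
      from add.IH obtain k l where "prod_closure p S k" "prod_closure p S l"
        "\<forall>x\<in>S. frechet_derivative f (at x) v = k x" "\<forall>x\<in>S. frechet_derivative g (at x) v = l x" by blast
      then show "\<exists>k. prod_closure p S k \<and> (\<forall>x\<in>S. frechet_derivative (\<lambda>x. f x + g x) (at x) v = k x)"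
        using frechet_derivative_eqI[OF d] by (intro exI[of _ "\<lambda>x. k x + l x"]) (auto intro: prod_closure.add)
    qed
  qed
qed fact

lemma smooth_on_mult:
  fixes f g :: "'a::real_normed_vector \<Rightarrow> 'b::real_normed_algebra"
  shows "open S \<Longrightarrow> smooth_on S f \<Longrightarrow> smooth_on S g \<Longrightarrow> smooth_on S (\<lambda>x. f x * g x)"
  using smooth_on_bilinear[OF _ bounded_bilinear_mult] .

lemma smooth_on_scaleR:
  "open S \<Longrightarrow> smooth_on S f \<Longrightarrow> smooth_on S g \<Longrightarrow> smooth_on S (\<lambda>x. f x *\<^sub>R g x)"
  using smooth_on_bilinear[OF _ bounded_bilinear_scaleR] .

lemma smooth_on_prod:
  fixes f :: "'i \<Rightarrow> 'a::real_normed_vector \<Rightarrow> 'b::{real_normed_algebra, comm_monoid_mult}"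
  assumes "open S" "\<And>i. i \<in> A \<Longrightarrow> smooth_on S (f i)"
  shows "smooth_on S (\<lambda>x. \<Prod>i\<in>A. f i x)"
  using assms(2)
  by (induction A rule: infinite_finite_induct) (auto intro: smooth_on_const smooth_on_mult assms(1))

lemma smooth_on_minus: "open S \<Longrightarrow> smooth_on S f \<Longrightarrow> smooth_on S (\<lambda>x. - f x)"
  by (rule smooth_on_bounded_linear_comp[OF _ bounded_linear_minus[OF bounded_linear_ident]])

lemma smooth_on_diff:
  "open S \<Longrightarrow> smooth_on S f \<Longrightarrow> smooth_on S g \<Longrightarrow> smooth_on S (\<lambda>x. f x - g x)"
  using smooth_on_add[OF _ _ smooth_on_minus, of S f g] by simp

text \<open>In coordinates the chain rule turns \<open>h (f x)\<close> into a sum over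
  \<open>Basis\<close> of smooth scalars times partial derivatives of \<open>h\<close> at
  \<open>f x\<close>. Sums and smooth multiples of such terms therefore form a class stable under
  derivatives; \<open>zero\<close> covers empty sums.\<close>

inductive comp_closure :: "('a::real_normed_vector \<Rightarrow> 'b::euclidean_space) \<Rightarrow> 'a set \<Rightarrow> 'b set
    \<Rightarrow> ('a \<Rightarrow> 'c::real_normed_vector) \<Rightarrow> bool"
  for f and S and T where
  base: "smooth_on T h \<Longrightarrow> comp_closure f S T (\<lambda>x. h (f x))"
| scale: "smooth_on S a \<Longrightarrow> comp_closure f S T k \<Longrightarrow> comp_closure f S T (\<lambda>x. a x *\<^sub>R k x)"
| zero: "comp_closure f S T (\<lambda>x. 0)"
| add: "comp_closure f S T k \<Longrightarrow> comp_closure f S T l \<Longrightarrow> comp_closure f S T (\<lambda>x. k x + l x)"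

lemma comp_closure_sum: "(\<And>i. i \<in> A \<Longrightarrow> comp_closure f S T (k i)) \<Longrightarrow> comp_closure f S T (\<lambda>x. \<Sum>i\<in>A. k i x)"
  by (induction A rule: infinite_finite_induct) (auto intro: comp_closure.intros)

lemma smooth_on_compose:
  fixes f :: "'a::real_normed_vector \<Rightarrow> 'b::euclidean_space"
  assumes S: "open S" and f: "smooth_on S f" and h: "smooth_on T h" and fS: "f ` S \<subseteq> T"
  shows "smooth_on S (\<lambda>x. h (f x))"
proof (rule smooth_on_coinduct[where P="comp_closure f S T"])
  show "comp_closure f S T (\<lambda>x. h (f x))" using h by (rule comp_closure.base)
  fix h :: "'a \<Rightarrow> 'c" assume "comp_closure f S T h"
  then show "(\<forall>x\<in>S. h differentiable at x) \<and>
         (\<forall>v. \<exists>g. comp_closure f S T g \<and> (\<forall>x\<in>S. frechet_derivative h (at x) v = g x))"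
  proof induction
    case (base h)
    have d: "((\<lambda>x. h (f x)) has_derivative
        (\<lambda>v. frechet_derivative h (at (f x)) (frechet_derivative f (at x) v))) (at x)"
      if "x \<in> S" for x
    proof -
      have "(f has_derivative frechet_derivative f (at x)) (at x)"
        by (rule smooth_on_imp_has_derivative[OF f that])
      moreover have "(h has_derivative frechet_derivative h (at (f x))) (at (f x))"
        using smooth_on_imp_has_derivative[OF base] that fS by blast
      ultimately show ?thesis by (rule has_derivative_compose)
    qed
    have e: "frechet_derivative h (at (f x)) (frechet_derivative f (at x) v) =
      (\<Sum>b\<in>Basis. (frechet_derivative f (at x) v \<bullet> b) *\<^sub>R frechet_derivative h (at (f x)) b)"
      if "x \<in> S" for x v
    proof -
      have "linear (frechet_derivative h (at (f x)))"
        using smooth_on_imp_has_derivative[OF base, of "f x"] that fS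
        by (meson has_derivative_linear image_subset_iff)
      then have "frechet_derivative h (at (f x)) (\<Sum>b\<in>Basis. (frechet_derivative f (at x) v \<bullet> b) *\<^sub>R b) =
        (\<Sum>b\<in>Basis. (frechet_derivative f (at x) v \<bullet> b) *\<^sub>R frechet_derivative h (at (f x)) b)"
        by (simp add: linear_sum linear_scale del: euclidean_representation)
      then show ?thesis by (simp only: euclidean_representation)
    qed
    show ?case
    proof (intro conjI ballI allI)
      fix x assume "x \<in> S" then show "(\<lambda>x. h (f x)) differentiable at x"
        using d differentiable_def by blast
    next
      fix v
      have sm: "smooth_on S (\<lambda>x. frechet_derivative f (at x) v \<bullet> b)" for b
        by (rule smooth_on_bounded_linear_comp[OF S bounded_linear_inner_left smooth_on_frechet_derivative[OF f]])
      have cb: "comp_closure f S T (\<lambda>x. frechet_derivative h (at (f x)) b)" for b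
        by (rule comp_closure.base[OF smooth_on_frechet_derivative[OF base]])
      have "comp_closure f S T (\<lambda>x. \<Sum>b\<in>Basis. (frechet_derivative f (at x) v \<bullet> b) *\<^sub>R frechet_derivative h (at (f x)) b)"
        by (intro comp_closure_sum comp_closure.scale sm cb)
      then show "\<exists>g. comp_closure f S T g \<and> (\<forall>x\<in>S. frechet_derivative (\<lambda>x. h (f x)) (at x) v = g x)"
        using frechet_derivative_eqI[OF d] e by (intro exI conjI) (assumption, simp)
    qed
  next
    case (scale a k)
    have d: "((\<lambda>x. a x *\<^sub>R k x) has_derivative
        (\<lambda>v. a x *\<^sub>R frechet_derivative k (at x) v + frechet_derivative a (at x) v *\<^sub>R k x)) (at x)"
      if "x \<in> S" for x
      using that scale.IH
      by (intro bounded_bilinear.FDERIV[OF bounded_bilinear_scaleR] smooth_on_imp_has_derivative[OF scale(1)])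
        (auto simp flip: frechet_derivative_works)
    show ?case
    proof (intro conjI ballI allI)
      fix x assume "x \<in> S" then show "(\<lambda>x. a x *\<^sub>R k x) differentiable at x"
        using d differentiable_def by blast
    next
      fix v
      from scale.IH obtain k' where k': "comp_closure f S T k'" "\<forall>x\<in>S. frechet_derivative k (at x) v = k' x"
        by blast
      have "comp_closure f S T (\<lambda>x. a x *\<^sub>R k' x + frechet_derivative a (at x) v *\<^sub>R k x)"
        by (intro comp_closure.add comp_closure.scale scale k' smooth_on_frechet_derivative)
      then show "\<exists>g. comp_closure f S T g \<and> (\<forall>x\<in>S. frechet_derivative (\<lambda>x. a x *\<^sub>R k x) (at x) v = g x)"
        using frechet_derivative_eqI[OF d] k'(2)
        by (intro exI[of _ "\<lambda>x. a x *\<^sub>R k' x + frechet_derivative a (at x) v *\<^sub>R k x"]) auto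
    qed
  next
    case zero
    then show ?case by (auto simp: frechet_derivative_const intro: comp_closure.zero)
  next
    case (add k l)
    have d: "((\<lambda>x. k x + l x) has_derivative
        (\<lambda>v. frechet_derivative k (at x) v + frechet_derivative l (at x) v)) (at x)"
      if "x \<in> S" for x
      using that add.IH by (intro has_derivative_add) (auto simp flip: frechet_derivative_works)
    show ?case
    proof (intro conjI ballI allI)
      fix x assume "x \<in> S" then show "(\<lambda>x. k x + l x) differentiable at x"
        using d differentiable_def by blast
    next
      fix v
      from add.IH obtain k' l' where "comp_closure f S T k'" "comp_closure f S T l'"
        "\<forall>x\<in>S. frechet_derivative k (at x) v = k' x" "\<forall>x\<in>S. frechet_derivative l (at x) v = l' x" by blast
      then show "\<exists>g. comp_closure f S T g \<and> (\<forall>x\<in>S. frechet_derivative (\<lambda>x. k x + l x) (at x) v = g x)"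
        using frechet_derivative_eqI[OF d] by (intro exI[of _ "\<lambda>x. k' x + l' x"]) (auto intro: comp_closure.add)
    qed
  qed
qed fact

section \<open>Elementary smooth functions\<close>

lemma smooth_on_inverse_field:
  "smooth_on (- {0}) (inverse :: 'a::{real_normed_field} \<Rightarrow> 'a)"
proof (rule smooth_on_coinduct[where P="\<lambda>f. \<exists>c k. f = (\<lambda>z. c * inverse z ^ k)"])
  show "\<exists>c k. inverse = (\<lambda>z::'a. c * inverse z ^ k)" by (intro exI[of _ 1]) auto
  fix f :: "'a \<Rightarrow> 'a" assume "\<exists>c k. f = (\<lambda>z. c * inverse z ^ k)"
  then obtain c k where f: "f = (\<lambda>z. c * inverse z ^ k)" by blast
  have d: "(f has_derivative (\<lambda>v. v * (c * (- of_nat k * inverse z ^ Suc k)))) (at z)" if "z \<noteq> 0" for z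
  proof -
    have "(f has_field_derivative c * (of_nat k * inverse z ^ (k - 1) * (- (inverse z ^ 2)))) (at z)"
      unfolding f using that by (auto intro!: derivative_eq_intros simp: power2_eq_square)
    also have "c * (of_nat k * inverse z ^ (k - 1) * (- (inverse z ^ 2))) = c * (- of_nat k * inverse z ^ Suc k)"
      by (cases k) (auto simp: power2_eq_square algebra_simps)
    finally show ?thesis by (simp only: has_field_derivative_def mult_commute_abs)
  qed
  show "(\<forall>x\<in>- {0}. f differentiable at x) \<and> (\<forall>v. \<exists>g. (\<exists>c k. g = (\<lambda>z. c * inverse z ^ k)) \<and>
            (\<forall>x\<in>- {0}. frechet_derivative f (at x) v = g x))"
  proof (intro conjI ballI allI)
    fix x :: 'a assume "x \<in> - {0}" then show "f differentiable at x"
        using d differentiable_def by blast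
  next
    fix v
    show "\<exists>g. (\<exists>c k. g = (\<lambda>z. c * inverse z ^ k)) \<and> (\<forall>x\<in>- {0}. frechet_derivative f (at x) v = g x)"
      using frechet_derivative_eqI[OF d]
      by (intro exI[of _ "\<lambda>z. (- v * c * of_nat k) * inverse z ^ Suc k"] conjI exI[of _ "(- v * c * of_nat k)"] exI[of _ "Suc k"])
        (auto simp: algebra_simps)
  qed
qed auto

lemma smooth_on_cis: "smooth_on UNIV cis"
proof (rule smooth_on_coinduct[where P="\<lambda>f. \<exists>c. f = (\<lambda>t. c * cis t)"])
  show "\<exists>c. cis = (\<lambda>t. c * cis t)" by (intro exI[of _ 1]) auto
  fix f assume "\<exists>c. f = (\<lambda>t. c * cis t)"
  then obtain c where f: "f = (\<lambda>t. c * cis t)" by blast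
  have d: "(f has_derivative (\<lambda>v. c * (v *\<^sub>R (\<i> * cis t)))) (at t)" for t
  proof -
    have "((\<lambda>z. exp (\<i> * z)) has_field_derivative \<i> * exp (\<i> * of_real t)) (at (of_real t))"
      by (auto intro!: derivative_eq_intros)
    from has_vector_derivative_real_field[OF this]
    have "((\<lambda>t. cis t) has_vector_derivative \<i> * cis t) (at t)"
      by (simp add: cis_conv_exp)
    then have "(cis has_derivative (\<lambda>v. v *\<^sub>R (\<i> * cis t))) (at t)" by (simp add: has_vector_derivative_def)
    then show ?thesis unfolding f by (rule has_derivative_mult_right)
  qed
  show "(\<forall>x\<in>UNIV. f differentiable at x) \<and> (\<forall>v. \<exists>g. (\<exists>c. g = (\<lambda>t. c * cis t)) \<and>
            (\<forall>x\<in>UNIV. frechet_derivative f (at x) v = g x))"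
  proof (intro conjI ballI allI)
    fix x show "f differentiable at x" using d differentiable_def by blast
  next
    fix v
    show "\<exists>g. (\<exists>c. g = (\<lambda>t. c * cis t)) \<and> (\<forall>x\<in>UNIV. frechet_derivative f (at x) v = g x)"
      using frechet_derivative_eqI[OF d]
      by (intro exI[of _ "\<lambda>t. (c * of_real v * \<i>) * cis t"] conjI exI[of _ "(c * of_real v * \<i>)"])
        (auto simp: algebra_simps scaleR_conv_of_real)
  qed
qed auto

lemma smooth_on_sqrt: "smooth_on {0<..} sqrt"
proof (rule smooth_on_cong)
  show "smooth_on {0<..} (\<lambda>t::real. t powr (1/2))"
  \<comment> \<open>Real exponents are used because the exponent starts at 1/2 and drops by one at
    each derivative.\<close>
  proof (rule smooth_on_coinduct[where P="\<lambda>f. \<exists>c k. f = (\<lambda>t::real. c * t powr k)"])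
    show "\<exists>c k. (\<lambda>t::real. t powr (1/2)) = (\<lambda>t. c * t powr k)" by (intro exI[of _ 1] exI[of _ "1/2"]) auto
    fix f :: "real \<Rightarrow> real" assume "\<exists>c k. f = (\<lambda>t. c * t powr k)"
    then obtain c k where f: "f = (\<lambda>t. c * t powr k)" by blast
    have d: "(f has_derivative (\<lambda>v. v * (c * (k * t powr (k - 1))))) (at t)" if "t > 0" for t
    proof -
      have "(f has_field_derivative c * (k * t powr (k - 1))) (at t)"
        unfolding f using that by (auto intro!: derivative_eq_intros)
      then show ?thesis by (simp add: has_field_derivative_def mult_commute_abs)
    qed
    show "(\<forall>x\<in>{0<..}. f differentiable at x) \<and> (\<forall>v. \<exists>g. (\<exists>c k. g = (\<lambda>t. c * t powr k)) \<and>
              (\<forall>x\<in>{0<..}. frechet_derivative f (at x) v = g x))"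
    proof (intro conjI ballI allI)
      fix x :: real assume "x \<in> {0<..}" then show "f differentiable at x"
          using d differentiable_def by blast
    next
      fix v
      show "\<exists>g. (\<exists>c k. g = (\<lambda>t. c * t powr k)) \<and> (\<forall>x\<in>{0<..}. frechet_derivative f (at x) v = g x)"
        using frechet_derivative_eqI[OF d]
        by (intro exI[of _ "\<lambda>t. (v * c * k) * t powr (k - 1)"] conjI exI[of _ "(v * c * k)"] exI[of _ "k - 1"])
          auto
    qed
  qed auto
qed (auto simp: powr_half_sqrt)

lemma smooth_on_inverse:
  fixes f :: "'a::real_normed_vector \<Rightarrow> 'b::{real_normed_field, euclidean_space}"
  assumes "open S" "smooth_on S f" "\<And>x. x \<in> S \<Longrightarrow> f x \<noteq> 0"
  shows "smooth_on S (\<lambda>x. inverse (f x))"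
  by (rule smooth_on_compose[OF assms(1,2) smooth_on_inverse_field]) (use assms(3) in auto)

lemma smooth_on_divide:
  fixes f g :: "'a::real_normed_vector \<Rightarrow> 'b::{real_normed_field, euclidean_space}"
  assumes "open S" "smooth_on S f" "smooth_on S g" "\<And>x. x \<in> S \<Longrightarrow> g x \<noteq> 0"
  shows "smooth_on S (\<lambda>x. f x / g x)"
  unfolding divide_inverse by (intro smooth_on_mult smooth_on_inverse assms)

lemma smooth_on_Pair:
  assumes "open S" "smooth_on S f" "smooth_on S g"
  shows "smooth_on S (\<lambda>x. (f x, g x))"
proof -
  have "smooth_on S (\<lambda>x. (f x, 0) + (0, g x))"
    by (intro smooth_on_add smooth_on_bounded_linear_comp[where L="\<lambda>y. (y, 0)"]
        smooth_on_bounded_linear_comp[where L="\<lambda>y. (0, y)"] assms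
        bounded_linear_Pair bounded_linear_ident bounded_linear_zero)
  then show ?thesis by simp
qed

lemma bounded_linear_axis: "bounded_linear (axis i :: 'a::real_normed_vector \<Rightarrow> 'a^'n::finite)"
proof (rule bounded_linear_intro[where K=1])
  show "norm (axis i x :: 'a^'n) \<le> norm x * 1" for x
    by (simp add: norm_vec_def L2_set_def axis_def if_distrib[where f=norm] if_distrib[where f="\<lambda>r. r^2"] cong: if_cong)
qed (auto simp: axis_def vec_eq_iff)

lemma smooth_on_vec_lambda:
  fixes f :: "'n::finite \<Rightarrow> 'a::real_normed_vector \<Rightarrow> 'b::real_normed_vector"
  assumes "open S" "\<And>i. smooth_on S (f i)"
  shows "smooth_on S (\<lambda>x. \<chi> i. f i x)"
proof -
  have "smooth_on S (\<lambda>x. \<Sum>i\<in>UNIV. axis i (f i x))"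
    by (intro smooth_on_sum smooth_on_bounded_linear_comp[OF _ bounded_linear_axis] assms)
  moreover have "(\<Sum>i\<in>UNIV. axis i (f i x)) = (\<chi> i. f i x)" for x
    by (auto simp: vec_eq_iff axis_def if_distrib cong: if_cong)
  ultimately show ?thesis by simp
qed

lemma smooth_on_det:
  fixes A :: "'a::real_normed_vector \<Rightarrow> 'b::{real_normed_algebra_1,comm_ring_1}^'n^'n"
  assumes "open S" "\<And>i j. smooth_on S (\<lambda>x. A x $ i $ j)"
  shows "smooth_on S (\<lambda>x. det (A x))"
  unfolding det_def by (intro smooth_on_sum smooth_on_mult smooth_on_const smooth_on_prod assms)

section \<open>Power series with geometrically decaying coefficients\<close>

text \<open>Norm of the algebra of series absolutely convergent on the circle of radius
  \<open>r\<close>, truncated at degree \<open>n\<close>. The truncation is always finite, so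
  estimates can be made before any convergence is known.\<close>

definition wnorm :: "real \<Rightarrow> nat \<Rightarrow> complex fps \<Rightarrow> real" where
  "wnorm r n F = (\<Sum>k\<le>n. cmod (fps_nth F k) * r ^ k)"

lemma wnorm_nonneg: "0 \<le> r \<Longrightarrow> 0 \<le> wnorm r n F"
  unfolding wnorm_def by (intro sum_nonneg) auto

lemma wnorm_add: "0 \<le> r \<Longrightarrow> wnorm r n (F + G) \<le> wnorm r n F + wnorm r n G"
  unfolding wnorm_def sum.distrib[symmetric]
  by (intro sum_mono) (auto simp flip: distrib_right intro!: mult_right_mono norm_triangle_ineq)

text \<open>The triangle of index pairs with i + j \<le> n lies in the square of pairs with i, j
  \<le> n; all terms being nonnegative, the truncated Cauchy product is bounded by the product of
  the truncations.\<close>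

lemma wnorm_mult:
  assumes r: "0 \<le> r"
  shows "wnorm r n (F * G) \<le> wnorm r n F * wnorm r n G"
proof -
  let ?f = "\<lambda>i. cmod (fps_nth F i) * r ^ i" and ?g = "\<lambda>i. cmod (fps_nth G i) * r ^ i"
  have "wnorm r n (F * G) \<le> (\<Sum>k\<le>n. \<Sum>i\<le>k. ?f i * ?g (k - i))"
    unfolding wnorm_def
  proof (rule sum_mono)
    fix k
    have "cmod (fps_nth (F * G) k) * r ^ k \<le> (\<Sum>i\<le>k. cmod (fps_nth F i * fps_nth G (k - i))) * r ^ k"
      unfolding fps_mult_nth atLeast0AtMost by (intro mult_right_mono norm_sum) (use r in auto)
    also have "\<dots> = (\<Sum>i\<le>k. ?f i * ?g (k - i))"
      unfolding sum_distrib_right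
      by (intro sum.cong) (auto simp: norm_mult mult_ac simp flip: power_add)
    finally show "cmod (fps_nth (F * G) k) * r ^ k \<le> (\<Sum>i\<le>k. ?f i * ?g (k - i))" .
  qed
  also have "\<dots> = (\<Sum>(i, j)\<in>{(i, j). i + j \<le> n}. ?f i * ?g j)"
    by (rule sum.triangle_reindex_eq[symmetric])
  also have "\<dots> \<le> (\<Sum>(i, j)\<in>{..n} \<times> {..n}. ?f i * ?g j)"
    by (intro sum_mono2) (use r in auto)
  also have "\<dots> = wnorm r n F * wnorm r n G"
    unfolding wnorm_def sum_product by (rule sum.cartesian_product[symmetric])
  finally show ?thesis .
qed

lemma wnorm_mono: "0 \<le> r \<Longrightarrow> r \<le> r' \<Longrightarrow> wnorm r n F \<le> wnorm r' n F"
  unfolding wnorm_def by (intro sum_mono mult_left_mono power_mono) auto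

text \<open>Holomorphy beyond the closed unit disc. Rational functions without poles on the closed
  disc have this property, and unlike square summability it passes to products.\<close>

definition fgeo :: "complex fps \<Rightarrow> bool" where
  "fgeo F \<longleftrightarrow> (\<exists>r>1. \<exists>C. \<forall>n. wnorm r n F \<le> C)"

lemma wnorm_coeff_bound:
  assumes "0 < r" "wnorm r n F \<le> C"
  shows "cmod (fps_nth F n) \<le> C * (1 / r) ^ n"
proof -
  have "cmod (fps_nth F n) * r ^ n \<le> wnorm r n F"
    unfolding wnorm_def by (rule member_le_sum) (use assms in auto)
  with assms show ?thesis by (simp add: field_simps power_divide)
qed

lemma fgeo_bound:
  assumes "fgeo F"
  obtains C r where "0 < r" "r < 1" "\<And>n. cmod (fps_nth F n) \<le> C * r ^ n" "C \<ge> 0"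
proof -
  from assms obtain r C where r: "r > 1" "\<And>n. wnorm r n F \<le> C" unfolding fgeo_def by blast
  have "C \<ge> 0" using r(2)[of 0] wnorm_nonneg[of r 0 F] r(1) by linarith
  then show ?thesis using that[of "1/r" C] wnorm_coeff_bound[OF _ r(2)] r(1) by auto
qed

lemma fgeo_add: "fgeo F \<Longrightarrow> fgeo G \<Longrightarrow> fgeo (F + G)"
proof -
  assume "fgeo F" "fgeo G"
  then obtain r C r' C' where r: "r > 1" "\<And>n. wnorm r n F \<le> C" "r' > 1" "\<And>n. wnorm r' n G \<le> C'"
    unfolding fgeo_def by blast
  have "wnorm (min r r') n (F + G) \<le> C + C'" for n
    using wnorm_add[of "min r r'" n F G] wnorm_mono[of "min r r'" r n F] wnorm_mono[of "min r r'" r' n G]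
      r(2)[of n] r(4)[of n] r(1,3) by auto
  then show ?thesis unfolding fgeo_def using r(1,3) by (intro exI[of _ "min r r'"]) auto
qed

lemma fgeo_mult: "fgeo F \<Longrightarrow> fgeo G \<Longrightarrow> fgeo (F * G)"
proof -
  assume "fgeo F" "fgeo G"
  then obtain r C r' C' where r: "r > 1" "\<And>n. wnorm r n F \<le> C" "r' > 1" "\<And>n. wnorm r' n G \<le> C'"
    unfolding fgeo_def by blast
  have "wnorm (min r r') n (F * G) \<le> C * C'" for n
  proof -
    have "wnorm (min r r') n F \<le> C" "wnorm (min r r') n G \<le> C'"
      using wnorm_mono[of "min r r'" r n F] wnorm_mono[of "min r r'" r' n G] r(2)[of n] r(4)[of n] r(1,3)
      by auto
    then have "wnorm (min r r') n F * wnorm (min r r') n G \<le> C * C'"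
      using r(1,3) wnorm_nonneg[of "min r r'" n] by (intro mult_mono) (auto intro: order_trans)
    then show ?thesis using wnorm_mult[of "min r r'" n F G] r(1,3) by linarith
  qed
  then show ?thesis unfolding fgeo_def using r(1,3) by (intro exI[of _ "min r r'"]) auto
qed

lemma wnorm_fps_of_poly_bound:
  assumes "0 \<le> r"
  shows "wnorm r n (fps_of_poly p) \<le> (\<Sum>k\<le>degree p. cmod (coeff p k) * r ^ k)"
proof -
  have "wnorm r n (fps_of_poly p) = (\<Sum>k\<in>{..n} \<inter> {..degree p}. cmod (coeff p k) * r ^ k)"
    unfolding wnorm_def by (intro sum.mono_neutral_cong_right) (auto simp: coeff_eq_0)
  also have "\<dots> \<le> (\<Sum>k\<le>degree p. cmod (coeff p k) * r ^ k)"
    by (intro sum_mono2) (use assms in auto)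
  finally show ?thesis .
qed

lemma fgeo_poly: "fgeo (fps_of_poly p)"
  unfolding fgeo_def using wnorm_fps_of_poly_bound[of 2 _ p] by (intro exI[of _ 2]) auto

lemma fgeo_const: "fgeo (fps_const c)"
  using fgeo_poly[of "[:c:]"] by (simp add: fps_of_poly_const)

lemma fgeo_1: "fgeo 1" and fgeo_0: "fgeo 0"
  using fgeo_const[of 1] fgeo_const[of 0] by simp_all

lemma fgeo_X: "fgeo fps_X"
  using fgeo_poly[of "[:0,1:]"] by (simp add: fps_of_poly_pCons)

lemma fgeo_sum: "(\<And>i. i \<in> A \<Longrightarrow> fgeo (f i)) \<Longrightarrow> fgeo (\<Sum>i\<in>A. f i)"
  by (induction A rule: infinite_finite_induct) (auto intro: fgeo_add fgeo_0)

lemma inverse_fps_eqI: "(F::complex fps) * G = 1 \<Longrightarrow> inverse F = G"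
  by (metis fps_inverse_unique mult.commute)

lemma fgeo_inverse_linear:
  assumes "cmod r > 1"
  shows "fgeo (inverse (fps_of_poly [:-r, 1:]))"
proof -
  let ?G = "Abs_fps (\<lambda>n. - ((1/r) ^ Suc n))"
  have r0: "r \<noteq> 0" using assms by auto
  have "fps_of_poly [:-r, 1:] * ?G = 1"
  proof (rule fps_ext)
    fix n
    show "fps_nth (fps_of_poly [:-r, 1:] * ?G) n = fps_nth 1 n"
      using r0 by (cases n) (auto simp: fps_of_poly_pCons algebra_simps)
  qed
  then have inv: "inverse (fps_of_poly [:-r, 1:]) = ?G" by (rule inverse_fps_eqI)
  define a where "a = cmod r"
  \<comment> \<open>Any weight strictly between 1 and the modulus of the root makes the geometric
    series converge; this is the midpoint.\<close>
  define q where "q = (1 + a) / 2"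
  have a: "a > 1" "q > 1" "q / a < 1" using assms by (simp_all add: a_def q_def divide_simps)
  have "wnorm q n ?G \<le> (1 / a) * (1 / (1 - q / a))" for n
  proof -
    have "wnorm q n ?G = (1 / a) * (\<Sum>k\<le>n. (q / a) ^ k)"
      unfolding wnorm_def sum_distrib_left
      by (intro sum.cong) (auto simp: norm_mult norm_power norm_divide a_def power_divide field_simps)
    also have "\<dots> \<le> (1 / a) * (\<Sum>k. (q / a) ^ k)"
      using a by (intro mult_left_mono sum_le_suminf summable_geometric) auto
    also have "(\<Sum>k. (q / a) ^ k) = 1 / (1 - q / a)" using a by (intro suminf_geometric) auto
    finally show ?thesis .
  qed
  then show ?thesis unfolding inv fgeo_def using a by blast
qed

text \<open>Linear factors are split off one at a time by the fundamental theorem of algebra; each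
  root lies outside the closed disc.\<close>

lemma fgeo_inverse_poly:
  assumes "\<And>z. cmod z \<le> 1 \<Longrightarrow> poly B z \<noteq> 0"
  shows "fgeo (inverse (fps_of_poly B))"
  using assms
proof (induction "degree B" arbitrary: B)
  case 0
  then obtain c where "B = [:c:]" by (metis degree_eq_zeroE)
  with 0 have "c \<noteq> 0" using "0.prems"[of 0] by auto
  then show ?case unfolding \<open>B = [:c:]\<close> by (simp add: fps_of_poly_const fps_const_inverse fgeo_const)
next
  case (Suc n)
  then have "\<not> constant (poly B)" by (simp add: constant_degree)
  then obtain r where r: "poly B r = 0" using fundamental_theorem_of_algebra by blast
  then obtain Q where Q: "B = [:-r, 1:] * Q" by (metis poly_eq_0_iff_dvd dvdE)
  have r1: "cmod r > 1" using Suc.prems r by (meson not_le)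
  have "B \<noteq> 0" using Suc.hyps by auto
  then have Q0: "Q \<noteq> 0" using Q by auto
  have "degree B = Suc (degree Q)" unfolding Q using Q0 by (subst degree_mult_eq) auto
  then have "fgeo (inverse (fps_of_poly Q))"
    using Suc.hyps Suc.prems Q by (intro Suc.hyps(1)) auto
  moreover have "inverse (fps_of_poly B) = inverse (fps_of_poly [:-r, 1:]) * inverse (fps_of_poly Q)"
    unfolding Q fps_of_poly_mult by (rule fps_inverse_mult)
  ultimately show ?case using fgeo_mult fgeo_inverse_linear[OF r1] by simp
qed

lemma fgeo_l2p:
  assumes "fgeo F"
  shows "fps_nth F \<in> l2p"
proof -
  from fgeo_bound[OF assms] obtain C r where r: "0 < r" "r < 1" "\<And>n. cmod (fps_nth F n) \<le> C * r ^ n" "C \<ge> 0"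
    by blast
  have "r\<^sup>2 < 1" using r by (simp add: power_less_one_iff)
  then have s: "summable (\<lambda>n. C\<^sup>2 * (r\<^sup>2) ^ n)" by (intro summable_mult summable_geometric) auto
  have "(cmod (fps_nth F n))\<^sup>2 \<le> C\<^sup>2 * (r\<^sup>2) ^ n" for n
    using power_mono[OF r(3)[of n], of 2] by (simp add: power_mult_distrib mult.commute flip: power_mult)
  then show ?thesis unfolding l2p_def
    using summable_comparison_test'[OF s, of 0 "\<lambda>n. (cmod (fps_nth F n))\<^sup>2"] by simp
qed

lemma l2p_bounded:
  assumes "h \<in> l2p"
  obtains M where "\<And>n. cmod (h n) \<le> M" "M \<ge> 0"
proof -
  have "(\<lambda>k. (cmod (h k))\<^sup>2) \<longlonglongrightarrow> 0" using assms by (intro summable_LIMSEQ_zero) (simp add: l2p_def)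
  then have "(\<lambda>k. sqrt ((cmod (h k))\<^sup>2)) \<longlonglongrightarrow> sqrt 0" by (rule tendsto_real_sqrt)
  then have "Bseq (\<lambda>k. cmod (h k))" by (intro convergent_imp_Bseq) (auto simp: convergent_def)
  then obtain M where "M > 0" "\<And>n. norm (cmod (h n)) \<le> M" unfolding Bseq_def by blast
  then show ?thesis using that[of M] by auto
qed

text \<open>Decay of one factor suffices, so these series can be paired with arbitrary elements of
  \<open>l2p\<close>, which are bounded.\<close>

lemma summable_geo_bounded:
  assumes "fgeo F" "\<And>n. cmod (h n) \<le> M"
  shows "summable (\<lambda>n. cmod (fps_nth F n * cnj (h n)))"
    and "summable (\<lambda>n. fps_nth F n * cnj (h n))"
proof -
  from fgeo_bound[OF assms(1)] obtain C r where r: "0 < r" "r < 1" "\<And>n. cmod (fps_nth F n) \<le> C * r ^ n" "C \<ge> 0"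
    by blast
  have s: "summable (\<lambda>n. (C * M) * r ^ n)" using r by (intro summable_mult summable_geometric) auto
  have "M \<ge> 0" using assms(2)[of 0] norm_ge_zero[of "h 0"] by linarith
  have "cmod (fps_nth F n * cnj (h n)) \<le> (C * M) * r ^ n" for n
    using mult_mono[OF r(3)[of n] assms(2)[of n]] r(1,4) by (simp add: norm_mult mult_ac)
  then show "summable (\<lambda>n. cmod (fps_nth F n * cnj (h n)))"
    using summable_comparison_test'[OF s, of 0 "\<lambda>n. cmod (fps_nth F n * cnj (h n))"] by simp
  then show "summable (\<lambda>n. fps_nth F n * cnj (h n))" by (rule summable_norm_cancel)
qed

section \<open>The inner product on series with geometric decay\<close>

abbreviation hip :: "complex fps \<Rightarrow> complex fps \<Rightarrow> complex" where
  "hip F G \<equiv> hinner (fps_nth F) (fps_nth G)"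

lemma fgeo_bounded: "fgeo G \<Longrightarrow> \<exists>M. \<forall>n. cmod (fps_nth G n) \<le> M"
  using fgeo_l2p l2p_bounded by metis

lemma summable_hip: "fgeo F \<Longrightarrow> fgeo G \<Longrightarrow> summable (\<lambda>n. fps_nth F n * cnj (fps_nth G n))"
  using summable_geo_bounded(2) fgeo_bounded by metis

lemma hinner_add_left: 
  assumes "fgeo F" "fgeo G" "h \<in> l2p"
  shows "hinner (fps_nth (F + G)) h = hinner (fps_nth F) h + hinner (fps_nth G) h"
proof -
  from l2p_bounded[OF assms(3)] obtain M where M: "\<And>n. cmod (h n) \<le> M" by blast
  show ?thesis unfolding hinner_def
    by (subst suminf_add) (auto simp: distrib_right intro!: summable_geo_bounded(2)[OF _ M] assms)
qed

lemma hinner_scale_left: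
  assumes "fgeo F" "h \<in> l2p"
  shows "hinner (fps_nth (fps_const c * F)) h = c * hinner (fps_nth F) h"
proof -
  from l2p_bounded[OF assms(2)] obtain M where M: "\<And>n. cmod (h n) \<le> M" by blast
  show ?thesis unfolding hinner_def
    using suminf_mult[OF summable_geo_bounded(2)[OF assms(1) M], of c] by (simp add: mult.assoc)
qed

lemma hinner_sum_left:
  assumes "\<And>i. i \<in> A \<Longrightarrow> fgeo (F i)" "h \<in> l2p"
  shows "hinner (fps_nth (\<Sum>i\<in>A. F i)) h = (\<Sum>i\<in>A. hinner (fps_nth (F i)) h)"
  using assms(1)
proof (induction A rule: infinite_finite_induct)
  case (insert x A)
  then have "hinner (fps_nth (F x + (\<Sum>i\<in>A. F i))) h = hinner (fps_nth (F x)) h + (\<Sum>i\<in>A. hinner (fps_nth (F i)) h)"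
    using hinner_add_left[of "F x" "\<Sum>i\<in>A. F i" h] assms(2) by (simp only: fgeo_sum insert_iff simp_thms)
  then show ?case by (simp only: sum.insert[OF insert.hyps])
qed (auto simp: hinner_def)

lemma hip_cnj: "fgeo F \<Longrightarrow> fgeo G \<Longrightarrow> hip F G = cnj (hip G F)"
  unfolding hinner_def using bounded_linear.suminf[OF bounded_linear_cnj summable_hip[of G F]]
  by (simp add: mult.commute)

lemma hip_add_left: "fgeo F \<Longrightarrow> fgeo G \<Longrightarrow> fgeo H \<Longrightarrow> hip (F + G) H = hip F H + hip G H"
  by (rule hinner_add_left) (auto intro: fgeo_l2p)

lemma hip_scale_left: "fgeo F \<Longrightarrow> fgeo H \<Longrightarrow> hip (fps_const c * F) H = c * hip F H"
  by (rule hinner_scale_left) (auto intro: fgeo_l2p)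

lemma hip_sum_left: "(\<And>i. i \<in> A \<Longrightarrow> fgeo (F i)) \<Longrightarrow> fgeo H \<Longrightarrow> hip (\<Sum>i\<in>A. F i) H = (\<Sum>i\<in>A. hip (F i) H)"
  by (rule hinner_sum_left) (auto intro: fgeo_l2p)

lemma hip_add_right: "fgeo F \<Longrightarrow> fgeo G \<Longrightarrow> fgeo H \<Longrightarrow> hip H (F + G) = hip H F + hip H G"
  by (subst (1 2 3) hip_cnj) (auto simp: hip_add_left fgeo_add)

lemma hip_scale_right: "fgeo F \<Longrightarrow> fgeo H \<Longrightarrow> hip H (fps_const c * F) = cnj c * hip H F"
  by (subst (1 2) hip_cnj) (auto simp: hip_scale_left fgeo_mult fgeo_const)

lemma hip_sum_right:
  assumes "\<And>i. i \<in> A \<Longrightarrow> fgeo (F i)" "fgeo H"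
  shows "hip H (\<Sum>i\<in>A. F i) = (\<Sum>i\<in>A. hip H (F i))"
proof -
  have "hip H (\<Sum>i\<in>A. F i) = cnj (\<Sum>i\<in>A. hip (F i) H)"
    using assms by (subst hip_cnj) (auto simp: hip_sum_left fgeo_sum)
  also have "\<dots> = (\<Sum>i\<in>A. hip H (F i))"
    unfolding cnj_sum by (intro sum.cong refl hip_cnj[symmetric] assms)
  finally show ?thesis .
qed

lemma hsqnorm_eq_hip: "hsqnorm h = Re (hinner h h)" if "h \<in> l2p"
proof -
  have "(\<lambda>k. (cmod (h k))\<^sup>2) sums hsqnorm h" using that unfolding l2p_def hsqnorm_def by (simp add: summable_sums)
  then have "(\<lambda>k. complex_of_real ((cmod (h k))\<^sup>2)) sums complex_of_real (hsqnorm h)" by (rule sums_of_real)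
  then have "(\<lambda>k. h k * cnj (h k)) sums complex_of_real (hsqnorm h)" by (simp only: complex_norm_square)
  then have "hinner h h = complex_of_real (hsqnorm h)"
    unfolding hinner_def by (simp add: sums_iff)
  then show ?thesis by simp
qed

lemma hip_self: "fgeo F \<Longrightarrow> hip F F = complex_of_real (hsqnorm (fps_nth F))"
proof -
  assume F: "fgeo F"
  have "hip F F = cnj (hip F F)" using hip_cnj[OF F F] .
  then have "hip F F = complex_of_real (Re (hip F F))" by (simp add: complex_eq_iff)
  then show ?thesis using hsqnorm_eq_hip[OF fgeo_l2p[OF F]] by simp
qed

lemma hsqnorm_eq_0: "h \<in> l2p \<Longrightarrow> hsqnorm h = 0 \<Longrightarrow> h = (\<lambda>_. 0)"
  unfolding hsqnorm_def l2p_def by (subst (asm) suminf_eq_zero_iff) auto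

lemma hsqnorm_nonneg: "h \<in> l2p \<Longrightarrow> hsqnorm h \<ge> 0"
  unfolding hsqnorm_def l2p_def by (auto intro: suminf_nonneg)

lemma hip_self_eq_0: "fgeo F \<Longrightarrow> hip F F = 0 \<Longrightarrow> F = 0"
  using hip_self[of F] hsqnorm_eq_0[OF fgeo_l2p, of F] by (auto intro!: fps_ext simp: fun_eq_iff)

section \<open>Cauchy matrices\<close>

text \<open>Off the diagonal, partial fractions give c_jm c_jl = (c_jm - c_jl) / (t_m - t_l), and
  the two weighted column sums are both 1. The column relations provide an explicit left inverse of
  the square matrix \<open>c\<close>; it is also a right inverse, which gives the row relations, and
  the row sums follow by inserting the column sums.\<close>

lemma cauchy_orthogonality:
  fixes s t w q :: "'n::finite \<Rightarrow> real" and c :: "'n \<Rightarrow> 'n \<Rightarrow> real"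
  assumes c: "\<And>j m. c j m = 1 / (s j - t m)" and st: "\<And>j m. s j \<noteq> t m" and t: "inj t"
    and w: "\<And>j. w j > 0" and w1: "\<And>m. (\<Sum>j\<in>UNIV. w j * c j m) = 1"
    and q: "\<And>m. q m = 1 / (\<Sum>j\<in>UNIV. w j * (c j m)\<^sup>2)"
  shows "q m > 0"
    and "(\<Sum>j\<in>UNIV. w j * c j m * c j l) = (if m = l then 1 / q m else 0)"
    and "(\<Sum>m\<in>UNIV. q m * c j m * c k m) = (if j = k then 1 / w j else 0)"
    and "(\<Sum>m\<in>UNIV. q m * c j m) = 1"
proof -
  have pos: "(\<Sum>j\<in>UNIV. w j * (c j m)\<^sup>2) > 0" for m
    by (intro sum_pos) (use w st in \<open>auto simp: c\<close>)
  show qpos: "q m > 0" for m using pos[of m] by (simp add: q)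
  show o1: "(\<Sum>j\<in>UNIV. w j * c j m * c j l) = (if m = l then 1 / q m else 0)" for m l
  proof (cases "m = l")
    case True
    then show ?thesis by (simp add: q power2_eq_square mult.assoc)
  next
    case False
    then have "t m \<noteq> t l" using t by (auto dest: injD)
    then have "c j m * c j l = (c j m - c j l) / (t m - t l)" for j
      using st[of j m] st[of j l] by (simp add: c divide_simps)
    then have "w j * c j m * c j l = (w j * c j m - w j * c j l) / (t m - t l)" for j
      by (metis (no_types, lifting) mult.assoc right_diff_distrib' times_divide_eq_right)
    then have "(\<Sum>j\<in>UNIV. w j * c j m * c j l) = ((\<Sum>j\<in>UNIV. w j * c j m) - (\<Sum>j\<in>UNIV. w j * c j l)) / (t m - t l)"
      by (simp add: sum_subtractf flip: sum_divide_distrib)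
    then show ?thesis using False w1 by simp
  qed
  \<comment> \<open>The inverse of the Cauchy matrix: its transpose with rows scaled by
    \<open>q\<close> and columns scaled by \<open>w\<close>.\<close>
  define A :: "real^'n^'n" where "A = (\<chi> m j. q m * w j * c j m)"
  define C :: "real^'n^'n" where "C = (\<chi> j m. c j m)"
  have "A ** C = mat 1"
  proof -
    have "(\<Sum>j\<in>UNIV. q m * w j * c j m * c j l) = (if m = l then 1 else 0)" for m l
    proof -
      have "(\<Sum>j\<in>UNIV. q m * w j * c j m * c j l) = q m * (\<Sum>j\<in>UNIV. w j * c j m * c j l)"
        by (simp add: sum_distrib_left mult.assoc)
      then show ?thesis using o1[of m l] qpos[of m] by (cases "m = l") auto
    qed
    then show ?thesis by (simp add: A_def C_def matrix_matrix_mult_def mat_def vec_eq_iff)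
  qed
  then have CA: "C ** A = mat 1" using matrix_left_right_inverse by blast
  show o2: "(\<Sum>m\<in>UNIV. q m * c j m * c k m) = (if j = k then 1 / w j else 0)" for j k
  proof -
    have "(C ** A) $ j $ k = (if j = k then 1 else 0)" unfolding CA by (simp add: mat_def)
    then have "(\<Sum>m\<in>UNIV. c j m * (q m * w k * c k m)) = (if j = k then 1 else 0)"
      by (simp add: A_def C_def matrix_matrix_mult_def)
    moreover have "(\<Sum>m\<in>UNIV. c j m * (q m * w k * c k m)) = w k * (\<Sum>m\<in>UNIV. q m * c j m * c k m)"
      by (simp add: sum_distrib_left mult_ac)
    ultimately show ?thesis using w[of k] by (auto simp: field_simps split: if_splits)
  qed
  have "(\<Sum>m\<in>UNIV. q m * c j m) = (\<Sum>m\<in>UNIV. q m * c j m * (\<Sum>k\<in>UNIV. w k * c k m))"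
    using w1 by simp
  also have "\<dots> = (\<Sum>k\<in>UNIV. w k * (\<Sum>m\<in>UNIV. q m * c j m * c k m))"
    unfolding sum_distrib_left by (subst sum.swap) (simp add: mult_ac)
  also have "\<dots> = (\<Sum>k\<in>UNIV. if j = k then 1 else 0)"
    by (intro sum.cong refl) (use w in \<open>auto simp: o2 less_imp_neq[symmetric]\<close>)
  also have "\<dots> = 1" by simp
  finally show "(\<Sum>m\<in>UNIV. q m * c j m) = 1" .
qed

section \<open>Cramer's rule for matrices of polynomials\<close>

lemma poly_det:
  fixes P :: "complex poly^'n^'n"
  shows "poly (det P) z = det (\<chi> i j. poly (P $ i $ j) z)"
  unfolding det_def by (simp add: poly_sum poly_prod)

lemma poly_eqI_disc:
  assumes "\<And>z::complex. cmod z \<le> 1 \<Longrightarrow> poly p z = poly q z"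
  shows "p = q"
proof (rule ccontr)
  assume "p \<noteq> q"
  then have "finite {z. poly (p - q) z = 0}" by (intro poly_roots_finite) auto
  moreover have "cball 0 1 \<subseteq> {z. poly (p - q) z = 0}" using assms by auto
  ultimately have "finite (cball (0::complex) 1)" using finite_subset by blast
  then show False using uncountable_cball[of 1 "0::complex"] by (auto dest: countable_finite)
qed

definition cramer_poly :: "complex poly^'n^'n \<Rightarrow> ('n \<Rightarrow> complex) \<Rightarrow> 'n \<Rightarrow> complex poly" where
  "cramer_poly P y m = det (\<chi> i j. if j = m then [:y i:] else P $ i $ j)"

text \<open>Polynomials do not form a field, so Cramer's rule is applied to the values at each point
  of the closed disc; agreement at infinitely many points is equality of polynomials.\<close>

lemma cramer_poly:
  fixes P :: "complex poly^'n^'n"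
  assumes nz: "\<And>z. cmod z \<le> 1 \<Longrightarrow> poly (det P) z \<noteq> 0"
  shows "(\<Sum>m\<in>UNIV. P $ j $ m * cramer_poly P y m) = smult (y j) (det P)"
proof (rule poly_eqI_disc)
  fix z :: complex assume z: "cmod z \<le> 1"
  define A :: "complex^'n^'n" where "A = (\<chi> i j. poly (P $ i $ j) z)"
  define b :: "complex^'n" where "b = (\<chi> i. y i)"
  define x :: "complex^'n" where "x = (\<chi> k. det (\<chi> i j. if j = k then b$i else A$i$j) / det A)"
  have d: "det A \<noteq> 0" using nz[OF z] by (simp add: A_def poly_det)
  have "A *v x = b" using cramer[OF d, of x b] unfolding x_def by blast
  then have "(\<Sum>m\<in>UNIV. A $ j $ m * x $ m) = y j"
    by (auto simp: matrix_vector_mult_def b_def vec_eq_iff)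
  moreover have "poly (cramer_poly P y m) z = x $ m * det A" for m
  proof -
    have "poly (cramer_poly P y m) z = det (\<chi> i j. if j = m then b$i else A$i$j)"
      unfolding cramer_poly_def poly_det A_def b_def
      by (intro arg_cong[where f=det]) (auto simp: vec_eq_iff)
    then show ?thesis using d by (simp add: x_def)
  qed
  ultimately show "poly (\<Sum>m\<in>UNIV. P $ j $ m * cramer_poly P y m) z = poly (smult (y j) (det P)) z"
    unfolding poly_sum
    by (simp add: poly_det flip: A_def) (simp add: A_def flip: sum_distrib_right mult.assoc)
qed

definition cramer_fps :: "complex poly^'n^'n \<Rightarrow> ('n \<Rightarrow> complex) \<Rightarrow> 'n \<Rightarrow> complex fps" where
  "cramer_fps P y m = fps_of_poly (cramer_poly P y m) * inverse (fps_of_poly (det P))"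

lemma cramer_fps:
  fixes P :: "complex poly^'n^'n"
  assumes nz: "\<And>z. cmod z \<le> 1 \<Longrightarrow> poly (det P) z \<noteq> 0"
  shows "fgeo (cramer_fps P y m)"
    and "(\<Sum>m\<in>UNIV. fps_of_poly (P $ j $ m) * cramer_fps P y m) = fps_const (y j)"
proof -
  show "fgeo (cramer_fps P y m)"
    unfolding cramer_fps_def by (intro fgeo_mult fgeo_poly fgeo_inverse_poly nz)
  have "coeff (det P) 0 \<noteq> 0" using nz[of 0] by (simp add: poly_0_coeff_0)
  then have inv: "fps_of_poly (det P) * inverse (fps_of_poly (det P)) = 1"
    by (intro inverse_mult_eq_1') auto
  have "(\<Sum>m\<in>UNIV. fps_of_poly (P $ j $ m) * cramer_fps P y m) =
     fps_of_poly (\<Sum>m\<in>UNIV. P $ j $ m * cramer_poly P y m) * inverse (fps_of_poly (det P))"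
    by (simp add: cramer_fps_def fps_of_poly_sum fps_of_poly_mult sum_distrib_right mult.assoc)
  also have "\<dots> = fps_const (y j) * (fps_of_poly (det P) * inverse (fps_of_poly (det P)))"
    using cramer_poly[OF nz, of j y] by (simp add: fps_of_poly_smult mult.assoc)
  finally show "(\<Sum>m\<in>UNIV. fps_of_poly (P $ j $ m) * cramer_fps P y m) = fps_const (y j)"
    by (simp add: inv)
qed

section \<open>Antilinear operators in Takagi normal form\<close>

definition lcomb :: "('n::finite \<Rightarrow> complex fps) \<Rightarrow> ('n \<Rightarrow> complex) \<Rightarrow> complex fps" where
  "lcomb v y = (\<Sum>j\<in>UNIV. fps_const (y j) * v j)"

lemma lcomb_nth: "fps_nth (lcomb v y) n = (\<Sum>j\<in>UNIV. y j * fps_nth (v j) n)"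
  by (simp add: lcomb_def fps_sum_nth)

lemma fgeo_lcomb: "(\<And>j. fgeo (v j)) \<Longrightarrow> fgeo (lcomb v y)"
  unfolding lcomb_def by (intro fgeo_sum fgeo_mult fgeo_const)

lemma lcomb_0: "lcomb v (\<lambda>_. 0) = 0" by (simp add: lcomb_def)

lemma fps_nth_inject_iff: "fps_nth F = fps_nth G \<longleftrightarrow> F = G"
  by (metis fps_nth_inject)

text \<open>An antilinear symmetric operator of finite rank, diagonal in the orthogonal system
  \<open>v\<close>. Rotating a vector by exp(ia) rotates its diagonal entry by exp(-2ia). Hence
  eigenvectors with positive eigenvalue exist and, after normalisation, are fixed up to sign, while
  \<open>T\<close> composed with itself is linear with nonzero eigenvalues \<sigma>.\<close>

locale takagi =
  fixes v :: "'n::finite \<Rightarrow> complex fps" and d \<sigma> :: "'n \<Rightarrow> real" and g :: "'n \<Rightarrow> complex"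
    and T :: "(nat \<Rightarrow> complex) \<Rightarrow> nat \<Rightarrow> complex"
  assumes v: "fgeo (v j)" and d: "d j > 0"
    and gram: "hip (v j) (v k) = (if j = k then complex_of_real (d j) else 0)"
    and T: "h \<in> l2p \<Longrightarrow> T h = fps_nth (lcomb v (\<lambda>j. g j / d j * hinner (fps_nth (v j)) h))"
    and g: "(cmod (g j))\<^sup>2 = \<sigma> j" and \<sigma>_pos: "\<sigma> j > 0" and \<sigma>_inj: "inj \<sigma>"
begin

lemma hip_lcomb_left: "hip (lcomb v y) (v k) = y k * d k"
  unfolding lcomb_def
  by (subst hip_sum_left) (auto simp: v fgeo_mult fgeo_const hip_scale_left gram if_distrib cong: if_cong)

lemma hip_lcomb_right: "hip (v k) (lcomb v y) = cnj (y k) * d k"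
  using hip_lcomb_left[of y k] hip_cnj[of "v k" "lcomb v y"] by (simp add: v fgeo_lcomb)

lemma lcomb_inject: "lcomb v y = lcomb v y' \<longleftrightarrow> y = y'"
proof
  assume "lcomb v y = lcomb v y'"
  then have "y k * d k = y' k * d k" for k using hip_lcomb_left by metis
  then show "y = y'" using d by (auto simp: fun_eq_iff less_imp_neq[symmetric])
qed auto

lemma T_lcomb: "T (fps_nth (lcomb v y)) = fps_nth (lcomb v (\<lambda>j. g j * cnj (y j)))"
proof -
  have "T (fps_nth (lcomb v y)) = fps_nth (lcomb v (\<lambda>j. g j / d j * (cnj (y j) * d j)))"
    by (subst T) (auto simp: fgeo_l2p fgeo_lcomb v hip_lcomb_right)
  also have "(\<lambda>j. g j / d j * (cnj (y j) * d j)) = (\<lambda>j. g j * cnj (y j))"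
    using d by (auto simp: fun_eq_iff less_imp_neq[symmetric])
  finally show ?thesis .
qed

lemma scale_lcomb: "(\<lambda>n. c * fps_nth (lcomb v y) n) = fps_nth (lcomb v (\<lambda>j. c * y j))"
  by (auto simp: fun_eq_iff lcomb_nth sum_distrib_left mult.assoc)

lemma g_cnj: "g j * cnj (g j) = complex_of_real (\<sigma> j)"
  by (simp only: g[symmetric] complex_norm_square)

lemma T_T_lcomb: "T (T (fps_nth (lcomb v y))) = fps_nth (lcomb v (\<lambda>j. complex_of_real (\<sigma> j) * y j))"
  by (simp add: T_lcomb mult.assoc flip: g_cnj)

text \<open>A positive eigenvalue puts its eigenvector in the range of \<open>T\<close>, hence in
  the span of \<open>v\<close>, where comparing coordinates decides.\<close>

lemma eigenvalues:
  "{r. r > 0 \<and> (\<exists>h\<in>l2p. h \<noteq> (\<lambda>_. 0) \<and> T (T h) = (\<lambda>n. complex_of_real r * h n))} = range \<sigma>" (is "?E = _")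
proof (intro equalityI subsetI)
  fix r assume "r \<in> ?E"
  then obtain h where r: "r > 0" and h: "h \<in> l2p" "h \<noteq> (\<lambda>_. 0)" "T (T h) = (\<lambda>n. complex_of_real r * h n)" by blast
  obtain y' where "T h = fps_nth (lcomb v y')" using T[OF h(1)] by blast
  then have "(\<lambda>n. complex_of_real r * h n) = fps_nth (lcomb v (\<lambda>j. g j * cnj (y' j)))" using h(3) T_lcomb by simp
  then have "(\<lambda>n. complex_of_real (1 / r) * (complex_of_real r * h n)) =
      (\<lambda>n. complex_of_real (1 / r) * fps_nth (lcomb v (\<lambda>j. g j * cnj (y' j))) n)"
    by (simp add: fun_eq_iff)
  then obtain y where y: "h = fps_nth (lcomb v y)" using r unfolding scale_lcomb by (auto simp: fun_eq_iff)
  have "lcomb v (\<lambda>j. complex_of_real (\<sigma> j) * y j) = lcomb v (\<lambda>j. complex_of_real r * y j)"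
    using h(3) unfolding y T_T_lcomb scale_lcomb by (simp only: fps_nth_inject_iff)
  then have e: "of_real (\<sigma> j) * y j = of_real r * y j" for j by (simp add: lcomb_inject fun_eq_iff)
  have "y \<noteq> (\<lambda>_. 0)" using h(2) unfolding y by (auto simp: lcomb_0)
  then obtain k where "y k \<noteq> 0" by auto
  then show "r \<in> range \<sigma>" using e[of k] by auto
next
  fix r assume "r \<in> range \<sigma>"
  then obtain k where k: "r = \<sigma> k" by blast
  let ?y = "\<lambda>j. if j = k then 1 else 0"
  have "lcomb v ?y \<noteq> lcomb v (\<lambda>_. 0)" by (auto simp: lcomb_inject fun_eq_iff)
  then have "fps_nth (lcomb v ?y) \<noteq> (\<lambda>_. 0)"
    by (simp add: lcomb_0 fps_eq_iff fun_eq_iff)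
  moreover have "T (T (fps_nth (lcomb v ?y))) = (\<lambda>n. complex_of_real r * fps_nth (lcomb v ?y) n)"
    unfolding T_T_lcomb scale_lcomb k by (intro arg_cong[where f=fps_nth] arg_cong[where f="lcomb v"]) auto
  ultimately show "r \<in> ?E"
    using \<sigma>_pos[of k] k fgeo_l2p[OF fgeo_lcomb[of v ?y]] v by blast
qed

text \<open>Comparing moduli of coordinates singles out the index \<open>k\<close> because \<sigma>
  is injective; the normalisation then determines the square of the remaining coordinate. Its sign
  stays free, which is harmless since only squares enter the phases.\<close>

lemma unit_eigenvector:
  assumes e: "e \<in> l2p" "hsqnorm e = 1" "T e = (\<lambda>n. complex_of_real (sqrt (\<sigma> k)) * e n)"
  obtains y where "e = fps_nth (fps_const y * v k)" "y\<^sup>2 = g k / (sqrt (\<sigma> k) * d k)"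
proof -
  have sp: "sqrt (\<sigma> k) > 0" using \<sigma>_pos by simp
  obtain y' where y': "T e = fps_nth (lcomb v y')" using T[OF e(1)] by blast
  have "e = (\<lambda>n. complex_of_real (1 / sqrt (\<sigma> k)) * T e n)"
    using sp unfolding e(3) by (auto simp: fun_eq_iff)
  then obtain y where y: "e = fps_nth (lcomb v y)" unfolding y' scale_lcomb by blast
  have "lcomb v (\<lambda>j. g j * cnj (y j)) = lcomb v (\<lambda>j. complex_of_real (sqrt (\<sigma> k)) * y j)"
    using e(3) unfolding y T_lcomb scale_lcomb by (simp only: fps_nth_inject_iff)
  then have eq: "g j * cnj (y j) = sqrt (\<sigma> k) * y j" for j by (simp add: lcomb_inject fun_eq_iff)
  have y0: "y j = 0" if "j \<noteq> k" for j
  proof (rule ccontr)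
    assume "y j \<noteq> 0"
    moreover have "(cmod (g j) * cmod (y j))\<^sup>2 = (sqrt (\<sigma> k) * cmod (y j))\<^sup>2"
      using arg_cong[OF eq[of j], of "\<lambda>x. (cmod x)\<^sup>2"] by (simp add: norm_mult power_mult_distrib)
    ultimately have "\<sigma> j = \<sigma> k" using \<sigma>_pos[of k] by (simp add: power_mult_distrib g)
    then show False using that \<sigma>_inj by (auto dest: injD)
  qed
  have ev: "lcomb v y = fps_const (y k) * v k"
    unfolding lcomb_def by (subst sum.mono_neutral_right[of UNIV "{k}"]) (auto simp: y0)
  have "hip (lcomb v y) (lcomb v y) = 1" using hip_self[OF fgeo_lcomb[of v y]] v e(2) y by auto
  then have "cnj (y k) * (y k * d k) = 1"
    unfolding ev by (simp add: hip_scale_left hip_scale_right v fgeo_mult fgeo_const gram)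
  then have yy: "y k * cnj (y k) = 1 / d k" using d[of k] by (simp add: field_simps)
  have "y k * (g k * cnj (y k)) = y k * (sqrt (\<sigma> k) * y k)" using eq[of k] by simp
  then have "g k * (1 / d k) = sqrt (\<sigma> k) * (y k)\<^sup>2"
    using yy by (simp add: power2_eq_square mult_ac)
  then have "(y k)\<^sup>2 = g k / (sqrt (\<sigma> k) * d k)" using sp d[of k] by (simp add: field_simps)
  then show ?thesis using that[of "y k"] y ev by simp
qed

text \<open>Guarantees that the choices in \<open>phase_phi\<close> and \<open>phase_theta\<close>
  are made from nonempty sets; the scalar is a square root of the value forced by
  \<open>unit_eigenvector\<close>.\<close>

lemma unit_eigenvector_exists:
  obtains y where "fgeo (fps_const y * v k)" "hsqnorm (fps_nth (fps_const y * v k)) = 1"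
    "T (fps_nth (fps_const y * v k)) = (\<lambda>n. complex_of_real (sqrt (\<sigma> k)) * fps_nth (fps_const y * v k) n)"
    "y\<^sup>2 = g k / (sqrt (\<sigma> k) * d k)"
proof -
  have sp: "sqrt (\<sigma> k) > 0" using \<sigma>_pos by simp
  define y where "y = csqrt (g k / (sqrt (\<sigma> k) * d k))"
  have y2: "y\<^sup>2 = g k / (sqrt (\<sigma> k) * d k)" by (simp add: y_def)
  have "sqrt (\<sigma> k) = cmod (g k)" using g[of k] by (metis norm_ge_zero real_sqrt_unique)
  then have "(cmod y)\<^sup>2 = 1 / d k"
    using arg_cong[OF y2, of cmod] sp d[of k] by (simp add: norm_power norm_divide norm_mult)
  then have yy: "y * cnj y = 1 / d k" using complex_norm_square[of y] by simp
  have ge: "fgeo (fps_const y * v k)" by (intro fgeo_mult fgeo_const v)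
  have "hip (fps_const y * v k) (fps_const y * v k) = y * cnj y * d k"
    by (simp add: hip_scale_left hip_scale_right v fgeo_mult fgeo_const gram)
  then have "complex_of_real (hsqnorm (fps_nth (fps_const y * v k))) = 1"
    using hip_self[OF ge] yy d[of k] by simp
  then have n: "hsqnorm (fps_nth (fps_const y * v k)) = 1" by (metis of_real_eq_1_iff)
  have ev: "fps_const y * v k = lcomb v (\<lambda>j. if j = k then y else 0)"
    unfolding lcomb_def by (subst sum.mono_neutral_right[of UNIV "{k}"]) auto
  have y0: "y \<noteq> 0" using yy d[of k] by auto
  have "y * (g k * cnj y) = g k * (y * cnj y)" by (simp add: mult_ac)
  also have "\<dots> = sqrt (\<sigma> k) * y\<^sup>2" unfolding yy y2 using sp by simp
  also have "\<dots> = y * (sqrt (\<sigma> k) * y)" by (simp add: power2_eq_square)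
  finally have "y * (g k * cnj y) = y * (sqrt (\<sigma> k) * y)" .
  then have eq: "g k * cnj y = sqrt (\<sigma> k) * y" using y0 by simp
  have "T (fps_nth (fps_const y * v k)) = (\<lambda>n. complex_of_real (sqrt (\<sigma> k)) * fps_nth (fps_const y * v k) n)"
    unfolding ev T_lcomb scale_lcomb using eq
    by (intro arg_cong[where f=fps_nth] arg_cong[where f="lcomb v"]) auto
  then show ?thesis using that ge n y2 by blast
qed

end

section \<open>The inverse spectral construction\<close>

definition cmat :: "('n \<Rightarrow> real) \<Rightarrow> ('n \<Rightarrow> real) \<Rightarrow> 'n \<Rightarrow> 'n \<Rightarrow> real" where
  "cmat s t j m = 1 / (s j - t m)"

definition pmat :: "('n \<Rightarrow> real) \<Rightarrow> ('n \<Rightarrow> real) \<Rightarrow> ('n \<Rightarrow> complex) \<Rightarrow> ('n \<Rightarrow> complex) \<Rightarrow> complex poly^'n^'n" where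
  "pmat s t al be = (\<chi> j m. [:al j * cmat s t j m, - (be m * cmat s t j m):])"

text \<open>Annihilation by all powers is annihilation by all polynomials; the one that vanishes at
  every node but s_j isolates y_j.\<close>

lemma vandermonde_kernel:
  fixes s :: "'n::finite \<Rightarrow> real" and y :: "'n \<Rightarrow> complex"
  assumes "inj s" and y: "\<And>k. (\<Sum>j\<in>UNIV. of_real (s j) ^ k * y j) = 0"
  shows "y j = 0"
proof -
  have p: "(\<Sum>i\<in>UNIV. poly p (of_real (s i)) * y i) = 0" for p :: "complex poly"
  proof -
    have "(\<Sum>i\<in>UNIV. poly p (of_real (s i)) * y i) = (\<Sum>k\<le>degree p. coeff p k * (\<Sum>i\<in>UNIV. of_real (s i) ^ k * y i))"
      unfolding poly_altdef sum_distrib_right sum_distrib_left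
      by (subst sum.swap) (simp add: mult_ac)
    then show ?thesis by (simp add: y)
  qed
  define r where "r = (\<Prod>k\<in>-{j}. [:- complex_of_real (s k), 1:])"
  have r0: "poly r (of_real (s i)) = 0" if "i \<noteq> j" for i
    unfolding r_def poly_prod by (rule prod_zero) (use that in auto)
  have "poly r (of_real (s j)) \<noteq> 0"
    unfolding r_def poly_prod using assms(1) by (subst prod_zero_iff) (auto dest: injD)
  moreover have "(\<Sum>i\<in>UNIV. poly r (of_real (s i)) * y i) = poly r (of_real (s j)) * y j"
    by (subst sum.mono_neutral_right[of UNIV "{j}"]) (auto simp: r0)
  ultimately show ?thesis using p[of r] by auto
qed

lemma sesqui_expand:
  fixes M M' :: "'n::finite \<Rightarrow> 'm::finite \<Rightarrow> complex"
  shows "(\<Sum>m\<in>UNIV. a m * (\<Sum>j\<in>UNIV. M j m * X j) * cnj (\<Sum>k\<in>UNIV. M' k m * X' k)) =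
    (\<Sum>j\<in>UNIV. \<Sum>k\<in>UNIV. X j * cnj (X' k) * (\<Sum>m\<in>UNIV. a m * M j m * cnj (M' k m)))"
proof -
  have "(\<Sum>m\<in>UNIV. a m * (\<Sum>j\<in>UNIV. M j m * X j) * cnj (\<Sum>k\<in>UNIV. M' k m * X' k)) =
    (\<Sum>m\<in>UNIV. \<Sum>j\<in>UNIV. \<Sum>k\<in>UNIV. X j * cnj (X' k) * (a m * M j m * cnj (M' k m)))"
    by (simp add: sum_product sum_distrib_left sum_distrib_right mult_ac)
  also have "\<dots> = (\<Sum>j\<in>UNIV. \<Sum>m\<in>UNIV. \<Sum>k\<in>UNIV. X j * cnj (X' k) * (a m * M j m * cnj (M' k m)))"
    by (rule sum.swap)
  also have "\<dots> = (\<Sum>j\<in>UNIV. \<Sum>k\<in>UNIV. \<Sum>m\<in>UNIV. X j * cnj (X' k) * (a m * M j m * cnj (M' k m)))"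
    by (intro sum.cong refl sum.swap)
  finally show ?thesis by (simp add: sum_distrib_left)
qed

lemma fps_linear_mult_nth:
  fixes F :: "complex fps"
  shows
  "fps_nth (fps_of_poly [:a, b:] * F) 0 = a * fps_nth F 0"
  "fps_nth (fps_of_poly [:a, b:] * F) (Suc n) = a * fps_nth F (Suc n) + b * fps_nth F n"
proof -
  have "fps_of_poly [:a, b:] * F = fps_const a * F + fps_const b * (fps_X * F)"
    by (simp add: fps_of_poly_pCons fps_of_poly_const algebra_simps)
  then show "fps_nth (fps_of_poly [:a, b:] * F) 0 = a * fps_nth F 0"
    "fps_nth (fps_of_poly [:a, b:] * F) (Suc n) = a * fps_nth F (Suc n) + b * fps_nth F n"
    by simp_all
qed

lemma sum_sum_delta:
  fixes f :: "'n::finite \<Rightarrow> 'n \<Rightarrow> 'a::semiring_0"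
  shows "(\<Sum>j\<in>UNIV. \<Sum>k\<in>UNIV. f j k * (if j = k then a j else 0)) = (\<Sum>j\<in>UNIV. f j j * a j)"
proof (intro sum.cong refl)
  fix j
  have "(\<Sum>k\<in>UNIV. f j k * (if j = k then a j else 0)) = (\<Sum>k\<in>UNIV. if j = k then f j j * a j else 0)"
    by (intro sum.cong) auto
  then show "(\<Sum>k\<in>UNIV. f j k * (if j = k then a j else 0)) = f j j * a j" by simp
qed

section \<open>Interlacing sequences and their weights\<close>

locale interlacing =
  fixes ix :: "'n::finite \<Rightarrow> nat" and s t :: "'n \<Rightarrow> real"
  assumes ix: "bij_betw ix UNIV {..<CARD('n)}"
    and t_less_s: "t j < s j" and t_pos: "0 < t j" and s_less_t_Suc: "ix j = Suc (ix i) \<Longrightarrow> s j < t i"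
begin

lemma ix_surj: "k < CARD('n) \<Longrightarrow> \<exists>i. ix i = k"
  using ix unfolding bij_betw_def by (metis imageE lessThan_iff)

lemma ix_less: "ix i < CARD('n)"
  using ix unfolding bij_betw_def by auto

lemma ix_inj: "ix i = ix j \<longleftrightarrow> i = j"
  using ix unfolding bij_betw_def inj_on_def by auto

lemma s_less_t: "ix i < ix j \<Longrightarrow> s j < t i"
proof -
  have "\<forall>j. ix j = ix i + Suc k \<longrightarrow> s j < t i" for k
  proof (induction k)
    case 0
    then show ?case using s_less_t_Suc by simp
  next
    case (Suc k)
    show ?case
    proof (intro allI impI)
      fix j assume j: "ix j = ix i + Suc (Suc k)"
      then have "ix i + Suc k < CARD('n)" using ix_less[of j] by simp
      then obtain l where l: "ix l = ix i + Suc k" using ix_surj by blast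
      then have "s l < t i" using Suc by blast
      moreover have "s j < t l" using s_less_t_Suc[of j l] j l by simp
      ultimately show "s j < t i" using t_less_s[of l] by linarith
    qed
  qed
  then show "ix i < ix j \<Longrightarrow> s j < t i" by (metis less_natE add_Suc_right)
qed

lemma s_decr: "ix i < ix j \<Longrightarrow> s j < s i" and t_decr: "ix i < ix j \<Longrightarrow> t j < t i"
  using s_less_t t_less_s by (meson less_trans)+

lemma s_pos: "s j > 0" using t_pos t_less_s by (meson less_trans)

lemma inj_s: "inj s" and inj_t: "inj t"
  by (rule injI, metis s_decr ix_inj less_irrefl linorder_neqE_nat)
    (rule injI, metis t_decr ix_inj less_irrefl linorder_neqE_nat)

lemma s_neq_t: "s j \<noteq> t m"
  using s_less_t[of m j] t_less_s[of m] s_decr[of j m] t_less_s[of j] ix_inj[of j m]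
  by (metis less_asym less_irrefl linorder_neqE_nat less_trans)

abbreviation "c \<equiv> cmat s t"

lemma c_eq: "c j m = 1 / (s j - t m)" by (simp add: cmat_def)

lemma s_c: "s j * c j m = t m * c j m + 1"
  using s_neq_t[of j m] by (simp add: c_eq field_simps)

text \<open>Residues of \<Prod>(X - t_k) / \<Prod>(X - s_k) at the points s_j. They will be the
  squared moduli of the components of u along normalised eigenvectors of H.\<close>

definition w :: "'n \<Rightarrow> real" where
  "w j = (s j - t j) * (\<Prod>k\<in>-{j}. (s j - t k) / (s j - s k))"

text \<open>Interlacing gives the numerator and the denominator of every factor the same
  sign.\<close>

lemma w_pos: "w j > 0"
proof -
  have "(s j - t k) / (s j - s k) > 0" if "k \<noteq> j" for k
  proof (cases "ix k < ix j")
    case True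
    then show ?thesis using s_less_t[of k j] s_decr[of k j] by (simp add: zero_less_divide_iff)
  next
    case False
    then have "ix j < ix k" using that ix_inj[of k j] by linarith
    then show ?thesis using s_decr[of j k] t_less_s[of k] by (simp add: zero_less_divide_iff)
  qed
  then show ?thesis unfolding w_def using t_less_s by (intro mult_pos_pos prod_pos) auto
qed

text \<open>Lagrange interpolation of \<open>\<Prod>(X - s) - \<Prod>(X - t)\<close> at the points \<open>s\<close>, evaluated at \<open>t\<close>.\<close>

lemma w_sum: "(\<Sum>j\<in>UNIV. w j * c j m) = 1"
proof -
  define N where "N = CARD('n)"
  define S where "S = (\<Prod>k\<in>UNIV. [:- s k, 1:])"
  define T where "T = (\<Prod>k\<in>UNIV. [:- t k, 1:])"
  define S' where "S' j = (\<Prod>k\<in>-{j}. [:- s k, 1:])" for j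
  define L where "L = (\<Sum>j\<in>UNIV. smult (w j) (S' j))"
  have S_split: "S = [:- s j, 1:] * S' j" for j
    unfolding S_def S'_def by (subst prod.remove[of UNIV j]) (auto simp: Compl_eq_Diff_UNIV)
  have degP: "degree (\<Prod>k\<in>A. [:- f k, 1::real:]) = card A" "lead_coeff (\<Prod>k\<in>A. [:- f k, 1::real:]) = 1" 
    for f :: "'n \<Rightarrow> real" and A
    by (simp add: degree_prod_eq_sum_degree, simp add: lead_coeff_prod)
  have d1: "degree (S - T) < N"
  proof -
    have "coeff (S - T) N = 0" "degree (S - T) \<le> N"
      using degP[of s UNIV] degP[of t UNIV] degree_diff_le[of S N T] unfolding S_def T_def N_def by auto
    moreover have "N > 0" by (simp add: N_def)
    ultimately show ?thesis
      by (metis degree_0 le_neq_implies_less leading_coeff_0_iff)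
  qed
  have d2: "degree L < N"
  proof -
    have "degree (smult (w j) (S' j)) \<le> N - 1" for j
      using degP(1)[of s "-{j}"] unfolding S'_def N_def
      by (simp add: card_Diff_singleton Compl_eq_Diff_UNIV)
    then have "degree L \<le> N - 1" unfolding L_def by (intro degree_sum_le) auto
    moreover have "N > 0" by (simp add: N_def)
    ultimately show ?thesis by linarith
  qed
  have z: "poly (S - T + L) (s j) = 0" for j
  proof -
    have a: "poly (S' i) (s j) = 0" if "i \<noteq> j" for i
      unfolding S'_def poly_prod by (rule prod_zero) (use that in auto)
    have b: "w j * poly (S' j) (s j) = poly T (s j)"
    proof -
      have ne: "s j - s k \<noteq> 0" if "k \<in> -{j}" for k using that inj_s by (auto dest: injD)
      have "w j * poly (S' j) (s j) = (s j - t j) * ((\<Prod>k\<in>-{j}. (s j - t k) / (s j - s k)) * (\<Prod>k\<in>-{j}. s j - s k))"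
        by (simp add: w_def S'_def poly_prod)
      also have "\<dots> = (s j - t j) * (\<Prod>k\<in>-{j}. s j - t k)"
        unfolding prod.distrib[symmetric]
        by (intro arg_cong2[where f="(*)"] refl prod.cong) (use ne in auto)
      also have "\<dots> = poly T (s j)"
        unfolding T_def poly_prod by (subst prod.remove[of UNIV j]) (auto simp: Compl_eq_Diff_UNIV)
      finally show ?thesis .
    qed
    have "poly L (s j) = w j * poly (S' j) (s j)"
      unfolding L_def poly_sum by (subst sum.mono_neutral_right[of UNIV "{j}"]) (auto simp: a)
    moreover have "poly S (s j) = 0" unfolding S_split[of j] by simp
    ultimately show ?thesis using b by simp
  qed
  have "S - T + L = 0"
  proof (rule ccontr)
    assume ne: "S - T + L \<noteq> 0"
    then have "card {x. poly (S - T + L) x = 0} \<le> degree (S - T + L)" by (rule card_poly_roots_bound)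
    moreover have "degree (S - T + L) < N" using d1 d2 degree_add_less by blast
    moreover have "N \<le> card {x. poly (S - T + L) x = 0}"
    proof -
      have "card (range s) = N" using card_image[OF inj_s] by (simp add: N_def)
      moreover have "range s \<subseteq> {x. poly (S - T + L) x = 0}" using z by auto
      ultimately show ?thesis using card_mono[OF poly_roots_finite[OF ne]] by metis
    qed
    ultimately show False by linarith
  qed
  then have "poly (S - T + L) (t m) = 0" by simp
  moreover have "poly T (t m) = 0" unfolding T_def poly_prod by (rule prod_zero) auto
  moreover have "poly L (t m) = - poly S (t m) * (\<Sum>j\<in>UNIV. w j * c j m)"
  proof -
    have "w j * poly (S' j) (t m) = - poly S (t m) * (w j * c j m)" for j
      using s_neq_t[of j m] unfolding S_split[of j] by (simp add: c_eq field_simps)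
    then show ?thesis unfolding L_def poly_sum by (simp add: sum_distrib_left sum_negf)
  qed
  ultimately have "poly S (t m) * (1 - (\<Sum>j\<in>UNIV. w j * c j m)) = 0" by (simp add: algebra_simps)
  moreover have "poly S (t m) \<noteq> 0"
    unfolding S_def poly_prod using s_neq_t by (subst prod_zero_iff) (auto, metis)
  ultimately show ?thesis by simp
qed

text \<open>Dual weights: \<open>1 / w j\<close> and \<open>q m\<close> will be the squared norms of
  \<open>et j\<close> and \<open>eta m\<close>.\<close>

definition q :: "'n \<Rightarrow> real" where "q m = 1 / (\<Sum>j\<in>UNIV. w j * (c j m)\<^sup>2)"

lemmas orth = cauchy_orthogonality[of c s t w q, OF c_eq s_neq_t inj_t w_pos w_sum q_def]

lemma q_pos: "q m > 0" by (rule orth(1))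

text \<open>Since t c = s c - 1 entrywise, this is the row orthogonality scaled by s_j minus a
  matrix of ones; that matrix is the trace of the rank one difference between H^2 and K^2.\<close>

lemma orth_t: "(\<Sum>m\<in>UNIV. q m * t m * c j m * c k m) = (if j = k then s j / w j else 0) - 1"
proof -
  have "q m * t m * c j m * c k m = s j * (q m * c j m * c k m) - q m * c k m" for m
  proof -
    have "q m * t m * c j m * c k m = q m * c k m * (s j * c j m - 1)"
      using s_c[of j m] by (simp add: mult_ac)
    then show ?thesis by (simp add: algebra_simps)
  qed
  then have "(\<Sum>m\<in>UNIV. q m * t m * c j m * c k m) = s j * (\<Sum>m\<in>UNIV. q m * c j m * c k m) - (\<Sum>m\<in>UNIV. q m * c k m)"
    by (simp add: sum_subtractf sum_distrib_left)
  then show ?thesis using orth(3)[of j k] orth(4)[of k] by (simp only:) auto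
qed

text \<open>The weighted transpose of \<open>c\<close> is a left inverse up to the nonzero factors 1
  / q.\<close>

lemma c_injective:
  fixes x :: "'n \<Rightarrow> 'a::real_field"
  assumes "\<And>j. (\<Sum>m\<in>UNIV. of_real (c j m) * x m) = 0"
  shows "x m = 0"
proof -
  have "0 = (\<Sum>j\<in>UNIV. of_real (w j * c j m) * (\<Sum>l\<in>UNIV. of_real (c j l) * x l))" by (simp add: assms)
  also have "\<dots> = (\<Sum>j\<in>UNIV. \<Sum>l\<in>UNIV. of_real (w j * c j m * c j l) * x l)"
    by (simp add: sum_distrib_left mult_ac)
  also have "\<dots> = (\<Sum>l\<in>UNIV. of_real (\<Sum>j\<in>UNIV. w j * c j m * c j l) * x l)"
    unfolding of_real_sum sum_distrib_right by (rule sum.swap)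
  also have "\<dots> = (\<Sum>l\<in>UNIV. if m = l then x m / of_real (q m) else 0)"
    unfolding orth(2) by (intro sum.cong refl) auto
  finally show ?thesis using q_pos[of m] by simp
qed

lemma lamsq_order:
  assumes "f = s \<or> f = t"
  shows "rev (sorted_list_of_set (range f)) ! ix j = f j"
proof -
  define N where "N = CARD('n)"
  define l where "l = map (f \<circ> inv_into UNIV ix) [0..<N]"
  have inv: "inv_into UNIV ix (ix i) = i" for i using ix by (simp add: bij_betw_def)
  have ixinv: "ix (inv_into UNIV ix k) = k" if "k < N" for k
    using ix that by (metis N_def bij_betw_inv_into_right lessThan_iff)
  have decr: "f i > f k" if "ix i < ix k" for i k using assms s_decr t_decr that by blast
  have "sorted_wrt (>) l"
    unfolding l_def sorted_wrt_map sorted_wrt_iff_nth_less using decr ixinv by auto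
  then have "sorted_wrt (<) (rev l)" by (simp add: sorted_wrt_rev)
  moreover have "set (rev l) = range f"
  proof -
    have "inv_into UNIV ix ` {0..<N} = UNIV"
      using inv ix_less by (metis N_def UNIV_eq_I atLeastLessThan_iff imageI zero_le)
    then show ?thesis unfolding l_def by (simp only: set_rev set_map set_upt image_comp[symmetric])
  qed
  ultimately have "sorted_list_of_set (range f) = rev l"
    by (metis sorted_list_of_set.idem_if_sorted_distinct strict_sorted_iff)
  then show ?thesis using ix_less[of j] inv[of j] by (simp add: l_def N_def)
qed

end

text \<open>In the notation of the theorem, \<open>s\<^sub>j = \<lambda>\<^sub>j\<^sup>2\<close>, \<open>t\<^sub>m = \<mu>\<^sub>m\<^sup>2\<close>, \<open>al\<^sub>j = \<lambda>\<^sub>j exp(i \<phi>\<^sub>j)\<close>,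
  \<open>be\<^sub>m = \<mu>\<^sub>m exp(-i \<theta>\<^sub>m)\<close>; up to complex factors, \<open>et j\<close> and \<open>eta m\<close> will be \<open>e\<^sub>j\<close> and \<open>f\<^sub>m\<close>.\<close>

locale inv_spec = interlacing ix s t for ix :: "'n::finite \<Rightarrow> nat" and s t :: "'n \<Rightarrow> real" +
  fixes al be :: "'n \<Rightarrow> complex"
  assumes al: "(cmod (al j))\<^sup>2 = s j" and be: "(cmod (be m))\<^sup>2 = t m"
begin

lemma al_cnj: "al j * cnj (al j) = of_real (s j)" and be_cnj: "be m * cnj (be m) = of_real (t m)"
  by (simp_all add: al[symmetric] be[symmetric] complex_norm_square[symmetric])

lemma al_nz: "al j \<noteq> 0" and be_nz: "be m \<noteq> 0"
  using al[of j] be[of m] s_pos[of j] t_pos[of m] by auto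

abbreviation "cc j m \<equiv> complex_of_real (c j m)"
abbreviation "P \<equiv> pmat s t al be"

lemma form_al:
  "(\<Sum>m\<in>UNIV. of_real (q m) * (\<Sum>j\<in>UNIV. al j * cc j m * X j) * cnj (\<Sum>k\<in>UNIV. al k * cc k m * X' k)) =
   (\<Sum>j\<in>UNIV. X j * cnj (X' j) * of_real (s j / w j))"
proof -
  have E: "(\<Sum>m\<in>UNIV. of_real (q m) * (al j * cc j m) * cnj (al k * cc k m)) =
      (if j = k then of_real (s j / w j) else 0)" for j k
  proof -
    have "(\<Sum>m\<in>UNIV. of_real (q m) * (al j * cc j m) * cnj (al k * cc k m)) =
      al j * cnj (al k) * of_real (\<Sum>m\<in>UNIV. q m * c j m * c k m)"
      by (simp add: sum_distrib_left mult_ac)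
    then show ?thesis using al_cnj[of j] by (cases "j = k") (simp_all add: orth(3))
  qed
  show ?thesis unfolding sesqui_expand E sum_sum_delta ..
qed

text \<open>Compared with \<open>form_al\<close>, the weighted form is lowered by the product of the
  coordinate sums. This loss drives both the invertibility on the disc and the telescoping sum for
  inner products.\<close>

lemma form_be:
  "(\<Sum>m\<in>UNIV. of_real (q m * t m) * (\<Sum>j\<in>UNIV. cc j m * X j) * cnj (\<Sum>k\<in>UNIV. cc k m * X' k)) =
   (\<Sum>j\<in>UNIV. X j * cnj (X' j) * of_real (s j / w j)) - (\<Sum>j\<in>UNIV. X j) * cnj (\<Sum>j\<in>UNIV. X' j)"
proof -
  have E: "(\<Sum>m\<in>UNIV. of_real (q m * t m) * cc j m * cnj (cc k m)) =
      (if j = k then of_real (s j / w j) else 0) - 1" for j k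
  proof -
    have "(\<Sum>m\<in>UNIV. of_real (q m * t m) * cc j m * cnj (cc k m)) =
      of_real (\<Sum>m\<in>UNIV. q m * t m * c j m * c k m)" by simp
    then show ?thesis unfolding orth_t by simp
  qed
  show ?thesis unfolding sesqui_expand E right_diff_distrib sum_subtractf sum_sum_delta
    by (simp add: sum_product)
qed

text \<open>With \<open>nrm\<close> the weighted norm from \<open>form_al\<close>, a null vector
  satisfies nrm y = |z|^2 (nrm y - |\<Sum> y|^2), which forces y = 0 inside the disc. On the circle
  it only gives \<Sum> y = 0; but then the null space is stable under y \<mapsto> conj (al y), hence
  under multiplication by s, so all the moments \<Sum> s^k y vanish.\<close>

lemma left_null_trivial:
  assumes z: "cmod z \<le> 1" and null: "\<And>m. (\<Sum>j\<in>UNIV. (al j - z * be m) * cc j m * y j) = 0"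
  shows "y j = 0"
proof -
  define Null where "Null y \<longleftrightarrow> (\<forall>m. (\<Sum>j\<in>UNIV. (al j - z * be m) * cc j m * y j) = 0)" for y
  define nrm where "nrm y = (\<Sum>j\<in>UNIV. (cmod (y j))\<^sup>2 * (s j / w j))" for y
  have nrm_nonneg: "nrm y \<ge> 0" for y
    unfolding nrm_def using s_pos w_pos by (intro sum_nonneg) (auto simp: less_imp_le)
  have nrm0: "y j = 0" if "nrm y = 0" for y j
  proof -
    have "\<forall>j\<in>UNIV. (cmod (y j))\<^sup>2 * (s j / w j) = 0"
      using that unfolding nrm_def
      by (subst (asm) sum_nonneg_eq_0_iff) (use s_pos w_pos in \<open>auto simp: less_imp_le\<close>)
    then show ?thesis using s_pos[of j] w_pos[of j] by auto
  qed
  have key: "nrm y = (cmod z)\<^sup>2 * (nrm y - (cmod (\<Sum>j\<in>UNIV. y j))\<^sup>2)" if "Null y" for y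
  proof -
    have T: "(\<Sum>j\<in>UNIV. al j * cc j m * y j) = z * be m * (\<Sum>j\<in>UNIV. cc j m * y j)" for m
      using that unfolding Null_def by (simp add: algebra_simps sum_subtractf sum_distrib_left)
    have nc: "complex_of_real (nrm y) = (\<Sum>j\<in>UNIV. y j * cnj (y j) * of_real (s j / w j))"
      unfolding nrm_def by (simp only: of_real_sum of_real_mult complex_norm_square)
    also have "\<dots> = (\<Sum>m\<in>UNIV. of_real (q m) * (z * be m * (\<Sum>j\<in>UNIV. cc j m * y j)) * cnj (z * be m * (\<Sum>j\<in>UNIV. cc j m * y j)))"
      unfolding form_al[symmetric] T ..
    also have "\<dots> = (\<Sum>m\<in>UNIV. z * cnj z * (of_real (q m * t m) * (\<Sum>j\<in>UNIV. cc j m * y j) * cnj (\<Sum>j\<in>UNIV. cc j m * y j)))"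
      by (intro sum.cong refl) (simp only: of_real_mult be_cnj[symmetric] complex_cnj_mult mult_ac)
    also have "\<dots> = z * cnj z * ((\<Sum>j\<in>UNIV. y j * cnj (y j) * of_real (s j / w j)) - (\<Sum>j\<in>UNIV. y j) * cnj (\<Sum>j\<in>UNIV. y j))"
      unfolding form_be[symmetric] sum_distrib_left ..
    also have "\<dots> = complex_of_real ((cmod z)\<^sup>2 * (nrm y - (cmod (\<Sum>j\<in>UNIV. y j))\<^sup>2))"
      unfolding nc[symmetric] by (simp only: of_real_mult of_real_diff complex_norm_square)
    finally show ?thesis unfolding of_real_eq_iff .
  qed
  show ?thesis
  proof (cases "cmod z < 1")
    case True
    have "nrm y * (1 - (cmod z)\<^sup>2) + (cmod z)\<^sup>2 * (cmod (\<Sum>j\<in>UNIV. y j))\<^sup>2 = 0"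
      using key[of y] null by (simp add: Null_def algebra_simps)
    moreover have z2: "(cmod z)\<^sup>2 < 1" using True by (simp add: power_less_one_iff)
    moreover have "nrm y * (1 - (cmod z)\<^sup>2) \<ge> 0" "(cmod z)\<^sup>2 * (cmod (\<Sum>j\<in>UNIV. y j))\<^sup>2 \<ge> 0"
      using nrm_nonneg[of y] z2 by simp_all
    ultimately have "nrm y * (1 - (cmod z)\<^sup>2) = 0" by linarith
    then have "nrm y = 0" using z2 by auto
    then show ?thesis by (rule nrm0)
  next
    case False
    then have z1: "cmod z = 1" using z by linarith
    have sum0: "(\<Sum>j\<in>UNIV. y j) = 0" if "Null y" for y using key[OF that] z1 by simp
    have zz: "z * cnj z = 1" using z1 complex_norm_square[of z] by simp
    \<comment> \<open>Conjugating the null equation exchanges the roles of \<open>al\<close> and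
      \<open>be\<close>. It closes up because |al|^2 = s, |be|^2 = t and s c = t c + 1, where the
      extra 1 contributes only the vanishing sum of \<open>y\<close>.\<close>
    have step: "Null (\<lambda>j. cnj (al j * y j))" if "Null y" for y
      unfolding Null_def
    proof
      fix m
      have T: "(\<Sum>j\<in>UNIV. al j * cc j m * y j) = z * be m * (\<Sum>j\<in>UNIV. cc j m * y j)"
        using that unfolding Null_def by (simp add: algebra_simps sum_subtractf sum_distrib_left)
      have "cnj (\<Sum>j\<in>UNIV. (al j - z * be m) * cc j m * cnj (al j * y j)) =
        (\<Sum>j\<in>UNIV. (al j * cnj (al j)) * cc j m * y j) - cnj (z * be m) * (\<Sum>j\<in>UNIV. al j * cc j m * y j)"
        by (simp add: algebra_simps sum_subtractf sum_distrib_left)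
      also have "(\<Sum>j\<in>UNIV. (al j * cnj (al j)) * cc j m * y j) = (\<Sum>j\<in>UNIV. (of_real (t m) * cc j m + 1) * y j)"
        unfolding al_cnj by (intro sum.cong refl) (metis s_c of_real_1 of_real_add of_real_mult)
      also have "\<dots> = of_real (t m) * (\<Sum>j\<in>UNIV. cc j m * y j)"
        using sum0[OF that] by (simp add: distrib_right sum.distrib sum_distrib_left mult.assoc)
      also have "cnj (z * be m) * (\<Sum>j\<in>UNIV. al j * cc j m * y j) = (z * cnj z) * (be m * cnj (be m)) * (\<Sum>j\<in>UNIV. cc j m * y j)"
        unfolding T by (simp add: mult_ac)
      finally have "cnj (\<Sum>j\<in>UNIV. (al j - z * be m) * cc j m * cnj (al j * y j)) = 0"
        unfolding zz be_cnj by simp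
      then show "(\<Sum>j\<in>UNIV. (al j - z * be m) * cc j m * cnj (al j * y j)) = 0"
        by (metis complex_cnj_zero_iff)
    qed
    have step2: "Null (\<lambda>j. of_real (s j) * y j)" if "Null y" for y
    proof -
      have "(\<lambda>j. cnj (al j * cnj (al j * y j))) = (\<lambda>j. of_real (s j) * y j)"
        unfolding al_cnj[symmetric] by (simp add: mult_ac)
      then show ?thesis using step[OF step[OF that]] by (simp only:)
    qed
    have "Null (\<lambda>j. of_real (s j) ^ k * y j)" for k
    proof (induction k)
      case 0
      then show ?case using null by (simp add: Null_def)
    next
      case (Suc k)
      then show ?case using step2[OF Suc] by (simp add: mult.assoc)
    qed
    then have "(\<Sum>j\<in>UNIV. of_real (s j) ^ k * y j) = 0" for k by (rule sum0)
    then show ?thesis by (rule vandermonde_kernel[OF inj_s])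
  qed
qed

lemma det_P_nz: "cmod z \<le> 1 \<Longrightarrow> poly (det P) z \<noteq> 0"
proof
  assume z: "cmod z \<le> 1" and d0: "poly (det P) z = 0"
  define A where "A = transpose (\<chi> i j. poly (P $ i $ j) z)"
  have "det A = 0" using d0 unfolding A_def det_transpose poly_det .
  then have "\<not> (\<exists>B. B ** A = mat 1)"
    by (metis invertible_det_nz invertible_left_inverse)
  then obtain x where x: "A *v x = 0" "x \<noteq> 0" using matrix_left_invertible_ker by blast
  have "(\<Sum>j\<in>UNIV. (al j - z * be m) * cc j m * x $ j) = 0" for m
    using arg_cong[OF x(1), of "\<lambda>v. v $ m"]
    by (simp add: A_def matrix_vector_mult_def transpose_def pmat_def algebra_simps)
  then have "x $ j = 0" for j using left_null_trivial[OF z] by metis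
  then show False using x(2) by (simp add: vec_eq_iff)
qed

definition eta :: "'n \<Rightarrow> complex fps" where "eta m = cramer_fps P (\<lambda>_. 1) m"
definition et :: "'n \<Rightarrow> complex fps" where "et j = (\<Sum>m\<in>UNIV. fps_const (cc j m) * eta m)"
definition u :: "complex fps" where "u = (\<Sum>m\<in>UNIV. eta m)"

lemma fgeo_eta: "fgeo (eta m)" unfolding eta_def by (rule cramer_fps(1)[OF det_P_nz])
lemma fgeo_et: "fgeo (et j)" unfolding et_def by (intro fgeo_sum fgeo_mult fgeo_const fgeo_eta)
lemma fgeo_u: "fgeo u" unfolding u_def by (intro fgeo_sum fgeo_eta)

lemma et_nth: "fps_nth (et j) n = (\<Sum>m\<in>UNIV. cc j m * fps_nth (eta m) n)"
  by (simp add: et_def fps_sum_nth)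

lemma eta_eq: "(\<Sum>m\<in>UNIV. fps_of_poly (P $ j $ m) * eta m) = 1"
  using cramer_fps(2)[OF det_P_nz, of j "\<lambda>_. 1"] by (simp add: eta_def)

lemma et_0: "al j * fps_nth (et j) 0 = 1"
proof -
  have "fps_nth (\<Sum>m\<in>UNIV. fps_of_poly (P $ j $ m) * eta m) 0 = 1" unfolding eta_eq by simp
  then show ?thesis
    by (simp add: fps_sum_nth pmat_def fps_linear_mult_nth et_nth sum_distrib_left mult.assoc del: fps_mult_nth_0)
qed

lemma et_Suc: "al j * fps_nth (et j) (Suc n) = (\<Sum>m\<in>UNIV. cc j m * be m * fps_nth (eta m) n)"
proof -
  have "fps_nth (\<Sum>m\<in>UNIV. fps_of_poly (P $ j $ m) * eta m) (Suc n) = 0" unfolding eta_eq by simp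
  then have "(\<Sum>m\<in>UNIV. al j * cc j m * fps_nth (eta m) (Suc n)) = (\<Sum>m\<in>UNIV. be m * cc j m * fps_nth (eta m) n)"
    by (simp add: fps_sum_nth pmat_def fps_linear_mult_nth sum_subtractf)
  then show ?thesis by (simp add: et_nth sum_distrib_left mult_ac)
qed

text \<open>Coefficientwise form of the transposed system: the row of series \<open>R\<close>
  multiplied by the matrix \<open>P\<close> gives the constant row \<open>y\<close>.\<close>

definition row_sol :: "('n \<Rightarrow> complex) \<Rightarrow> ('n \<Rightarrow> complex fps) \<Rightarrow> bool" where
  "row_sol y R \<longleftrightarrow> (\<forall>m. (\<Sum>j\<in>UNIV. al j * cc j m * fps_nth (R j) 0) = y m) \<and>
    (\<forall>m n. (\<Sum>j\<in>UNIV. al j * cc j m * fps_nth (R j) (Suc n)) = be m * (\<Sum>j\<in>UNIV. cc j m * fps_nth (R j) n))"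

lemma row_solution: "\<exists>R. (\<forall>j. fgeo (R j)) \<and> row_sol y R"
proof -
  define R where "R = cramer_fps (transpose P) y"
  have nz: "\<And>z. cmod z \<le> 1 \<Longrightarrow> poly (det (transpose P)) z \<noteq> 0" unfolding det_transpose by (rule det_P_nz)
  have e: "(\<Sum>j\<in>UNIV. fps_of_poly (P $ j $ m) * R j) = fps_const (y m)" for m
    using cramer_fps(2)[OF nz, of m y] by (simp add: transpose_def R_def)
  have "(\<Sum>j\<in>UNIV. al j * cc j m * fps_nth (R j) 0) = y m" for m
    using arg_cong[OF e[of m], of "\<lambda>F. fps_nth F 0"]
    by (simp add: fps_sum_nth pmat_def fps_linear_mult_nth mult.assoc del: fps_mult_nth_0)
  moreover have "(\<Sum>j\<in>UNIV. al j * cc j m * fps_nth (R j) (Suc n)) = be m * (\<Sum>j\<in>UNIV. cc j m * fps_nth (R j) n)" for m n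
    using arg_cong[OF e[of m], of "\<lambda>F. fps_nth F (Suc n)"]
    by (simp add: fps_sum_nth pmat_def fps_linear_mult_nth sum_subtractf sum_distrib_left mult.assoc)
  moreover have "fgeo (R j)" for j unfolding R_def by (rule cramer_fps(1)[OF nz])
  ultimately show ?thesis unfolding row_sol_def by (intro exI[of _ R] conjI allI)
qed

text \<open>The \<open>n\<close>-th backward shift of \<open>\<Sum>\<^sub>m y\<^sub>m \<eta>\<^sub>m\<close> has coordinates \<open>R\<^sub>j(n) \<alpha>\<^sub>j\<close> in the basis \<open>et\<close>.\<close>

lemma shift_expansion:
  assumes "row_sol y R"
  shows "fps_nth (lcomb eta y) (n + k) = (\<Sum>j\<in>UNIV. fps_nth (R j) n * al j * fps_nth (et j) k)"
proof -
  have R0: "\<And>m. (\<Sum>j\<in>UNIV. al j * cc j m * fps_nth (R j) 0) = y m"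
    and RS: "\<And>m n. (\<Sum>j\<in>UNIV. al j * cc j m * fps_nth (R j) (Suc n)) = be m * (\<Sum>j\<in>UNIV. cc j m * fps_nth (R j) n)"
    using assms unfolding row_sol_def by blast+
  show ?thesis
proof (induction n arbitrary: k)
  case 0
  have "(\<Sum>j\<in>UNIV. fps_nth (R j) 0 * al j * fps_nth (et j) k) =
      (\<Sum>j\<in>UNIV. \<Sum>m\<in>UNIV. (al j * cc j m * fps_nth (R j) 0) * fps_nth (eta m) k)"
    by (simp add: et_nth sum_distrib_left mult_ac)
  also have "\<dots> = (\<Sum>m\<in>UNIV. (\<Sum>j\<in>UNIV. al j * cc j m * fps_nth (R j) 0) * fps_nth (eta m) k)"
    unfolding sum_distrib_right by (rule sum.swap)
  finally show ?case by (simp add: R0 lcomb_nth)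
next
  case (Suc n)
  have "fps_nth (lcomb eta y) (Suc n + k) = (\<Sum>j\<in>UNIV. fps_nth (R j) n * (al j * fps_nth (et j) (Suc k)))"
    using Suc[of "Suc k"] by (simp add: mult.assoc)
  also have "\<dots> = (\<Sum>j\<in>UNIV. \<Sum>m\<in>UNIV. (be m * (cc j m * fps_nth (R j) n)) * fps_nth (eta m) k)"
    unfolding et_Suc by (simp add: sum_distrib_left mult_ac)
  also have "\<dots> = (\<Sum>m\<in>UNIV. (be m * (\<Sum>j\<in>UNIV. cc j m * fps_nth (R j) n)) * fps_nth (eta m) k)"
    unfolding sum_distrib_left sum_distrib_right by (rule sum.swap)
  also have "\<dots> = (\<Sum>m\<in>UNIV. (\<Sum>j\<in>UNIV. al j * cc j m * fps_nth (R j) (Suc n)) * fps_nth (eta m) k)"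
    by (simp only: RS)
  also have "\<dots> = (\<Sum>j\<in>UNIV. \<Sum>m\<in>UNIV. (al j * cc j m * fps_nth (R j) (Suc n)) * fps_nth (eta m) k)"
    unfolding sum_distrib_right by (rule sum.swap)
  also have "\<dots> = (\<Sum>j\<in>UNIV. fps_nth (R j) (Suc n) * al j * fps_nth (et j) k)"
    by (simp add: et_nth sum_distrib_left mult_ac)
  finally show ?case .
qed
qed

text \<open>The weighted form of \<open>form_al\<close>, taken on the coordinates of the n-th
  backward shifts, drops at each step by a product of n-th Taylor coefficients, by
  \<open>form_be\<close>, and tends to 0. The inner product is therefore its initial value.\<close>

lemma hip_lcomb_eta: "hip (lcomb eta y) (lcomb eta y') = (\<Sum>m\<in>UNIV. of_real (q m) * y m * cnj (y' m))"
proof -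
  obtain R where Rg: "\<forall>j. fgeo (R j)" and Rs: "row_sol y R" using row_solution by blast
  obtain R' where R'g: "\<forall>j. fgeo (R' j)" and R's: "row_sol y' R'" using row_solution by blast
  note R = Rg[rule_format] Rs[unfolded row_sol_def, THEN conjunct1, rule_format] Rs[unfolded row_sol_def, THEN conjunct2, rule_format]
  note R' = R'g[rule_format] R's[unfolded row_sol_def, THEN conjunct1, rule_format] R's[unfolded row_sol_def, THEN conjunct2, rule_format]
  define \<gamma> where "\<gamma> n = (\<Sum>j\<in>UNIV. fps_nth (R j) n * cnj (fps_nth (R' j) n) * of_real (s j / w j))" for n
  have F: "fps_nth (lcomb eta y) n = (\<Sum>j\<in>UNIV. fps_nth (R j) n)"
    "fps_nth (lcomb eta y') n = (\<Sum>j\<in>UNIV. fps_nth (R' j) n)" for n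
    using shift_expansion[OF Rs, of n 0] shift_expansion[OF R's, of n 0] et_0
    by (simp_all add: mult.assoc)
  have "\<gamma> (Suc n) = \<gamma> n - fps_nth (lcomb eta y) n * cnj (fps_nth (lcomb eta y') n)" for n
  proof -
    have "\<gamma> (Suc n) = (\<Sum>m\<in>UNIV. of_real (q m) * (be m * (\<Sum>j\<in>UNIV. cc j m * fps_nth (R j) n)) *
        cnj (be m * (\<Sum>j\<in>UNIV. cc j m * fps_nth (R' j) n)))"
      unfolding \<gamma>_def form_al[symmetric] R(3) R'(3) ..
    also have "\<dots> = (\<Sum>m\<in>UNIV. of_real (q m * t m) * (\<Sum>j\<in>UNIV. cc j m * fps_nth (R j) n) *
        cnj (\<Sum>j\<in>UNIV. cc j m * fps_nth (R' j) n))"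
      by (intro sum.cong refl) (simp only: of_real_mult be_cnj[symmetric] complex_cnj_mult mult_ac)
    finally show ?thesis unfolding form_be F \<gamma>_def .
  qed
  then have tel: "fps_nth (lcomb eta y) n * cnj (fps_nth (lcomb eta y') n) = \<gamma> n - \<gamma> (Suc n)" for n by simp
  have "\<gamma> \<longlonglongrightarrow> 0"
  proof -
    have lim: "(\<lambda>n. fps_nth G n) \<longlonglongrightarrow> 0" if "fgeo G" for G
    proof -
      from fgeo_bound[OF that] obtain C r where r: "0 < r" "r < 1" "\<And>n. cmod (fps_nth G n) \<le> C * r ^ n" by blast
      have "(\<lambda>n. C * r ^ n) \<longlonglongrightarrow> 0" by (intro tendsto_mult_right_zero LIMSEQ_power_zero) (use r in auto)
      with always_eventually[OF allI[OF r(3)]] show ?thesis by (rule Lim_null_comparison)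
    qed
    have "(\<lambda>n. \<Sum>j\<in>UNIV. fps_nth (R j) n * cnj (fps_nth (R' j) n) * of_real (s j / w j)) \<longlonglongrightarrow>
       (\<Sum>j\<in>UNIV. 0 * cnj 0 * of_real (s j / w j))"
      by (intro tendsto_intros lim R(1) R'(1))
    then show ?thesis unfolding \<gamma>_def by simp
  qed
  from telescope_sums'[OF this] have "hip (lcomb eta y) (lcomb eta y') = \<gamma> 0"
    unfolding hinner_def tel by (simp add: sums_iff)
  also have "\<gamma> 0 = (\<Sum>m\<in>UNIV. of_real (q m) * y m * cnj (y' m))"
    unfolding \<gamma>_def form_al[symmetric] R(2) R'(2) ..
  finally show ?thesis .
qed

lemma eta_lcomb: "eta m = lcomb eta (\<lambda>k. if k = m then 1 else 0)"
  unfolding lcomb_def by (subst sum.mono_neutral_right[of UNIV "{m}"]) auto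

lemma et_lcomb: "et j = lcomb eta (\<lambda>m. cc j m)"
  by (simp add: et_def lcomb_def)

lemma gram_eta: "hip (eta m) (eta l) = (if m = l then of_real (q m) else 0)"
proof -
  have "hip (eta m) (eta l) = (\<Sum>k\<in>UNIV. if k = m then (if m = l then of_real (q m) else 0) else 0)"
    by (subst (1 2) eta_lcomb, unfold hip_lcomb_eta, intro sum.cong) auto
  then show ?thesis by simp
qed

lemma gram_et: "hip (et j) (et k) = (if j = k then of_real (1 / w j) else 0)"
proof -
  have "hip (et j) (et k) = of_real (\<Sum>m\<in>UNIV. q m * c j m * c k m)"
    unfolding et_lcomb hip_lcomb_eta by simp
  then show ?thesis unfolding orth(3) by simp
qed

lemma sum_w_et: "(\<Sum>j\<in>UNIV. of_real (w j * c j m) * fps_nth (et j) n) = fps_nth (eta m) n / of_real (q m)"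
proof -
  have "(\<Sum>j\<in>UNIV. of_real (w j * c j m) * fps_nth (et j) n) =
      (\<Sum>j\<in>UNIV. \<Sum>l\<in>UNIV. of_real (w j * c j m * c j l) * fps_nth (eta l) n)"
    by (simp add: et_nth sum_distrib_left mult_ac)
  also have "\<dots> = (\<Sum>l\<in>UNIV. of_real (\<Sum>j\<in>UNIV. w j * c j m * c j l) * fps_nth (eta l) n)"
    unfolding of_real_sum sum_distrib_right by (rule sum.swap)
  also have "\<dots> = (\<Sum>l\<in>UNIV. if m = l then fps_nth (eta m) n / of_real (q m) else 0)"
    unfolding orth(2) by (intro sum.cong refl) auto
  finally show ?thesis by simp
qed

lemma u_eq: "u = lcomb eta (\<lambda>_. 1)" by (simp add: u_def lcomb_def)

text \<open>For the right-hand side 1 the row solution is again built from \<open>et\<close>. This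
  self-duality makes the expansion of the coefficient of index n + k of \<open>u\<close> symmetric
  in n and k.\<close>

lemma row_sol_w: "row_sol (\<lambda>_. 1) (\<lambda>j. fps_const (of_real (w j)) * et j)"
proof -
  define R where "R j = fps_const (of_real (w j)) * et j" for j
  have Rn: "fps_nth (R j) n = of_real (w j) * fps_nth (et j) n" for j n by (simp add: R_def)
  have "row_sol (\<lambda>_. 1) R"
  proof (unfold row_sol_def, intro conjI allI)
    fix m
    have "(\<Sum>j\<in>UNIV. al j * cc j m * fps_nth (R j) 0) = (\<Sum>j\<in>UNIV. of_real (w j * c j m) * (al j * fps_nth (et j) 0))"
      by (simp add: Rn mult_ac)
    also have "\<dots> = of_real (\<Sum>j\<in>UNIV. w j * c j m)" unfolding et_0 by simp
    finally show "(\<Sum>j\<in>UNIV. al j * cc j m * fps_nth (R j) 0) = 1" by (simp add: w_sum)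
  next
    fix m n
    have "(\<Sum>j\<in>UNIV. al j * cc j m * fps_nth (R j) (Suc n)) = (\<Sum>j\<in>UNIV. of_real (w j * c j m) * (al j * fps_nth (et j) (Suc n)))"
      by (simp add: Rn mult_ac)
    also have "\<dots> = (\<Sum>j\<in>UNIV. \<Sum>l\<in>UNIV. of_real (w j * c j m * c j l) * (be l * fps_nth (eta l) n))"
      unfolding et_Suc by (simp add: sum_distrib_left mult_ac)
    also have "\<dots> = (\<Sum>l\<in>UNIV. of_real (\<Sum>j\<in>UNIV. w j * c j m * c j l) * (be l * fps_nth (eta l) n))"
      unfolding of_real_sum sum_distrib_right by (rule sum.swap)
    also have "\<dots> = (\<Sum>l\<in>UNIV. if m = l then be m * (fps_nth (eta m) n / of_real (q m)) else 0)"
      unfolding orth(2) by (intro sum.cong refl) auto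
    also have "\<dots> = be m * (\<Sum>j\<in>UNIV. of_real (w j * c j m) * fps_nth (et j) n)"
      unfolding sum_w_et by simp
    also have "\<dots> = be m * (\<Sum>j\<in>UNIV. cc j m * fps_nth (R j) n)" by (simp add: Rn mult_ac)
    finally show "(\<Sum>j\<in>UNIV. al j * cc j m * fps_nth (R j) (Suc n)) = be m * (\<Sum>j\<in>UNIV. cc j m * fps_nth (R j) n)" .
  qed
  then show ?thesis unfolding R_def .
qed

lemma u_nth_add: "fps_nth u (n + k) = (\<Sum>j\<in>UNIV. of_real (w j) * al j * fps_nth (et j) n * fps_nth (et j) k)"
  unfolding u_eq using shift_expansion[OF row_sol_w, of n k] by (simp add: mult_ac)

text \<open>The row system as an identity of power series; it will eliminate the derivative of
  \<open>eta\<close> when the linear system is differentiated.\<close>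

lemma zeta_eq: "(\<Sum>j\<in>UNIV. fps_of_poly (P $ j $ m) * (fps_const (of_real (w j)) * et j)) = 1"
proof (rule fps_ext)
  fix n
  show "fps_nth (\<Sum>j\<in>UNIV. fps_of_poly (P $ j $ m) * (fps_const (of_real (w j)) * et j)) n = fps_nth 1 n"
  proof (cases n)
    case 0
    then show ?thesis using row_sol_w unfolding row_sol_def
      by (simp add: fps_sum_nth pmat_def fps_linear_mult_nth del: fps_mult_nth_0)
  next
    case (Suc n)
    have "(\<Sum>j\<in>UNIV. al j * cc j m * fps_nth (fps_const (of_real (w j)) * et j) (Suc n)) =
        be m * (\<Sum>j\<in>UNIV. cc j m * fps_nth (fps_const (of_real (w j)) * et j) n)"
      using row_sol_w unfolding row_sol_def by blast
    then show ?thesis unfolding Suc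
      by (simp add: fps_sum_nth pmat_def fps_linear_mult_nth sum_subtractf sum_distrib_left mult.assoc)
  qed
qed

lemma u_nth_add_Suc: "fps_nth u (n + Suc k) = (\<Sum>m\<in>UNIV. be m / of_real (q m) * fps_nth (eta m) n * fps_nth (eta m) k)"
proof -
  have "fps_nth u (n + Suc k) = (\<Sum>j\<in>UNIV. of_real (w j) * fps_nth (et j) n * (al j * fps_nth (et j) (Suc k)))"
    unfolding u_nth_add by (simp add: mult_ac)
  also have "\<dots> = (\<Sum>j\<in>UNIV. \<Sum>m\<in>UNIV. of_real (w j * c j m) * fps_nth (et j) n * (be m * fps_nth (eta m) k))"
    unfolding et_Suc by (simp add: sum_distrib_left mult_ac)
  also have "\<dots> = (\<Sum>m\<in>UNIV. (\<Sum>j\<in>UNIV. of_real (w j * c j m) * fps_nth (et j) n) * (be m * fps_nth (eta m) k))"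
    unfolding sum_distrib_right by (rule sum.swap)
  finally show ?thesis unfolding sum_w_et by (simp add: mult_ac)
qed

lemma u_et: "u = (\<Sum>j\<in>UNIV. fps_const (of_real (w j)) * et j)"
proof (rule fps_ext)
  fix n
  have "fps_nth u (n + 0) = (\<Sum>j\<in>UNIV. of_real (w j) * fps_nth (et j) n * (al j * fps_nth (et j) 0))"
    unfolding u_nth_add by (simp add: mult_ac)
  then show "fps_nth u n = fps_nth (\<Sum>j\<in>UNIV. fps_const (of_real (w j)) * et j) n"
    by (simp add: et_0 fps_sum_nth)
qed

end

section \<open>Rational symbols\<close>

text \<open>Coefficient \<open>n\<close> of the product is a combination, over k, of the
  coefficients of index n + k of B u = A, which vanish; \<open>degree B\<close> being at most
  \<open>M\<close>, no coefficient of \<open>B\<close> is cut off.\<close>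

lemma hankel_poly_range:
  assumes u: "fgeo u" and h: "h \<in> l2p" and Bu: "fps_of_poly B * u = fps_of_poly A"
    and A: "\<And>n. n \<ge> M \<Longrightarrow> coeff A n = 0" and B: "degree B \<le> M" and n: "n \<ge> M"
  shows "fps_nth (fps_of_poly B * Abs_fps (hankel (fps_nth u) h)) n = 0"
proof -
  from l2p_bounded[OF h] obtain C where C: "\<And>n. cmod (h n) \<le> C" by blast
  have shift: "fgeo (Abs_fps (\<lambda>k. fps_nth u (l + k)))" for l
  proof -
    from u obtain r D where r: "r > 1" "\<And>n. wnorm r n u \<le> D" unfolding fgeo_def by blast
    have "wnorm r n (Abs_fps (\<lambda>k. fps_nth u (l + k))) \<le> D" for n
    proof -
      have "wnorm r n (Abs_fps (\<lambda>k. fps_nth u (l + k))) \<le> (\<Sum>k\<le>n. cmod (fps_nth u (l + k)) * r ^ (l + k))"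
        unfolding wnorm_def using r(1) by (intro sum_mono) (auto intro!: mult_left_mono power_increasing)
      also have "\<dots> = (\<Sum>k\<in>(+) l ` {..n}. cmod (fps_nth u k) * r ^ k)"
        by (subst sum.reindex) (auto simp: o_def)
      also have "\<dots> \<le> wnorm r (l + n) u"
        unfolding wnorm_def using r(1) by (intro sum_mono2) auto
      finally show ?thesis using r(2)[of "l + n"] by linarith
    qed
    then show ?thesis unfolding fgeo_def using r(1) by blast
  qed
  have sm: "summable (\<lambda>k. fps_nth u (l + k) * cnj (h k))" for l
    using summable_geo_bounded(2)[OF shift[of l], of h C] C by simp
  have "fps_nth (fps_of_poly B * Abs_fps (hankel (fps_nth u) h)) n =
      (\<Sum>i\<le>n. coeff B i * (\<Sum>k. fps_nth u (n - i + k) * cnj (h k)))"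
    by (simp add: fps_mult_nth hankel_def atLeast0AtMost)
  also have "\<dots> = (\<Sum>i\<le>n. \<Sum>k. coeff B i * (fps_nth u (n - i + k) * cnj (h k)))"
    by (intro sum.cong refl suminf_mult[symmetric] sm)
  also have "\<dots> = (\<Sum>k. \<Sum>i\<le>n. coeff B i * (fps_nth u (n - i + k) * cnj (h k)))"
    by (intro suminf_sum[symmetric] summable_mult sm)
  also have "\<dots> = (\<Sum>k. 0)"
  proof (intro suminf_cong)
    fix k
    have "(\<Sum>i\<le>n. coeff B i * fps_nth u (n - i + k)) = (\<Sum>i\<le>n + k. coeff B i * fps_nth u (n + k - i))"
      using B n by (intro sum.mono_neutral_cong_left) (auto simp: coeff_eq_0)
    also have "\<dots> = fps_nth (fps_of_poly B * u) (n + k)"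
      by (simp add: fps_mult_nth atLeast0AtMost)
    also have "\<dots> = 0" unfolding Bu using A n by simp
    finally show "(\<Sum>i\<le>n. coeff B i * (fps_nth u (n - i + k) * cnj (h k))) = 0"
      by (simp add: sum_distrib_right[symmetric] mult.assoc[symmetric])
  qed
  finally show ?thesis by simp
qed

text \<open>Since \<open>M\<close> is smaller than the number of series, their square matrix of
  coefficients has a zero row.\<close>

lemma polys_dependent:
  fixes v :: "'n::finite \<Rightarrow> complex fps" and ix :: "'n \<Rightarrow> nat"
  assumes ix: "bij_betw ix UNIV {..<CARD('n)}" and M: "M < CARD('n)"
    and z: "\<And>j n. n \<ge> M \<Longrightarrow> fps_nth (v j) n = 0"
  obtains y where "y \<noteq> (\<lambda>_. 0)" "lcomb v y = 0"
proof -
  define Q :: "complex^'n^'n" where "Q = (\<chi> r j. fps_nth (v j) (ix r))"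
  obtain r0 where r0: "ix r0 = M" using ix M unfolding bij_betw_def by (metis imageE lessThan_iff)
  have "row r0 Q = 0" using z r0 by (auto simp: Q_def row_def vec_eq_iff)
  then have "det Q = 0" by (rule det_zero_row(2))
  then have "\<not> (\<exists>B. B ** Q = mat 1)"
    by (metis invertible_det_nz invertible_left_inverse)
  then obtain x where x: "Q *v x = 0" "x \<noteq> 0" using matrix_left_invertible_ker by blast
  have "lcomb v (\<lambda>j. x $ j) = 0"
  proof (rule fps_ext)
    fix n
    show "fps_nth (lcomb v (\<lambda>j. x $ j)) n = fps_nth 0 n"
    proof (cases "n < CARD('n)")
      case True
      then obtain r where r: "ix r = n" using ix unfolding bij_betw_def by (metis imageE lessThan_iff)
      have "(Q *v x) $ r = 0" using x(1) by simp
      then show ?thesis by (simp add: lcomb_nth matrix_vector_mult_def Q_def r mult.commute)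
    next
      case False
      then show ?thesis using z M by (simp add: lcomb_nth)
    qed
  qed
  moreover have "(\<lambda>j. x $ j) \<noteq> (\<lambda>_. 0)" using x(2) by (auto simp: vec_eq_iff fun_eq_iff)
  ultimately show ?thesis using that by blast
qed

lemma polyA_coeffs:
  fixes ix :: "'n::finite \<Rightarrow> nat"
  assumes ix: "bij_betw ix UNIV {..<CARD('n)}" and p: "degree p < CARD('n)"
  shows "polyA ix (\<chi> i. coeff p (ix i)) = p"
proof -
  have "polyA ix (\<chi> i. coeff p (ix i)) = (\<Sum>k<CARD('n). monom (coeff p k) k)"
    unfolding polyA_def using sum.reindex_bij_betw[OF ix, of "\<lambda>k. monom (coeff p k) k"] by simp
  also have "\<dots> = (\<Sum>k\<le>degree p. monom (coeff p k) k)"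
    using p by (intro sum.mono_neutral_right) (auto simp: coeff_eq_0)
  finally show ?thesis by (simp add: poly_as_sum_of_monoms)
qed

lemma polyB_coeffs:
  fixes ix :: "'n::finite \<Rightarrow> nat"
  assumes ix: "bij_betw ix UNIV {..<CARD('n)}" and p: "degree p \<le> CARD('n)" "coeff p 0 = 1"
  shows "polyB ix (\<chi> i. coeff p (ix i + 1)) = p"
proof -
  have "polyB ix (\<chi> i. coeff p (ix i + 1)) = 1 + (\<Sum>k<CARD('n). monom (coeff p (k + 1)) (k + 1))"
    unfolding polyB_def using sum.reindex_bij_betw[OF ix, of "\<lambda>k. monom (coeff p (k + 1)) (k + 1)"] by simp
  also have "\<dots> = (\<Sum>k<Suc CARD('n). monom (coeff p k) k)"
    by (subst sum.lessThan_Suc_shift) (simp add: p monom_0 one_pCons)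
  also have "\<dots> = (\<Sum>k\<le>degree p. monom (coeff p k) k)"
    using p by (intro sum.mono_neutral_right) (auto simp: coeff_eq_0)
  finally show ?thesis by (simp add: poly_as_sum_of_monoms)
qed

lemma coeff_polyA:
  fixes ix :: "'n::finite \<Rightarrow> nat"
  assumes ix: "bij_betw ix UNIV {..<CARD('n)}"
  shows "coeff (polyA ix a) (ix i) = a $ i" and "n \<ge> CARD('n) \<Longrightarrow> coeff (polyA ix a) n = 0"
proof -
  have inj: "ix j = ix i \<longleftrightarrow> j = i" for i j using ix unfolding bij_betw_def inj_on_def by auto
  have less: "ix j < CARD('n)" for j using ix unfolding bij_betw_def by auto
  show "coeff (polyA ix a) (ix i) = a $ i"
    unfolding polyA_def by (simp add: coeff_sum inj)
  show "n \<ge> CARD('n) \<Longrightarrow> coeff (polyA ix a) n = 0"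
    unfolding polyA_def coeff_sum by (intro sum.neutral) (use less in \<open>auto simp: not_le[symmetric]\<close>)
qed

lemma coeff_polyB:
  fixes ix :: "'n::finite \<Rightarrow> nat"
  assumes ix: "bij_betw ix UNIV {..<CARD('n)}"
  shows "coeff (polyB ix b) (Suc (ix i)) = b $ i" and "coeff (polyB ix b) 0 = 1"
    and "degree (polyB ix b) \<le> CARD('n)"
proof -
  have inj: "ix j = ix i \<longleftrightarrow> j = i" for i j using ix unfolding bij_betw_def inj_on_def by auto
  have less: "ix j < CARD('n)" for j using ix unfolding bij_betw_def by auto
  show "coeff (polyB ix b) (Suc (ix i)) = b $ i"
    unfolding polyB_def by (simp add: coeff_sum inj)
  show "coeff (polyB ix b) 0 = 1"
    unfolding polyB_def by (simp add: coeff_sum)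
  show "degree (polyB ix b) \<le> CARD('n)"
  proof (rule degree_le, intro allI impI)
    fix n assume n: "CARD('n) < n"
    have "(\<Sum>i\<in>UNIV. coeff (monom (b $ i) (ix i + 1)) n) = 0"
      by (intro sum.neutral ballI) (use less n in \<open>auto simp: not_less_eq[symmetric] dest: less_trans\<close>)
    then show "coeff (polyB ix b) n = 0" using n unfolding polyB_def by (simp add: coeff_sum coeff_1)
  qed
qed

lemma ratfun_fps:
  fixes ix :: "'n::finite \<Rightarrow> nat"
  assumes ix: "bij_betw ix UNIV {..<CARD('n)}"
  shows "ratfun ix p = fps_nth (fps_of_poly (polyA ix (fst p)) * inverse (fps_of_poly (polyB ix (snd p))))"
proof -
  have "fps_of_poly (polyA ix (fst p)) / fps_of_poly (polyB ix (snd p)) =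
      fps_of_poly (polyA ix (fst p)) * inverse (fps_of_poly (polyB ix (snd p)))"
    by (rule fps_divide_unit) (simp add: coeff_polyB[OF ix])
  then show ?thesis by (simp add: ratfun_def)
qed

text \<open>Cross multiplication and coprimality make the two denominators divide each other, and
  the constant coefficient 1 fixes the remaining unit.\<close>

lemma ratfun_inject:
  fixes ix :: "'n::finite \<Rightarrow> nat"
  assumes ix: "bij_betw ix UNIV {..<CARD('n)}" and p: "p \<in> paramsM ix" "p' \<in> paramsM ix"
    and eq: "ratfun ix p = ratfun ix p'"
  shows "p = p'"
proof -
  define A B A' B' where AB: "A = polyA ix (fst p)" "B = polyB ix (snd p)"
    "A' = polyA ix (fst p')" "B' = polyB ix (snd p')"
  have B0: "coeff B 0 = 1" "coeff B' 0 = 1" unfolding AB by (rule coeff_polyB[OF ix])+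
  have cop: "coprime A B" "coprime A' B'" using p unfolding AB paramsM_def by auto
  have inv: "fps_of_poly B * inverse (fps_of_poly B) = 1" "fps_of_poly B' * inverse (fps_of_poly B') = 1"
    by (intro inverse_mult_eq_1'; simp add: B0)+
  have "fps_of_poly A * inverse (fps_of_poly B) = fps_of_poly A' * inverse (fps_of_poly B')"
    using eq unfolding ratfun_fps[OF ix] AB by (simp only: fps_nth_inject_iff)
  then have "fps_of_poly A * inverse (fps_of_poly B) * fps_of_poly B * fps_of_poly B' =
     fps_of_poly A' * inverse (fps_of_poly B') * fps_of_poly B * fps_of_poly B'" by simp
  then have "fps_of_poly A * fps_of_poly B' * (fps_of_poly B * inverse (fps_of_poly B)) =
     fps_of_poly A' * fps_of_poly B * (fps_of_poly B' * inverse (fps_of_poly B'))" by (simp only: mult_ac)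
  then have "fps_of_poly (A * B') = fps_of_poly (A' * B)" by (simp add: inv fps_of_poly_mult)
  then have e: "A * B' = A' * B" by (simp only: fps_of_poly_eq_iff)
  have "B dvd A * B'" unfolding e by (rule dvd_triv_right)
  then have "B dvd B'" using coprime_dvd_mult_right_iff[OF coprime_commute[THEN iffD1, OF cop(1)]] by blast
  moreover have "B' dvd A' * B" unfolding e[symmetric] by (rule dvd_triv_right)
  then have "B' dvd B" using coprime_dvd_mult_right_iff[OF coprime_commute[THEN iffD1, OF cop(2)]] by blast
  ultimately obtain C C' where C: "B' = B * C" "B = B' * C'" unfolding dvd_def by blast
  have Bnz: "B \<noteq> 0" using B0 by auto
  have "B * (C * C') = B * 1"
    by (simp only: mult.assoc[symmetric] C(1)[symmetric] C(2)[symmetric] mult_1_right)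
  then have "C * C' = 1" using Bnz mult_cancel_left by blast
  then have "is_unit C" by (metis dvd_triv_left)
  then obtain k where k: "C = [:k:]" by (auto elim: is_unit_polyE)
  have "coeff B' 0 = coeff B 0 * k" unfolding C(1) k by (simp add: mult.commute)
  then have "k = 1" using B0 by simp
  then have BB: "B' = B" using C k by (simp add: one_pCons[symmetric])
  then have "A = A'" using e Bnz by simp
  then have "fst p = fst p'" "snd p = snd p'"
    using coeff_polyA(1)[OF ix] coeff_polyB(1)[OF ix] BB unfolding AB vec_eq_iff by metis+
  then show ?thesis by (simp add: prod_eq_iff)
qed

lemma degree_det_le:
  fixes P :: "complex poly^'n^'n"
  assumes "\<And>i j. degree (P $ i $ j) \<le> e j"
  shows "degree (det P) \<le> (\<Sum>j\<in>UNIV. e j)"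
  unfolding det_def
proof (intro degree_sum_le)
  fix p assume "p \<in> {p. p permutes (UNIV :: 'n set)}"
  then have p: "p permutes UNIV" by simp
  have "degree (of_int (sign p) * (\<Prod>i\<in>UNIV. P $ i $ p i)) \<le> degree (\<Prod>i\<in>UNIV. P $ i $ p i)"
    using degree_mult_le[of "of_int (sign p)" "\<Prod>i\<in>UNIV. P $ i $ p i"] by simp
  also have "\<dots> \<le> (\<Sum>i\<in>UNIV. degree (P $ i $ p i))" 
    using degree_prod_sum_le[of UNIV "\<lambda>i. P $ i $ p i"] by (simp add: o_def)
  also have "\<dots> \<le> (\<Sum>i\<in>UNIV. e (p i))" by (intro sum_mono assms)
  also have "\<dots> = (\<Sum>j\<in>UNIV. e j)" using sum.permute[OF p, of e] by (simp add: o_def)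
  finally show "degree (of_int (sign p) * (\<Prod>i\<in>UNIV. P $ i $ p i)) \<le> (\<Sum>j\<in>UNIV. e j)" .
qed (simp add: finite_permutations)

text \<open>Dividing by the determinant at 0 gives the denominator the constant coefficient 1 built
  into \<open>polyB\<close>; the numerator is scaled alike.\<close>

definition nump :: "complex poly^'n^'n \<Rightarrow> complex poly" where
  "nump P = smult (inverse (poly (det P) 0)) (\<Sum>m\<in>UNIV. cramer_poly P (\<lambda>_. 1) m)"

definition denp :: "complex poly^'n^'n \<Rightarrow> complex poly" where
  "denp P = smult (inverse (poly (det P) 0)) (det P)"

definition params_of :: "('n::finite \<Rightarrow> nat) \<Rightarrow> complex poly^'n^'n \<Rightarrow> (complex^'n) \<times> (complex^'n)" where
  "params_of ix P = (\<chi> i. coeff (nump P) (ix i), \<chi> i. coeff (denp P) (ix i + 1))"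

section \<open>Hankel operators of geometrically decaying symbols\<close>

lemma hinner_one: "hinner one_l2 h = cnj (h 0)"
proof -
  have "hinner one_l2 h = (\<Sum>k\<in>{0}. one_l2 k * cnj (h k))"
    unfolding hinner_def by (intro suminf_finite) (auto simp: one_l2_def)
  then show ?thesis by (simp add: one_l2_def)
qed

lemma hankel_one: "hankel u one_l2 = u"
proof
  fix n
  have "hankel u one_l2 n = (\<Sum>k\<in>{0}. u (n + k) * cnj (one_l2 k))"
    unfolding hankel_def by (intro suminf_finite) (auto simp: one_l2_def)
  then show "hankel u one_l2 n = u n" by (simp add: one_l2_def)
qed

lemma kop_eq_hankel_Suc:
  assumes "\<And>n. summable (\<lambda>k. u (n + k) * cnj (shiftz h k))"
  shows "kop u h n = hankel u h (Suc n)"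
proof -
  have "kop u h n = (\<Sum>k. u (n + Suc k) * cnj (shiftz h (Suc k))) + u (n + 0) * cnj (shiftz h 0)"
    unfolding kop_def hankel_def using suminf_split_initial_segment[OF assms, of n 1] by simp
  then show ?thesis by (simp add: hankel_def shiftz_def)
qed

lemma shiftz_l2p: "h \<in> l2p \<Longrightarrow> shiftz h \<in> l2p"
  unfolding l2p_def mem_Collect_eq
  by (subst summable_Suc_iff[symmetric]) (simp add: shiftz_def)

lemma fgeo_shift_summable:
  assumes "fgeo u" "h \<in> l2p"
  shows "summable (\<lambda>k. fps_nth u (n + k) * cnj (h k))"
proof -
  from l2p_bounded[OF assms(2)] obtain M where M: "\<And>n. cmod (h n) \<le> M" "M \<ge> 0" by blast
  from fgeo_bound[OF assms(1)] obtain C r where r: "0 < r" "r < 1" "\<And>n. cmod (fps_nth u n) \<le> C * r ^ n" "C \<ge> 0"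
    by blast
  have s: "summable (\<lambda>k. (C * r ^ n * M) * r ^ k)" using r by (intro summable_mult summable_geometric) auto
  have "cmod (fps_nth u (n + k) * cnj (h k)) \<le> (C * r ^ n * M) * r ^ k" for k
    using mult_mono[OF r(3)[of "n + k"] M(1)[of k]] r(1,4) by (simp add: norm_mult power_add mult_ac)
  then show ?thesis
    using summable_comparison_test'[OF s, of 0 "\<lambda>k. fps_nth u (n + k) * cnj (h k)"] by simp
qed

lemma kop_fgeo: "fgeo u \<Longrightarrow> h \<in> l2p \<Longrightarrow> kop (fps_nth u) h n = hankel (fps_nth u) h (Suc n)"
  by (intro kop_eq_hankel_Suc fgeo_shift_summable shiftz_l2p)

text \<open>A diagonal factorisation of the Hankel matrix of the symbol shifted by \<open>l\<close>
  diagonalises the operator: \<open>l = 0\<close> serves for H and \<open>l = 1\<close> for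
  K.\<close>

lemma hankel_expand:
  assumes u: "\<And>n k. fps_nth u (n + l + k) = (\<Sum>j\<in>UNIV. a j * fps_nth (v j) n * fps_nth (v j) k)"
    and v: "\<And>j::'n::finite. fgeo (v j)" and h: "h \<in> l2p"
  shows "hankel (fps_nth u) h (n + l) = fps_nth (lcomb v (\<lambda>j. a j * hinner (fps_nth (v j)) h)) n"
proof -
  from l2p_bounded[OF h] obtain M where M: "\<And>n. cmod (h n) \<le> M" "M \<ge> 0" by blast
  have sm: "summable (\<lambda>k. fps_nth (v j) k * cnj (h k))" for j by (rule summable_geo_bounded(2)[OF v M(1)])
  have "hankel (fps_nth u) h (n + l) = (\<Sum>k. \<Sum>j\<in>UNIV. a j * fps_nth (v j) n * (fps_nth (v j) k * cnj (h k)))"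
    unfolding hankel_def u by (simp add: sum_distrib_right sum_distrib_left mult_ac)
  also have "\<dots> = (\<Sum>j\<in>UNIV. \<Sum>k. a j * fps_nth (v j) n * (fps_nth (v j) k * cnj (h k)))"
    by (intro suminf_sum summable_mult sm)
  also have "\<dots> = (\<Sum>j\<in>UNIV. a j * fps_nth (v j) n * hinner (fps_nth (v j)) h)"
    unfolding hinner_def by (intro sum.cong refl suminf_mult sm)
  finally show ?thesis by (simp add: lcomb_nth mult_ac)
qed

lemma sgn_scale_real: "r > 0 \<Longrightarrow> sgn (complex_of_real r * z) = sgn z"
  by (simp add: sgn_mult sgn_of_real)

section \<open>Spectral data of the constructed symbol\<close>

context inv_spec
begin

lemma hankel_u: "h \<in> l2p \<Longrightarrow>
  hankel (fps_nth u) h = fps_nth (lcomb et (\<lambda>j. al j / complex_of_real (1 / w j) * hinner (fps_nth (et j)) h))"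
  using hankel_expand[of u 0 "\<lambda>j. of_real (w j) * al j" et h] fgeo_et u_nth_add
  by (auto simp: fun_eq_iff mult.commute)

lemma kop_u: "h \<in> l2p \<Longrightarrow>
  kop (fps_nth u) h = fps_nth (lcomb eta (\<lambda>m. be m / complex_of_real (q m) * hinner (fps_nth (eta m)) h))"
  using hankel_expand[of u 1 "\<lambda>m. be m / of_real (q m)" eta h] fgeo_eta u_nth_add_Suc
  by (auto simp: fun_eq_iff kop_fgeo fgeo_u)

sublocale H: takagi et "\<lambda>j. 1 / w j" s al "hankel (fps_nth u)"
  by unfold_locales (auto simp: fgeo_et w_pos gram_et hankel_u al s_pos inj_s)

sublocale K: takagi eta q t be "kop (fps_nth u)"
  by unfold_locales (auto simp: fgeo_eta q_pos gram_eta kop_u be t_pos inj_t)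

lemma eigsH_u: "eigsH (fps_nth u) = range s" unfolding eigsH_def by (rule H.eigenvalues)
lemma eigsK_u: "eigsK (fps_nth u) = range t" unfolding eigsK_def by (rule K.eigenvalues)
lemma lamsq_u: "lamsq (fps_nth u) (ix j) = s j" unfolding lamsq_def eigsH_u by (rule lamsq_order) simp
lemma musq_u: "musq (fps_nth u) (ix j) = t j" unfolding musq_def eigsK_u by (rule lamsq_order) simp

text \<open>For e = y \<open>et j\<close> one has e(0) = y / \<open>al j\<close>, so (1|e)^2 = conj
  (y^2 / al^2). Inserting the forced value of y^2 leaves a positive multiple of 1 / conj (al), hence
  of \<open>al j\<close>.\<close>

lemma phase_phi_u: "phase_phi (fps_nth u) (ix j) = sgn (al j)"
proof -
  have val: "sgn ((hinner one_l2 (fps_nth (fps_const y * et j)))\<^sup>2) = sgn (al j)"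
    if y: "y\<^sup>2 = al j / (sqrt (s j) * complex_of_real (1 / w j))" for y
  proof -
    have e0: "fps_nth (et j) 0 = 1 / al j" using et_0[of j] al_nz[of j] by (simp add: field_simps)
    have "(hinner one_l2 (fps_nth (fps_const y * et j)))\<^sup>2 = cnj (y\<^sup>2 / (al j)\<^sup>2)"
      unfolding hinner_one by (simp add: e0 power_divide)
    also have "\<dots> = of_real (w j / sqrt (s j)) * (1 / cnj (al j))"
      unfolding y using al_nz[of j] by (simp add: power2_eq_square)
    also have "1 / cnj (al j) = of_real (1 / s j) * al j"
      using al_cnj[of j] al_nz[of j] s_pos[of j] by (simp add: field_simps)
    also have "of_real (w j / sqrt (s j)) * (of_real (1 / s j) * al j) = of_real (w j / sqrt (s j) * (1 / s j)) * al j"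
      by simp
    finally show ?thesis using w_pos[of j] s_pos[of j] by (simp only: sgn_scale_real divide_pos_pos mult_pos_pos real_sqrt_gt_zero zero_less_one)
  qed
  show ?thesis unfolding phase_phi_def lamsq_u
  proof (rule someI2_ex)
    obtain y where "fgeo (fps_const y * et j)" "hsqnorm (fps_nth (fps_const y * et j)) = 1"
      "hankel (fps_nth u) (fps_nth (fps_const y * et j)) = (\<lambda>n. complex_of_real (sqrt (s j)) * fps_nth (fps_const y * et j) n)"
      by (rule H.unit_eigenvector_exists[of j])
    then show "\<exists>w. \<exists>e\<in>l2p. hsqnorm e = 1 \<and> hankel (fps_nth u) e = (\<lambda>n. complex_of_real (sqrt (s j)) * e n) \<and>
        w = sgn ((hinner one_l2 e)\<^sup>2)" using fgeo_l2p by blast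
  next
    fix x assume "\<exists>e\<in>l2p. hsqnorm e = 1 \<and> hankel (fps_nth u) e = (\<lambda>n. complex_of_real (sqrt (s j)) * e n) \<and>
        x = sgn ((hinner one_l2 e)\<^sup>2)"
    then obtain e where e: "e \<in> l2p" "hsqnorm e = 1" "hankel (fps_nth u) e = (\<lambda>n. complex_of_real (sqrt (s j)) * e n)"
      "x = sgn ((hinner one_l2 e)\<^sup>2)" by blast
    obtain y where "e = fps_nth (fps_const y * et j)" "y\<^sup>2 = al j / (sqrt (s j) * complex_of_real (1 / w j))"
      by (rule H.unit_eigenvector[OF e(1-3)]) auto
    then show "x = sgn (al j)" using val e(4) by blast
  qed
qed

text \<open>Here (u|f)^2 = conj (y^2) q^2 is a positive multiple of conj (\<open>be m\<close>); this
  conjugate is the reason for the sign in be = \<mu> exp(-i \<theta>).\<close>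

lemma phase_theta_u: "phase_theta (fps_nth u) (ix m) = cnj (sgn (be m))"
proof -
  have val: "sgn ((hinner (fps_nth u) (fps_nth (fps_const y * eta m)))\<^sup>2) = cnj (sgn (be m))"
    if y: "y\<^sup>2 = be m / (sqrt (t m) * complex_of_real (q m))" for y
  proof -
    have "hip u (eta m) = of_real (q m)" unfolding u_eq using K.hip_lcomb_left[of "\<lambda>_. 1" m] by simp
    then have "(hinner (fps_nth u) (fps_nth (fps_const y * eta m)))\<^sup>2 = cnj (y\<^sup>2) * (of_real (q m))\<^sup>2"
      by (simp add: hip_scale_right fgeo_u fgeo_eta power_mult_distrib)
    also have "\<dots> = of_real (q m / sqrt (t m)) * cnj (be m)"
      unfolding y using q_pos[of m] by (simp add: power2_eq_square)
    finally show ?thesis using q_pos[of m] t_pos[of m]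
      by (simp only: sgn_scale_real divide_pos_pos real_sqrt_gt_zero) (simp add: sgn_eq)
  qed
  show ?thesis unfolding phase_theta_def musq_u
  proof (rule someI2_ex)
    obtain y where "fgeo (fps_const y * eta m)" "hsqnorm (fps_nth (fps_const y * eta m)) = 1"
      "kop (fps_nth u) (fps_nth (fps_const y * eta m)) = (\<lambda>n. complex_of_real (sqrt (t m)) * fps_nth (fps_const y * eta m) n)"
      by (rule K.unit_eigenvector_exists[of m])
    then show "\<exists>w. \<exists>e\<in>l2p. hsqnorm e = 1 \<and> kop (fps_nth u) e = (\<lambda>n. complex_of_real (sqrt (t m)) * e n) \<and>
        w = sgn ((hinner (fps_nth u) e)\<^sup>2)" using fgeo_l2p by blast
  next
    fix x assume "\<exists>e\<in>l2p. hsqnorm e = 1 \<and> kop (fps_nth u) e = (\<lambda>n. complex_of_real (sqrt (t m)) * e n) \<and>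
        x = sgn ((hinner (fps_nth u) e)\<^sup>2)"
    then obtain e where e: "e \<in> l2p" "hsqnorm e = 1" "kop (fps_nth u) e = (\<lambda>n. complex_of_real (sqrt (t m)) * e n)"
      "x = sgn ((hinner (fps_nth u) e)\<^sup>2)" by blast
    obtain y where "e = fps_nth (fps_const y * eta m)" "y\<^sup>2 = be m / (sqrt (t m) * complex_of_real (q m))"
      by (rule K.unit_eigenvector[OF e(1-3)]) auto
    then show "x = cnj (sgn (be m))" using val e(4) by blast
  qed
qed

lemma lcomb_et_eta: "lcomb et y = lcomb eta (\<lambda>m. \<Sum>j\<in>UNIV. y j * cc j m)"
proof (rule fps_ext)
  fix n
  have "fps_nth (lcomb et y) n = (\<Sum>j\<in>UNIV. \<Sum>m\<in>UNIV. y j * cc j m * fps_nth (eta m) n)"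
    by (simp add: lcomb_nth et_nth sum_distrib_left mult.assoc)
  also have "\<dots> = (\<Sum>m\<in>UNIV. \<Sum>j\<in>UNIV. y j * cc j m * fps_nth (eta m) n)" by (rule sum.swap)
  finally show "fps_nth (lcomb et y) n = fps_nth (lcomb eta (\<lambda>m. \<Sum>j\<in>UNIV. y j * cc j m)) n"
    by (simp add: lcomb_nth sum_distrib_right)
qed

text \<open>If 1 = H h, then h may be taken in the span of \<open>et\<close>. In that case K h is
  the backward shift of 1, that is 0, and injectivity of K on the span gives h = 0, a
  contradiction.\<close>

lemma one_not_in_range: "one_l2 \<notin> hankel (fps_nth u) ` l2p"
proof
  assume "one_l2 \<in> hankel (fps_nth u) ` l2p"
  then obtain h where h: "h \<in> l2p" "one_l2 = hankel (fps_nth u) h" by blast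
  obtain y where y: "one_l2 = fps_nth (lcomb et y)" using h(2) unfolding hankel_u[OF h(1)] by blast
  define h' where "h' = lcomb et (\<lambda>j. cnj (y j / al j))"
  have h'g: "fgeo h'" unfolding h'_def by (intro fgeo_lcomb fgeo_et)
  have H1: "hankel (fps_nth u) (fps_nth h') = one_l2"
    unfolding h'_def H.T_lcomb y using al_nz by simp
  define x where "x = (\<lambda>m. \<Sum>j\<in>UNIV. cnj (y j / al j) * cc j m)"
  have h'x: "h' = lcomb eta x" unfolding h'_def x_def by (rule lcomb_et_eta)
  have "kop (fps_nth u) (fps_nth h') = (\<lambda>n. one_l2 (Suc n))"
    using kop_fgeo[OF fgeo_u fgeo_l2p[OF h'g]] H1 by auto
  then have "fps_nth (lcomb eta (\<lambda>m. be m * cnj (x m))) = (\<lambda>_. 0)"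
    unfolding h'x K.T_lcomb by (simp add: one_l2_def)
  then have "lcomb eta (\<lambda>m. be m * cnj (x m)) = lcomb eta (\<lambda>_. 0)"
    unfolding lcomb_0 by (simp add: fps_eq_iff)
  then have "x m = 0" for m using be_nz[of m] unfolding K.lcomb_inject by (auto simp: fun_eq_iff)
  then have "h' = lcomb eta (\<lambda>_. 0)" unfolding h'x by presburger
  then have "h' = lcomb et (\<lambda>_. 0)" by (simp add: lcomb_0)
  then have "one_l2 = fps_nth (lcomb et (\<lambda>_. 0))" using H1 H.T_lcomb[of "\<lambda>_. 0"] by simp
  from fun_cong[OF this, of 0] have "one_l2 0 = 0" by (simp add: lcomb_0)
  then show False by (simp add: one_l2_def)
qed

lemma hankel_powers: "((hankel (fps_nth u)) ^^ (2 * Suc k)) one_l2 =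
   fps_nth (lcomb et (\<lambda>j. of_real (s j) ^ k * (of_real (w j) * al j)))"
proof (induction k)
  case 0
  have "u = lcomb et (\<lambda>j. of_real (w j))" by (simp add: u_et lcomb_def)
  then have "hankel (fps_nth u) (hankel (fps_nth u) one_l2) = fps_nth (lcomb et (\<lambda>j. al j * cnj (of_real (w j))))"
    unfolding hankel_one by (metis H.T_lcomb)
  then show ?case by (simp add: numeral_2_eq_2 mult.commute)
next
  case (Suc k)
  have "((hankel (fps_nth u)) ^^ (2 * Suc (Suc k))) one_l2 =
     hankel (fps_nth u) (hankel (fps_nth u) (((hankel (fps_nth u)) ^^ (2 * Suc k)) one_l2))"
    by simp
  then show ?case unfolding Suc H.T_T_lcomb by (simp add: mult.assoc)
qed

text \<open>The vectors H^(2k) 1 have coordinates s^(k-1) w al with nonvanishing w al, so a linear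
  relation between the first N of them is a polynomial of degree less than N with the N roots
  s_j.\<close>

lemma generic_u: "generic CARD('n) (fps_nth u)"
  unfolding generic_def
proof (intro conjI allI impI ballI)
  show "one_l2 \<notin> hankel (fps_nth u) ` l2p" by (rule one_not_in_range)
next
  fix a :: "nat \<Rightarrow> complex" and k
  assume z: "\<forall>n. (\<Sum>k\<in>{1..CARD('n)}. a k * ((hankel (fps_nth u) ^^ (2 * k)) one_l2) n) = 0"
    and k: "k \<in> {1..CARD('n)}"
  define N where "N = CARD('n)"
  have "lcomb et (\<lambda>j. \<Sum>k<N. a (Suc k) * (of_real (s j) ^ k * (of_real (w j) * al j))) = 0"
  proof (rule fps_ext)
    fix n
    have "0 = (\<Sum>k\<in>{1..N}. a k * ((hankel (fps_nth u) ^^ (2 * k)) one_l2) n)" using z by (simp add: N_def)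
    also have "\<dots> = (\<Sum>k<N. a (Suc k) * ((hankel (fps_nth u) ^^ (2 * Suc k)) one_l2) n)"
      by (rule sum.reindex_bij_witness[of _ Suc "\<lambda>k. k - 1"]) auto
    also have "\<dots> = (\<Sum>k<N. \<Sum>j\<in>UNIV. a (Suc k) * (of_real (s j) ^ k * (of_real (w j) * al j)) * fps_nth (et j) n)"
      unfolding hankel_powers by (simp add: lcomb_nth sum_distrib_left mult.assoc)
    also have "\<dots> = (\<Sum>j\<in>UNIV. \<Sum>k<N. a (Suc k) * (of_real (s j) ^ k * (of_real (w j) * al j)) * fps_nth (et j) n)"
      by (rule sum.swap)
    finally show "fps_nth (lcomb et (\<lambda>j. \<Sum>k<N. a (Suc k) * (of_real (s j) ^ k * (of_real (w j) * al j)))) n = fps_nth 0 n"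
      by (simp add: lcomb_nth sum_distrib_right)
  qed
  then have e: "(\<Sum>k<N. a (Suc k) * (of_real (s j) ^ k * (of_real (w j) * al j))) = 0" for j
    using H.lcomb_inject[of _ "\<lambda>_. 0"] unfolding lcomb_0 by (simp add: fun_eq_iff)
  define p where "p = (\<Sum>k<N. monom (a (Suc k)) k)"
  have r: "poly p (of_real (s j)) = 0" for j
  proof -
    have "poly p (of_real (s j)) * (of_real (w j) * al j) = 0"
      using e[of j] by (simp add: p_def poly_sum poly_monom sum_distrib_right mult.assoc)
    then show ?thesis using w_pos[of j] al_nz[of j] by simp
  qed
  have "p = 0"
  proof (rule ccontr)
    assume ne: "p \<noteq> 0"
    have "degree p \<le> N - 1" unfolding p_def
      by (intro degree_sum_le) (auto intro: order_trans[OF degree_monom_le])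
    then have "degree p < N" using zero_less_card_finite[where 'a='n] unfolding N_def by linarith
    moreover have "card {x. poly p x = 0} \<le> degree p" using ne by (rule card_poly_roots_bound)
    moreover have "N \<le> card {x. poly p x = 0}"
    proof -
      have "inj (\<lambda>j. complex_of_real (s j))" using inj_s by (auto simp: inj_def)
      then have "card (range (\<lambda>j. complex_of_real (s j))) = N" by (simp add: card_image N_def)
      moreover have "range (\<lambda>j. complex_of_real (s j)) \<subseteq> {x. poly p x = 0}" using r by auto
      ultimately show ?thesis using card_mono[OF poly_roots_finite[OF ne]] by metis
    qed
    ultimately show False by linarith
  qed
  moreover have "coeff p (k - 1) = a k"
  proof -
    have "coeff p (k - 1) = (\<Sum>i<N. if i = k - 1 then a (Suc i) else 0)" unfolding p_def by (simp add: coeff_sum)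
    then show ?thesis using k by (simp add: N_def) auto
  qed
  ultimately show "a k = 0" by simp
qed

text \<open>The range of H contains the N independent series \<open>et\<close>, while a quotient of
  smaller degree would confine it to a space of dimension \<open>M\<close>. This excludes both a
  common factor of numerator and denominator and a simultaneous drop of their degrees.\<close>

lemma no_low_rank:
  assumes M: "M < CARD('n)" and Bu: "fps_of_poly B * u = fps_of_poly A"
    and A: "\<And>n. n \<ge> M \<Longrightarrow> coeff A n = 0" and B: "degree B \<le> M" "B \<noteq> 0"
  shows False
proof -
  define v where "v j = fps_of_poly B * et j" for j
  have "fps_nth (v j) n = 0" if n: "n \<ge> M" for j n
  proof -
    have "et j = lcomb et (\<lambda>k. if k = j then 1 else 0)"
      unfolding lcomb_def by (subst sum.mono_neutral_right[of UNIV "{j}"]) auto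
    moreover have "lcomb et (\<lambda>k. al k * cnj (if k = j then 1 else 0)) = fps_const (al j) * et j"
      unfolding lcomb_def by (subst sum.mono_neutral_right[of UNIV "{j}"]) auto
    ultimately have "hankel (fps_nth u) (fps_nth (et j)) = fps_nth (fps_const (al j) * et j)"
      by (metis H.T_lcomb)
    then have "fps_nth (fps_of_poly B * (fps_const (al j) * et j)) n = 0"
      using hankel_poly_range[OF fgeo_u fgeo_l2p[OF fgeo_et[of j]] Bu A B(1) n] by (simp only: fps_nth_inverse)
    then have "al j * fps_nth (v j) n = 0" unfolding v_def by (simp add: mult.left_commute[of _ "fps_const _"])
    then show ?thesis using al_nz by simp
  qed
  then obtain y where y: "y \<noteq> (\<lambda>_. 0)" "lcomb v y = 0" using polys_dependent[OF ix M] by metis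
  have "lcomb v y = fps_of_poly B * lcomb et y"
    unfolding lcomb_def v_def by (simp add: sum_distrib_left mult_ac)
  then have "lcomb et y = lcomb et (\<lambda>_. 0)" using y(2) B(2) by (simp add: lcomb_0)
  then show False using y(1) H.lcomb_inject by blast
qed

section \<open>The constructed symbol as a reduced fraction\<close>

lemma deg_den: "degree (denp P) \<le> CARD('n)" and deg_num: "degree (nump P) < CARD('n)"
proof -
  have dP: "degree (P $ i $ j) \<le> 1" for i j by (simp add: pmat_def)
  then show "degree (denp P) \<le> CARD('n)"
    unfolding denp_def using degree_det_le[of P "\<lambda>_. 1"] degree_smult_le[of _ "det P"] by (auto intro: order_trans)
  have "degree (cramer_poly P (\<lambda>_. 1) m) \<le> CARD('n) - 1" for m
  proof -
    have "degree (cramer_poly P (\<lambda>_. 1) m) \<le> (\<Sum>j\<in>UNIV. if j = m then 0 else 1)"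
      unfolding cramer_poly_def by (rule degree_det_le) (use dP in \<open>auto simp: one_pCons[symmetric]\<close>)
    also have "\<dots> = CARD('n) - 1"
      by (simp add: sum.If_cases card_Diff_singleton Collect_neg_eq Compl_eq_Diff_UNIV)
    finally show ?thesis .
  qed
  then have "degree (\<Sum>m\<in>UNIV. cramer_poly P (\<lambda>_. 1) m) \<le> CARD('n) - 1" by (intro degree_sum_le) auto
  then have "degree (nump P) \<le> CARD('n) - 1"
    unfolding nump_def using degree_smult_le order_trans by blast
  then show "degree (nump P) < CARD('n)" using zero_less_card_finite[where 'a='n] by linarith
qed

lemma den_0: "coeff (denp P) 0 = 1"
  using det_P_nz[of 0] by (simp add: denp_def poly_0_coeff_0)

lemma den_nz: "cmod z \<le> 1 \<Longrightarrow> poly (denp P) z \<noteq> 0"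
  using det_P_nz[of z] det_P_nz[of 0] by (simp add: denp_def)

lemma u_rational: "u = fps_of_poly (nump P) * inverse (fps_of_poly (denp P))"
proof -
  define k where "k = poly (det P) 0"
  have k: "k \<noteq> 0" using det_P_nz[of 0] by (simp add: k_def)
  have "inverse (fps_of_poly (denp P)) = fps_const k * inverse (fps_of_poly (det P))"
    unfolding denp_def fps_of_poly_smult k_def[symmetric] fps_inverse_mult
    using k by (simp add: fps_const_inverse)
  then have "fps_of_poly (nump P) * inverse (fps_of_poly (denp P)) =
     (fps_const (inverse k) * fps_const k) * (fps_of_poly (\<Sum>m\<in>UNIV. cramer_poly P (\<lambda>_. 1) m) * inverse (fps_of_poly (det P)))"
    unfolding nump_def fps_of_poly_smult k_def[symmetric] by (simp only: mult_ac)
  also have "fps_const (inverse k) * fps_const k = 1" using k by simp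
  finally show ?thesis
    by (simp add: u_def eta_def cramer_fps_def fps_of_poly_sum sum_distrib_right)
qed

lemma den_u: "fps_of_poly (denp P) * u = fps_of_poly (nump P)"
proof -
  have "fps_of_poly (denp P) * inverse (fps_of_poly (denp P)) = 1"
    by (rule inverse_mult_eq_1') (simp add: den_0)
  then show ?thesis unfolding u_rational by (metis mult.left_commute mult.right_neutral)
qed

lemma polyA_params: "polyA ix (fst (params_of ix P)) = nump P"
  unfolding params_of_def using polyA_coeffs[OF ix deg_num] by simp

lemma polyB_params: "polyB ix (snd (params_of ix P)) = denp P"
  unfolding params_of_def using polyB_coeffs[OF ix deg_den den_0] by simp

lemma ratfun_params: "ratfun ix (params_of ix P) = fps_nth u"
  unfolding ratfun_fps[OF ix] polyA_params polyB_params u_rational ..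

lemma coprime_num_den: "coprime (nump P) (denp P)"
proof (rule ccontr)
  let ?N = "CARD('n)"
  assume "\<not> coprime (nump P) (denp P)"
  then obtain d where d: "d dvd nump P" "d dvd denp P" "\<not> is_unit d" by (auto simp: coprime_def)
  then obtain A B where AB: "nump P = d * A" "denp P = d * B" by (auto elim!: dvdE)
  have dn: "denp P \<noteq> 0" using den_0 by auto
  then have nz: "d \<noteq> 0" "B \<noteq> 0" using AB by auto
  have dd: "degree d \<ge> 1"
    using d(3) nz(1) by (metis is_unit_iff_degree less_one not_le)
  have "degree d + degree B \<le> ?N" using deg_den unfolding AB(2) by (simp add: degree_mult_eq nz)
  then have B: "degree B \<le> ?N - 1" using dd by linarith
  have A: "coeff A n = 0" if "n \<ge> ?N - 1" for n
  proof (cases "A = 0")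
    case False
    have "degree d + degree A < ?N" using deg_num unfolding AB(1) by (simp add: degree_mult_eq nz False)
    then show ?thesis using that dd by (intro coeff_eq_0) linarith
  qed simp
  have "fps_of_poly d * (fps_of_poly B * u) = fps_of_poly d * fps_of_poly A"
    using den_u unfolding AB fps_of_poly_mult by (simp add: mult.assoc)
  then have "fps_of_poly B * u = fps_of_poly A" using nz(1) by simp
  then show False using no_low_rank[of "?N - 1" B A] A B nz(2) zero_less_card_finite[where 'a='n] by simp
qed

lemma params_in_paramsM: "params_of ix P \<in> paramsM ix"
proof -
  let ?N = "CARD('n)"
  have "degree (nump P) = ?N - 1 \<or> degree (denp P) = ?N"
  proof (rule ccontr)
    assume "\<not> ?thesis"
    then have "degree (nump P) < ?N - 1" "degree (denp P) \<le> ?N - 1" using deg_num deg_den by linarith+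
    moreover have "denp P \<noteq> 0" using den_0 by auto
    ultimately show False
      using no_low_rank[of "?N - 1", OF _ den_u] zero_less_card_finite[where 'a='n] by (simp add: coeff_eq_0)
  qed
  then show ?thesis
    using coprime_num_den den_nz polyA_params polyB_params unfolding paramsM_def
    by (auto simp: case_prod_unfold)
qed

lemma params_in_gen: "params_of ix P \<in> gen_params ix"
  unfolding gen_params_def using params_in_paramsM generic_u ratfun_params by simp

lemma chi_coord_params: "chi_coord ix (params_of ix P) =
  ((\<chi> i. 2 * s i, \<chi> i. 2 * t i), (\<chi> i. sgn (al i), \<chi> i. cnj (sgn (be i))))"
  unfolding chi_coord_def ratfun_params Let_def lamsq_u musq_u phase_phi_u phase_theta_u ..

end

section \<open>The inverse map\<close>

type_synonym 'n angles = "((real^'n) \<times> (real^'n)) \<times> ((real^'n) \<times> (real^'n))"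

definition sx :: "'n::finite angles \<Rightarrow> 'n \<Rightarrow> real" where "sx x i = fst (fst x) $ i / 2"
definition tx :: "'n::finite angles \<Rightarrow> 'n \<Rightarrow> real" where "tx x i = snd (fst x) $ i / 2"
definition alx :: "'n::finite angles \<Rightarrow> 'n \<Rightarrow> complex" where
  "alx x i = complex_of_real (sqrt (sx x i)) * cis (fst (snd x) $ i)"
definition bex :: "'n::finite angles \<Rightarrow> 'n \<Rightarrow> complex" where
  "bex x i = complex_of_real (sqrt (tx x i)) * cis (- (snd (snd x) $ i))"
definition px :: "'n::finite angles \<Rightarrow> complex poly^'n^'n" where
  "px x = pmat (sx x) (tx x) (alx x) (bex x)"
definition gmap :: "('n::finite \<Rightarrow> nat) \<Rightarrow> 'n angles \<Rightarrow> (complex^'n) \<times> (complex^'n)" where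
  "gmap ix x = params_of ix (px x)"

lemma inv_spec_x:
  fixes ix :: "'n::finite \<Rightarrow> nat"
  assumes "bij_betw ix UNIV {..<CARD('n)}" "x \<in> OmegaN ix \<times> UNIV"
  shows "inv_spec ix (sx x) (tx x) (alx x) (bex x)"
proof -
  have "tx x j < sx x j" "0 < tx x j" "ix i = Suc (ix j) \<Longrightarrow> sx x i < tx x j" for i j
    using assms(2) by (auto simp: OmegaN_def sx_def tx_def)
  moreover from this have "0 < sx x j" for j by (meson less_trans)
  ultimately show ?thesis
    using assms(1) by unfold_locales (auto simp: alx_def bex_def norm_mult power_mult_distrib less_imp_le)
qed

lemma gmap_in_gen:
  fixes ix :: "'n::finite \<Rightarrow> nat"
  assumes "bij_betw ix UNIV {..<CARD('n)}" "x \<in> OmegaN ix \<times> UNIV"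
  shows "gmap ix x \<in> gen_params ix"
proof -
  interpret inv_spec ix "sx x" "tx x" "alx x" "bex x" by (rule inv_spec_x[OF assms])
  show ?thesis unfolding gmap_def px_def by (rule params_in_gen)
qed

lemma chi_gmap:
  fixes ix :: "'n::finite \<Rightarrow> nat"
  assumes "bij_betw ix UNIV {..<CARD('n)}" "x \<in> OmegaN ix \<times> UNIV"
  shows "chi_coord ix (gmap ix x) = cover x"
proof -
  interpret inv_spec ix "sx x" "tx x" "alx x" "bex x" by (rule inv_spec_x[OF assms])
  have "sgn (alx x i) = cis (fst (snd x) $ i)" for i
    unfolding alx_def using s_pos by (simp add: sgn_scale_real sgn_cis)
  moreover have "cnj (sgn (bex x i)) = cis (snd (snd x) $ i)" for i
    unfolding bex_def using t_pos by (simp add: sgn_scale_real sgn_cis cis_cnj)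
  ultimately show ?thesis
    unfolding gmap_def px_def chi_coord_params cover_def by (simp add: sx_def tx_def prod_eq_iff vec_eq_iff)
qed

section \<open>Generic symbols lie in the range of the construction\<close>

lemma infsum_eq_suminf:
  fixes f :: "nat \<Rightarrow> 'a::banach"
  assumes "summable (\<lambda>n. norm (f n))"
  shows "infsum f UNIV = suminf f"
  using norm_summable_imp_has_sum[OF assms summable_sums[OF summable_norm_cancel[OF assms]]]
  by (rule infsumI)

text \<open>The bound by a product of geometric series gives absolute summability over pairs. The
  swap is carried out for unordered sums, and each inner and outer series is then identified with
  its ordered sum.\<close>

lemma suminf_swap_geometric:
  fixes f :: "nat \<Rightarrow> nat \<Rightarrow> complex"
  assumes b: "\<And>n k. cmod (f n k) \<le> C * r ^ n * r ^ k" and r: "0 \<le> r" "r < 1" and C: "0 \<le> C"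
  shows "(\<Sum>n. \<Sum>k. f n k) = (\<Sum>k. \<Sum>n. f n k)"
proof -
  have inner: "summable (\<lambda>k. norm (f n k))" for n
  proof (rule summable_comparison_test'[where N=0])
    show "summable (\<lambda>k. C * r ^ n * r ^ k)" using r by (intro summable_mult summable_geometric) auto
  qed (use b in auto)
  have inner': "summable (\<lambda>n. norm (f n k))" for k
  proof (rule summable_comparison_test'[where N=0])
    show "summable (\<lambda>n. C * r ^ k * r ^ n)" using r by (intro summable_mult summable_geometric) auto
    show "norm (norm (f n k)) \<le> C * r ^ k * r ^ n" for n using b[of n k] by (simp add: mult_ac)
  qed
  have ib: "(\<Sum>k. norm (f n k)) \<le> C / (1 - r) * r ^ n" for n
  proof -
    have "(\<Sum>k. norm (f n k)) \<le> (\<Sum>k. C * r ^ n * r ^ k)"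
      using inner b r by (intro suminf_le summable_mult summable_geometric) auto
    also have "\<dots> = C * r ^ n * (1 / (1 - r))" using r by (simp add: suminf_mult summable_geometric suminf_geometric)
    finally show ?thesis by simp
  qed
  have ib': "(\<Sum>n. norm (f n k)) \<le> C / (1 - r) * r ^ k" for k
  proof -
    have "(\<Sum>n. norm (f n k)) \<le> (\<Sum>n. C * r ^ k * r ^ n)"
    proof (intro suminf_le)
      show "norm (f n k) \<le> C * r ^ k * r ^ n" for n using b[of n k] by (simp add: mult_ac)
    qed (use inner' r in \<open>auto intro!: summable_mult summable_geometric\<close>)
    also have "\<dots> = C * r ^ k * (1 / (1 - r))" using r by (simp add: suminf_mult summable_geometric suminf_geometric)
    finally show ?thesis by simp
  qed
  have geo: "summable (\<lambda>n. C / (1 - r) * r ^ n)" using r by (intro summable_mult summable_geometric) auto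
  have outer: "summable (\<lambda>n. norm (\<Sum>k. norm (f n k)))"
    using ib suminf_nonneg[OF inner] by (intro summable_comparison_test'[OF geo, of 0]) auto
  have abs: "(\<lambda>p. norm (case p of (n, k) \<Rightarrow> f n k)) summable_on UNIV \<times> UNIV"
  proof (subst Infinite_Sum.abs_summable_on_Sigma_iff, intro conjI ballI)
    fix n
    show "(\<lambda>y. norm (case (n, y) of (n, k) \<Rightarrow> f n k)) summable_on UNIV"
      using inner[of n] by (simp add: norm_summable_imp_summable_on)
  next
    have "(\<lambda>n. norm (\<Sum>k. norm (f n k))) summable_on UNIV"
      using outer by (intro norm_summable_imp_summable_on) simp
    then show "(\<lambda>x. norm (\<Sum>\<^sub>\<infinity>y. norm (case (x, y) of (n, k) \<Rightarrow> f n k))) summable_on UNIV"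
      using inner by (simp add: infsum_eq_suminf)
  qed
  have sw: "infsum (\<lambda>n. infsum (\<lambda>k. f n k) UNIV) UNIV = infsum (\<lambda>k. infsum (\<lambda>n. f n k) UNIV) UNIV"
    by (rule infsum_swap_banach[OF Infinite_Sum.abs_summable_summable[OF abs]])
  have s1: "summable (\<lambda>n. norm (\<Sum>k. f n k))"
  proof (rule summable_comparison_test'[OF geo, of 0])
    show "norm (norm (\<Sum>k. f n k)) \<le> C / (1 - r) * r ^ n" for n
      using summable_norm[OF inner[of n]] ib[of n] by simp
  qed
  have s2: "summable (\<lambda>k. norm (\<Sum>n. f n k))"
  proof (rule summable_comparison_test'[OF geo, of 0])
    show "norm (norm (\<Sum>n. f n k)) \<le> C / (1 - r) * r ^ k" for k
      using summable_norm[OF inner'[of k]] ib'[of k] by simp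
  qed
  show ?thesis using sw inner inner' s1 s2 by (simp add: infsum_eq_suminf)
qed

lemma fgeo_common_bound:
  assumes "fgeo F" "fgeo G"
  shows "\<exists>C r. 0 < r \<and> r < 1 \<and> C \<ge> 0 \<and> (\<forall>n. cmod (fps_nth F n) \<le> C * r ^ n \<and> cmod (fps_nth G n) \<le> C * r ^ n)"
proof -
  from fgeo_bound[OF assms(1)] obtain C r where 1: "0 < r" "r < 1" "\<And>n. cmod (fps_nth F n) \<le> C * r ^ n" "C \<ge> 0" by blast
  from fgeo_bound[OF assms(2)] obtain D s where 2: "0 < s" "s < 1" "\<And>n. cmod (fps_nth G n) \<le> D * s ^ n" "D \<ge> 0" by blast
  show ?thesis
  proof (rule exI[of _ "max C D"], rule exI[of _ "max r s"], intro conjI allI)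
    show "cmod (fps_nth F n) \<le> max C D * max r s ^ n" for n
      using 1 2 by (intro order_trans[OF 1(3)] mult_mono power_mono) auto
    show "cmod (fps_nth G n) \<le> max C D * max r s ^ n" for n
      using 1 2 by (intro order_trans[OF 2(3)] mult_mono power_mono) auto
  qed (use 1 2 in auto)
qed

section \<open>The Hankel operator acting on power series\<close>

definition hop :: "complex fps \<Rightarrow> complex fps \<Rightarrow> complex fps" where
  "hop u F = Abs_fps (hankel (fps_nth u) (fps_nth F))"

lemma hop_nth: "fps_nth (hop u F) = hankel (fps_nth u) (fps_nth F)" by (simp add: hop_def Abs_fps_inverse)

lemma fgeo_shift_bound:
  assumes "fgeo u" "fgeo F"
  shows "\<exists>C r. 0 < r \<and> r < 1 \<and> C \<ge> 0 \<and> (\<forall>n k. cmod (fps_nth u (n + k) * cnj (fps_nth F k)) \<le> C * r ^ n * r ^ k)"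
proof -
  from fgeo_common_bound[OF assms] obtain C r where 1: "0 < r" "r < 1" "C \<ge> 0"
    and 2: "\<forall>n. cmod (fps_nth u n) \<le> C * r ^ n \<and> cmod (fps_nth F n) \<le> C * r ^ n" by blast
  have "cmod (fps_nth u (n + k) * cnj (fps_nth F k)) \<le> (C * C) * r ^ n * r ^ k" for n k
  proof -
    have "C * r ^ k \<le> C * 1" using 1 by (intro mult_left_mono power_le_one) auto
    then have "cmod (fps_nth F k) \<le> C" using 2 by (metis mult.right_neutral order_trans)
    then have "cmod (fps_nth u (n + k)) * cmod (fps_nth F k) \<le> (C * r ^ (n + k)) * C"
      using 1 2 by (intro mult_mono) auto
    then show ?thesis by (simp add: norm_mult power_add mult_ac)
  qed
  then show ?thesis using 1 by - (rule exI[of _ "C * C"], rule exI[of _ r], auto)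
qed

lemma hop_sum:
  assumes "fgeo u" "\<And>i. i \<in> A \<Longrightarrow> fgeo (F i)"
  shows "hop u (\<Sum>i\<in>A. F i) = (\<Sum>i\<in>A. hop u (F i))"
proof (rule fps_ext)
  fix n
  have "fps_nth (hop u (\<Sum>i\<in>A. F i)) n = (\<Sum>k. \<Sum>i\<in>A. fps_nth u (n + k) * cnj (fps_nth (F i) k))"
    by (simp add: hop_nth hankel_def fps_sum_nth sum_distrib_left)
  also have "\<dots> = (\<Sum>i\<in>A. \<Sum>k. fps_nth u (n + k) * cnj (fps_nth (F i) k))"
    by (intro suminf_sum fgeo_shift_summable assms fgeo_l2p)
  finally show "fps_nth (hop u (\<Sum>i\<in>A. F i)) n = fps_nth (\<Sum>i\<in>A. hop u (F i)) n"
    by (simp add: hop_nth hankel_def fps_sum_nth)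
qed

lemma hop_scale:
  assumes "fgeo u" "fgeo F"
  shows "hop u (fps_const c * F) = fps_const (cnj c) * hop u F"
proof (rule fps_ext)
  fix n
  show "fps_nth (hop u (fps_const c * F)) n = fps_nth (fps_const (cnj c) * hop u F) n"
    using suminf_mult[OF fgeo_shift_summable[OF assms(1) fgeo_l2p[OF assms(2)], of n], of "cnj c"]
    by (simp add: hop_nth hankel_def mult.left_commute)
qed

lemma hop_lcomb: "fgeo u \<Longrightarrow> (\<And>j. fgeo (v j)) \<Longrightarrow> hop u (lcomb v y) = lcomb (\<lambda>j. hop u (v j)) (\<lambda>j. cnj (y j))"
  unfolding lcomb_def by (subst hop_sum) (auto simp: hop_scale fgeo_mult fgeo_const)

lemma hop_add: "fgeo u \<Longrightarrow> fgeo F \<Longrightarrow> fgeo G \<Longrightarrow> hop u (F + G) = hop u F + hop u G"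
  using hop_sum[of u "{True, False}" "\<lambda>b. if b then F else G"] by simp

lemma hop_1: "hop u 1 = u"
proof -
  have "fps_nth 1 = one_l2" by (auto simp: one_l2_def fun_eq_iff)
  then show ?thesis unfolding hop_def by (simp add: hankel_one fps_nth_inverse)
qed

text \<open>Both sides are the double series with terms u(n + k) conj F(k) conj G(n), summed in
  opposite orders.\<close>

lemma hop_symmetric:
  assumes "fgeo u" "fgeo F" "fgeo G"
  shows "hip (hop u F) G = hip (hop u G) F"
proof -
  from fgeo_shift_bound[OF assms(1,2)] obtain C r where 1: "0 < r" "r < 1" "C \<ge> 0"
    "\<forall>n k. cmod (fps_nth u (n + k) * cnj (fps_nth F k)) \<le> C * r ^ n * r ^ k" by blast
  from fgeo_bounded[OF assms(3)] obtain M where M: "\<And>n. cmod (fps_nth G n) \<le> M" by blast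
  have "M \<ge> 0" using M[of 0] norm_ge_zero[of "fps_nth G 0"] by linarith
  have b: "cmod (fps_nth u (n + k) * cnj (fps_nth F k) * cnj (fps_nth G n)) \<le> (C * M) * r ^ n * r ^ k" for n k
  proof -
    have "cmod (fps_nth u (n + k) * cnj (fps_nth F k)) * cmod (fps_nth G n) \<le> (C * r ^ n * r ^ k) * M"
      using 1 M by (intro mult_mono) auto
    then show ?thesis by (simp add: norm_mult mult_ac)
  qed
  have "hip (hop u F) G = (\<Sum>n. \<Sum>k. fps_nth u (n + k) * cnj (fps_nth F k) * cnj (fps_nth G n))"
    unfolding hinner_def hop_nth hankel_def
    by (intro suminf_cong suminf_mult2 fgeo_shift_summable assms fgeo_l2p)
  also have "\<dots> = (\<Sum>k. \<Sum>n. fps_nth u (n + k) * cnj (fps_nth F k) * cnj (fps_nth G n))"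
    using b 1 \<open>M \<ge> 0\<close> by (intro suminf_swap_geometric[where C="C*M" and r=r]) auto
  also have "\<dots> = (\<Sum>k. (\<Sum>n. fps_nth u (k + n) * cnj (fps_nth G n)) * cnj (fps_nth F k))"
  proof (intro suminf_cong)
    fix k
    show "(\<Sum>n. fps_nth u (n + k) * cnj (fps_nth F k) * cnj (fps_nth G n)) =
        (\<Sum>n. fps_nth u (k + n) * cnj (fps_nth G n)) * cnj (fps_nth F k)"
      using suminf_mult2[OF fgeo_shift_summable[OF assms(1) fgeo_l2p[OF assms(3)], of k], of "cnj (fps_nth F k)"]
      by (simp add: mult_ac add.commute)
  qed
  finally show ?thesis by (simp add: hinner_def hop_nth hankel_def)
qed

lemma hop_0: "fps_nth (hop u F) 0 = hip u F"
  by (simp add: hop_nth hankel_def hinner_def)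

definition bshift :: "complex fps \<Rightarrow> complex fps" where "bshift F = Abs_fps (\<lambda>n. fps_nth F (Suc n))"

lemma bshift_nth: "fps_nth (bshift F) n = fps_nth F (Suc n)" by (simp add: bshift_def)

lemma bshift_eq: "(F :: complex fps) = fps_const (fps_nth F 0) + fps_X * bshift F"
proof (rule fps_ext)
  fix n show "fps_nth F n = fps_nth (fps_const (fps_nth F 0) + fps_X * bshift F) n"
    by (cases n) (simp_all add: bshift_nth)
qed

lemma bshift_scale: "bshift (fps_const c * F) = fps_const c * bshift F"
  by (rule fps_ext) (simp add: bshift_nth)

lemma bshift_lcomb: "bshift (lcomb v y) = lcomb (\<lambda>j. bshift (v j)) y"
  by (rule fps_ext) (simp add: bshift_nth lcomb_nth)

lemma hop_X:
  assumes "fgeo u" "fgeo F"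
  shows "hop u (fps_X * F) = bshift (hop u F)"
proof (rule fps_ext)
  fix n
  have "summable (\<lambda>k. fps_nth u (n + k) * cnj (fps_nth (fps_X * F) k))"
    by (intro fgeo_shift_summable assms fgeo_l2p fgeo_mult fgeo_X)
  from suminf_split_initial_segment[OF this, of 1]
  show "fps_nth (hop u (fps_X * F)) n = fps_nth (bshift (hop u F)) n"
    by (simp add: hop_nth hankel_def bshift_nth)
qed

section \<open>Spectral theory of a generic symbol\<close>

locale generic_symbol =
  fixes ix :: "'n::finite \<Rightarrow> nat" and A B :: "complex poly" and u :: "complex fps"
  assumes ix: "bij_betw ix UNIV {..<CARD('n)}"
    and Bu: "fps_of_poly B * u = fps_of_poly A"
    and A: "n \<ge> CARD('n) \<Longrightarrow> coeff A n = 0" and B: "degree B \<le> CARD('n)"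
    and B_nz: "cmod z \<le> 1 \<Longrightarrow> poly B z \<noteq> 0"
    and gen: "generic CARD('n) (fps_nth u)"
begin

lemma ix_surj: "k < CARD('n) \<Longrightarrow> \<exists>i. ix i = k"
  using ix unfolding bij_betw_def by (metis imageE lessThan_iff)

lemma ix_less: "ix i < CARD('n)"
  using ix unfolding bij_betw_def by auto

lemma ix_inj: "ix i = ix j \<longleftrightarrow> i = j"
  using ix unfolding bij_betw_def inj_on_def by auto

lemma B0: "B \<noteq> 0" using B_nz[of 0] by auto

lemma invB: "fps_of_poly B * inverse (fps_of_poly B) = 1"
  using B_nz[of 0] by (intro inverse_mult_eq_1') (simp add: poly_0_coeff_0)

text \<open>The range of the Hankel operator: rational functions with denominator \<open>B\<close> and numerator of
  degree less than \<open>N\<close>.\<close>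

definition inW :: "complex fps \<Rightarrow> bool" where
  "inW F \<longleftrightarrow> (\<forall>n\<ge>CARD('n). fps_nth (fps_of_poly B * F) n = 0)"

lemma inW_fgeo: "inW F \<Longrightarrow> fgeo F"
proof -
  assume F: "inW F"
  define p where "p = Poly (map (fps_nth (fps_of_poly B * F)) [0..<CARD('n)])"
  have "fps_of_poly B * F = fps_of_poly p"
    using F unfolding inW_def p_def
    by (intro fps_ext) (auto simp: coeff_Poly_eq nth_default_def not_less)
  then have "F = fps_of_poly p * inverse (fps_of_poly B)"
    using invB by (metis mult.assoc mult.commute mult.right_neutral)
  then show ?thesis using fgeo_mult fgeo_poly fgeo_inverse_poly[OF B_nz] by simp
qed

lemma inW_lcomb: "(\<And>j. inW (v j)) \<Longrightarrow> inW (lcomb v y)"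
  for v :: "'m::finite \<Rightarrow> complex fps"
proof -
  assume v: "\<And>j. inW (v j)"
  have "fps_of_poly B * lcomb v y = lcomb (\<lambda>j. fps_of_poly B * v j) y"
    unfolding lcomb_def by (simp add: sum_distrib_left mult_ac)
  then show ?thesis using v unfolding inW_def by (simp add: lcomb_nth)
qed

lemma inW_scale: "inW F \<Longrightarrow> inW (fps_const c * F)"
  unfolding inW_def by (simp add: mult.left_commute[of _ "fps_const c"])

lemma inW_u: "inW u" unfolding inW_def Bu using A by simp

lemma fgeo_u: "fgeo u" using inW_u by (rule inW_fgeo)

abbreviation "H \<equiv> hop u"

lemma inW_H: "fgeo F \<Longrightarrow> inW (H F)"
  unfolding inW_def hop_def using hankel_poly_range[OF fgeo_u fgeo_l2p Bu A B] by blast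

lemma fgeo_H: "fgeo F \<Longrightarrow> fgeo (H F)" using inW_H inW_fgeo by blast

text \<open>An element of the range is determined by the N coefficients of its numerator.
  Independence of N elements is therefore invertibility of a square matrix, which then solves for
  the coordinates of any other element.\<close>

lemma inW_span:
  assumes v: "\<And>j::'n. inW (v j)" and ind: "\<And>y. lcomb v y = 0 \<Longrightarrow> y = (\<lambda>_. 0)" and F: "inW F"
  shows "\<exists>y. F = lcomb v y"
proof -
  define Q :: "complex^'n^'n" where "Q = (\<chi> r j. fps_nth (fps_of_poly B * v j) (ix r))"
  have nth: "fps_nth (fps_of_poly B * lcomb v y) n = (\<Sum>j\<in>UNIV. y j * fps_nth (fps_of_poly B * v j) n)" for y n
  proof -
    have "fps_of_poly B * lcomb v y = lcomb (\<lambda>j. fps_of_poly B * v j) y"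
      unfolding lcomb_def by (simp add: sum_distrib_left mult_ac)
    then show ?thesis by (simp add: lcomb_nth)
  qed
  have eqI: "G = lcomb v y" if "inW G" "\<And>r. fps_nth (fps_of_poly B * G) (ix r) = fps_nth (fps_of_poly B * lcomb v y) (ix r)" for G y
  proof -
    have "fps_nth (fps_of_poly B * G) n = fps_nth (fps_of_poly B * lcomb v y) n" for n
      using that ix_surj[of n] inW_lcomb[of v y, OF v] unfolding inW_def by (cases "n < CARD('n)") auto
    then have "fps_of_poly B * G = fps_of_poly B * lcomb v y" by (intro fps_ext)
    then show ?thesis using B0 by simp
  qed
  have "x = 0" if "Q *v x = 0" for x
  proof -
    have "(0::complex fps) = lcomb v (\<lambda>j. x $ j)"
    proof (rule eqI)
      fix r
      have "(Q *v x) $ r = 0" using that by simp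
      then show "fps_nth (fps_of_poly B * 0) (ix r) = fps_nth (fps_of_poly B * lcomb v (\<lambda>j. x $ j)) (ix r)"
        unfolding nth by (simp add: matrix_vector_mult_def Q_def mult.commute)
    qed (simp add: inW_def)
    then have "(\<lambda>j. x $ j) = (\<lambda>_. 0)" using ind by metis
    then show ?thesis by (simp add: vec_eq_iff fun_eq_iff)
  qed
  then obtain R where "R ** Q = mat 1" using matrix_left_invertible_ker by blast
  then have QR: "Q ** R = mat 1" by (simp add: matrix_left_right_inverse)
  define b :: "complex^'n" where "b = (\<chi> r. fps_nth (fps_of_poly B * F) (ix r))"
  have "Q *v (R *v b) = b" by (simp add: matrix_vector_mul_assoc QR)
  then have "F = lcomb v (\<lambda>j. (R *v b) $ j)"
  proof (intro eqI F)
    fix r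
    have "fps_nth (fps_of_poly B * F) (ix r) = (Q *v (R *v b)) $ r" unfolding \<open>Q *v (R *v b) = b\<close> by (simp add: b_def)
    also have "\<dots> = (\<Sum>j\<in>UNIV. Q $ r $ j * (R *v b) $ j)" by (simp add: matrix_vector_mult_def[of Q])
    finally show "fps_nth (fps_of_poly B * F) (ix r) = fps_nth (fps_of_poly B * lcomb v (\<lambda>j. (R *v b) $ j)) (ix r)"
      unfolding nth by (simp add: Q_def mult.commute)
  qed
  then show ?thesis by blast
qed

abbreviation "H2 F \<equiv> H (H F)"

lemma H2_lcomb: "(\<And>j. fgeo (v j)) \<Longrightarrow> H2 (lcomb v y) = lcomb (\<lambda>j. H2 (v j)) y" for v :: "'m::finite \<Rightarrow> complex fps"
  by (simp add: hop_lcomb fgeo_u fgeo_H)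

lemma H2_scale: "fgeo F \<Longrightarrow> H2 (fps_const c * F) = fps_const c * H2 F"
  by (simp add: hop_scale fgeo_u fgeo_H)

lemma H2_sum: "(\<And>i. i \<in> I \<Longrightarrow> fgeo (F i)) \<Longrightarrow> H2 (\<Sum>i\<in>I. F i) = (\<Sum>i\<in>I. H2 (F i))"
  by (simp add: hop_sum fgeo_u fgeo_H)

lemma H2_pos: "fgeo F \<Longrightarrow> hip (H2 F) F = hip (H F) (H F)"
  using hop_symmetric[OF fgeo_u fgeo_H, of F F] .

lemma H2_adjoint: "fgeo F \<Longrightarrow> fgeo G \<Longrightarrow> hip (H2 F) G = hip F (H2 G)"
proof -
  assume FG: "fgeo F" "fgeo G"
  have "hip (H2 F) G = hip (H G) (H F)" by (intro hop_symmetric fgeo_u fgeo_H FG)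
  also have "\<dots> = cnj (hip (H F) (H G))" by (intro hip_cnj fgeo_H FG)
  also have "hip (H F) (H G) = hip (H2 G) F" by (intro hop_symmetric[symmetric] fgeo_u fgeo_H FG)
  also have "cnj (hip (H2 G) F) = hip F (H2 G)" by (intro hip_cnj[symmetric] fgeo_H FG)
  finally show ?thesis .
qed

primrec V :: "nat \<Rightarrow> complex fps" where
  "V 0 = 1" | "V (Suc k) = H2 (V k)"

lemma fgeo_V: "fgeo (V k)" by (induction k) (auto simp: fgeo_1 fgeo_H)

lemma inW_V: "inW (V (Suc k))" by (simp add: inW_H fgeo_H fgeo_V)

lemma V_hankel: "((hankel (fps_nth u)) ^^ (2 * k)) one_l2 = fps_nth (V k)"
proof (induction k)
  case 0
  show ?case by (auto simp: one_l2_def fun_eq_iff)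
next
  case (Suc k)
  then show ?case by (simp add: hop_nth)
qed

lemma V_independent:
  assumes "(\<Sum>k<CARD('n). fps_const (a k) * V (Suc k)) = 0" "k < CARD('n)"
  shows "a k = 0"
proof -
  have "(\<Sum>k\<in>{1..CARD('n)}. a (k - 1) * (((hankel (fps_nth u)) ^^ (2 * k)) one_l2) n) = 0" for n
  proof -
    have "(\<Sum>k\<in>{1..CARD('n)}. a (k - 1) * (((hankel (fps_nth u)) ^^ (2 * k)) one_l2) n) =
        (\<Sum>k<CARD('n). a k * fps_nth (V (Suc k)) n)"
      unfolding V_hankel by (rule sum.reindex_bij_witness[of _ Suc "\<lambda>k. k - 1"]) auto
    also have "\<dots> = fps_nth (\<Sum>k<CARD('n). fps_const (a k) * V (Suc k)) n" by (simp add: fps_sum_nth)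
    finally show ?thesis using assms(1) by simp
  qed
  then have "\<forall>k\<in>{1..CARD('n)}. a (k - 1) = 0"
    by (intro gen[unfolded generic_def, THEN conjunct2, THEN spec[of _ "\<lambda>k. a (k - 1)"], THEN mp] allI)
  from bspec[OF this, of "Suc k"] show ?thesis using assms(2) by simp
qed

text \<open>\<open>act p = p(H\<^sup>2) H\<^sup>2 1\<close>, for \<open>degree p \<le> N\<close>.\<close>

definition act :: "complex poly \<Rightarrow> complex fps" where
  "act p = (\<Sum>i\<le>CARD('n). fps_const (coeff p i) * V (Suc i))"

lemma inW_act: "inW (act p)"
proof -
  have "fps_of_poly B * act p = (\<Sum>i\<le>CARD('n). fps_const (coeff p i) * (fps_of_poly B * V (Suc i)))"
    unfolding act_def sum_distrib_left by (intro sum.cong refl) (simp only: mult.left_commute)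
  then show ?thesis using inW_V unfolding inW_def by (simp add: fps_sum_nth del: V.simps)
qed

lemma act_eq_0: "degree p < CARD('n) \<Longrightarrow> act p = 0 \<Longrightarrow> p = 0"
proof -
  assume p: "degree p < CARD('n)" "act p = 0"
  have "(\<Sum>i<CARD('n). fps_const (coeff p i) * V (Suc i)) = act p"
    unfolding act_def using p(1) by (simp add: lessThan_Suc_atMost[symmetric] coeff_eq_0)
  then have "coeff p i = 0" if "i < CARD('n)" for i using V_independent[OF _ that] p(2) by metis
  then show ?thesis using p(1) by (metis leading_coeff_0_iff)
qed

text \<open>\<open>act\<close> intertwines multiplication by the variable with H^2; the degree bound
  keeps the top term within the range of summation.\<close>

lemma act_mult_linear:
  assumes "degree p < CARD('n)"
  shows "act ([:-z, 1:] * p) = H2 (act p) - fps_const z * act p"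
proof -
  have "H2 (act p) = (\<Sum>i\<le>CARD('n). fps_const (coeff p i) * V (Suc (Suc i)))"
    unfolding act_def by (subst H2_sum) (auto simp: H2_scale fgeo_mult fgeo_const fgeo_H fgeo_V)
  also have "\<dots> = (\<Sum>i<CARD('n). fps_const (coeff p i) * V (Suc (Suc i)))"
    using assms by (simp add: lessThan_Suc_atMost[symmetric] coeff_eq_0)
  also have "\<dots> = (\<Sum>i\<le>CARD('n). fps_const (coeff (pCons 0 p) i) * V (Suc i))"
    by (subst lessThan_Suc_atMost[symmetric], subst sum.lessThan_Suc_shift) simp
  finally have "H2 (act p) - fps_const z * act p = (\<Sum>i\<le>CARD('n). (fps_const (coeff (pCons 0 p) i) - fps_const (z * coeff p i)) * V (Suc i))"
    unfolding act_def by (simp add: sum_distrib_left sum_subtractf left_diff_distrib mult.assoc flip: fps_const_mult del: V.simps)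
  also have "\<dots> = act ([:-z, 1:] * p)"
    unfolding act_def by (intro sum.cong refl) (simp add: fps_const_sub del: V.simps)
  finally show ?thesis ..
qed

text \<open>By independence the series \<open>V (Suc k)\<close> with k < N span the range, so
  \<open>F\<close> is orthogonal to itself.\<close>

lemma ortho_W:
  assumes "inW F" "\<And>k. hip (V (Suc k)) F = 0"
  shows "F = 0"
proof -
  define v where "v j = V (Suc (ix j))" for j
  have "\<exists>y. F = lcomb v y"
  proof (rule inW_span[OF _ _ assms(1)])
    show "inW (v j)" for j unfolding v_def by (rule inW_V)
    fix y assume "lcomb v y = 0"
    moreover have "lcomb v y = (\<Sum>k<CARD('n). fps_const (y (inv_into UNIV ix k)) * V (Suc k))"
      unfolding lcomb_def v_def
      using sum.reindex_bij_betw[OF ix, of "\<lambda>k. fps_const (y (inv_into UNIV ix k)) * V (Suc k)"] ix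
      by (simp add: bij_betw_def del: V.simps)
    ultimately have "y (inv_into UNIV ix k) = 0" if "k < CARD('n)" for k
      using V_independent[of "\<lambda>k. y (inv_into UNIV ix k)"] that by simp
    from this[OF ix_less] show "y = (\<lambda>_. 0)" using ix by (auto simp: bij_betw_def fun_eq_iff)
  qed
  then obtain y where y: "F = lcomb v y" by blast
  have "hip (lcomb v y) F = 0"
    unfolding lcomb_def using assms inW_fgeo[OF assms(1)]
    by (subst hip_sum_left) (auto simp: hip_scale_left fgeo_mult fgeo_const fgeo_V v_def simp del: V.simps)
  then show ?thesis using y hip_self_eq_0 inW_fgeo[OF assms(1)] by simp
qed

text \<open>Moving H across the inner product shows that \<open>F\<close> is orthogonal to every H^2
  (V k) = V (k + 1).\<close>

lemma H_injective:
  assumes "inW F" "H F = 0"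
  shows "F = 0"
proof (rule ortho_W[OF assms(1)])
  fix k
  have "hip (V (Suc k)) F = hip (H F) (H (V k))"
    using hop_symmetric[OF fgeo_u fgeo_H[OF fgeo_V[of k]] inW_fgeo[OF assms(1)]] by simp
  then show "hip (V (Suc k)) F = 0" unfolding assms(2) by (simp add: hinner_def)
qed

text \<open>The vector H^2 1 is cyclic: expressing one more power through the first N gives a monic
  polynomial p of degree N with p(H^2) H^2 1 = 0. Over the complex numbers it splits, and each
  cofactor applied to the cyclic vector is an eigenvector, nonzero by independence. Positivity of
  H^2 makes the roots positive.\<close>

lemma spectrum:
  obtains s :: "'n \<Rightarrow> real" and E :: "'n \<Rightarrow> complex fps"
  where "\<And>j. s j > 0" "\<And>i j. ix i < ix j \<Longrightarrow> s j < s i" "\<And>j. inW (E j)" "\<And>j. E j \<noteq> 0"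
    "\<And>j. H2 (E j) = fps_const (of_real (s j)) * E j"
proof -
  define v where "v j = V (Suc (ix j))" for j
  have "\<exists>y. V (Suc CARD('n)) = lcomb v y"
  proof (rule inW_span[OF _ _ inW_V])
    show "inW (v j)" for j unfolding v_def by (rule inW_V)
    fix y assume "lcomb v y = 0"
    moreover have "lcomb v y = (\<Sum>k<CARD('n). fps_const (y (inv_into UNIV ix k)) * V (Suc k))"
      unfolding lcomb_def v_def
      using sum.reindex_bij_betw[OF ix, of "\<lambda>k. fps_const (y (inv_into UNIV ix k)) * V (Suc k)"] ix
      by (simp add: bij_betw_def del: V.simps)
    ultimately have "y (inv_into UNIV ix k) = 0" if "k < CARD('n)" for k
      using V_independent[of "\<lambda>k. y (inv_into UNIV ix k)"] that by simp
    from this[OF ix_less] show "y = (\<lambda>_. 0)" using ix by (auto simp: bij_betw_def fun_eq_iff)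
  qed
  then obtain y where y: "V (Suc CARD('n)) = lcomb v y" by blast
  define p where "p = monom 1 CARD('n) - (\<Sum>k<CARD('n). monom (y (inv_into UNIV ix k)) k)"
  have cp: "coeff p k = (if k = CARD('n) then 1 else if k < CARD('n) then - y (inv_into UNIV ix k) else 0)" for k
    unfolding p_def by (auto simp: coeff_sum)
  have deg: "degree p = CARD('n)" using cp by (intro antisym degree_le le_degree) auto
  have lc: "lead_coeff p = 1" by (simp add: deg cp)
  have "act p = (\<Sum>i<CARD('n). fps_const (coeff p i) * V (Suc i)) + V (Suc CARD('n))"
    unfolding act_def by (simp add: lessThan_Suc_atMost[symmetric] cp del: V.simps)
  also have "(\<Sum>i<CARD('n). fps_const (coeff p i) * V (Suc i)) = - (\<Sum>k<CARD('n). fps_const (y (inv_into UNIV ix k)) * V (Suc k))"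
    unfolding sum_negf[symmetric] by (intro sum.cong refl) (simp add: cp fps_const_neg[symmetric] del: V.simps fps_const_neg)
  also have "(\<Sum>k<CARD('n). fps_const (y (inv_into UNIV ix k)) * V (Suc k)) = lcomb v y"
    unfolding lcomb_def v_def
    using sum.reindex_bij_betw[OF ix, of "\<lambda>k. fps_const (y (inv_into UNIV ix k)) * V (Suc k)"] ix
    by (simp add: bij_betw_def del: V.simps)
  finally have actp: "act p = 0" using y by simp
  obtain root where "smult (lead_coeff p) (\<Prod>i<degree p. [:- root i, 1:]) = p"
    by (rule complex_poly_decompose')
  then have pf: "p = (\<Prod>i<CARD('n). [:- root i, 1:])" by (simp add: cp deg)
  define qq where "qq I = (\<Prod>i\<in>I. [:- root i, 1:])" for I
  have degq: "degree (qq I) = card I" and qnz: "qq I \<noteq> 0" for I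
    unfolding qq_def by (simp add: degree_prod_eq_sum_degree) (cases "finite I", auto)
  define F where "F i = act (qq ({..<CARD('n)} - {i}))" for i
  have FW: "inW (F i)" for i unfolding F_def by (rule inW_act)
  have cardm: "card ({..<CARD('n)} - {i}) < CARD('n)" if "i < CARD('n)" for i using that by (simp add: card_Diff_singleton)
  have Fnz: "F i \<noteq> 0" if "i < CARD('n)" for i
    unfolding F_def using act_eq_0[of "qq ({..<CARD('n)} - {i})"] cardm[OF that] qnz degq by metis
  have FE: "H2 (F i) = fps_const (root i) * F i" if "i < CARD('n)" for i
  proof -
    have "p = [:- root i, 1:] * qq ({..<CARD('n)} - {i})"
      unfolding pf qq_def using that by (subst prod.remove[of _ i]) auto
    then have "act ([:- root i, 1:] * qq ({..<CARD('n)} - {i})) = 0" using actp by simp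
    then show ?thesis using act_mult_linear[of "qq ({..<CARD('n)} - {i})" "root i"] cardm[OF that] degq
      unfolding F_def by simp
  qed
  have pos: "\<exists>r>0. root i = complex_of_real r" if i: "i < CARD('n)" for i
  proof -
    have g: "fgeo (F i)" using FW inW_fgeo by blast
    have "H (F i) \<noteq> 0" using H_injective[OF FW] Fnz[OF i] by blast
    then have p1: "hsqnorm (fps_nth (H (F i))) > 0" and p2: "hsqnorm (fps_nth (F i)) > 0"
      using Fnz[OF i] hip_self_eq_0[OF g] hip_self[OF g] hip_self_eq_0[OF fgeo_H[OF g]] hip_self[OF fgeo_H[OF g]]
        hsqnorm_nonneg[OF fgeo_l2p[OF g]] hsqnorm_nonneg[OF fgeo_l2p[OF fgeo_H[OF g]]]
      by (auto simp: less_le)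
    have "root i * hip (F i) (F i) = hip (H (F i)) (H (F i))"
      using H2_pos[OF g] unfolding FE[OF i] by (simp add: hip_scale_left g)
    then have "root i = complex_of_real (hsqnorm (fps_nth (H (F i))) / hsqnorm (fps_nth (F i)))"
      unfolding hip_self[OF g] hip_self[OF fgeo_H[OF g]] using p2 by (simp add: field_simps)
    then show ?thesis using p1 p2 by (meson divide_pos_pos)
  qed
  have inj: "root i \<noteq> root k" if ik: "i < CARD('n)" "k < CARD('n)" "i \<noteq> k" for i k
  proof
    assume e: "root i = root k"
    \<comment> \<open>A double root would give a generalised eigenvector: F_i = (H^2 - root) R.
      Self-adjointness moves H^2 - root onto F_i, which it annihilates, so F_i is orthogonal to
      itself.\<close>
    define R where "R = act (qq ({..<CARD('n)} - {i} - {k}))"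
    have g: "fgeo (F i)" "fgeo R" using FW inW_act inW_fgeo unfolding R_def by blast+
    have "card ({..<CARD('n)} - {i} - {k}) < CARD('n)" using ik by (simp add: card_Diff_singleton)
    moreover have "qq ({..<CARD('n)} - {i}) = [:- root k, 1:] * qq ({..<CARD('n)} - {i} - {k})"
      unfolding qq_def using ik by (subst prod.remove[of _ k]) auto
    ultimately have FR: "F i = H2 R - fps_const (root i) * R"
      unfolding F_def R_def e using act_mult_linear degq by simp
    obtain r where r: "root i = complex_of_real r" using pos[OF ik(1)] by blast
    have "hip (F i) (F i) = hip (H2 R + fps_const (- root i) * R) (F i)"
      by (subst (1) FR) (simp add: fps_const_neg[symmetric] del: fps_const_neg)
    also have "\<dots> = hip (H2 R) (F i) + (- root i) * hip R (F i)"
      by (simp only: hip_add_left hip_scale_left g fgeo_H fgeo_mult fgeo_const)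
    also have "hip (H2 R) (F i) = hip R (fps_const (root i) * F i)"
      unfolding FE[OF ik(1), symmetric] by (rule H2_adjoint[OF g(2,1)])
    also have "\<dots> = root i * hip R (F i)" using r by (simp add: hip_scale_right g)
    finally have "hip (F i) (F i) = 0" by simp
    then show False using Fnz[OF ik(1)] hip_self_eq_0[OF g(1)] by blast
  qed
  define rr where "rr i = Re (root i)" for i
  have rr: "root i = complex_of_real (rr i)" "rr i > 0" if "i < CARD('n)" for i
    using pos[OF that] by (auto simp: rr_def)
  have "inj_on rr {..<CARD('n)}" using inj rr by (intro inj_onI) (metis lessThan_iff)
  then have card: "card (rr ` {..<CARD('n)}) = CARD('n)" by (simp add: card_image)
  define l where "l = sorted_list_of_set (rr ` {..<CARD('n)})"
  have len: "length l = CARD('n)" and set: "set l = rr ` {..<CARD('n)}" unfolding l_def using card by auto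
  have srt: "sorted_wrt (<) l" unfolding l_def by simp
  define s where "s j = rev l ! ix j" for j
  have smem: "s j \<in> rr ` {..<CARD('n)}" for j unfolding s_def set[symmetric] using ix_less[of j] len by (metis length_rev nth_mem set_rev)
  then have "\<exists>i. i < CARD('n) \<and> s j = rr i" for j by auto
  then obtain f where f: "\<And>j. f j < CARD('n) \<and> s j = rr (f j)" by metis
  show ?thesis
  proof (rule that[of s "\<lambda>j. F (f j)"])
    show "s j > 0" for j using f rr(2) by metis
    show "s j < s i" if "ix i < ix j" for i j
      unfolding s_def using srt that ix_less[of j] len
      by (simp add: rev_nth sorted_wrt_iff_nth_less)
    show "inW (F (f j))" for j by (rule FW)
    show "F (f j) \<noteq> 0" for j using f Fnz by blast
    show "H2 (F (f j)) = fps_const (of_real (s j)) * F (f j)" for j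
      using FE f rr(1) by metis
  qed
qed

end

text \<open>\<open>R\<close> is the numerator of the secular function 1 - \<Sum> w_j / (s_j - x).
  Its values at consecutive s_j have opposite signs; at the smallest s_j it is negative, while
  \<open>w1\<close> makes it positive at 0. The intermediate value theorem gives a root in each of
  these gaps.\<close>

lemma interlacing_roots:
  fixes ix :: "'n::finite \<Rightarrow> nat" and s w :: "'n \<Rightarrow> real"
  assumes ix: "bij_betw ix UNIV {..<CARD('n)}" and s_pos: "\<And>j. s j > 0"
    and s_decr: "\<And>i j. ix i < ix j \<Longrightarrow> s j < s i" and w: "\<And>j. w j > 0"
    and w1: "(\<Sum>j\<in>UNIV. w j / s j) < 1"
  shows "\<exists>t. (\<forall>j. 0 < t j \<and> t j < s j) \<and> (\<forall>i j. ix j = Suc (ix i) \<longrightarrow> s j < t i) \<and>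
     (\<forall>m. (\<Sum>j\<in>UNIV. w j / (s j - t m)) = 1)"
proof -
  have ix_inj: "ix i = ix j \<longleftrightarrow> i = j" for i j using ix unfolding bij_betw_def inj_on_def by auto
  have s_inj: "s i \<noteq> s j" if "i \<noteq> j" for i j
    using s_decr[of i j] s_decr[of j i] that ix_inj[of i j] by (metis less_irrefl linorder_neqE_nat)
  define S where "S j = (\<Prod>k\<in>-{j}. [:s k, -1:])" for j
  define R where "R = (\<Prod>k\<in>UNIV. [:s k, -1:]) - (\<Sum>j\<in>UNIV. smult (w j) (S j))"
  have pS: "poly (S j) x = (\<Prod>k\<in>-{j}. s k - x)" for j x by (simp add: S_def poly_prod)
  have prod_split: "(\<Prod>k\<in>UNIV. s k - x) = (s j - x) * (\<Prod>k\<in>-{j}. s k - x)" for j x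
    by (subst prod.remove[of UNIV j]) (auto simp: Compl_eq_Diff_UNIV)
  have Rs: "poly R (s j) = - w j * (\<Prod>k\<in>-{j}. s k - s j)" for j
  proof -
    have z: "(\<Prod>k\<in>-{i}. s k - s j) = 0" if "i \<noteq> j" for i
      by (rule prod_zero) (use that in auto)
    have "poly R (s j) = - (\<Sum>i\<in>UNIV. w i * (\<Prod>k\<in>-{i}. s k - s j))"
      unfolding R_def by (simp add: poly_prod poly_sum pS prod_split[of _ j])
    also have "(\<Sum>i\<in>UNIV. w i * (\<Prod>k\<in>-{i}. s k - s j)) = w j * (\<Prod>k\<in>-{j}. s k - s j)"
      by (subst sum.mono_neutral_right[of UNIV "{j}"]) (auto simp: z)
    finally show ?thesis by simp
  qed
  have Rx: "poly R x = (\<Prod>k\<in>UNIV. s k - x) * (1 - (\<Sum>j\<in>UNIV. w j / (s j - x)))" if "\<And>j. s j \<noteq> x" for x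
  proof -
    have "w j * (\<Prod>k\<in>-{j}. s k - x) = (\<Prod>k\<in>UNIV. s k - x) * (w j / (s j - x))" for j
      using that[of j] by (simp add: prod_split[of x j])
    then show ?thesis
      unfolding R_def by (simp add: poly_prod poly_sum pS right_diff_distrib sum_distrib_left)
  qed
  have ex: "\<exists>t. 0 < t \<and> t < s m \<and> (\<forall>j. ix j = Suc (ix m) \<longrightarrow> s j < t) \<and> (\<Sum>j\<in>UNIV. w j / (s j - t)) = 1" for m
  proof -
    \<comment> \<open>\<open>lo\<close> is the lower end of the gap below s_m: the next smaller s,
      or 0 when s_m is the smallest.\<close>
    have fin: ?thesis if t: "lo < t" "t < s m" "poly R t = 0" and lo: "lo \<ge> 0" "\<And>j. ix j = Suc (ix m) \<Longrightarrow> s j \<le> lo"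
      and lo': "\<And>j. ix m < ix j \<Longrightarrow> s j \<le> lo" for t lo
    proof -
      have ne: "s j \<noteq> t" for j
      proof (cases "ix m < ix j")
        case True
        then show ?thesis using lo'[OF True] t by linarith
      next
        case False
        then have "s j \<ge> s m" using s_decr[of j m] ix_inj[of j m] by (metis less_imp_le linorder_neqE_nat order_refl)
        then show ?thesis using t by linarith
      qed
      have "(\<Prod>k\<in>UNIV. s k - t) \<noteq> 0" using ne by (subst prod_zero_iff) auto
      then have "(\<Sum>j\<in>UNIV. w j / (s j - t)) = 1" using Rx[OF ne] t(3) by simp
      then show ?thesis using t lo by (intro exI[of _ t]) (auto intro: le_less_trans)
    qed
    show ?thesis
    proof (cases "\<exists>i. ix i = Suc (ix m)")
      case True
      then obtain i where i: "ix i = Suc (ix m)" by blast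
      have im: "i \<noteq> m" using i by auto
      have si: "s i < s m" using s_decr[of m i] i by simp
      \<comment> \<open>No s_k lies between the neighbours s_i and s_m, so both differences have the
        same sign and the sign change of \<open>R\<close> comes from the mutual factors
        alone.\<close>
      have pos: "(s k - s i) * (s k - s m) > 0" if "k \<noteq> i" "k \<noteq> m" for k
      proof -
        have "ix k \<noteq> ix i" "ix k \<noteq> ix m" using that ix_inj by auto
        then have "ix k < ix m \<or> ix i < ix k" using i by linarith
        then show ?thesis
        proof
          assume "ix k < ix m"
          then have "s m < s k" "s i < s k" using s_decr i by auto
          then show ?thesis by (intro mult_pos_pos) auto
        next
          assume "ix i < ix k"
          then have "s k < s i" "s k < s m" using s_decr i by auto
          then show ?thesis by (intro mult_neg_neg) auto
        qed
      qed
      have "poly R (s i) * poly R (s m) = w i * w m * ((\<Prod>k\<in>-{i}. s k - s i) * (\<Prod>k\<in>-{m}. s k - s m))"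
        unfolding Rs by simp
      also have "(\<Prod>k\<in>-{i}. s k - s i) = (s m - s i) * (\<Prod>k\<in>-{i,m}. s k - s i)"
        using im by (subst prod.remove[of _ m]) (auto intro!: prod.cong arg_cong2[where f="(*)"])
      also have "(\<Prod>k\<in>-{m}. s k - s m) = (s i - s m) * (\<Prod>k\<in>-{i,m}. s k - s m)"
        using im by (subst prod.remove[of _ i]) (auto intro!: prod.cong arg_cong2[where f="(*)"])
      also have "w i * w m * ((s m - s i) * (\<Prod>k\<in>-{i,m}. s k - s i) * ((s i - s m) * (\<Prod>k\<in>-{i,m}. s k - s m))) =
         - (w i * w m * (s m - s i)\<^sup>2 * (\<Prod>k\<in>-{i,m}. (s k - s i) * (s k - s m)))"
        unfolding prod.distrib power2_eq_square by algebra
      also have "\<dots> < 0"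
      proof -
        have "0 < w i * w m * (s m - s i)\<^sup>2 * (\<Prod>k\<in>-{i,m}. (s k - s i) * (s k - s m))"
        proof (intro mult_pos_pos[where b="\<Prod>k\<in>_. _ k"] prod_pos)
          show "0 < w i * w m * (s m - s i)\<^sup>2" using w si by simp
          show "0 < (s k - s i) * (s k - s m)" if "k \<in> -{i, m}" for k using pos that by simp
        qed
        then show ?thesis by simp
      qed
      finally obtain t where "s i < t" "t < s m" "poly R t = 0" using poly_IVT[OF si] by blast
      moreover have "s j \<le> s i" if "ix m < ix j" for j
        using that i s_decr[of i j] ix_inj[of i j] by (metis Suc_leI le_neq_implies_less less_imp_le order_refl)
      ultimately show ?thesis using s_pos[of i] by (intro fin[of "s i" t]) auto
    next
      case False
      have last: "ix k < ix m" if "k \<noteq> m" for k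
      proof (rule ccontr)
        assume "\<not> ix k < ix m"
        then have "Suc (ix m) \<le> ix k" using that ix_inj[of k m] by linarith
        moreover have "ix k < CARD('n)" using ix unfolding bij_betw_def by auto
        ultimately have "Suc (ix m) \<in> ix ` UNIV" using ix unfolding bij_betw_def by auto
        then show False using False by (metis imageE)
      qed
      have "(\<Prod>k\<in>-{m}. s k - s m) > 0" using s_decr[OF last] by (intro prod_pos) auto
      then have 1: "poly R (s m) < 0" unfolding Rs using w[of m] by (simp add: mult_pos_pos)
      have "s j \<noteq> 0" for j using s_pos[of j] by simp
      from Rx[OF this] have 2: "poly R 0 > 0" using w1 s_pos by (simp add: mult_pos_pos prod_pos)
      have "poly R 0 * poly R (s m) < 0" using 1 2 by (rule mult_pos_neg[rotated])
      then obtain t where "0 < t" "t < s m" "poly R t = 0" using poly_IVT[OF s_pos] by blast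
      moreover have "s j \<le> 0" if "ix m < ix j" for j using last[of j] that by (cases "j = m") auto
      ultimately show ?thesis by (intro fin[of 0 t]) auto
    qed
  qed
  then obtain t where "\<And>m. 0 < t m \<and> t m < s m \<and> (\<forall>j. ix j = Suc (ix m) \<longrightarrow> s j < t m) \<and> (\<Sum>j\<in>UNIV. w j / (s j - t m)) = 1"
    by metis
  then show ?thesis by (intro exI[of _ t]) auto
qed

text \<open>The constant term of the matrix is the Cauchy matrix with rows scaled by
  \<open>al\<close>, which is injective; hence the system determines the coefficients one after the
  other.\<close>

lemma (in inv_spec) eta_unique:
  assumes F: "\<And>j. (\<Sum>m\<in>UNIV. fps_of_poly (P $ j $ m) * F m) = 1"
  shows "F = eta"
proof -
  define d where "d m = F m - eta m" for m
  have z: "(\<Sum>m\<in>UNIV. fps_of_poly (P $ j $ m) * d m) = 0" for j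
    using F[of j] eta_eq[of j] by (simp add: d_def right_diff_distrib sum_subtractf)
  have "\<forall>m. fps_nth (d m) n = 0" for n
  proof (induction n)
    case 0
    have "al j * (\<Sum>m\<in>UNIV. cc j m * fps_nth (d m) 0) = 0" for j
      using arg_cong[OF z[of j], of "\<lambda>F. fps_nth F 0"]
      by (simp add: fps_sum_nth pmat_def fps_linear_mult_nth sum_distrib_left mult.assoc del: fps_mult_nth_0)
    then show ?case using c_injective[of "\<lambda>m. fps_nth (d m) 0"] al_nz by simp
  next
    case (Suc n)
    have "al j * (\<Sum>m\<in>UNIV. cc j m * fps_nth (d m) (Suc n)) = 0" for j
      using arg_cong[OF z[of j], of "\<lambda>F. fps_nth F (Suc n)"] Suc
      by (simp add: fps_sum_nth pmat_def fps_linear_mult_nth sum_distrib_left mult.assoc)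
    then show ?case using c_injective[of "\<lambda>m. fps_nth (d m) (Suc n)"] al_nz by simp
  qed
  then have "d m = 0" for m by (intro fps_ext) simp
  then show ?thesis by (auto simp: d_def fun_eq_iff)
qed

context generic_symbol
begin

text \<open>H commutes with its square, whose eigenvalues are simple, so it preserves each
  eigenline. The component of u along an eigenvector is nonzero: otherwise the eigenvector would be
  orthogonal to 1 and, by self-adjointness, to all H^(2k) 1.\<close>

lemma eigenbasis:
  "\<exists>s w al et. (\<forall>j. s j > 0) \<and> (\<forall>i j. ix i < ix j \<longrightarrow> s j < s i) \<and> (\<forall>j. w j > 0) \<and>
    (\<forall>j. (cmod (al j))\<^sup>2 = s j) \<and> (\<forall>j. inW (et j)) \<and> (\<forall>j. H (et j) = fps_const (al j) * et j) \<and>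
    (\<forall>j. hip u (et j) = 1) \<and> (\<forall>j k. hip (et j) (et k) = (if j = k then complex_of_real (1 / w j) else 0)) \<and>
    (\<forall>F. inW F \<longrightarrow> (\<exists>y. F = lcomb et y))"
proof -
  obtain s :: "'n \<Rightarrow> real" and E :: "'n \<Rightarrow> complex fps"
    where s: "\<forall>j. s j > 0" "\<forall>i j. ix i < ix j \<longrightarrow> s j < s i" and E: "\<forall>j. inW (E j)" "\<forall>j. E j \<noteq> 0"
    "\<forall>j. H2 (E j) = fps_const (of_real (s j)) * E j"
    using spectrum by metis
  have s_inj: "s i \<noteq> s j" if "i \<noteq> j" for i j
    using s(2) that ix_inj[of i j] by (metis less_irrefl linorder_neqE_nat)
  have Eg: "fgeo (E j)" for j using E(1) inW_fgeo by blast
  have Eo: "hip (E i) (E j) = 0" if "i \<noteq> j" for i j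
  proof -
    have "of_real (s i) * hip (E i) (E j) = hip (H2 (E i)) (E j)"
      using E(3) by (simp add: hip_scale_left Eg)
    also have "\<dots> = hip (E i) (H2 (E j))" by (rule H2_adjoint[OF Eg Eg])
    also have "\<dots> = of_real (s j) * hip (E i) (E j)" using E(3) by (simp add: hip_scale_right Eg)
    finally show ?thesis using s_inj[OF that] by simp
  qed
  have En: "hip (E j) (E j) = complex_of_real (hsqnorm (fps_nth (E j)))" "hsqnorm (fps_nth (E j)) > 0" for j
    using hip_self[OF Eg[of j]] hip_self_eq_0[OF Eg[of j]] E(2) hsqnorm_nonneg[OF fgeo_l2p[OF Eg[of j]]]
    by (auto simp: less_le)
  have Ecoord: "hip (lcomb E y) (E k) = y k * hip (E k) (E k)" for y k
  proof -
    have "hip (lcomb E y) (E k) = (\<Sum>j\<in>UNIV. y j * hip (E j) (E k))"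
      unfolding lcomb_def by (subst hip_sum_left) (auto simp: hip_scale_left Eg fgeo_mult fgeo_const)
    also have "\<dots> = y k * hip (E k) (E k)"
      by (subst sum.mono_neutral_right[of UNIV "{k}"]) (auto simp: Eo)
    finally show ?thesis .
  qed
  have Einj: "y k = y' k" if "lcomb E y = lcomb E y'" for y y' k
  proof -
    have "y k * hip (E k) (E k) = y' k * hip (E k) (E k)" using that Ecoord by metis
    moreover have "hip (E k) (E k) \<noteq> 0" using En[of k] by simp
    ultimately show ?thesis by simp
  qed
  have span: "\<exists>y. F = lcomb E y" if "inW F" for F
  proof (rule inW_span[OF _ _ that])
    show "inW (E j)" for j using E(1) by blast
    show "y = (\<lambda>_. 0)" if "lcomb E y = 0" for y
      using Einj[of y "\<lambda>_. 0"] that by (auto simp: lcomb_0)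
  qed
  have "\<exists>g. H (E j) = fps_const g * E j" for j
  proof -
    obtain y where y: "H (E j) = lcomb E y" using span inW_H[OF Eg] by blast
    have "H2 (H (E j)) = fps_const (of_real (s j)) * H (E j)"
      using E(3) by (simp add: hop_scale fgeo_u Eg)
    moreover have "H2 (lcomb E y) = lcomb E (\<lambda>k. of_real (s k) * y k)"
    proof -
      have "H2 (lcomb E y) = lcomb (\<lambda>j. H2 (E j)) y" by (rule H2_lcomb[OF Eg])
      then show ?thesis using E(3) by (simp add: lcomb_def mult_ac flip: fps_const_mult)
    qed
    moreover have "fps_const (of_real (s j)) * lcomb E y = lcomb E (\<lambda>k. of_real (s j) * y k)"
      by (simp add: lcomb_def sum_distrib_left mult.assoc flip: fps_const_mult)
    ultimately have "of_real (s k) * y k = of_real (s j) * y k" for k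
      using Einj[of "\<lambda>k. of_real (s k) * y k" "\<lambda>k. of_real (s j) * y k" k] y by simp
    then have "y k = 0" if "k \<noteq> j" for k using s_inj[OF that] by (metis mult_cancel_right of_real_eq_iff)
    then have "lcomb E y = fps_const (y j) * E j"
      unfolding lcomb_def by (subst sum.mono_neutral_right[of UNIV "{j}"]) auto
    then show ?thesis using y by auto
  qed
  then obtain g where g: "\<And>j. H (E j) = fps_const (g j) * E j" by metis
  have gg: "cnj (g j) * g j = of_real (s j)" for j
  proof -
    have "H2 (E j) = fps_const (cnj (g j) * g j) * E j"
      unfolding g by (simp add: hop_scale fgeo_u Eg g mult.assoc flip: fps_const_mult)
    from trans[OF sym[OF this] E(3)[rule_format]]
    have "fps_const (cnj (g j) * g j) * E j = fps_const (of_real (s j)) * E j" .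
    then have "fps_const (cnj (g j) * g j) = fps_const (complex_of_real (s j))"
      using E(2) mult_right_cancel by blast
    from arg_cong[OF this, of "\<lambda>F. fps_nth F 0"] show ?thesis by simp
  qed
  then have gn: "(cmod (g j))\<^sup>2 = s j" for j
    by (metis complex_norm_square mult.commute of_real_eq_iff)
  have E1: "hip 1 (E j) \<noteq> 0" for j
  proof
    assume z: "hip 1 (E j) = 0"
    have "hip (V k) (E j) = 0" for k
    proof (induction k)
      case 0
      then show ?case using z by (simp only: V.simps)
    next
      case (Suc k)
      have "hip (V (Suc k)) (E j) = hip (V k) (H2 (E j))" using H2_adjoint[OF fgeo_V Eg] by simp
      then show ?case using Suc E(3) by (simp add: hip_scale_right Eg fgeo_V)
    qed
    then show False using ortho_W[of "E j"] E(1,2) by blast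
  qed
  define r where "r j = hip u (E j)" for j
  have rnz: "r j \<noteq> 0" for j
  proof -
    have "r j = hip (H 1) (E j)" by (simp add: r_def hop_1)
    also have "\<dots> = hip (H (E j)) 1" by (rule hop_symmetric[OF fgeo_u fgeo_1 Eg])
    also have "\<dots> = g j * cnj (hip 1 (E j))"
      using hip_cnj[OF Eg[of j] fgeo_1] by (simp add: g hip_scale_left Eg fgeo_1)
    finally have "r j = g j * cnj (hip 1 (E j))" .
    moreover have "g j \<noteq> 0" using gn[of j] s(1) by (metis less_irrefl norm_zero power_zero_numeral)
    ultimately show ?thesis using E1 by simp
  qed
  \<comment> \<open>The normalisation is (u|et) = 1 rather than unit length, so that no square root
    or sign has to be chosen.\<close>
  define et where "et j = fps_const (1 / cnj (r j)) * E j" for j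
  define al where "al j = cnj (1 / cnj (r j)) * g j * cnj (r j)" for j
  define w where "w j = (cmod (r j))\<^sup>2 / hsqnorm (fps_nth (E j))" for j
  have "H (et j) = fps_const (al j) * et j" for j
  proof -
    have "H (et j) = fps_const (cnj (1 / cnj (r j)) * g j) * E j"
      unfolding et_def by (simp add: hop_scale fgeo_u Eg g mult.assoc flip: fps_const_mult)
    also have "cnj (1 / cnj (r j)) * g j = al j * (1 / cnj (r j))" using rnz[of j] by (simp add: al_def)
    finally show ?thesis by (simp add: et_def mult.assoc flip: fps_const_mult)
  qed
  moreover have "(cmod (al j))\<^sup>2 = s j" for j
    using rnz[of j] by (simp add: al_def norm_mult norm_divide gn)
  moreover have "hip u (et j) = 1" for j
    using rnz[of j] unfolding et_def by (simp add: hip_scale_right fgeo_u Eg flip: r_def)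
  moreover have "hip (et j) (et k) = (if j = k then complex_of_real (1 / w j) else 0)" for j k
  proof -
    have "hip (et j) (et k) = 1 / cnj (r j) * (1 / r k) * hip (E j) (E k)"
      unfolding et_def by (simp add: hip_scale_left hip_scale_right Eg fgeo_mult fgeo_const)
    moreover have "1 / cnj (r j) * (1 / r j) * hip (E j) (E j) = complex_of_real (1 / w j)"
    proof -
      have "complex_of_real ((cmod (r j))\<^sup>2) = cnj (r j) * r j"
        by (simp only: complex_norm_square mult.commute)
      then show ?thesis unfolding w_def En(1) by (simp add: mult_ac)
    qed
    ultimately show ?thesis using Eo by (cases "j = k") auto
  qed
  moreover have "\<exists>y. F = lcomb et y" if "inW F" for F
  proof -
    obtain y where y: "F = lcomb E y" using span[OF \<open>inW F\<close>] by blast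
    have "F = lcomb et (\<lambda>j. y j * cnj (r j))"
      unfolding y lcomb_def et_def by (intro sum.cong refl) (simp add: mult.assoc[symmetric] rnz)
    then show ?thesis by blast
  qed
  moreover have "w j > 0" for j using rnz[of j] En(2)[of j] by (simp add: w_def)
  moreover have "inW (et j)" for j unfolding et_def using E(1) by (intro inW_scale) simp
  ultimately show ?thesis using s
    by - (rule exI[of _ s], rule exI[of _ w], rule exI[of _ al], rule exI[of _ et], intro conjI allI impI; blast)
qed

text \<open>The weights and the \<lambda>^2 determine the \<mu>^2 as roots of the secular equation,
  and \<open>eta\<close> is obtained from \<open>et\<close> by the inverse Cauchy matrix. The rank
  one formula for K^2 makes \<open>eta m\<close> an eigenvector of K^2, and simplicity of the
  eigenvalue makes K preserve its line. Splitting H (et j) into its constant term and the remainder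
  z K (et j) is then the linear system.\<close>

lemma normal_form:
  "\<exists>s t al be. inv_spec ix s t al be \<and> u = inv_spec.u s t al be"
proof -
  from eigenbasis obtain s w :: "'n \<Rightarrow> real" and al et where
    s: "\<forall>j. s j > 0" "\<forall>i j. ix i < ix j \<longrightarrow> s j < s i" and w: "\<forall>j. w j > 0"
    and al: "\<forall>j. (cmod (al j))\<^sup>2 = s j" and etW: "\<forall>j. inW (et j)"
    and He: "\<forall>j. H (et j) = fps_const (al j) * et j" and ue: "\<forall>j. hip u (et j) = 1"
    and gram: "\<forall>j k. hip (et j) (et k) = (if j = k then complex_of_real (1 / w j) else 0)"
    and span: "\<forall>F. inW F \<longrightarrow> (\<exists>y. F = lcomb et y)" by metis
  have eg: "fgeo (et j)" for j using etW inW_fgeo by blast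
  have alnz: "al j \<noteq> 0" for j using al s by (metis less_irrefl norm_zero power_zero_numeral)
  have alc: "al j * cnj (al j) = of_real (s j)" for j using al by (metis complex_norm_square)
  have coord: "hip (lcomb et y) (et k) = y k / of_real (w k)" for y k
  proof -
    have "hip (lcomb et y) (et k) = (\<Sum>j\<in>UNIV. y j * hip (et j) (et k))"
      unfolding lcomb_def by (subst hip_sum_left) (auto simp: hip_scale_left eg fgeo_mult fgeo_const)
    also have "\<dots> = y k * hip (et k) (et k)"
      by (subst sum.mono_neutral_right[of UNIV "{k}"]) (auto simp: gram)
    finally show ?thesis by (simp add: gram)
  qed
  have inj: "y k = y' k" if "lcomb et y = lcomb et y'" for y y' k
    using coord[of y k] coord[of y' k] that w by (metis divide_cancel_right less_irrefl of_real_eq_0_iff)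
  have u_et: "u = lcomb et (\<lambda>j. of_real (w j))"
  proof -
    obtain y where y: "u = lcomb et y" using span inW_u by blast
    have "y j = of_real (w j)" for j
      using coord[of y j] ue w y by (metis divide_eq_1_iff zero_neq_one)
    then show ?thesis using y by presburger
  qed
  have et0: "al j * fps_nth (et j) 0 = 1" for j
    using hop_0[of u "et j"] He ue by simp
  have H_et: "H (lcomb et y) = lcomb et (\<lambda>j. al j * cnj (y j))" for y
    using hop_lcomb[where v=et, OF fgeo_u eg, of y] He by (simp add: lcomb_def mult_ac flip: fps_const_mult)
  have w1: "(\<Sum>j\<in>UNIV. w j / s j) < 1"
  proof -
    define y where "y j = of_real (w j) * cnj (1 / al j)" for j
    \<comment> \<open>The component of 1 orthogonal to the range of H. Its squared norm is 1 -
      \<Sum> w_j / s_j, and it is nonzero because 1 is not in the range.\<close>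
    define D where "D = 1 - lcomb et y"
    have lg: "fgeo (lcomb et y)" by (rule fgeo_lcomb[OF eg])
    have Deq: "D = 1 + fps_const (-1) * lcomb et y" by (simp add: D_def flip: fps_const_neg)
    have Dg: "fgeo D" unfolding Deq by (intro fgeo_add fgeo_mult fgeo_const fgeo_1 lg)
    have one: "hip 1 F = cnj (fps_nth F 0)" for F
    proof -
      have "fps_nth 1 = one_l2" by (auto simp: one_l2_def fun_eq_iff)
      then show ?thesis using hinner_one[of "fps_nth F"] by simp
    qed
    have De: "hip D (et j) = 0" for j
    proof -
      have "fps_nth (et j) 0 = 1 / al j" using et0[of j] alnz[of j] by (simp add: field_simps)
      moreover have "w j \<noteq> 0" using w by (metis less_irrefl)
      ultimately show ?thesis unfolding Deq
        by (simp only: hip_add_left hip_scale_left fgeo_1 lg eg fgeo_mult fgeo_const coord one y_def) simp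
    qed
    have "hip D (lcomb et y) = 0"
      unfolding lcomb_def by (subst hip_sum_right) (auto simp: hip_scale_right eg fgeo_mult fgeo_const De Dg)
    then have "hip D D = hip D 1"
      by (subst (2) Deq) (simp add: hip_add_right hip_scale_right Dg fgeo_1 lg fgeo_mult fgeo_const)
    also have "\<dots> = fps_nth D 0" using one[of D] hip_cnj[OF Dg fgeo_1] by simp
    also have "\<dots> = 1 - (\<Sum>j\<in>UNIV. complex_of_real (w j / s j))"
    proof -
      have "y j * fps_nth (et j) 0 = complex_of_real (w j / s j)" for j
      proof -
        have "fps_nth (et j) 0 = 1 / al j" using et0[of j] alnz[of j] by (simp add: field_simps)
        then show ?thesis using alc[of j] by (simp add: y_def mult.commute)
      qed
      then show ?thesis unfolding D_def by (simp add: lcomb_nth)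
    qed
    finally have "complex_of_real (hsqnorm (fps_nth D)) = complex_of_real (1 - (\<Sum>j\<in>UNIV. w j / s j))"
      unfolding hip_self[OF Dg] by simp
    then have hs: "hsqnorm (fps_nth D) = 1 - (\<Sum>j\<in>UNIV. w j / s j)" by (simp only: of_real_eq_iff)
    have "D \<noteq> 0"
    proof
      assume "D = 0"
      then have "1 = lcomb et y" by (simp add: D_def)
      also have "\<dots> = H (lcomb et (\<lambda>j. cnj (y j / al j)))" unfolding H_et using alnz by simp
      finally have "fps_nth 1 = hankel (fps_nth u) (fps_nth (lcomb et (\<lambda>j. cnj (y j / al j))))"
        by (metis hop_nth)
      moreover have "fps_nth 1 = one_l2" by (auto simp: one_l2_def fun_eq_iff)
      ultimately have "one_l2 \<in> hankel (fps_nth u) ` l2p"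
        using fgeo_l2p[OF fgeo_lcomb[where v=et, OF eg]] by (metis imageI)
      then show False using gen unfolding generic_def by blast
    qed
    then have "hsqnorm (fps_nth D) \<noteq> 0" using hip_self_eq_0[OF Dg] hip_self[OF Dg] by auto
    then show ?thesis using hs hsqnorm_nonneg[OF fgeo_l2p[OF Dg]] by linarith
  qed
  obtain t where t: "\<forall>j. 0 < t j \<and> t j < s j" "\<forall>i j. ix j = Suc (ix i) \<longrightarrow> s j < t i"
    "\<forall>m. (\<Sum>j\<in>UNIV. w j / (s j - t m)) = 1"
    using interlacing_roots[OF ix, of s w] s w w1 by blast
  interpret I: interlacing ix s t by unfold_locales (use ix t in auto)
  define c where "c = cmat s t"
  define q where "q m = 1 / (\<Sum>j\<in>UNIV. w j * (c j m)\<^sup>2)" for m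
  have c_eq: "c j m = 1 / (s j - t m)" for j m by (simp add: c_def cmat_def)
  have wc: "(\<Sum>j\<in>UNIV. w j * c j m) = 1" for m using t(3) by (simp add: c_eq)
  note orth = cauchy_orthogonality[of c s t w q, OF c_eq I.s_neq_t I.inj_t spec[OF w] wc q_def]
  define eta where "eta m = lcomb et (\<lambda>j. of_real (q m * w j * c j m))" for m
  have etaW: "inW (eta m)" for m unfolding eta_def using etW by (intro inW_lcomb) blast
  have etag: "fgeo (eta m)" for m using etaW inW_fgeo by blast
  have u_eta: "u = (\<Sum>m\<in>UNIV. eta m)"
  proof (rule fps_ext)
    fix n
    have "fps_nth (\<Sum>m\<in>UNIV. eta m) n = (\<Sum>m\<in>UNIV. \<Sum>j\<in>UNIV. of_real (w j * (q m * c j m)) * fps_nth (et j) n)"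
      by (simp add: fps_sum_nth eta_def lcomb_nth mult_ac)
    also have "\<dots> = (\<Sum>j\<in>UNIV. \<Sum>m\<in>UNIV. of_real (w j * (q m * c j m)) * fps_nth (et j) n)" by (rule sum.swap)
    also have "\<dots> = (\<Sum>j\<in>UNIV. of_real (w j * (\<Sum>m\<in>UNIV. q m * c j m)) * fps_nth (et j) n)"
      by (simp add: sum_distrib_left sum_distrib_right)
    finally show "fps_nth u n = fps_nth (\<Sum>m\<in>UNIV. eta m) n"
      unfolding orth(4) by (simp add: u_et lcomb_nth)
  qed
  have et_eta: "et j = lcomb eta (\<lambda>m. of_real (c j m))" for j
  proof (rule fps_ext)
    fix n
    have "fps_nth (lcomb eta (\<lambda>m. of_real (c j m))) n =
        (\<Sum>m\<in>UNIV. \<Sum>k\<in>UNIV. of_real (w k * (q m * c j m * c k m)) * fps_nth (et k) n)"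
      by (simp add: lcomb_nth eta_def sum_distrib_left mult_ac)
    also have "\<dots> = (\<Sum>k\<in>UNIV. \<Sum>m\<in>UNIV. of_real (w k * (q m * c j m * c k m)) * fps_nth (et k) n)" by (rule sum.swap)
    also have "\<dots> = (\<Sum>k\<in>UNIV. of_real (w k * (\<Sum>m\<in>UNIV. q m * c j m * c k m)) * fps_nth (et k) n)"
      by (simp add: sum_distrib_left sum_distrib_right)
    also have "\<dots> = (\<Sum>k\<in>UNIV. if j = k then fps_nth (et j) n else 0)"
      unfolding orth(3) by (intro sum.cong refl) (use w in \<open>auto simp: less_imp_neq[symmetric]\<close>)
    finally show "fps_nth (et j) n = fps_nth (lcomb eta (\<lambda>m. of_real (c j m))) n" by simp
  qed
  define K where "K F = bshift (H F)" for F
  \<comment> \<open>Applying H to H F = (u|F) + z K F and using H (z G) = K G gives K^2 = H^2 -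
    (.|u) u.\<close>
  have K2: "K (K F) = H2 F - fps_const (cnj (hip u F)) * u" if F: "fgeo F" for F
  proof -
    have HF: "H F = fps_const (hip u F) * 1 + fps_X * K F" unfolding K_def using bshift_eq[of "H F"] by (simp add: hop_0)
    have KFg: "fgeo (K F)"
    proof -
      from fgeo_H[OF F] obtain r C where r: "r > 1" "\<And>n. wnorm r n (H F) \<le> C" unfolding fgeo_def by blast
      have "wnorm r n (K F) \<le> C" for n
      proof -
        have "wnorm r n (K F) \<le> (\<Sum>k\<le>n. cmod (fps_nth (H F) (Suc k)) * r ^ Suc k)"
          unfolding wnorm_def K_def bshift_nth using r(1) by (intro sum_mono mult_left_mono power_increasing) auto
        also have "\<dots> \<le> wnorm r (Suc n) (H F)"
          unfolding wnorm_def using r(1) by (simp add: sum.atMost_Suc_shift del: sum.atMost_Suc)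
        finally show ?thesis using r(2)[of "Suc n"] by linarith
      qed
      then show ?thesis unfolding fgeo_def using r(1) by blast
    qed
    have "H2 F = H (fps_const (hip u F) * 1 + fps_X * K F)" using HF by simp
    also have "\<dots> = fps_const (cnj (hip u F)) * u + H (fps_X * K F)"
      by (subst hop_add) (auto simp: fgeo_u fgeo_mult fgeo_const fgeo_1 fgeo_X KFg hop_scale hop_1 simp del: mult_1_right)
    also have "H (fps_X * K F) = K (K F)" unfolding K_def[of "K F"] by (rule hop_X[OF fgeo_u KFg])
    finally show ?thesis by simp
  qed
  have K_scale: "K (fps_const a * F) = fps_const (cnj a) * K F" if "fgeo F" for a F
    unfolding K_def by (simp add: hop_scale fgeo_u that bshift_scale)
  have uip: "hip u (lcomb et y) = (\<Sum>j\<in>UNIV. cnj (y j))" for y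
    unfolding lcomb_def by (subst hip_sum_right) (auto simp: hip_scale_right fgeo_u eg fgeo_mult fgeo_const ue)
  have K2_et: "K (K (lcomb et y)) = lcomb et (\<lambda>j. of_real (s j) * y j - (\<Sum>k\<in>UNIV. y k) * of_real (w j))" for y
  proof -
    have "H2 (lcomb et y) = lcomb et (\<lambda>j. of_real (s j) * y j)"
      by (simp add: H_et mult.assoc flip: alc)
    then have "K (K (lcomb et y)) = lcomb et (\<lambda>j. of_real (s j) * y j) - fps_const (\<Sum>k\<in>UNIV. y k) * lcomb et (\<lambda>j. of_real (w j))"
      using K2[OF fgeo_lcomb[where v=et, OF eg], of y] uip[of y] u_et by simp
    then show ?thesis
      by (simp add: lcomb_def sum_distrib_left mult.assoc left_diff_distrib sum_subtractf flip: fps_const_mult fps_const_sub)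
  qed
  have K2_eta: "K (K (eta m)) = fps_const (of_real (t m)) * eta m" for m
  proof -
    have "of_real (s j) * of_real (q m * w j * c j m) - (\<Sum>k\<in>UNIV. of_real (q m * w k * c k m)) * of_real (w j) =
        of_real (t m) * complex_of_real (q m * w j * c j m)" for j
    proof -
      have "(\<Sum>k\<in>UNIV. q m * w k * c k m) = q m * (\<Sum>k\<in>UNIV. w k * c k m)" by (simp add: sum_distrib_left mult.assoc)
      then have sm: "(\<Sum>k\<in>UNIV. complex_of_real (q m * w k * c k m)) = of_real (q m)"
        unfolding of_real_sum[symmetric] using wc[of m] by simp
      have "s j * (q m * w j * c j m) = q m * w j * (s j * c j m)" by (simp add: mult_ac)
      also have "\<dots> = t m * (q m * w j * c j m) + q m * w j"
        using I.s_c[of j m] unfolding c_def by (simp add: algebra_simps)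
      finally have "complex_of_real (s j * (q m * w j * c j m) - q m * w j) = of_real (t m * (q m * w j * c j m))"
        by simp
      then show ?thesis unfolding sm by (simp only: of_real_mult of_real_diff)
    qed
    then show ?thesis unfolding eta_def K2_et
      by (simp add: lcomb_def sum_distrib_left mult.assoc flip: fps_const_mult)
  qed
  have "\<exists>b. K (eta m) = fps_const b * eta m" for m
  proof -
    have KW: "inW (K (eta m))"
      unfolding K_def hop_X[OF fgeo_u etag, symmetric] by (intro inW_H fgeo_mult fgeo_X etag)
    then obtain y where y: "K (eta m) = lcomb et y" using span by blast
    have "K (K (K (eta m))) = fps_const (of_real (t m)) * K (eta m)" unfolding K2_eta by (simp add: K_scale etag)
    then have "lcomb et (\<lambda>j. of_real (s j) * y j - (\<Sum>k\<in>UNIV. y k) * of_real (w j)) = lcomb et (\<lambda>j. of_real (t m) * y j)"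
      unfolding y K2_et by (simp add: lcomb_def sum_distrib_left mult.assoc flip: fps_const_mult)
    from inj[OF this] have "(of_real (s j) - of_real (t m)) * y j = (\<Sum>k\<in>UNIV. y k) * of_real (w j)" for j
      by (simp add: algebra_simps)
    moreover have "complex_of_real (s j) - of_real (t m) \<noteq> 0" for j using I.s_neq_t[of j m] by simp
    \<comment> \<open>This is the simplicity of the eigenvalue t_m of K^2: up to the scalar \<Sum> y
      the coordinates are those of \<open>eta m\<close>.\<close>
    ultimately have yj: "y j = (\<Sum>k\<in>UNIV. y k) * of_real (w j) * of_real (c j m)" for j
      by (simp add: c_eq field_simps)
    have qnz: "q m \<noteq> 0" using orth(1)[of m] by simp
    have "y j = (\<Sum>k\<in>UNIV. y k) / of_real (q m) * of_real (q m * w j * c j m)" for j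
      using yj[of j] qnz by simp
    then have "lcomb et y = fps_const ((\<Sum>k\<in>UNIV. y k) / of_real (q m)) * eta m"
      unfolding eta_def lcomb_def sum_distrib_left
      by (intro sum.cong refl) (metis fps_const_mult mult.assoc)
    then show ?thesis using y by metis
  qed
  then obtain be where be: "\<And>m. K (eta m) = fps_const (be m) * eta m" by metis
  have etanz: "eta m \<noteq> 0" for m
  proof
    assume "eta m = 0"
    then have "lcomb et (\<lambda>j. of_real (q m * w j * c j m)) = lcomb et (\<lambda>_. 0)" by (simp add: eta_def lcomb_0)
    from inj[OF this] have "q m * w j * c j m = 0" for j by simp
    then show False using orth(1)[of m] w I.s_neq_t[of m m] by (auto simp: c_eq less_imp_neq[symmetric])
  qed
  have "(cmod (be m))\<^sup>2 = t m" for m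
  proof -
    have "fps_const (cnj (be m) * be m) * eta m = fps_const (of_real (t m)) * eta m"
      using K2_eta[of m] unfolding be K_scale[OF etag] by (simp add: mult.assoc flip: fps_const_mult)
    then have "fps_const (cnj (be m) * be m) = fps_const (complex_of_real (t m))" using etanz[of m] by simp
    from arg_cong[OF this, of "\<lambda>F. fps_nth F 0"] have "cnj (be m) * be m = complex_of_real (t m)" by simp
    then show ?thesis by (metis complex_norm_square mult.commute of_real_eq_iff)
  qed
  then interpret J: inv_spec ix s t al be by unfold_locales (use al in auto)
  have "(\<Sum>m\<in>UNIV. fps_of_poly (pmat s t al be $ j $ m) * eta m) = 1" for j
  proof -
    have K_et: "K (et j) = lcomb eta (\<lambda>m. of_real (c j m) * be m)"
    proof -
      have "K (et j) = bshift (lcomb (\<lambda>m. H (eta m)) (\<lambda>m. cnj (of_real (c j m))))"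
        unfolding K_def by (subst et_eta) (simp add: hop_lcomb fgeo_u etag)
      also have "\<dots> = lcomb (\<lambda>m. fps_const (be m) * eta m) (\<lambda>m. cnj (of_real (c j m)))"
        unfolding bshift_lcomb using be unfolding K_def by simp
      finally show ?thesis by (simp add: lcomb_def mult.assoc flip: fps_const_mult)
    qed
    have pm: "fps_of_poly (pmat s t al be $ j $ m) = fps_const (al j) * fps_const (of_real (c j m)) - fps_X * (fps_const (of_real (c j m) * be m))" for m
      by (simp add: pmat_def c_def fps_of_poly_pCons fps_of_poly_const mult.commute flip: fps_const_neg)
    have "(\<Sum>m\<in>UNIV. fps_of_poly (pmat s t al be $ j $ m) * eta m) =
       fps_const (al j) * lcomb eta (\<lambda>m. of_real (c j m)) - fps_X * lcomb eta (\<lambda>m. of_real (c j m) * be m)"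
      unfolding pm lcomb_def left_diff_distrib sum_subtractf sum_distrib_left mult.assoc ..
    also have "\<dots> = H (et j) - fps_X * K (et j)"
      by (simp only: et_eta[of j, symmetric] K_et He[rule_format])
    also have "\<dots> = fps_const (hip u (et j))" unfolding K_def using bshift_eq[of "H (et j)"] by (simp only: hop_0 diff_eq_eq)
    finally show ?thesis using ue by simp
  qed
  then have "eta = J.eta" by (rule J.eta_unique)
  then have "u = J.u" using u_eta by (simp add: J.u_def)
  then show ?thesis using J.inv_spec_axioms by blast
qed

end

text \<open>Arguments of the diagonal entries of the normal form supply the angles. The parameters
  then coincide because parameters in \<open>paramsM\<close> are determined by their symbol.\<close>

lemma gmap_surj:
  fixes ix :: "'n::finite \<Rightarrow> nat"
  assumes ix: "bij_betw ix UNIV {..<CARD('n)}" and p: "p \<in> gen_params ix"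
  shows "\<exists>x\<in>OmegaN ix \<times> UNIV. p = gmap ix x"
proof -
  define A B where "A = polyA ix (fst p)" and "B = polyB ix (snd p)"
  define v where "v = fps_of_poly A * inverse (fps_of_poly B)"
  have pM: "p \<in> paramsM ix" and gen: "generic CARD('n) (ratfun ix p)" using p by (auto simp: gen_params_def)
  have rv: "ratfun ix p = fps_nth v" unfolding v_def A_def B_def by (rule ratfun_fps[OF ix])
  have inv: "fps_of_poly B * inverse (fps_of_poly B) = 1"
    by (rule inverse_mult_eq_1') (simp add: B_def coeff_polyB[OF ix])
  interpret generic_symbol ix A B v
  proof unfold_locales
    show "fps_of_poly B * v = fps_of_poly A" unfolding v_def using inv by (metis mult.left_commute mult.right_neutral)
    show "coeff A n = 0" if "n \<ge> CARD('n)" for n unfolding A_def using coeff_polyA(2)[OF ix that] .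
    show "degree B \<le> CARD('n)" unfolding B_def by (rule coeff_polyB(3)[OF ix])
    show "poly B z \<noteq> 0" if "cmod z \<le> 1" for z
      using pM that unfolding B_def paramsM_def by (cases p) auto
    show "generic CARD('n) (fps_nth v)" using gen rv by simp
  qed (rule ix)
  obtain s t al be where J: "inv_spec ix s t al be" and vu: "v = inv_spec.u s t al be" using normal_form by blast
  interpret J: inv_spec ix s t al be by (rule J)
  define x :: "'n angles" where
    "x = ((\<chi> i. 2 * s i, \<chi> i. 2 * t i), (\<chi> i. Arg (al i), \<chi> i. - Arg (be i)))"
  have st: "sx x = s" "tx x = t" by (auto simp: sx_def tx_def x_def fun_eq_iff)
  have "cmod (al i) = sqrt (s i)" "cmod (be i) = sqrt (t i)" for i
    using J.al[of i] J.be[of i] by (metis norm_ge_zero real_sqrt_unique)+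
  then have "alx x = al" "bex x = be"
    using rcis_cmod_Arg[of "al _"] rcis_cmod_Arg[of "be _"]
    by (auto simp: alx_def bex_def st fun_eq_iff rcis_def) (auto simp: x_def)
  then have px: "px x = pmat s t al be" by (simp add: px_def st)
  have "gmap ix x = params_of ix (pmat s t al be)" by (simp add: gmap_def px)
  moreover have "ratfun ix p = ratfun ix (params_of ix (pmat s t al be))"
    unfolding rv vu J.ratfun_params ..
  then have "p = params_of ix (pmat s t al be)"
    by (rule ratfun_inject[OF ix pM J.params_in_paramsM])
  moreover have "x \<in> OmegaN ix \<times> UNIV"
    using J.t_less_s J.t_pos J.s_less_t_Suc by (auto simp: x_def OmegaN_def)
  ultimately show ?thesis by metis
qed

section \<open>Symmetry of second derivatives\<close>

lemma has_vector_derivative_along_line: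
  assumes "(f has_derivative D) (at (c + s *\<^sub>R a))"
  shows "((\<lambda>s. f (c + s *\<^sub>R a)) has_vector_derivative D a) (at s)"
proof -
  have "((\<lambda>s. c + s *\<^sub>R a) has_derivative (\<lambda>h. h *\<^sub>R a)) (at s)"
    by (auto intro!: derivative_eq_intros)
  from has_derivative_compose[OF this assms]
  have "((\<lambda>s. f (c + s *\<^sub>R a)) has_derivative (\<lambda>h. D (h *\<^sub>R a))) (at s)" .
  moreover have "(\<lambda>h. D (h *\<^sub>R a)) = (\<lambda>h. h *\<^sub>R D a)"
    using has_derivative_linear[OF assms] by (simp add: linear_scale)
  ultimately show ?thesis by (simp add: has_vector_derivative_def)
qed

text \<open>The mean value theorem is applied twice: in direction \<open>a\<close> to the difference
  of \<open>f\<close> in direction \<open>b\<close>, then in direction \<open>b\<close> to the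
  derivative obtained.\<close>

lemma second_difference:
  fixes f :: "'a::real_normed_vector \<Rightarrow> real"
  assumes sm: "smooth_on S f" and h: "h > 0"
    and S: "\<And>s t. 0 \<le> s \<Longrightarrow> s \<le> h \<Longrightarrow> 0 \<le> t \<Longrightarrow> t \<le> h \<Longrightarrow> x + s *\<^sub>R a + t *\<^sub>R b \<in> S"
  shows "\<exists>s t. 0 < s \<and> s < h \<and> 0 < t \<and> t < h \<and>
     f (x + h *\<^sub>R a + h *\<^sub>R b) - f (x + h *\<^sub>R a) - f (x + h *\<^sub>R b) + f x =
     h * (h * frechet_derivative (\<lambda>y. frechet_derivative f (at y) a) (at (x + s *\<^sub>R a + t *\<^sub>R b)) b)"
proof -
  define Da where "Da y = frechet_derivative f (at y) a" for y
  define p where "p s = f (x + s *\<^sub>R a + h *\<^sub>R b) - f (x + s *\<^sub>R a)" for s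
  have p': "(p has_real_derivative Da (x + s *\<^sub>R a + h *\<^sub>R b) - Da (x + s *\<^sub>R a)) (at s)"
    if s: "0 \<le> s" "s \<le> h" for s
  proof -
    have 1: "x + s *\<^sub>R a + h *\<^sub>R b \<in> S" "x + s *\<^sub>R a \<in> S" using S[of s h] S[of s 0] s h by auto
    have 2: "((\<lambda>s. f (x + s *\<^sub>R a)) has_vector_derivative Da (x + s *\<^sub>R a)) (at s)"
      unfolding Da_def by (rule has_vector_derivative_along_line[OF smooth_on_imp_has_derivative[OF sm 1(2)]])
    have "x + h *\<^sub>R b + s *\<^sub>R a \<in> S" using 1(1) by (simp add: algebra_simps)
    from has_vector_derivative_along_line[OF smooth_on_imp_has_derivative[OF sm this]]
    have "((\<lambda>s. f (x + s *\<^sub>R a + h *\<^sub>R b)) has_vector_derivative Da (x + s *\<^sub>R a + h *\<^sub>R b)) (at s)"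
      unfolding Da_def by (simp add: algebra_simps)
    from has_vector_derivative_diff[OF this 2] show ?thesis
      unfolding p_def has_real_derivative_iff_has_vector_derivative .
  qed
  obtain s where s: "0 < s" "s < h" "p h - p 0 = (h - 0) * (Da (x + s *\<^sub>R a + h *\<^sub>R b) - Da (x + s *\<^sub>R a))"
    using MVT2[OF h, of p "\<lambda>s. Da (x + s *\<^sub>R a + h *\<^sub>R b) - Da (x + s *\<^sub>R a)"] p' by blast
  have smD: "smooth_on S Da" unfolding Da_def by (rule smooth_on_frechet_derivative[OF sm])
  have q': "((\<lambda>t. Da (x + s *\<^sub>R a + t *\<^sub>R b)) has_real_derivative
      frechet_derivative Da (at (x + s *\<^sub>R a + t *\<^sub>R b)) b) (at t)" if t: "0 \<le> t" "t \<le> h" for t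
    unfolding has_real_derivative_iff_has_vector_derivative
    using S[of s t] s t by (intro has_vector_derivative_along_line smooth_on_imp_has_derivative[OF smD]) auto
  obtain t where t: "0 < t" "t < h" "Da (x + s *\<^sub>R a + h *\<^sub>R b) - Da (x + s *\<^sub>R a + 0 *\<^sub>R b) =
      (h - 0) * frechet_derivative Da (at (x + s *\<^sub>R a + t *\<^sub>R b)) b"
    using MVT2[OF h, of "\<lambda>t. Da (x + s *\<^sub>R a + t *\<^sub>R b)" "\<lambda>t. frechet_derivative Da (at (x + s *\<^sub>R a + t *\<^sub>R b)) b"] q' by blast
  have "f (x + h *\<^sub>R a + h *\<^sub>R b) - f (x + h *\<^sub>R a) - f (x + h *\<^sub>R b) + f x = p h - p 0"
    by (simp add: p_def)
  also have "\<dots> = h * (h * frechet_derivative Da (at (x + s *\<^sub>R a + t *\<^sub>R b)) b)" using s t by simp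
  finally show ?thesis using s t unfolding Da_def by blast
qed

text \<open>The second difference is symmetric in \<open>a\<close> and \<open>b\<close>, so it is
  h^2 times either mixed derivative at points near \<open>x\<close>, and both mixed derivatives are
  continuous.\<close>

lemma clairaut_real:
  fixes f :: "'a::real_normed_vector \<Rightarrow> real"
  assumes S: "open S" and sm: "smooth_on S f" and x: "x \<in> S"
  shows "frechet_derivative (\<lambda>y. frechet_derivative f (at y) a) (at x) b =
         frechet_derivative (\<lambda>y. frechet_derivative f (at y) b) (at x) a"
proof (rule ccontr)
  define U where "U y = frechet_derivative (\<lambda>y. frechet_derivative f (at y) a) (at y) b" for y
  define W where "W y = frechet_derivative (\<lambda>y. frechet_derivative f (at y) b) (at y) a" for y
  assume "\<not> ?thesis"
  then have ne: "dist (U x) (W x) / 2 > 0" by (simp add: U_def W_def)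
  have "continuous_on S U" "continuous_on S W"
    unfolding U_def W_def
    by (intro smooth_on_imp_continuous_on smooth_on_frechet_derivative[OF smooth_on_frechet_derivative[OF sm]])+
  then have "isCont U x" "isCont W x" using S x by (auto simp: continuous_on_eq_continuous_at)
  then obtain d1 d2 where d: "d1 > 0" "d2 > 0"
    "\<And>y. dist y x < d1 \<Longrightarrow> dist (U y) (U x) < dist (U x) (W x) / 2"
    "\<And>y. dist y x < d2 \<Longrightarrow> dist (W y) (W x) < dist (U x) (W x) / 2"
    using ne unfolding continuous_at_eps_delta by metis
  obtain r where r: "r > 0" "ball x r \<subseteq> S" using S x openE by blast
  define e where "e = min r (min d1 d2)"
  define c where "c = norm a + norm b + 1"
  \<comment> \<open>With this size the whole parallelogram spanned by h a and h b stays within e/2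
    of \<open>x\<close>; the 1 in \<open>c\<close> covers vanishing directions.\<close>
  define h where "h = e / (2 * c)"
  have pos: "e > 0" "c > 0" using d r by (auto simp: e_def c_def add_nonneg_pos)
  then have h: "h > 0" by (simp add: h_def)
  have near: "dist (x + s *\<^sub>R a' + t *\<^sub>R b') x < e" if "0 \<le> s" "s \<le> h" "0 \<le> t" "t \<le> h"
    "norm a' + norm b' = norm a + norm b" for s t and a' b' :: 'a
  proof -
    have "dist (x + s *\<^sub>R a' + t *\<^sub>R b') x = norm (s *\<^sub>R a' + t *\<^sub>R b')" by (simp add: dist_norm)
    also have "\<dots> \<le> s * norm a' + t * norm b'" using norm_triangle_ineq[of "s *\<^sub>R a'" "t *\<^sub>R b'"] that by simp
    also have "\<dots> \<le> h * norm a' + h * norm b'" using that by (intro add_mono mult_right_mono) auto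
    also have "\<dots> = h * (norm a + norm b)" using that(5) by (simp flip: distrib_left)
    also have "\<dots> \<le> h * c" using h by (simp add: c_def)
    also have "\<dots> = e / 2" using pos by (simp add: h_def)
    finally show ?thesis using pos by linarith
  qed
  have inS: "y \<in> S" if "dist y x < e" for y using that r(2) by (auto simp: e_def dist_commute)
  obtain s t where st: "0 < s" "s < h" "0 < t" "t < h"
    "f (x + h *\<^sub>R a + h *\<^sub>R b) - f (x + h *\<^sub>R a) - f (x + h *\<^sub>R b) + f x = h * (h * U (x + s *\<^sub>R a + t *\<^sub>R b))"
    using second_difference[OF sm h, of x a b] inS near[of _ _ a b] unfolding U_def by blast
  obtain s' t' where st': "0 < s'" "s' < h" "0 < t'" "t' < h"
    "f (x + h *\<^sub>R b + h *\<^sub>R a) - f (x + h *\<^sub>R b) - f (x + h *\<^sub>R a) + f x = h * (h * W (x + s' *\<^sub>R b + t' *\<^sub>R a))"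
    using second_difference[OF sm h, of x b a] inS near[of _ _ b a] add.commute[of "norm a" "norm b"] unfolding W_def by metis
  have "f (x + h *\<^sub>R b + h *\<^sub>R a) = f (x + h *\<^sub>R a + h *\<^sub>R b)" by (simp add: algebra_simps)
  with st(5) st'(5) have "h * (h * U (x + s *\<^sub>R a + t *\<^sub>R b)) = h * (h * W (x + s' *\<^sub>R b + t' *\<^sub>R a))"
    by linarith
  then have eq: "U (x + s *\<^sub>R a + t *\<^sub>R b) = W (x + s' *\<^sub>R b + t' *\<^sub>R a)" using h by simp
  have "dist (U (x + s *\<^sub>R a + t *\<^sub>R b)) (U x) < dist (U x) (W x) / 2"
    using near[of s t a b] st by (intro d) (auto simp: e_def)
  moreover have "dist (W (x + s' *\<^sub>R b + t' *\<^sub>R a)) (W x) < dist (U x) (W x) / 2"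
    using near[of s' t' b a] st' by (intro d) (auto simp: e_def)
  ultimately show False
    using dist_triangle3[of "U x" "W x" "W (x + s' *\<^sub>R b + t' *\<^sub>R a)"] unfolding eq by linarith
qed

lemma frechet_derivative_linear_comp:
  assumes "bounded_linear L" "f differentiable (at x)"
  shows "frechet_derivative (\<lambda>y. L (f y)) (at x) v = L (frechet_derivative f (at x) v)"
  using bounded_linear.has_derivative[OF assms(1) assms(2)[unfolded frechet_derivative_works]]
  by (rule frechet_derivative_eqI)

lemma clairaut:
  fixes f :: "'a::real_normed_vector \<Rightarrow> complex"
  assumes S: "open S" and sm: "smooth_on S f" and x: "x \<in> S"
  shows "frechet_derivative (\<lambda>y. frechet_derivative f (at y) a) (at x) b =
         frechet_derivative (\<lambda>y. frechet_derivative f (at y) b) (at x) a"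
proof -
  have *: "L (frechet_derivative (\<lambda>y. frechet_derivative f (at y) a) (at x) b) =
      frechet_derivative (\<lambda>y. frechet_derivative (\<lambda>z. L (f z)) (at y) a) (at x) b"
    if L: "bounded_linear L" for L :: "complex \<Rightarrow> real" and a b
  proof -
    have "L (frechet_derivative (\<lambda>y. frechet_derivative f (at y) a) (at x) b) =
       frechet_derivative (\<lambda>y. L (frechet_derivative f (at y) a)) (at x) b"
      by (rule frechet_derivative_linear_comp[OF L, symmetric])
        (rule smooth_on_imp_differentiable[OF smooth_on_frechet_derivative[OF sm] x])
    also have "\<dots> = frechet_derivative (\<lambda>y. frechet_derivative (\<lambda>z. L (f z)) (at y) a) (at x) b"
      by (intro fun_cong[OF frechet_derivative_cong_open[OF S x]])
        (simp add: frechet_derivative_linear_comp[OF L smooth_on_imp_differentiable[OF sm]])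
    finally show ?thesis .
  qed
  have "L (frechet_derivative (\<lambda>y. frechet_derivative f (at y) a) (at x) b) =
        L (frechet_derivative (\<lambda>y. frechet_derivative f (at y) b) (at x) a)"
    if L: "bounded_linear L" for L :: "complex \<Rightarrow> real"
    unfolding *[OF L] by (rule clairaut_real[OF S smooth_on_bounded_linear_comp[OF S L sm] x])
  from this[OF bounded_linear_Re] this[OF bounded_linear_Im] show ?thesis by (simp add: complex_eq_iff)
qed

section \<open>Smooth families of power series\<close>

text \<open>Differentiability of each coefficient: \<open>F' v x\<close> is the derivative at
  \<open>x\<close> in direction \<open>v\<close>. The direction comes first so that
  \<open>F' v\<close> is again a family in \<open>x\<close>.\<close>

definition fdiff :: "'a::real_normed_vector set \<Rightarrow> ('a \<Rightarrow> complex fps) \<Rightarrow> ('a \<Rightarrow> 'a \<Rightarrow> complex fps) \<Rightarrow> bool" where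
  "fdiff S F F' \<longleftrightarrow> (\<forall>x\<in>S. \<forall>n. ((\<lambda>y. fps_nth (F y) n) has_derivative (\<lambda>v. fps_nth (F' v x) n)) (at x))"

lemma fdiff_const:
  assumes "smooth_on S a"
  shows "fdiff S (\<lambda>x. fps_const (a x)) (\<lambda>v x. fps_const (frechet_derivative a (at x) v))"
  unfolding fdiff_def
proof (intro ballI allI)
  fix x n assume "x \<in> S"
  from smooth_on_imp_has_derivative[OF assms this]
  show "((\<lambda>y. fps_nth (fps_const (a y)) n) has_derivative (\<lambda>v. fps_nth (fps_const (frechet_derivative a (at x) v)) n)) (at x)"
    by (cases "n = 0") auto
qed

lemma fdiff_constant: "fdiff S (\<lambda>x. C) (\<lambda>v x. 0)"
  unfolding fdiff_def by auto

lemma fdiff_add: "fdiff S F F' \<Longrightarrow> fdiff S G G' \<Longrightarrow> fdiff S (\<lambda>x. F x + G x) (\<lambda>v x. F' v x + G' v x)"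
  unfolding fdiff_def by (auto intro!: has_derivative_add)

lemma fdiff_mult:
  assumes "fdiff S F F'" "fdiff S G G'"
  shows "fdiff S (\<lambda>x. F x * G x) (\<lambda>v x. F' v x * G x + F x * G' v x)"
  unfolding fdiff_def
proof (intro ballI allI)
  fix x n assume x: "x \<in> S"
  have "((\<lambda>y. \<Sum>i=0..n. fps_nth (F y) i * fps_nth (G y) (n - i)) has_derivative
     (\<lambda>v. \<Sum>i=0..n. fps_nth (F x) i * fps_nth (G' v x) (n - i) + fps_nth (F' v x) i * fps_nth (G x) (n - i))) (at x)"
    using assms x unfolding fdiff_def by (intro has_derivative_sum has_derivative_mult) auto
  then show "((\<lambda>y. fps_nth (F y * G y) n) has_derivative (\<lambda>v. fps_nth (F' v x * G x + F x * G' v x) n)) (at x)"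
    by (simp add: fps_mult_nth sum.distrib add.commute)
qed

lemma fdiff_sum:
  assumes "\<And>i. i \<in> A \<Longrightarrow> fdiff S (F i) (F' i)"
  shows "fdiff S (\<lambda>x. \<Sum>i\<in>A. F i x) (\<lambda>v x. \<Sum>i\<in>A. F' i v x)"
  using assms unfolding fdiff_def by (auto simp: fps_sum_nth intro!: has_derivative_sum)

lemma fdiff_cong:
  assumes "open S" "fdiff S F F'" "\<And>x. x \<in> S \<Longrightarrow> F x = G x" "\<And>x v. x \<in> S \<Longrightarrow> F' v x = G' v x"
  shows "fdiff S G G'"
  unfolding fdiff_def
proof (intro ballI allI)
  fix x n assume x: "x \<in> S"
  have "((\<lambda>y. fps_nth (F y) n) has_derivative (\<lambda>v. fps_nth (F' v x) n)) (at x)"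
    using assms(2) x unfolding fdiff_def by blast
  moreover have "(\<lambda>v. fps_nth (F' v x) n) = (\<lambda>v. fps_nth (G' v x) n)" using assms(4)[OF x] by simp
  ultimately show "((\<lambda>y. fps_nth (G y) n) has_derivative (\<lambda>v. fps_nth (G' v x) n)) (at x)"
    using has_derivative_cong_open[OF assms(1) x, of "\<lambda>y. fps_nth (F y) n" "\<lambda>y. fps_nth (G y) n"] assms(3) by simp
qed

lemma fdiff_unique:
  assumes "open S" "fdiff S F F'" "fdiff S G G'" "\<And>x. x \<in> S \<Longrightarrow> F x = G x" "x \<in> S"
  shows "F' v x = G' v x"
proof (rule fps_ext)
  fix n
  have "fdiff S G F'" by (rule fdiff_cong[OF assms(1,2,4)]) auto
  then have "(\<lambda>v. fps_nth (F' v x) n) = (\<lambda>v. fps_nth (G' v x) n)"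
    using assms(3,5) unfolding fdiff_def by (metis has_derivative_unique)
  then show "fps_nth (F' v x) n = fps_nth (G' v x) n" by (rule fun_cong)
qed

lemma fdiff_frechet: "fdiff S F F' \<Longrightarrow> x \<in> S \<Longrightarrow> frechet_derivative (\<lambda>y. fps_nth (F y) n) (at x) v = fps_nth (F' v x) n"
  unfolding fdiff_def by (intro frechet_derivative_eqI) blast

lemma fdiff_linear:
  assumes "fdiff S F F'" "x \<in> S"
  shows "F' (v + w) x = F' v x + F' w x" "F' (c *\<^sub>R v) x = fps_const (of_real c) * F' v x"
    "F' (\<Sum>i\<in>A. g i) x = (\<Sum>i\<in>A. F' (g i) x)"
proof -
  have l: "linear (\<lambda>v. fps_nth (F' v x) n)" for n
    using assms unfolding fdiff_def by (metis has_derivative_linear)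
  show "F' (v + w) x = F' v x + F' w x" by (rule fps_ext) (use linear_add[OF l] in simp)
  show "F' (c *\<^sub>R v) x = fps_const (of_real c) * F' v x"
    by (rule fps_ext) (use linear_scale[OF l] in \<open>simp add: scaleR_conv_of_real\<close>)
  show "F' (\<Sum>i\<in>A. g i) x = (\<Sum>i\<in>A. F' (g i) x)"
    by (rule fps_ext) (use linear_sum[OF l] in \<open>simp add: fps_sum_nth\<close>)
qed

text \<open>By recursion the coefficients of the inverse are rational in finitely many coefficients
  of \<open>F\<close>, hence differentiable; the formula results from differentiating the product of
  \<open>F\<close> and its inverse, which is constant.\<close>

lemma fdiff_inverse:
  assumes S: "open S" and F: "fdiff S F F'" and nz: "\<And>x. x \<in> S \<Longrightarrow> fps_nth (F x) 0 \<noteq> 0"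
  shows "fdiff S (\<lambda>x. inverse (F x)) (\<lambda>v x. - (F' v x * inverse (F x) * inverse (F x)))"
proof -
  have inv: "F x * inverse (F x) = 1" if "x \<in> S" for x using nz[OF that] by (rule inverse_mult_eq_1')
  have dF: "(\<lambda>y. fps_nth (F y) n) differentiable (at x)" if "x \<in> S" for n x
    using F that unfolding fdiff_def differentiable_def by blast
  have dif: "\<forall>x\<in>S. (\<lambda>y. fps_nth (inverse (F y)) n) differentiable (at x)" for n
  proof (induction n rule: less_induct)
    case (less n)
    show ?case
    proof
      fix x assume x: "x \<in> S"
      have eq: "fps_nth (inverse (F y)) n =
         ((if n = 0 then 1 else 0) - (\<Sum>i=1..n. fps_nth (F y) i * fps_nth (inverse (F y)) (n - i))) / fps_nth (F y) 0"
        if "y \<in> S" for y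
      proof -
        have "(if n = 0 then 1 else 0) = fps_nth (F y * inverse (F y)) n" by (simp add: inv[OF that])
        also have "\<dots> = fps_nth (F y) 0 * fps_nth (inverse (F y)) n + (\<Sum>i=1..n. fps_nth (F y) i * fps_nth (inverse (F y)) (n - i))"
          unfolding fps_mult_nth by (simp add: sum.atLeast_Suc_atMost del: fps_inverse_nth_0)
        finally show ?thesis using nz[OF that] by (simp add: field_simps del: fps_inverse_nth_0)
      qed
      have "(\<lambda>y. ((if n = 0 then 1 else 0) - (\<Sum>i=1..n. fps_nth (F y) i * fps_nth (inverse (F y)) (n - i))) / fps_nth (F y) 0)
          differentiable (at x)"
      proof (intro differentiable_divide differentiable_diff differentiable_sum ballI differentiable_mult dF x)
        show "(\<lambda>y. fps_nth (inverse (F y)) (n - i)) differentiable at x" if "i \<in> {1..n}" for i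
          using less[of "n - i"] x that by auto
      qed (use nz[OF x] in auto)
      then show "(\<lambda>y. fps_nth (inverse (F y)) n) differentiable (at x)"
        using differentiable_cong_open[OF S x eq] by simp
    qed
  qed
  define G' where "G' v x = Abs_fps (\<lambda>n. frechet_derivative (\<lambda>y. fps_nth (inverse (F y)) n) (at x) v)" for v x
  have G: "fdiff S (\<lambda>x. inverse (F x)) G'"
    using dif unfolding fdiff_def G'_def by (simp add: frechet_derivative_works[symmetric])
  have "G' v x = - (F' v x * inverse (F x) * inverse (F x))" if x: "x \<in> S" for v x
  proof -
    have "F' v x * inverse (F x) + F x * G' v x = 0"
      using fdiff_unique[OF S fdiff_mult[OF F G] fdiff_constant[of S 1] inv x] .
    then have "inverse (F x) * (F' v x * inverse (F x) + F x * G' v x) = 0" by simp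
    then have "F' v x * inverse (F x) * inverse (F x) + (F x * inverse (F x)) * G' v x = 0"
      by (simp only: distrib_left mult_ac)
    then have "F' v x * inverse (F x) * inverse (F x) + G' v x = 0" by (simp only: inv[OF x] mult_1)
    then show ?thesis by (simp add: add_eq_0_iff2)
  qed
  then show ?thesis by (intro fdiff_cong[OF S G]) auto
qed

text \<open>The algebra generated by smooth constants, the variable and 1/B. It is stable under
  derivatives, as (1/B)' = -B'/B^2, and its generators have locally uniform geometric bounds once B
  has no zero in the closed disc; smoothness and estimates thus propagate by induction.\<close>

inductive fam :: "'a::real_normed_vector set \<Rightarrow> ('a \<Rightarrow> complex poly) \<Rightarrow> ('a \<Rightarrow> complex fps) \<Rightarrow> bool"
  for S and B where
  fconst: "smooth_on S a \<Longrightarrow> fam S B (\<lambda>x. fps_const (a x))"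
| fX: "fam S B (\<lambda>x. fps_X)"
| fadd: "fam S B F \<Longrightarrow> fam S B G \<Longrightarrow> fam S B (\<lambda>x. F x + G x)"
| fmult: "fam S B F \<Longrightarrow> fam S B G \<Longrightarrow> fam S B (\<lambda>x. F x * G x)"
| finv: "fam S B (\<lambda>x. inverse (fps_of_poly (B x)))"

text \<open>One radius and one constant for all parameters near \<open>x0\<close>: this uniformity
  is what termwise differentiation of inner products requires.\<close>

definition locbnd :: "'a::real_normed_vector set \<Rightarrow> ('a \<Rightarrow> complex fps) \<Rightarrow> bool" where
  "locbnd S F \<longleftrightarrow> (\<forall>x0\<in>S. \<exists>r>1. \<exists>e>0. \<exists>C. ball x0 e \<subseteq> S \<and> (\<forall>x\<in>ball x0 e. \<forall>n. wnorm r n (F x) \<le> C))"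

lemma locbnd_common:
  assumes F: "locbnd S F" and G: "locbnd S G" and x0: "x0 \<in> S"
  shows "\<exists>r>1. \<exists>e>0. \<exists>C. ball x0 e \<subseteq> S \<and> (\<forall>x\<in>ball x0 e. \<forall>n. wnorm r n (F x) \<le> C \<and> wnorm r n (G x) \<le> C)"
proof -
  from F x0 obtain r e C where 1: "r > 1" "e > 0" "ball x0 e \<subseteq> S" "\<forall>x\<in>ball x0 e. \<forall>n. wnorm r n (F x) \<le> C"
    unfolding locbnd_def by blast
  from G x0 obtain r' e' C' where 2: "r' > 1" "e' > 0" "ball x0 e' \<subseteq> S" "\<forall>x\<in>ball x0 e'. \<forall>n. wnorm r' n (G x) \<le> C'"
    unfolding locbnd_def by blast
  define ee where "ee = min e e'"
  have "wnorm (min r r') n (F x) \<le> max C C' \<and> wnorm (min r r') n (G x) \<le> max C C'" if "x \<in> ball x0 ee" for x n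
  proof -
    have "wnorm r n (F x) \<le> C" "wnorm r' n (G x) \<le> C'" using that 1 2 by (auto simp: ee_def)
    then show ?thesis
      using wnorm_mono[of "min r r'" r n "F x"] wnorm_mono[of "min r r'" r' n "G x"] 1(1) 2(1) by auto
  qed
  moreover have "min r r' > 1" "ee > 0" "ball x0 ee \<subseteq> S" using 1 2 by (auto simp: ee_def)
  ultimately show ?thesis by blast
qed

lemma locbnd_add: "locbnd S F \<Longrightarrow> locbnd S G \<Longrightarrow> locbnd S (\<lambda>x. F x + G x)"
  unfolding locbnd_def[of S "\<lambda>x. F x + G x"]
proof
  fix x0 assume FG: "locbnd S F" "locbnd S G" "x0 \<in> S"
  obtain r e C where 1: "r > 1" "e > 0" "ball x0 e \<subseteq> S" "\<forall>x\<in>ball x0 e. \<forall>n. wnorm r n (F x) \<le> C \<and> wnorm r n (G x) \<le> C"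
    using locbnd_common[OF FG] by blast
  have "wnorm r n (F x + G x) \<le> C + C" if "x \<in> ball x0 e" for x n
  proof -
    have "wnorm r n (F x) \<le> C" "wnorm r n (G x) \<le> C" using that 1 by auto
    then show ?thesis using wnorm_add[of r n "F x" "G x"] 1(1) by linarith
  qed
  then show "\<exists>r>1. \<exists>e>0. \<exists>C. ball x0 e \<subseteq> S \<and> (\<forall>x\<in>ball x0 e. \<forall>n. wnorm r n (F x + G x) \<le> C)" using 1 by blast
qed

lemma locbnd_mult: "locbnd S F \<Longrightarrow> locbnd S G \<Longrightarrow> locbnd S (\<lambda>x. F x * G x)"
  unfolding locbnd_def[of S "\<lambda>x. F x * G x"]
proof
  fix x0 assume FG: "locbnd S F" "locbnd S G" "x0 \<in> S"
  obtain r e C where 1: "r > 1" "e > 0" "ball x0 e \<subseteq> S" "\<forall>x\<in>ball x0 e. \<forall>n. wnorm r n (F x) \<le> C \<and> wnorm r n (G x) \<le> C"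
    using locbnd_common[OF FG] by blast
  have "wnorm r n (F x * G x) \<le> C * C" if "x \<in> ball x0 e" for x n
  proof -
    have b: "wnorm r n (F x) \<le> C" "wnorm r n (G x) \<le> C" using that 1 by auto
    have nn: "0 \<le> wnorm r n (F x)" "0 \<le> wnorm r n (G x)" using 1(1) by (auto intro: wnorm_nonneg)
    have "wnorm r n (F x) * wnorm r n (G x) \<le> C * C" using b nn by (intro mult_mono) auto
    then show ?thesis using wnorm_mult[of r n "F x" "G x"] 1(1) by linarith
  qed
  then show "\<exists>r>1. \<exists>e>0. \<exists>C. ball x0 e \<subseteq> S \<and> (\<forall>x\<in>ball x0 e. \<forall>n. wnorm r n (F x * G x) \<le> C)" using 1 by blast
qed

lemma wnorm_const_le: "0 \<le> r \<Longrightarrow> wnorm r n (fps_const c) \<le> cmod c"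
  using wnorm_fps_of_poly_bound[of r n "[:c:]"] by (simp add: fps_of_poly_const)

lemma locbnd_const:
  assumes S: "open S" and a: "continuous_on S a"
  shows "locbnd S (\<lambda>x. fps_const (a x))"
  unfolding locbnd_def
proof
  fix x0 assume x0: "x0 \<in> S"
  then have "isCont a x0" using a S by (simp add: continuous_on_eq_continuous_at)
  then obtain d where d: "d > 0" "\<forall>y. dist y x0 < d \<longrightarrow> dist (a y) (a x0) < 1"
    unfolding continuous_at_eps_delta by (metis zero_less_one)
  obtain e where e: "e > 0" "ball x0 e \<subseteq> S" using S x0 openE by blast
  have "wnorm 2 n (fps_const (a x)) \<le> cmod (a x0) + 1" if "x \<in> ball x0 (min d e)" for x n
  proof -
    have "dist (a x) (a x0) < 1" using d that by (auto simp: dist_commute)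
    then have "cmod (a x) \<le> cmod (a x0) + 1"
      using norm_triangle_ineq2[of "a x" "a x0"] by (simp add: dist_norm)
    then show ?thesis using wnorm_const_le[of 2 n "a x"] by simp
  qed
  moreover have "ball x0 (min d e) \<subseteq> S" using e by auto
  ultimately show "\<exists>r>1. \<exists>e>0. \<exists>C. ball x0 e \<subseteq> S \<and> (\<forall>x\<in>ball x0 e. \<forall>n. wnorm r n (fps_const (a x)) \<le> C)"
    using d(1) e(1) by (intro exI[of _ 2] conjI exI[of _ "min d e"] exI[of _ "cmod (a x0) + 1"]) auto
qed

lemma locbnd_constant: "open S \<Longrightarrow> fgeo C \<Longrightarrow> locbnd S (\<lambda>x. C)"
  unfolding locbnd_def fgeo_def by (metis openE)

locale polyfam =
  fixes S :: "'a::real_normed_vector set" and B :: "'a \<Rightarrow> complex poly" and d :: nat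
  assumes S: "open S" and Bsm: "smooth_on S (\<lambda>x. coeff (B x) k)" and Bdeg: "degree (B x) \<le> d"
    and B0: "x \<in> S \<Longrightarrow> coeff (B x) 0 \<noteq> 0"
begin

lemma fam_sum: "(\<And>i. i \<in> A \<Longrightarrow> fam S B (F i)) \<Longrightarrow> fam S B (\<lambda>x. \<Sum>i\<in>A. F i x)"
proof (induction A rule: infinite_finite_induct)
  case (insert x A)
  then show ?case using fam.fadd[of S B "F x" "\<lambda>y. \<Sum>i\<in>A. F i y"] by simp
qed (use fam.fconst[OF smooth_on_const[OF S, of 0]] in auto)

lemma fam_X_power: "fam S B (\<lambda>x. fps_X ^ k)"
proof (induction k)
  case 0
  then show ?case using fam.fconst[OF smooth_on_const[OF S, of 1]] by simp
next
  case (Suc k)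
  then show ?case using fam.fmult[OF fam.fX] by simp
qed

lemma fps_of_poly_expand: "degree p \<le> e \<Longrightarrow> fps_of_poly p = (\<Sum>k\<le>e. fps_const (coeff p k) * fps_X ^ k)"
  by (rule fps_ext) (auto simp: fps_sum_nth fps_X_power_nth if_distrib coeff_eq_0 not_le cong: if_cong)

lemma fam_poly:
  assumes "\<And>k. smooth_on S (\<lambda>x. coeff (p x) k)" "\<And>x. degree (p x) \<le> e"
  shows "fam S B (\<lambda>x. fps_of_poly (p x))"
proof -
  have "(\<lambda>x. fps_of_poly (p x)) = (\<lambda>x. \<Sum>k\<le>e. fps_const (coeff (p x) k) * fps_X ^ k)"
    using fps_of_poly_expand[OF assms(2)] by auto
  moreover have "fam S B (\<lambda>x. \<Sum>k\<le>e. fps_const (coeff (p x) k) * fps_X ^ k)"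
    by (intro fam_sum fam.fmult fam.fconst assms fam_X_power)
  ultimately show ?thesis by simp
qed

lemma fam_minus: "fam S B F \<Longrightarrow> fam S B (\<lambda>x. - F x)"
  using fam.fmult[OF fam.fconst[OF smooth_on_const[OF S, of "-1"]], of B F] by (simp flip: fps_const_neg)

lemma fam_deriv: "fam S B F \<Longrightarrow> \<exists>F'. (\<forall>v. fam S B (F' v)) \<and> fdiff S F F'"
proof (induction rule: fam.induct)
  case (fconst a)
  show ?case
    by (rule exI[of _ "\<lambda>v x. fps_const (frechet_derivative a (at x) v)"])
      (auto intro!: fdiff_const fconst fam.fconst smooth_on_frechet_derivative)
next
  case fX
  then show ?case using fdiff_constant[of S fps_X] fam.fconst[OF smooth_on_const[OF S, of 0]]
    by (intro exI[of _ "\<lambda>v x. 0"]) auto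
next
  case (fadd F G)
  then obtain F' G' where "\<forall>v. fam S B (F' v)" "fdiff S F F'" "\<forall>v. fam S B (G' v)" "fdiff S G G'" by blast
  then show ?case by (intro exI[of _ "\<lambda>v x. F' v x + G' v x"]) (auto intro: fdiff_add fam.fadd)
next
  case (fmult F G)
  then obtain F' G' where F': "\<forall>v. fam S B (F' v)" "fdiff S F F'" and G': "\<forall>v. fam S B (G' v)" "fdiff S G G'" by blast
  have "fam S B (\<lambda>x. F' v x * G x + F x * G' v x)" for v
    using fmult(1,2) F'(1) G'(1) by (intro fam.fadd fam.fmult) auto
  then show ?case using fdiff_mult[OF F'(2) G'(2)]
    by (intro exI[of _ "\<lambda>v x. F' v x * G x + F x * G' v x"] conjI allI)
next
  case finv
  \<comment> \<open>The summand with factor 0 is the Leibniz term of the constant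
    \<open>fps_X ^ k\<close>, kept so that \<open>fdiff_mult\<close> applies literally.\<close>
  define b' where "b' v x = (\<Sum>k\<le>d. fps_const (frechet_derivative (\<lambda>y. coeff (B y) k) (at x) v) * fps_X ^ k
      + fps_const (coeff (B x) k) * 0)" for v x
  have b: "fdiff S (\<lambda>x. fps_of_poly (B x)) b'"
  proof -
    have "fdiff S (\<lambda>x. \<Sum>k\<le>d. fps_const (coeff (B x) k) * fps_X ^ k) b'"
      unfolding b'_def by (intro fdiff_sum fdiff_mult fdiff_const Bsm fdiff_constant)
    then show ?thesis using fps_of_poly_expand[OF Bdeg] by simp
  qed
  have bf: "fam S B (b' v)" for v
    unfolding b'_def by (simp, intro fam_sum fam.fmult fam.fconst smooth_on_frechet_derivative Bsm fam_X_power)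
  show ?case
    using fdiff_inverse[OF S b] B0
    by (intro exI[of _ "\<lambda>v x. - (b' v x * inverse (fps_of_poly (B x)) * inverse (fps_of_poly (B x)))"])
      (auto intro!: fam_minus fam.fmult fam.finv bf)
qed

lemma fam_smooth_nth: "fam S B F \<Longrightarrow> smooth_on S (\<lambda>x. fps_nth (F x) n)"
proof (rule smooth_on_coinduct[where P="\<lambda>f. \<exists>F. fam S B F \<and> (\<forall>x\<in>S. f x = fps_nth (F x) n)"])
  show "open S" by (rule S)
  show "fam S B F \<Longrightarrow> \<exists>Fa. fam S B Fa \<and> (\<forall>x\<in>S. fps_nth (F x) n = fps_nth (Fa x) n)" by blast
  fix f assume "\<exists>F. fam S B F \<and> (\<forall>x\<in>S. f x = fps_nth (F x) n)"
  then obtain F where F: "fam S B F" "\<forall>x\<in>S. f x = fps_nth (F x) n" by blast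
  obtain F' where F': "\<forall>v. fam S B (F' v)" "fdiff S F F'" using fam_deriv[OF F(1)] by blast
  have d: "(f has_derivative (\<lambda>v. fps_nth (F' v x) n)) (at x)" if "x \<in> S" for x
    using has_derivative_cong_open[OF S that, of f "\<lambda>y. fps_nth (F y) n"] F(2) F'(2) that unfolding fdiff_def by blast
  show "(\<forall>x\<in>S. f differentiable at x) \<and> (\<forall>v. \<exists>g. (\<exists>F. fam S B F \<and> (\<forall>x\<in>S. g x = fps_nth (F x) n)) \<and>
            (\<forall>x\<in>S. frechet_derivative f (at x) v = g x))"
  proof (intro conjI ballI allI)
    fix x assume "x \<in> S" then show "f differentiable at x" using d differentiable_def by blast
  next
    fix v
    show "\<exists>g. (\<exists>F. fam S B F \<and> (\<forall>x\<in>S. g x = fps_nth (F x) n)) \<and> (\<forall>x\<in>S. frechet_derivative f (at x) v = g x)"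
      using F'(1) frechet_derivative_eqI[OF d] by (intro exI[of _ "\<lambda>x. fps_nth (F' v x) n"]) blast
  qed
qed

end

locale polyfam_disc = polyfam +
  assumes Bnz: "x \<in> S \<Longrightarrow> cmod z \<le> 1 \<Longrightarrow> poly (B x) z \<noteq> 0"
begin

text \<open>A Neumann series argument: \<open>1/B\<^sub>x = 1/B\<^sub>0 + (1/B\<^sub>0) (B\<^sub>0 - B\<^sub>x) (1/B\<^sub>x)\<close>, and the truncated
  norms \<open>wnorm r n\<close> are finite, so that no convergence has to be known beforehand.\<close>

lemma locbnd_inverse: "locbnd S (\<lambda>x. inverse (fps_of_poly (B x)))"
  unfolding locbnd_def
proof
  fix x0 assume x0: "x0 \<in> S"
  have "fgeo (inverse (fps_of_poly (B x0)))" by (rule fgeo_inverse_poly[OF Bnz[OF x0]])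
  then obtain r C where r: "r > 1" and C: "\<And>n. wnorm r n (inverse (fps_of_poly (B x0))) \<le> C" unfolding fgeo_def by blast
  have C0: "C \<ge> 0" using C[of 0] wnorm_nonneg[of r 0 "inverse (fps_of_poly (B x0))"] r by linarith
  define \<delta> where "\<delta> x = (\<Sum>k\<le>d. cmod (coeff (B x0) k - coeff (B x) k) * r ^ k)" for x
  have "continuous_on S \<delta>"
    unfolding \<delta>_def by (intro continuous_intros smooth_on_imp_continuous_on[OF Bsm])
  then have "isCont \<delta> x0" using S x0 by (simp add: continuous_on_eq_continuous_at)
  moreover have "1 / (2 * (C + 1)) > 0" using C0 by simp
  ultimately obtain e1 where e1: "e1 > 0" "\<forall>y. dist y x0 < e1 \<longrightarrow> dist (\<delta> y) (\<delta> x0) < 1 / (2 * (C + 1))"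
    unfolding continuous_at_eps_delta by metis
  obtain e where e: "e > 0" "ball x0 e \<subseteq> S" using S x0 openE by blast
  have "wnorm r n (inverse (fps_of_poly (B x))) \<le> 2 * C" if x: "x \<in> ball x0 (min e1 e)" for x n
  proof -
    have xS: "x \<in> S" using x e by auto
    have "dist (\<delta> x) (\<delta> x0) < 1 / (2 * (C + 1))" using e1 x by (auto simp: dist_commute)
    moreover have "\<delta> x0 = 0" by (simp add: \<delta>_def)
    ultimately have dx: "\<delta> x < 1 / (2 * (C + 1))" by (simp add: dist_real_def)
    define g g0 where "g = inverse (fps_of_poly (B x))" and "g0 = inverse (fps_of_poly (B x0))"
    have gi: "fps_of_poly (B x) * g = 1" "fps_of_poly (B x0) * g0 = 1"
      unfolding g_def g0_def using B0[OF xS] B0[OF x0] by (auto intro: inverse_mult_eq_1')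
    have "g = g0 + g0 * (fps_of_poly (B x0 - B x) * g)"
    proof -
      have "g0 * (fps_of_poly (B x0 - B x) * g) = (fps_of_poly (B x0) * g0) * g - g0 * (fps_of_poly (B x) * g)"
        by (simp add: fps_of_poly_diff algebra_simps)
      then show ?thesis by (simp add: gi)
    qed
    then have "wnorm r n g \<le> wnorm r n g0 + wnorm r n (g0 * (fps_of_poly (B x0 - B x) * g))"
      using wnorm_add[of r n g0 "g0 * (fps_of_poly (B x0 - B x) * g)"] r by simp
    also have "\<dots> \<le> C + C * (\<delta> x * wnorm r n g)"
    proof (intro add_mono)
      show "wnorm r n g0 \<le> C" unfolding g0_def by (rule C)
      have "wnorm r n (fps_of_poly (B x0 - B x)) \<le> (\<Sum>k\<le>degree (B x0 - B x). cmod (coeff (B x0 - B x) k) * r ^ k)"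
        using r by (intro wnorm_fps_of_poly_bound) auto
      also have "\<dots> \<le> (\<Sum>k\<le>d. cmod (coeff (B x0 - B x) k) * r ^ k)"
        using degree_diff_le[OF Bdeg Bdeg, of x0 x] r by (intro sum_mono2) auto
      also have "\<dots> = \<delta> x" by (simp add: \<delta>_def)
      finally have db: "wnorm r n (fps_of_poly (B x0 - B x)) \<le> \<delta> x" .
      have nn: "0 \<le> wnorm r n F" for F using r by (intro wnorm_nonneg) auto
      have "wnorm r n (g0 * (fps_of_poly (B x0 - B x) * g)) \<le> wnorm r n g0 * wnorm r n (fps_of_poly (B x0 - B x) * g)"
        using r by (intro wnorm_mult) auto
      also have "\<dots> \<le> C * (\<delta> x * wnorm r n g)"
      proof (intro mult_mono)
        show "wnorm r n g0 \<le> C" unfolding g0_def by (rule C)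
        have "wnorm r n (fps_of_poly (B x0 - B x) * g) \<le> wnorm r n (fps_of_poly (B x0 - B x)) * wnorm r n g"
          using r by (intro wnorm_mult) auto
        also have "\<dots> \<le> \<delta> x * wnorm r n g" using db nn by (intro mult_right_mono) auto
        finally show "wnorm r n (fps_of_poly (B x0 - B x) * g) \<le> \<delta> x * wnorm r n g" .
      qed (use C0 nn in auto)
      finally show "wnorm r n (g0 * (fps_of_poly (B x0 - B x) * g)) \<le> C * (\<delta> x * wnorm r n g)" .
    qed
    finally have 1: "wnorm r n g \<le> C + (C * \<delta> x) * wnorm r n g" by (simp add: mult.assoc)
    have "\<delta> x \<ge> 0" unfolding \<delta>_def using r by (intro sum_nonneg) auto
    then have "C * \<delta> x \<le> (C + 1) * \<delta> x" by (simp add: mult_right_mono)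
    also have "\<dots> \<le> 1 / 2" using dx C0 by (simp add: field_simps)
    finally have "(C * \<delta> x) * wnorm r n g \<le> 1 / 2 * wnorm r n g"
      using r wnorm_nonneg[of r n g] by (intro mult_right_mono) auto
    then show ?thesis using 1 unfolding g_def by linarith
  qed
  moreover have "ball x0 (min e1 e) \<subseteq> S" using e by auto
  ultimately show "\<exists>r>1. \<exists>e>0. \<exists>C. ball x0 e \<subseteq> S \<and> (\<forall>x\<in>ball x0 e. \<forall>n. wnorm r n (inverse (fps_of_poly (B x))) \<le> C)"
    using r e1(1) e(1) by (intro exI[of _ r] conjI exI[of _ "min e1 e"] exI[of _ "2 * C"]) auto
qed

lemma fam_locbnd: "fam S B F \<Longrightarrow> locbnd S F"
  by (induction rule: fam.induct)
    (auto intro: locbnd_const locbnd_constant locbnd_add locbnd_mult locbnd_inverse S smooth_on_imp_continuous_on fgeo_X)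

lemma fam_fgeo: "fam S B F \<Longrightarrow> x \<in> S \<Longrightarrow> fgeo (F x)"
  using fam_locbnd[of F] unfolding locbnd_def fgeo_def by (metis centre_in_ball)

text \<open>Near \<open>x\<close> the first factor and its derivative decay geometrically, the
  second factor and its derivative are bounded, both uniformly; the differentiated series therefore
  converges uniformly by the Weierstrass test.\<close>

lemma hip_line_derivative:
  assumes F: "fam S B F" "fdiff S F F'" "fam S B (F' v)" and G: "fam S B G" "fdiff S G G'" "fam S B (G' v)"
    and x: "x \<in> S"
  shows "((\<lambda>t. hip (F (x + t *\<^sub>R v)) (G (x + t *\<^sub>R v))) has_vector_derivative
      (hip (F' v x) (G x) + hip (F x) (G' v x))) (at 0)"
proof -
  obtain r e C where 1: "r > 1" "e > 0" "ball x e \<subseteq> S"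
    "\<forall>y\<in>ball x e. \<forall>n. wnorm r n (F y) \<le> C \<and> wnorm r n (F' v y) \<le> C"
    using locbnd_common[OF fam_locbnd[OF F(1)] fam_locbnd[OF F(3)] x] by blast
  obtain r' e' C' where 2: "r' > 1" "e' > 0" "ball x e' \<subseteq> S"
    "\<forall>y\<in>ball x e'. \<forall>n. wnorm r' n (G y) \<le> C' \<and> wnorm r' n (G' v y) \<le> C'"
    using locbnd_common[OF fam_locbnd[OF G(1)] fam_locbnd[OF G(3)] x] by blast
  define \<rho> where "\<rho> = 1 / r"
  have \<rho>: "0 < \<rho>" "\<rho> < 1" using 1(1) by (auto simp: \<rho>_def)
  define ee where "ee = min e e'"
  have bF: "cmod (fps_nth (F y) n) \<le> C * \<rho> ^ n" "cmod (fps_nth (F' v y) n) \<le> C * \<rho> ^ n" if "y \<in> ball x ee" for y n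
    unfolding \<rho>_def using that 1 by (auto intro!: wnorm_coeff_bound simp: ee_def)
  have bG: "cmod (fps_nth (G y) n) \<le> C'" "cmod (fps_nth (G' v y) n) \<le> C'" if "y \<in> ball x ee" for y n
  proof -
    have "wnorm r' 0 (G y) \<le> C'" using 2(4) that by (auto simp: ee_def)
    then have "C' \<ge> 0" using wnorm_nonneg[of r' 0 "G y"] 2(1) by linarith
    moreover have "(1 / r') ^ n \<le> 1" using 2(1) by (intro power_le_one) auto
    ultimately have "C' * (1 / r') ^ n \<le> C'" by (simp add: mult_left_le)
    moreover have "cmod (fps_nth (G y) n) \<le> C' * (1 / r') ^ n" "cmod (fps_nth (G' v y) n) \<le> C' * (1 / r') ^ n"
      using that 2 by (auto intro!: wnorm_coeff_bound simp: ee_def)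
    ultimately show "cmod (fps_nth (G y) n) \<le> C'" "cmod (fps_nth (G' v y) n) \<le> C'" by linarith+
  qed
  have ee0: "ee > 0" using 1 2 by (simp add: ee_def)
  then have xb: "x \<in> ball x ee" by simp
  have C0: "C \<ge> 0" using bF(1)[OF xb, of 0] by (metis mult.right_neutral norm_ge_zero order_trans power_0)
  have C'0: "C' \<ge> 0" using bG(1)[OF xb, of 0] by (meson norm_ge_zero order_trans)
  \<comment> \<open>This interval keeps x + t v inside the ball of radius \<open>ee\<close>; the 1
    added to the norm covers v = 0.\<close>
  define T where "T = {- (ee / (norm v + 1)) <..< ee / (norm v + 1)}"
  have np: "norm v + 1 > 0" by (simp add: add_nonneg_pos)
  have inb: "x + t *\<^sub>R v \<in> ball x ee" if "t \<in> T" for t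
  proof -
    have "\<bar>t\<bar> * norm v \<le> \<bar>t\<bar> * (norm v + 1)" by (simp add: mult_left_mono)
    also have "\<dots> < ee" using that np by (auto simp: T_def abs_less_iff pos_less_divide_eq[OF np] minus_less_iff)
    finally show ?thesis by (simp add: dist_norm)
  qed
  have inS: "x + t *\<^sub>R v \<in> S" if "t \<in> T" for t using inb[OF that] 1(3) by (auto simp: ee_def)
  define f where "f n t = fps_nth (F (x + t *\<^sub>R v)) n * cnj (fps_nth (G (x + t *\<^sub>R v)) n)" for n t
  define g where "g n t = fps_nth (F (x + t *\<^sub>R v)) n * cnj (fps_nth (G' v (x + t *\<^sub>R v)) n) +
     fps_nth (F' v (x + t *\<^sub>R v)) n * cnj (fps_nth (G (x + t *\<^sub>R v)) n)" for n t
  have df: "(f n has_vector_derivative g n t) (at t within T)" if t: "t \<in> T" for n t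
  proof -
    have d: "((\<lambda>y. fps_nth (F y) n) has_derivative (\<lambda>w. fps_nth (F' w (x + t *\<^sub>R v)) n)) (at (x + t *\<^sub>R v))"
      "((\<lambda>y. fps_nth (G y) n) has_derivative (\<lambda>w. fps_nth (G' w (x + t *\<^sub>R v)) n)) (at (x + t *\<^sub>R v))"
      using F(2) G(2) inS[OF t] unfolding fdiff_def by blast+
    from has_vector_derivative_at_within[OF has_vector_derivative_mult[OF has_vector_derivative_along_line[OF d(1)]
        has_vector_derivative_cnj[OF has_vector_derivative_along_line[OF d(2)]]]]
    show ?thesis unfolding f_def g_def .
  qed
  have bg: "norm (g n t) \<le> (2 * C * C') * \<rho> ^ n" if t: "t \<in> T" for n t
  proof -
    have "cmod (fps_nth (F (x + t *\<^sub>R v)) n) * cmod (fps_nth (G' v (x + t *\<^sub>R v)) n) \<le> (C * \<rho> ^ n) * C'"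
      using bF(1)[OF inb[OF t]] bG(2)[OF inb[OF t]] C0 \<rho> by (intro mult_mono) auto
    moreover have "cmod (fps_nth (F' v (x + t *\<^sub>R v)) n) * cmod (fps_nth (G (x + t *\<^sub>R v)) n) \<le> (C * \<rho> ^ n) * C'"
      using bF(2)[OF inb[OF t]] bG(1)[OF inb[OF t]] C0 \<rho> by (intro mult_mono) auto
    ultimately have "cmod (fps_nth (F (x + t *\<^sub>R v)) n) * cmod (fps_nth (G' v (x + t *\<^sub>R v)) n) +
       cmod (fps_nth (F' v (x + t *\<^sub>R v)) n) * cmod (fps_nth (G (x + t *\<^sub>R v)) n) \<le> (2 * C * C') * \<rho> ^ n"
      by (simp add: mult_ac)
    moreover have "norm (g n t) \<le> cmod (fps_nth (F (x + t *\<^sub>R v)) n) * cmod (fps_nth (G' v (x + t *\<^sub>R v)) n) +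
       cmod (fps_nth (F' v (x + t *\<^sub>R v)) n) * cmod (fps_nth (G (x + t *\<^sub>R v)) n)"
      unfolding g_def by (rule order_trans[OF norm_triangle_ineq]) (simp add: norm_mult)
    ultimately show ?thesis by linarith
  qed
  have smM: "summable (\<lambda>n. (2 * C * C') * \<rho> ^ n)" using \<rho> by (intro summable_mult summable_geometric) auto
  have ul: "uniform_limit T (\<lambda>n t. \<Sum>i<n. g i t) (\<lambda>t. \<Sum>i. g i t) sequentially"
    by (rule Weierstrass_m_test[OF bg smM])
  have smf: "summable (\<lambda>n. f n t)" if t: "t \<in> T" for t
    unfolding f_def using inS[OF t] F(1) G(1) by (intro summable_hip fam_fgeo)
  have "0 \<in> T" using ee0 np by (simp add: T_def)
  have "convex T" unfolding T_def by simp
  have "\<exists>h. \<forall>t\<in>T. (\<lambda>n. f n t) sums h t \<and> (h has_derivative (\<lambda>k. k *\<^sub>R (\<Sum>i. g i t))) (at t within T)"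
  proof (rule has_derivative_series[OF \<open>convex T\<close>])
    show "(f n has_derivative (\<lambda>k. k *\<^sub>R g n t)) (at t within T)" if "t \<in> T" for n t
      using df[OF that] by (simp add: has_vector_derivative_def)
    show "\<forall>\<^sub>F n in sequentially. \<forall>t\<in>T. \<forall>k. norm ((\<Sum>i<n. k *\<^sub>R g i t) - k *\<^sub>R (\<Sum>i. g i t)) \<le> \<epsilon> * norm k" if "\<epsilon> > 0" for \<epsilon>
    proof -
      have "\<forall>\<^sub>F n in sequentially. \<forall>t\<in>T. dist (\<Sum>i<n. g i t) (\<Sum>i. g i t) < \<epsilon>"
        using ul that unfolding uniform_limit_iff by blast
      then show ?thesis
      proof (rule eventually_mono, intro ballI allI)
        fix n t and k :: real
        assume a: "\<forall>t\<in>T. dist (\<Sum>i<n. g i t) (\<Sum>i. g i t) < \<epsilon>" and t: "t \<in> T"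
        have "norm ((\<Sum>i<n. k *\<^sub>R g i t) - k *\<^sub>R (\<Sum>i. g i t)) = \<bar>k\<bar> * dist (\<Sum>i<n. g i t) (\<Sum>i. g i t)"
          by (simp add: dist_norm flip: scaleR_right.sum scaleR_diff_right)
        also have "\<dots> \<le> \<bar>k\<bar> * \<epsilon>" using a t by (intro mult_left_mono) auto
        finally show "norm ((\<Sum>i<n. k *\<^sub>R g i t) - k *\<^sub>R (\<Sum>i. g i t)) \<le> \<epsilon> * norm k" by (simp add: mult.commute)
      qed
    qed
    show "0 \<in> T" by fact
    show "(\<lambda>n. f n 0) sums (\<Sum>n. f n 0)" using smf[OF \<open>0 \<in> T\<close>] by (rule summable_sums)
  qed
  then obtain h where h: "\<forall>t\<in>T. (\<lambda>n. f n t) sums h t \<and> (h has_derivative (\<lambda>k. k *\<^sub>R (\<Sum>i. g i t))) (at t within T)" by blast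
  have hT: "h t = hip (F (x + t *\<^sub>R v)) (G (x + t *\<^sub>R v))" if "t \<in> T" for t
    using h that by (auto simp: hinner_def f_def sums_iff)
  have "open T" unfolding T_def by simp
  have "(h has_derivative (\<lambda>k. k *\<^sub>R (\<Sum>i. g i 0))) (at 0)"
    using h \<open>0 \<in> T\<close> at_within_open[OF \<open>0 \<in> T\<close> \<open>open T\<close>] by metis
  then have "((\<lambda>t. hip (F (x + t *\<^sub>R v)) (G (x + t *\<^sub>R v))) has_vector_derivative (\<Sum>i. g i 0)) (at 0)"
    unfolding has_vector_derivative_def
    using has_derivative_cong_open[OF \<open>open T\<close> \<open>0 \<in> T\<close>, of h "\<lambda>t. hip (F (x + t *\<^sub>R v)) (G (x + t *\<^sub>R v))"] hT by blast
  moreover have "(\<Sum>i. g i 0) = hip (F' v x) (G x) + hip (F x) (G' v x)"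
    unfolding g_def hinner_def using x F G
    by (subst suminf_add) (auto intro!: summable_hip fam_fgeo simp: add.commute)
  ultimately show ?thesis by simp
qed

end

section \<open>Pairings with the symbol\<close>

lemma Cauchy_pairing:
  assumes "fgeo e" "fgeo e'" "fgeo f" "fgeo g"
  shows "(\<lambda>n. \<Sum>i\<le>n. (fps_nth e i * cnj (fps_nth f i)) * (fps_nth e' (n - i) * cnj (fps_nth g (n - i))))
     sums (hip e f * hip e' g)"
proof -
  from fgeo_bounded[OF assms(3)] obtain M where M: "\<And>n. cmod (fps_nth f n) \<le> M" by blast
  from fgeo_bounded[OF assms(4)] obtain M' where M': "\<And>n. cmod (fps_nth g n) \<le> M'" by blast
  show ?thesis unfolding hinner_def
    by (rule Cauchy_product_sums[OF summable_geo_bounded(1)[OF assms(1) M] summable_geo_bounded(1)[OF assms(2) M']])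
qed

text \<open>In coefficient \<open>n\<close> of the product, \<open>U n\<close> may be read as U at i
  + (n - i) for each i. The separated expansion of \<open>U\<close> turns the sum into Cauchy
  products of two inner products.\<close>

lemma pairing_expand:
  assumes u: "\<And>i k. U (i + k) = (\<Sum>j\<in>UNIV. a j * fps_nth (e j) i * fps_nth (e j) k)"
    and e: "\<And>j::'n::finite. fgeo (e j)" and fg: "fgeo f" "fgeo g"
  shows "(\<lambda>n. U n * cnj (fps_nth (f * g) n)) sums (\<Sum>j\<in>UNIV. a j * hip (e j) f * hip (e j) g)"
proof -
  have "U n * cnj (fps_nth (f * g) n) =
      (\<Sum>j\<in>UNIV. a j * (\<Sum>i\<le>n. (fps_nth (e j) i * cnj (fps_nth f i)) * (fps_nth (e j) (n - i) * cnj (fps_nth g (n - i)))))" for n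
  proof -
    have "U n * cnj (fps_nth (f * g) n) = (\<Sum>i\<le>n. U (i + (n - i)) * (cnj (fps_nth f i) * cnj (fps_nth g (n - i))))"
      unfolding fps_mult_nth atLeast0AtMost by (simp add: sum_distrib_left)
    also have "\<dots> = (\<Sum>i\<le>n. \<Sum>j\<in>UNIV. a j * ((fps_nth (e j) i * cnj (fps_nth f i)) * (fps_nth (e j) (n - i) * cnj (fps_nth g (n - i)))))"
      unfolding u sum_distrib_right by (simp add: mult_ac)
    also have "\<dots> = (\<Sum>j\<in>UNIV. \<Sum>i\<le>n. a j * ((fps_nth (e j) i * cnj (fps_nth f i)) * (fps_nth (e j) (n - i) * cnj (fps_nth g (n - i)))))"
      by (rule sum.swap)
    finally show ?thesis by (simp add: sum_distrib_left)
  qed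
  moreover have "(\<lambda>n. \<Sum>j\<in>UNIV. a j * (\<Sum>i\<le>n. (fps_nth (e j) i * cnj (fps_nth f i)) * (fps_nth (e j) (n - i) * cnj (fps_nth g (n - i)))))
      sums (\<Sum>j\<in>UNIV. a j * (hip (e j) f * hip (e j) g))"
    by (intro sums_sum sums_mult Cauchy_pairing e fg)
  ultimately show ?thesis by (simp add: mult.assoc)
qed

context inv_spec
begin

text \<open>This is (u|e g) = (H e|g) with H e = al e: pairing with a product evaluates the Hankel
  form, and orthogonality leaves one term.\<close>

lemma hip_u_et:
  assumes "fgeo g"
  shows "hip u (et j * g) = al j * hip (et j) g"
proof -
  have "hip u (et j * g) = (\<Sum>k\<in>UNIV. (of_real (w k) * al k) * hip (et k) (et j) * hip (et k) g)"
    unfolding hinner_def[of "fps_nth u"]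
    by (rule sums_unique[symmetric], rule pairing_expand) (auto simp: u_nth_add fgeo_et assms)
  also have "\<dots> = (\<Sum>k\<in>UNIV. if k = j then al j * hip (et j) g else 0)"
    unfolding gram_et by (intro sum.cong refl) (use w_pos[of j] in auto)
  finally show ?thesis by simp
qed

text \<open>The additional factor \<open>fps_X\<close> replaces H by K.\<close>

lemma hip_u_eta:
  assumes "fgeo g"
  shows "hip u (fps_X * (eta m * g)) = be m * hip (eta m) g"
proof -
  have "(\<lambda>n. fps_nth u (Suc n) * cnj (fps_nth (eta m * g) n)) sums
      (\<Sum>k\<in>UNIV. (be k / of_real (q k)) * hip (eta k) (eta m) * hip (eta k) g)"
    by (rule pairing_expand[where U="\<lambda>n. fps_nth u (Suc n)"]) (use u_nth_add_Suc in \<open>auto simp: fgeo_eta assms\<close>)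
  then have "(\<lambda>n. fps_nth u (Suc n) * cnj (fps_nth (fps_X * (eta m * g)) (Suc n))) sums
      (\<Sum>k\<in>UNIV. (be k / of_real (q k)) * hip (eta k) (eta m) * hip (eta k) g)" by simp
  then have "(\<lambda>n. fps_nth u n * cnj (fps_nth (fps_X * (eta m * g)) n)) sums
      ((\<Sum>k\<in>UNIV. (be k / of_real (q k)) * hip (eta k) (eta m) * hip (eta k) g) + fps_nth u 0 * cnj (fps_nth (fps_X * (eta m * g)) 0))"
    by (rule sums_Suc)
  then have "hip u (fps_X * (eta m * g)) = (\<Sum>k\<in>UNIV. (be k / of_real (q k)) * hip (eta k) (eta m) * hip (eta k) g)"
    by (simp add: hinner_def sums_iff)
  also have "\<dots> = (\<Sum>k\<in>UNIV. if k = m then be m * hip (eta m) g else 0)"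
    unfolding gram_eta by (intro sum.cong refl) (use q_pos[of m] in auto)
  finally show ?thesis by simp
qed

text \<open>The recursion for the coefficients is real, and by injectivity of the Cauchy matrix its
  imaginary part has only the solution 0.\<close>

lemma eta_real:
  assumes "\<And>j. Im (al j) = 0" "\<And>m. Im (be m) = 0"
  shows "Im (fps_nth (eta m) n) = 0"
proof -
  have al_re: "Re (al j) \<noteq> 0" for j using al_nz[of j] assms(1)[of j] by (simp add: complex_eq_iff)
  have "\<forall>m. Im (fps_nth (eta m) n) = 0"
  proof (induction n)
    case 0
    have "Re (al j) * (\<Sum>m\<in>UNIV. c j m * Im (fps_nth (eta m) 0)) = 0" for j
      using arg_cong[OF et_0[of j], of Im] assms(1)[of j] by (simp add: et_nth)
    then show ?case using c_injective[of "\<lambda>m. Im (fps_nth (eta m) 0)"] al_re by simp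
  next
    case (Suc n)
    have "Re (al j) * (\<Sum>m\<in>UNIV. c j m * Im (fps_nth (eta m) (Suc n))) = 0" for j
      using arg_cong[OF et_Suc[of j n], of Im] assms Suc by (simp add: et_nth)
    then show ?case using c_injective[of "\<lambda>m. Im (fps_nth (eta m) (Suc n))"] al_re by simp
  qed
  then show ?thesis by blast
qed

end

section \<open>Smoothness of the inverse map\<close>

definition poly_smooth :: "'a::real_normed_vector set \<Rightarrow> ('a \<Rightarrow> complex poly) \<Rightarrow> bool" where
  "poly_smooth S p \<longleftrightarrow> (\<forall>k. smooth_on S (\<lambda>x. coeff (p x) k))"

lemma poly_smooth_const: "open S \<Longrightarrow> poly_smooth S (\<lambda>x. p)"
  unfolding poly_smooth_def by (auto intro: smooth_on_const)

lemma poly_smooth_mult: "open S \<Longrightarrow> poly_smooth S p \<Longrightarrow> poly_smooth S q \<Longrightarrow> poly_smooth S (\<lambda>x. p x * q x)"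
  unfolding poly_smooth_def coeff_mult by (auto intro!: smooth_on_sum smooth_on_mult)

lemma poly_smooth_sum: "open S \<Longrightarrow> (\<And>i. i \<in> A \<Longrightarrow> poly_smooth S (p i)) \<Longrightarrow> poly_smooth S (\<lambda>x. \<Sum>i\<in>A. p i x)"
  unfolding poly_smooth_def coeff_sum by (auto intro!: smooth_on_sum)

lemma poly_smooth_prod: "open S \<Longrightarrow> (\<And>i. i \<in> A \<Longrightarrow> poly_smooth S (p i)) \<Longrightarrow> poly_smooth S (\<lambda>x. \<Prod>i\<in>A. p i x)"
  by (induction A rule: infinite_finite_induct) (auto intro: poly_smooth_const poly_smooth_mult)

lemma poly_smooth_det:
  "open S \<Longrightarrow> (\<And>i j. poly_smooth S (\<lambda>x. M x $ i $ j)) \<Longrightarrow> poly_smooth S (\<lambda>x. det (M x))"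
  unfolding det_def by (intro poly_smooth_sum poly_smooth_mult poly_smooth_prod poly_smooth_const)

lemma poly_smooth_linear:
  "open S \<Longrightarrow> smooth_on S a \<Longrightarrow> smooth_on S b \<Longrightarrow> poly_smooth S (\<lambda>x. [:a x, b x:])"
  unfolding poly_smooth_def
proof
  fix k assume a: "open S" "smooth_on S a" "smooth_on S b"
  show "smooth_on S (\<lambda>x. coeff [:a x, b x:] k)"
  proof (cases k)
    case (Suc n)
    with a show ?thesis by (cases n) (auto intro: smooth_on_const)
  qed (use a in simp)
qed

lemma open_OmegaN: "open (OmegaN ix)"
proof -
  have "OmegaN ix = (\<Inter>i\<in>UNIV. {x. snd x $ i < fst x $ i} \<inter> {x. 0 < snd x $ i}) \<inter>
     (\<Inter>i\<in>UNIV. \<Inter>j\<in>{j. ix j = Suc (ix i)}. {x. fst x $ j < snd x $ i})"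
    by (auto simp: OmegaN_def)
  also have "open \<dots>"
    by (intro open_Int open_INT finite_code ballI) (auto intro!: open_Collect_less continuous_intros)
  finally show ?thesis .
qed

abbreviation (input) Om :: "('n::finite \<Rightarrow> nat) \<Rightarrow> 'n angles set" where
  "Om ix \<equiv> OmegaN ix \<times> UNIV"

lemma open_Om: "open (Om ix)" by (intro open_Times open_OmegaN open_UNIV)

lemma bounded_linear_coords:
  "bounded_linear (\<lambda>x::'n::finite angles. fst (fst x) $ i)" "bounded_linear (\<lambda>x::'n angles. snd (fst x) $ i)"
  "bounded_linear (\<lambda>x::'n angles. fst (snd x) $ i)" "bounded_linear (\<lambda>x::'n angles. snd (snd x) $ i)"
  by (intro bounded_linear_compose[OF bounded_linear_vec_nth] bounded_linear_compose[OF bounded_linear_fst]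
      bounded_linear_compose[OF bounded_linear_snd] bounded_linear_fst bounded_linear_snd)+

locale szego =
  fixes ix :: "'n::finite \<Rightarrow> nat"
  assumes ix: "bij_betw ix UNIV {..<CARD('n)}"
begin

abbreviation "\<Omega> \<equiv> Om ix"

lemma smooth_sx: "smooth_on \<Omega> (\<lambda>x. sx x i)" and smooth_tx: "smooth_on \<Omega> (\<lambda>x. tx x i)"
  unfolding sx_def tx_def
  by (intro smooth_on_divide smooth_on_const open_Om smooth_on_bounded_linear bounded_linear_coords; simp)+

lemma sx_pos: "x \<in> \<Omega> \<Longrightarrow> sx x i > 0" and tx_pos: "x \<in> \<Omega> \<Longrightarrow> tx x i > 0" and sx_neq_tx: "x \<in> \<Omega> \<Longrightarrow> sx x i \<noteq> tx x j"
proof -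
  assume "x \<in> \<Omega>"
  then interpret inv_spec ix "sx x" "tx x" "alx x" "bex x" by (rule inv_spec_x[OF ix])
  show "sx x i > 0" "tx x i > 0" "sx x i \<noteq> tx x j" by (rule s_pos t_pos s_neq_t)+
qed

lemma smooth_alx: "smooth_on \<Omega> (\<lambda>x. alx x i)"
  unfolding alx_def
proof (intro smooth_on_mult open_Om)
  have "smooth_on \<Omega> (\<lambda>x. sqrt (sx x i))"
    by (rule smooth_on_compose[OF open_Om smooth_sx smooth_on_sqrt]) (use sx_pos in auto)
  then show "smooth_on \<Omega> (\<lambda>x. complex_of_real (sqrt (sx x i)))"
    by (rule smooth_on_bounded_linear_comp[OF open_Om bounded_linear_of_real])
  show "smooth_on \<Omega> (\<lambda>x. cis (fst (snd x) $ i))"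
    by (rule smooth_on_compose[OF open_Om smooth_on_bounded_linear[OF open_Om bounded_linear_coords(3)] smooth_on_cis]) auto
qed

lemma smooth_bex: "smooth_on \<Omega> (\<lambda>x. bex x i)"
  unfolding bex_def
proof (intro smooth_on_mult open_Om)
  have "smooth_on \<Omega> (\<lambda>x. sqrt (tx x i))"
    by (rule smooth_on_compose[OF open_Om smooth_tx smooth_on_sqrt]) (use tx_pos in auto)
  then show "smooth_on \<Omega> (\<lambda>x. complex_of_real (sqrt (tx x i)))"
    by (rule smooth_on_bounded_linear_comp[OF open_Om bounded_linear_of_real])
  show "smooth_on \<Omega> (\<lambda>x. cis (- (snd (snd x) $ i)))"
    by (rule smooth_on_compose[OF open_Om smooth_on_minus[OF open_Om smooth_on_bounded_linear[OF open_Om bounded_linear_coords(4)]] smooth_on_cis]) auto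
qed

definition cF :: "'n \<Rightarrow> 'n \<Rightarrow> 'n angles \<Rightarrow> complex" where
  "cF j m x = complex_of_real (cmat (sx x) (tx x) j m)"

lemma smooth_cF: "smooth_on \<Omega> (cF j m)"
proof -
  have "smooth_on \<Omega> (\<lambda>x. cmat (sx x) (tx x) j m)"
    unfolding cmat_def
    by (intro smooth_on_divide smooth_on_const smooth_on_diff smooth_sx smooth_tx open_Om) (use sx_neq_tx in auto)
  then show ?thesis unfolding cF_def by (rule smooth_on_bounded_linear_comp[OF open_Om bounded_linear_of_real])
qed

lemma px_nth: "px x $ j $ m = [:alx x j * cF j m x, - (bex x m * cF j m x):]"
  by (simp add: px_def pmat_def cF_def)

lemma poly_smooth_px: "poly_smooth \<Omega> (\<lambda>x. px x $ j $ m)"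
  unfolding px_nth by (intro poly_smooth_linear smooth_on_minus smooth_on_mult smooth_alx smooth_bex smooth_cF open_Om)

lemma poly_smooth_cramer: "poly_smooth \<Omega> (\<lambda>x. cramer_poly (px x) (\<lambda>_. 1) m)"
  unfolding cramer_poly_def
proof (intro poly_smooth_det open_Om)
  show "poly_smooth \<Omega> (\<lambda>x. (\<chi> i j. if j = m then [:1:] else px x $ i $ j) $ i $ j)" for i j
    using poly_smooth_px poly_smooth_const[OF open_Om] by (cases "j = m") auto
qed

lemma deg_px: "degree (px x $ i $ j) \<le> 1" for x :: "'n angles" by (simp add: px_nth)

lemma deg_det: "degree (det (px x)) \<le> CARD('n)" for x :: "'n angles"
  using degree_det_le[of "px x" "\<lambda>_. 1"] deg_px by simp

lemma deg_cramer: "degree (cramer_poly (px x) (\<lambda>_. 1) m) \<le> CARD('n)" for x :: "'n angles"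
  unfolding cramer_poly_def
  using degree_det_le[of "\<chi> i j. if j = m then [:1:] else px x $ i $ j" "\<lambda>_. 1"] deg_px by simp

lemma det_px_nz: "x \<in> \<Omega> \<Longrightarrow> cmod z \<le> 1 \<Longrightarrow> poly (det (px x)) z \<noteq> 0"
proof -
  assume "x \<in> \<Omega>" and z: "cmod z \<le> 1"
  then interpret inv_spec ix "sx x" "tx x" "alx x" "bex x" by (intro inv_spec_x[OF ix])
  show ?thesis using det_P_nz[OF z] by (simp add: px_def)
qed

sublocale polyfam_disc \<Omega> "\<lambda>x. det (px x)" "CARD('n)"
proof unfold_locales
  show "open \<Omega>" by (rule open_Om)
  show "smooth_on \<Omega> (\<lambda>x. coeff (det (px x)) k)" for k
    using poly_smooth_det[OF open_Om poly_smooth_px] unfolding poly_smooth_def by blast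
  show "coeff (det (px x)) 0 \<noteq> 0" if "x \<in> \<Omega>" for x using det_px_nz[OF that, of 0] by (simp add: poly_0_coeff_0)
qed (use deg_det det_px_nz in auto)

lemma smooth_gmap: "smooth_on \<Omega> (gmap ix)"
proof -
  have d: "smooth_on \<Omega> (\<lambda>x. inverse (poly (det (px x)) 0))"
  proof (rule smooth_on_inverse[OF open_Om])
    show "smooth_on \<Omega> (\<lambda>x. poly (det (px x)) 0)" unfolding poly_0_coeff_0 by (rule Bsm)
  qed (use det_px_nz in auto)
  have 1: "smooth_on \<Omega> (\<lambda>x. coeff (nump (px x)) k)" for k
  proof -
    have "poly_smooth \<Omega> (\<lambda>x. \<Sum>m\<in>UNIV. cramer_poly (px x) (\<lambda>_. 1) m)"
      by (intro poly_smooth_sum open_Om poly_smooth_cramer)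
    then show ?thesis unfolding nump_def coeff_smult
      by (intro smooth_on_mult open_Om d) (simp add: poly_smooth_def)
  qed
  have 2: "smooth_on \<Omega> (\<lambda>x. coeff (denp (px x)) k)" for k
    unfolding denp_def coeff_smult by (intro smooth_on_mult open_Om d Bsm)
  have "gmap ix = (\<lambda>x. (\<chi> i. coeff (nump (px x)) (ix i), \<chi> i. coeff (denp (px x)) (ix i + 1)))"
    by (auto simp: gmap_def params_of_def fun_eq_iff)
  then show ?thesis using 1 2 by (simp only:) (intro smooth_on_Pair smooth_on_vec_lambda open_Om)
qed

section \<open>The symplectic form in action-angle coordinates\<close>

abbreviation "fm \<equiv> fam \<Omega> (\<lambda>x. det (px x))"

definition etaF :: "'n \<Rightarrow> 'n angles \<Rightarrow> complex fps" where "etaF m x = cramer_fps (px x) (\<lambda>_. 1) m"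
definition etF :: "'n \<Rightarrow> 'n angles \<Rightarrow> complex fps" where "etF j x = (\<Sum>m\<in>UNIV. fps_const (cF j m x) * etaF m x)"
definition uF :: "'n angles \<Rightarrow> complex fps" where "uF x = (\<Sum>m\<in>UNIV. etaF m x)"
definition pF :: "'n \<Rightarrow> 'n \<Rightarrow> 'n angles \<Rightarrow> complex fps" where
  "pF j m x = fps_const (alx x j * cF j m x) + fps_const (- (bex x m * cF j m x)) * fps_X"

lemma pF_eq: "pF j m x = fps_of_poly (px x $ j $ m)"
  by (simp add: pF_def px_nth fps_of_poly_pCons fps_of_poly_const)

lemma fam_etaF: "fm (etaF m)"
  unfolding etaF_def cramer_fps_def
  using poly_smooth_cramer deg_cramer unfolding poly_smooth_def by (intro fam.fmult fam.finv fam_poly) auto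

lemma fam_etF: "fm (etF j)"
  unfolding etF_def by (intro fam_sum fam.fmult fam.fconst smooth_cF fam_etaF)

lemma fam_uF: "fm uF"
  unfolding uF_def by (intro fam_sum fam_etaF)

text \<open>A choice of derivative family. Its values on \<Omega> are determined, and by
  \<open>fam_deriv\<close> it lies in the same algebra, so it can be differentiated again.\<close>

definition dfam :: "('n angles \<Rightarrow> complex fps) \<Rightarrow> 'n angles \<Rightarrow> 'n angles \<Rightarrow> complex fps" where
  "dfam F = (SOME F'. (\<forall>v. fm (F' v)) \<and> fdiff \<Omega> F F')"

lemma dfam: "fm F \<Longrightarrow> fm (dfam F v)" "fm F \<Longrightarrow> fdiff \<Omega> F (dfam F)"
proof -
  have *: "(\<forall>v. fm (dfam F v)) \<and> fdiff \<Omega> F (dfam F)" if "fm F"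
    unfolding dfam_def by (rule someI_ex[OF fam_deriv[OF that]])
  show "fm F \<Longrightarrow> fm (dfam F v)" "fm F \<Longrightarrow> fdiff \<Omega> F (dfam F)" using * by blast+
qed

lemma dfam_eqI:
  assumes "fm F" "fdiff \<Omega> F F'" "x \<in> \<Omega>"
  shows "dfam F v x = F' v x"
  using fdiff_unique[OF open_Om dfam(2)[OF assms(1)] assms(2) refl assms(3)] .

lemma dfam_nth: "fm F \<Longrightarrow> x \<in> \<Omega> \<Longrightarrow> fps_nth (dfam F v x) n = frechet_derivative (\<lambda>y. fps_nth (F y) n) (at x) v"
  using fdiff_frechet[OF dfam(2)] by simp

lemma dfam_symmetric:
  assumes F: "fm F" and x: "x \<in> \<Omega>"
  shows "dfam (dfam F v) w x = dfam (dfam F w) v x"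
proof (rule fps_ext)
  fix n
  have "fps_nth (dfam (dfam F v) w x) n =
      frechet_derivative (\<lambda>y. frechet_derivative (\<lambda>z. fps_nth (F z) n) (at y) v) (at x) w" for v w
    unfolding dfam_nth[OF dfam(1)[OF F] x]
    by (intro fun_cong[OF frechet_derivative_cong_open[OF open_Om x]] dfam_nth[OF F])
  then show "fps_nth (dfam (dfam F v) w x) n = fps_nth (dfam (dfam F w) v x) n"
    using clairaut[OF open_Om fam_smooth_nth[OF F] x] by simp
qed

lemma frechet_derivative_line:
  assumes "f differentiable (at x)" "((\<lambda>t. f (x + t *\<^sub>R v)) has_vector_derivative d) (at 0)"
  shows "frechet_derivative f (at x) v = d"
proof -
  have "(f has_derivative frechet_derivative f (at x)) (at (x + 0 *\<^sub>R v))"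
    using assms(1) by (simp add: frechet_derivative_works)
  from vector_derivative_unique_at[OF has_vector_derivative_along_line[OF this] assms(2)] show ?thesis .
qed

text \<open>Differentiating D \<eta> = 1 gives D \<eta>' = - D' \<eta>. Multiplication from the left
  by the row \<zeta> with entries w_j et_j, for which \<zeta> D = (1, ..., 1), turns the left side
  into \<Sum> \<eta>'_m, the derivative of u, without inverting D.\<close>

lemma du_formula:
  assumes x: "x \<in> \<Omega>"
  shows "dfam uF v x = - (\<Sum>j\<in>UNIV. \<Sum>m\<in>UNIV.
    (fps_const (of_real (interlacing.w (sx x) (tx x) j)) * etF j x) *
    (fps_const (frechet_derivative (\<lambda>y. alx y j * cF j m y) (at x) v) +
     fps_const (frechet_derivative (\<lambda>y. - (bex y m * cF j m y)) (at x) v) * fps_X) * etaF m x)"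
proof -
  interpret J: inv_spec ix "sx x" "tx x" "alx x" "bex x" by (rule inv_spec_x[OF ix x])
  have eta: "etaF m x = J.eta m" for m by (simp add: etaF_def J.eta_def px_def)
  have et: "etF j x = J.et j" for j by (simp add: etF_def J.et_def eta cF_def)
  define P' where "P' j m v x = fps_const (frechet_derivative (\<lambda>y. alx y j * cF j m y) (at x) v) +
     (fps_const (frechet_derivative (\<lambda>y. - (bex y m * cF j m y)) (at x) v) * fps_X + fps_const (- (bex x m * cF j m x)) * 0)" for j m v x
  have P': "fdiff \<Omega> (pF j m) (P' j m)" for j m
    unfolding pF_def P'_def
    by (intro fdiff_add fdiff_mult fdiff_const fdiff_constant smooth_on_mult smooth_on_minus smooth_alx smooth_bex smooth_cF open_Om)
  have one: "(\<Sum>m\<in>UNIV. pF j m y * etaF m y) = 1" if "y \<in> \<Omega>" for y j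
  proof -
    interpret Jy: inv_spec ix "sx y" "tx y" "alx y" "bex y" by (rule inv_spec_x[OF ix that])
    show ?thesis using Jy.eta_eq[of j] by (simp add: pF_eq etaF_def Jy.eta_def px_def)
  qed
  have "fdiff \<Omega> (\<lambda>y. \<Sum>m\<in>UNIV. pF j m y * etaF m y) (\<lambda>v y. \<Sum>m\<in>UNIV. P' j m v y * etaF m y + pF j m y * dfam (etaF m) v y)" for j
    by (intro fdiff_sum fdiff_mult P' dfam(2) fam_etaF)
  from fdiff_unique[OF open_Om this fdiff_constant one x]
  have z: "(\<Sum>m\<in>UNIV. P' j m v x * etaF m x + pF j m x * dfam (etaF m) v x) = 0" for j .
  define \<zeta> where "\<zeta> j = fps_const (complex_of_real (J.w j)) * etF j x" for j
  have zeta: "(\<Sum>j\<in>UNIV. \<zeta> j * pF j m x) = 1" for m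
    using J.zeta_eq[of m] by (simp add: \<zeta>_def et pF_eq px_def mult.commute)
  have "0 = (\<Sum>j\<in>UNIV. \<zeta> j * (\<Sum>m\<in>UNIV. P' j m v x * etaF m x + pF j m x * dfam (etaF m) v x))" using z by simp
  also have "\<dots> = (\<Sum>j\<in>UNIV. \<Sum>m\<in>UNIV. \<zeta> j * P' j m v x * etaF m x) + (\<Sum>j\<in>UNIV. \<Sum>m\<in>UNIV. \<zeta> j * pF j m x * dfam (etaF m) v x)"
    by (simp add: sum.distrib sum_distrib_left distrib_left mult.assoc)
  also have "(\<Sum>j\<in>UNIV. \<Sum>m\<in>UNIV. \<zeta> j * pF j m x * dfam (etaF m) v x) = (\<Sum>m\<in>UNIV. (\<Sum>j\<in>UNIV. \<zeta> j * pF j m x) * dfam (etaF m) v x)"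
    unfolding sum_distrib_right by (rule sum.swap)
  also have "\<dots> = dfam uF v x"
  proof -
    have "fdiff \<Omega> uF (\<lambda>v y. \<Sum>m\<in>UNIV. dfam (etaF m) v y)"
      unfolding uF_def by (intro fdiff_sum dfam(2) fam_etaF)
    from dfam_eqI[OF fam_uF this x] show ?thesis by (simp add: zeta)
  qed
  finally have "0 = (\<Sum>j\<in>UNIV. \<Sum>m\<in>UNIV. \<zeta> j * P' j m v x * etaF m x) + dfam uF v x" .
  from minus_unique[OF this[symmetric]]
  have "dfam uF v x = - (\<Sum>j\<in>UNIV. \<Sum>m\<in>UNIV. \<zeta> j * P' j m v x * etaF m x)" by (rule sym)
  then show ?thesis by (simp add: \<zeta>_def P'_def)
qed

definition vphi :: "'n \<Rightarrow> 'n angles" where "vphi j = ((0, 0), (axis j 1, 0))"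
definition vtheta :: "'n \<Rightarrow> 'n angles" where "vtheta m = ((0, 0), (0, axis m 1))"

lemma shift_vphi: "sx (x + t *\<^sub>R vphi j) = sx x" "tx (x + t *\<^sub>R vphi j) = tx x" "bex (x + t *\<^sub>R vphi j) = bex x"
  "cF k m (x + t *\<^sub>R vphi j) = cF k m x"
  by (auto simp: sx_def[abs_def] tx_def[abs_def] bex_def[abs_def] cF_def vphi_def fun_eq_iff)

lemma shift_vtheta: "sx (x + t *\<^sub>R vtheta j) = sx x" "tx (x + t *\<^sub>R vtheta j) = tx x" "alx (x + t *\<^sub>R vtheta j) = alx x"
  "cF k m (x + t *\<^sub>R vtheta j) = cF k m x"
  by (auto simp: sx_def[abs_def] tx_def[abs_def] alx_def[abs_def] cF_def vtheta_def fun_eq_iff)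

lemma cis_line: "((\<lambda>t. cis (a + t * b)) has_vector_derivative (of_real b * \<i> * cis a)) (at 0)"
proof -
  have "((\<lambda>z. exp (\<i> * (of_real a + z * of_real b))) has_field_derivative of_real b * \<i> * exp (\<i> * of_real a)) (at (of_real 0))"
    by (auto intro!: derivative_eq_intros)
  from has_vector_derivative_real_field[OF this] show ?thesis by (simp add: cis_conv_exp)
qed

lemma alx_vphi: "((\<lambda>t. alx (x + t *\<^sub>R vphi j) k) has_vector_derivative (if k = j then \<i> * alx x j else 0)) (at 0)"
proof -
  have "(\<lambda>t. alx (x + t *\<^sub>R vphi j) k) = (\<lambda>t. complex_of_real (sqrt (sx x k)) * cis (fst (snd x) $ k + t * (if k = j then 1 else 0)))"
    by (unfold alx_def shift_vphi) (auto simp: vphi_def axis_def fun_eq_iff)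
  moreover have "((\<lambda>t. complex_of_real (sqrt (sx x k)) * cis (fst (snd x) $ k + t * (if k = j then 1 else 0))) has_vector_derivative
      complex_of_real (sqrt (sx x k)) * (of_real (if k = j then 1 else 0) * \<i> * cis (fst (snd x) $ k))) (at 0)"
    by (rule has_vector_derivative_mult_right[OF cis_line])
  ultimately show ?thesis by (cases "k = j") (simp_all add: alx_def mult_ac)
qed

lemma bex_vtheta: "((\<lambda>t. bex (x + t *\<^sub>R vtheta j) k) has_vector_derivative (if k = j then - (\<i> * bex x j) else 0)) (at 0)"
proof -
  have "(\<lambda>t. bex (x + t *\<^sub>R vtheta j) k) = (\<lambda>t. complex_of_real (sqrt (tx x k)) * cis (- (snd (snd x) $ k) + t * (if k = j then -1 else 0)))"
    by (unfold bex_def shift_vtheta) (auto simp: vtheta_def axis_def fun_eq_iff intro!: arg_cong[where f=cis])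
  moreover have "((\<lambda>t. complex_of_real (sqrt (tx x k)) * cis (- (snd (snd x) $ k) + t * (if k = j then -1 else 0))) has_vector_derivative
      complex_of_real (sqrt (tx x k)) * (of_real (if k = j then -1 else 0) * \<i> * cis (- (snd (snd x) $ k)))) (at 0)"
    by (rule has_vector_derivative_mult_right[OF cis_line])
  ultimately show ?thesis by (cases "k = j") (simp_all add: bex_def mult_ac)
qed

text \<open>Only row \<open>j\<close> of the matrix depends on \<phi>_j, with derivative i al_j
  c_jm; summing c_jm \<eta>_m restores \<open>etF j\<close>, whence the square.\<close>

lemma du_phi:
  assumes x: "x \<in> \<Omega>"
  shows "dfam uF (vphi j) x = fps_const (- \<i> * alx x j * of_real (interlacing.w (sx x) (tx x) j)) * (etF j x * etF j x)"
proof -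
  have a: "frechet_derivative (\<lambda>y. alx y k * cF k m y) (at x) (vphi j) = (if k = j then \<i> * alx x j * cF j m x else 0)" for k m
  proof (rule frechet_derivative_line)
    show "(\<lambda>y. alx y k * cF k m y) differentiable at x"
      by (rule smooth_on_imp_differentiable[OF smooth_on_mult[OF open_Om smooth_alx smooth_cF] x])
    show "((\<lambda>t. alx (x + t *\<^sub>R vphi j) k * cF k m (x + t *\<^sub>R vphi j)) has_vector_derivative
        (if k = j then \<i> * alx x j * cF j m x else 0)) (at 0)"
      unfolding shift_vphi using has_vector_derivative_mult_left[OF alx_vphi[of x j k], of "cF k m x"]
      by (cases "k = j") auto
  qed
  have b: "frechet_derivative (\<lambda>y. - (bex y m * cF k m y)) (at x) (vphi j) = 0" for k m
  proof (rule frechet_derivative_line)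
    show "(\<lambda>y. - (bex y m * cF k m y)) differentiable at x"
      by (rule smooth_on_imp_differentiable[OF smooth_on_minus[OF open_Om smooth_on_mult[OF open_Om smooth_bex smooth_cF]] x])
  qed (simp add: shift_vphi)
  let ?w = "\<lambda>j. complex_of_real (interlacing.w (sx x) (tx x) j)"
  have "dfam uF (vphi j) x = - (\<Sum>k\<in>UNIV. if k = j then (\<Sum>m\<in>UNIV. (fps_const (?w j) * etF j x) * fps_const (\<i> * alx x j * cF j m x) * etaF m x) else 0)"
    unfolding du_formula[OF x] a b by (intro arg_cong[where f=uminus] sum.cong refl) auto
  also have "\<dots> = - (\<Sum>m\<in>UNIV. (fps_const (?w j) * etF j x) * fps_const (\<i> * alx x j * cF j m x) * etaF m x)" by simp
  also have "(\<Sum>m\<in>UNIV. (fps_const (?w j) * etF j x) * fps_const (\<i> * alx x j * cF j m x) * etaF m x) =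
     fps_const (\<i> * alx x j * ?w j) * (etF j x * (\<Sum>m\<in>UNIV. fps_const (cF j m x) * etaF m x))"
    unfolding sum_distrib_left by (intro sum.cong refl) (simp only: fps_const_mult[symmetric] mult_ac)
  also have "(\<Sum>m\<in>UNIV. fps_const (cF j m x) * etaF m x) = etF j x" by (simp add: etF_def)
  finally show ?thesis by (simp flip: fps_const_neg)
qed

text \<open>Only column \<open>m\<close> depends on \<theta>_m, and the weighted column sum of the
  \<open>etF k\<close> is \<open>etaF m\<close> divided by q_m.\<close>

lemma du_theta:
  assumes x: "x \<in> \<Omega>"
  shows "dfam uF (vtheta m) x = fps_const (- \<i> * bex x m / of_real (interlacing.q (sx x) (tx x) m)) * (fps_X * (etaF m x * etaF m x))"
proof -
  interpret J: inv_spec ix "sx x" "tx x" "alx x" "bex x" by (rule inv_spec_x[OF ix x])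
  have eta: "etaF m x = J.eta m" for m by (simp add: etaF_def J.eta_def px_def)
  have et: "etF j x = J.et j" for j by (simp add: etF_def J.et_def eta cF_def)
  have a: "frechet_derivative (\<lambda>y. alx y k * cF k l y) (at x) (vtheta m) = 0" for k l
  proof (rule frechet_derivative_line)
    show "(\<lambda>y. alx y k * cF k l y) differentiable at x"
      by (rule smooth_on_imp_differentiable[OF smooth_on_mult[OF open_Om smooth_alx smooth_cF] x])
  qed (simp add: shift_vtheta)
  have b: "frechet_derivative (\<lambda>y. - (bex y l * cF k l y)) (at x) (vtheta m) = (if l = m then \<i> * bex x m * cF k m x else 0)" for k l
  proof (rule frechet_derivative_line)
    show "(\<lambda>y. - (bex y l * cF k l y)) differentiable at x"
      by (rule smooth_on_imp_differentiable[OF smooth_on_minus[OF open_Om smooth_on_mult[OF open_Om smooth_bex smooth_cF]] x])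
    show "((\<lambda>t. - (bex (x + t *\<^sub>R vtheta m) l * cF k l (x + t *\<^sub>R vtheta m))) has_vector_derivative
        (if l = m then \<i> * bex x m * cF k m x else 0)) (at 0)"
      unfolding shift_vtheta
      using has_vector_derivative_minus[OF has_vector_derivative_mult_left[OF bex_vtheta[of x m l], of "cF k l x"]]
      by (cases "l = m") auto
  qed
  let ?w = "\<lambda>j. complex_of_real (J.w j)"
  have "dfam uF (vtheta m) x = - (\<Sum>k\<in>UNIV. \<Sum>l\<in>UNIV. if l = m then (fps_const (?w k) * etF k x) * (fps_const (\<i> * bex x m * cF k m x) * fps_X) * etaF m x else 0)"
    unfolding du_formula[OF x] a b by (intro arg_cong[where f=uminus] sum.cong refl) auto
  also have "\<dots> = - (\<Sum>k\<in>UNIV. (fps_const (?w k) * etF k x) * (fps_const (\<i> * bex x m * cF k m x) * fps_X) * etaF m x)" by simp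
  also have "(\<Sum>k\<in>UNIV. (fps_const (?w k) * etF k x) * (fps_const (\<i> * bex x m * cF k m x) * fps_X) * etaF m x) =
     fps_const (\<i> * bex x m) * (fps_X * (etaF m x * (\<Sum>k\<in>UNIV. fps_const (?w k * cF k m x) * etF k x)))"
    unfolding sum_distrib_left by (intro sum.cong refl) (simp only: fps_const_mult[symmetric] mult_ac)
  also have "(\<Sum>k\<in>UNIV. fps_const (?w k * cF k m x) * etF k x) = fps_const (1 / of_real (J.q m)) * etaF m x"
    by (rule fps_ext) (use J.sum_w_et[of m] in \<open>simp add: fps_sum_nth et eta cF_def\<close>)
  also have "fps_const (\<i> * bex x m) * (fps_X * (etaF m x * (fps_const (1 / of_real (J.q m)) * etaF m x))) =
    fps_const (\<i> * bex x m * (1 / of_real (J.q m))) * (fps_X * (etaF m x * etaF m x))"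
    by (simp only: fps_const_mult[symmetric] mult_ac)
  finally show ?thesis by (simp flip: fps_const_neg)
qed

section \<open>The pulled back form on angle directions\<close>

definition om :: "'n angles \<Rightarrow> 'n angles \<Rightarrow> 'n angles \<Rightarrow> real" where
  "om x v w = 4 * Im (hip (dfam uF v x) (dfam uF w x))"

lemma fgeo_dfam: "fm F \<Longrightarrow> x \<in> \<Omega> \<Longrightarrow> fgeo (dfam F v x)"
  by (rule fam_fgeo[OF dfam(1)])

lemma line_in_\<Omega>:
  assumes "x \<in> \<Omega>"
  shows "\<exists>\<delta>>0. \<forall>t. \<bar>t\<bar> < \<delta> \<longrightarrow> x + t *\<^sub>R v \<in> \<Omega>"
proof -
  have "open ((\<lambda>t. x + t *\<^sub>R v) -` \<Omega>)"
    by (rule open_vimage[OF open_Om]) (intro continuous_intros)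
  moreover have "0 \<in> (\<lambda>t. x + t *\<^sub>R v) -` \<Omega>" using assms by simp
  ultimately obtain \<delta> where "\<delta> > 0" "ball 0 \<delta> \<subseteq> (\<lambda>t. x + t *\<^sub>R v) -` \<Omega>" using openE by blast
  then show ?thesis by (intro exI[of _ \<delta>]) (auto simp: subset_iff)
qed

lemma line_derivative_cong:
  assumes "x \<in> \<Omega>" "\<And>y. y \<in> \<Omega> \<Longrightarrow> f y = g y" "((\<lambda>t. f (x + t *\<^sub>R v)) has_vector_derivative d) (at 0)"
  shows "((\<lambda>t. g (x + t *\<^sub>R v)) has_vector_derivative d) (at 0)"
proof -
  obtain \<delta> where \<delta>: "\<delta> > 0" "\<forall>t. \<bar>t\<bar> < \<delta> \<longrightarrow> x + t *\<^sub>R v \<in> \<Omega>" using line_in_\<Omega>[OF assms(1)] by blast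
  show ?thesis unfolding has_vector_derivative_def
  proof (rule has_derivative_transform_within_open[OF assms(3)[unfolded has_vector_derivative_def], of "{-\<delta><..<\<delta>}"])
    show "f (x + t *\<^sub>R v) = g (x + t *\<^sub>R v)" if "t \<in> {-\<delta><..<\<delta>}" for t
      using that \<delta>(2) by (intro assms(2)) (auto simp: abs_less_iff)
  qed (use \<delta> in auto)
qed

text \<open>First order perturbation: the identity \<open>key\<close> with g = e is differentiated,
  and the terms in which the derivative falls on the square are evaluated by \<open>key\<close> once
  more. What remains of the derivative of \<open>e\<close> is a difference of complex
  conjugates.\<close>

lemma pairing_variation:
  assumes e: "fm e" and Z: "fgeo Z" "fm (\<lambda>x. Z)" and a: "smooth_on \<Omega> a" and x: "x \<in> \<Omega>"
    and key: "\<And>y g. y \<in> \<Omega> \<Longrightarrow> fgeo g \<Longrightarrow> hip (uF y) (Z * (e y * g)) = a y * hip (e y) g"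
  shows "hip (dfam uF v x) (Z * (e x * e x)) =
     a x * (hip (dfam e v x) (e x) - hip (e x) (dfam e v x)) + frechet_derivative a (at x) v * hip (e x) (e x)"
proof -
  let ?e' = "dfam e v x"
  have eg: "fgeo (e x)" "fgeo ?e'" and ug: "fgeo (uF x)" "fgeo (dfam uF v x)"
    using e x fam_fgeo fgeo_dfam fam_uF by blast+
  define G' where "G' w y = 0 * (e y * e y) + Z * (dfam e w y * e y + e y * dfam e w y)" for w y
  have G: "fdiff \<Omega> (\<lambda>y. Z * (e y * e y)) G'"
    unfolding G'_def by (intro fdiff_mult fdiff_constant dfam(2) e)
  have fG': "fm (G' v)" unfolding G'_def by (simp only: mult_zero_left add_0, intro fam.fmult fam.fadd Z dfam(1) e)
  have fG: "fm (\<lambda>y. Z * (e y * e y))" by (intro fam.fmult Z e)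
  have 1: "((\<lambda>t. hip (uF (x + t *\<^sub>R v)) (Z * (e (x + t *\<^sub>R v) * e (x + t *\<^sub>R v)))) has_vector_derivative
      (hip (dfam uF v x) (Z * (e x * e x)) + hip (uF x) (G' v x))) (at 0)"
    by (rule hip_line_derivative[OF fam_uF dfam(2)[OF fam_uF] dfam(1)[OF fam_uF] fG G fG' x])
  have "((\<lambda>t. a (x + t *\<^sub>R v)) has_vector_derivative frechet_derivative a (at x) v) (at 0)"
    using has_vector_derivative_along_line[of a _ x 0 v] smooth_on_imp_has_derivative[OF a x] by simp
  from has_vector_derivative_mult[OF this hip_line_derivative[OF e dfam(2)[OF e] dfam(1)[OF e] e dfam(2)[OF e] dfam(1)[OF e] x]]
  have 2: "((\<lambda>t. a (x + t *\<^sub>R v) * hip (e (x + t *\<^sub>R v)) (e (x + t *\<^sub>R v))) has_vector_derivative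
     (a x * (hip ?e' (e x) + hip (e x) ?e') + frechet_derivative a (at x) v * hip (e x) (e x))) (at 0)" by simp
  have "((\<lambda>t. hip (uF (x + t *\<^sub>R v)) (Z * (e (x + t *\<^sub>R v) * e (x + t *\<^sub>R v)))) has_vector_derivative
     (a x * (hip ?e' (e x) + hip (e x) ?e') + frechet_derivative a (at x) v * hip (e x) (e x))) (at 0)"
    by (rule line_derivative_cong[OF x _ 2, where g="\<lambda>y. hip (uF y) (Z * (e y * e y))"])
      (simp add: key fam_fgeo[OF e])
  from vector_derivative_unique_at[OF 1 this]
  have 3: "hip (dfam uF v x) (Z * (e x * e x)) + hip (uF x) (G' v x) =
     a x * (hip ?e' (e x) + hip (e x) ?e') + frechet_derivative a (at x) v * hip (e x) (e x)" .
  have "G' v x = Z * (e x * ?e') + Z * (e x * ?e')" by (simp add: G'_def algebra_simps)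
  moreover have "hip (uF x) (Z * (e x * ?e') + Z * (e x * ?e')) = hip (uF x) (Z * (e x * ?e')) + hip (uF x) (Z * (e x * ?e'))"
    by (intro hip_add_right fgeo_mult Z eg ug)
  ultimately have "hip (uF x) (G' v x) = 2 * (a x * hip (e x) ?e')"
    using key[OF x eg(2)] by (simp only: mult_2)
  then show ?thesis using 3 by (simp add: algebra_simps)
qed

text \<open>The factor conj (-i a c) turns the imaginary part into a real part. The difference of
  conjugates is then multiplied by the real number |a|^2 and drops out; the rest is Re (conj (a)
  a'), half the derivative of |a|^2 = r.\<close>

lemma variation_real_part:
  assumes e: "fm e" and Z: "fgeo Z" "fm (\<lambda>x. Z)" and a: "smooth_on \<Omega> a" and x: "x \<in> \<Omega>"
    and key: "\<And>y g. y \<in> \<Omega> \<Longrightarrow> fgeo g \<Longrightarrow> hip (uF y) (Z * (e y * g)) = a y * hip (e y) g"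
    and r: "smooth_on \<Omega> r" "\<And>y. y \<in> \<Omega> \<Longrightarrow> a y * cnj (a y) = complex_of_real (r y)"
    and n: "hip (e x) (e x) = complex_of_real (1 / c)" "c > 0"
  shows "4 * Im (hip (dfam uF v x) (fps_const (- \<i> * a x * complex_of_real c) * (Z * (e x * e x)))) =
     2 * frechet_derivative r (at x) v"
proof -
  let ?a' = "frechet_derivative a (at x) v"
  have g: "fgeo (dfam uF v x)" "fgeo (Z * (e x * e x))" "fgeo (e x)" "fgeo (dfam e v x)"
    using e x Z fam_fgeo[OF e x] fgeo_dfam fam_uF by (auto intro: fgeo_mult)
  have ra: "Re (hip (dfam e v x) (e x) - hip (e x) (dfam e v x)) = 0"
    using hip_cnj[OF g(3,4)] by simp
  have al: "((\<lambda>t. a (x + t *\<^sub>R v)) has_vector_derivative ?a') (at 0)"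
    using has_vector_derivative_along_line[of a _ x 0 v] smooth_on_imp_has_derivative[OF a x] by simp
  from has_vector_derivative_mult[OF al has_vector_derivative_cnj[OF al]]
  have 1: "((\<lambda>t. a (x + t *\<^sub>R v) * cnj (a (x + t *\<^sub>R v))) has_vector_derivative (a x * cnj ?a' + ?a' * cnj (a x))) (at 0)" by simp
  have "((\<lambda>t. r (x + t *\<^sub>R v)) has_vector_derivative frechet_derivative r (at x) v) (at 0)"
    using has_vector_derivative_along_line[of r _ x 0 v] smooth_on_imp_has_derivative[OF r(1) x] by simp
  then have "((\<lambda>t. complex_of_real (r (x + t *\<^sub>R v))) has_vector_derivative complex_of_real (frechet_derivative r (at x) v)) (at 0)"
    unfolding has_vector_derivative_def
    by (rule bounded_linear.has_derivative[OF bounded_linear_of_real, THEN has_derivative_eq_rhs]) (auto simp: scaleR_conv_of_real)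
  then have "((\<lambda>t. a (x + t *\<^sub>R v) * cnj (a (x + t *\<^sub>R v))) has_vector_derivative complex_of_real (frechet_derivative r (at x) v)) (at 0)"
    by (rule line_derivative_cong[OF x, rotated, where f="\<lambda>y. complex_of_real (r y)" and g="\<lambda>y. a y * cnj (a y)"]) (simp add: r)
  from vector_derivative_unique_at[OF 1 this] have "a x * cnj ?a' + ?a' * cnj (a x) = complex_of_real (frechet_derivative r (at x) v)" .
  from arg_cong[OF this, of Re] have ra': "2 * Re (cnj (a x) * ?a') = frechet_derivative r (at x) v" by simp
  define D where "D = hip (dfam e v x) (e x) - hip (e x) (dfam e v x)"
  have pv: "hip (dfam uF v x) (Z * (e x * e x)) = a x * D + ?a' * hip (e x) (e x)"
    unfolding D_def by (rule pairing_variation[OF e Z a x]) (rule key)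
  have "hip (dfam uF v x) (fps_const (- \<i> * a x * complex_of_real c) * (Z * (e x * e x))) =
      cnj (- \<i> * a x * complex_of_real c) * (a x * D + ?a' * complex_of_real (1 / c))"
    unfolding hip_scale_right[OF g(2,1)] pv n ..
  also have "\<dots> = \<i> * (complex_of_real c * ((a x * cnj (a x)) * D) + cnj (a x) * ?a')"
    using n(2) by (simp add: algebra_simps)
  finally have "Im (hip (dfam uF v x) (fps_const (- \<i> * a x * complex_of_real c) * (Z * (e x * e x)))) =
     Re (complex_of_real c * ((a x * cnj (a x)) * D) + cnj (a x) * ?a')" by simp
  also have "\<dots> = c * (r x * Re D) + Re (cnj (a x) * ?a')" unfolding r(2)[OF x] by simp
  finally show ?thesis using ra ra' unfolding D_def by simp
qed

lemma frechet_sx: "frechet_derivative (\<lambda>y. sx y j) (at x) v = fst (fst v) $ j / 2"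
  and frechet_tx: "frechet_derivative (\<lambda>y. tx y j) (at x) v = snd (fst v) $ j / 2"
  for x v :: "'n angles"
proof -
  have "bounded_linear (\<lambda>x::'n angles. fst (fst x) $ j / 2)" "bounded_linear (\<lambda>x::'n angles. snd (fst x) $ j / 2)"
    by (intro bounded_linear_compose[OF bounded_linear_divide] bounded_linear_coords)+
  from frechet_derivative_eqI[OF bounded_linear_imp_has_derivative[OF this(1)]]
    frechet_derivative_eqI[OF bounded_linear_imp_has_derivative[OF this(2)]]
  show "frechet_derivative (\<lambda>y. sx y j) (at x) v = fst (fst v) $ j / 2"
    "frechet_derivative (\<lambda>y. tx y j) (at x) v = snd (fst v) $ j / 2"
    unfolding sx_def tx_def by blast+
qed

text \<open>The instance Z = 1, e = \<open>etF j\<close>, a = \<open>alx\<close> of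
  \<open>variation_real_part\<close>; its constant c is w_j, the inverse of the squared norm of
  e.\<close>

lemma om_phi:
  assumes x: "x \<in> \<Omega>"
  shows "om x v (vphi j) = fst (fst v) $ j"
proof -
  interpret J: inv_spec ix "sx x" "tx x" "alx x" "bex x" by (rule inv_spec_x[OF ix x])
  have n: "hip (etF j x) (etF j x) = complex_of_real (1 / J.w j)"
    using J.gram_et[of j j] by (simp add: etF_def J.et_def etaF_def J.eta_def cF_def px_def)
  have "4 * Im (hip (dfam uF v x) (fps_const (- \<i> * alx x j * complex_of_real (J.w j)) * (1 * (etF j x * etF j x)))) =
     2 * frechet_derivative (\<lambda>y. sx y j) (at x) v"
  proof (rule variation_real_part[OF fam_etF fgeo_1 _ smooth_alx x _ smooth_sx _ n J.w_pos])
    show "fm (\<lambda>x. 1)" using fam.fconst[OF smooth_on_const[OF open_Om, of _ 1]] by simp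
  next
    fix y assume y: "y \<in> \<Omega>"
    then interpret Jy: inv_spec ix "sx y" "tx y" "alx y" "bex y" by (rule inv_spec_x[OF ix])
    show "alx y j * cnj (alx y j) = complex_of_real (sx y j)" by (rule Jy.al_cnj)
  next
    fix y g assume y: "y \<in> \<Omega>" and "fgeo g"
    interpret Jy: inv_spec ix "sx y" "tx y" "alx y" "bex y" by (rule inv_spec_x[OF ix y])
    from Jy.hip_u_et[OF \<open>fgeo g\<close>, of j]
    show "hip (uF y) (1 * (etF j y * g)) = alx y j * hip (etF j y) g"
      by (simp add: uF_def Jy.u_def etF_def Jy.et_def etaF_def Jy.eta_def cF_def px_def)
  qed
  then show ?thesis unfolding om_def du_phi[OF x] frechet_sx by simp
qed

lemma om_theta:
  assumes x: "x \<in> \<Omega>"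
  shows "om x v (vtheta m) = snd (fst v) $ m"
proof -
  interpret J: inv_spec ix "sx x" "tx x" "alx x" "bex x" by (rule inv_spec_x[OF ix x])
  have n: "hip (etaF m x) (etaF m x) = complex_of_real (1 / (1 / J.q m))"
    using J.gram_eta[of m m] by (simp add: etaF_def J.eta_def px_def)
  have qp: "1 / J.q m > 0" using J.q_pos by simp
  have "4 * Im (hip (dfam uF v x) (fps_const (- \<i> * bex x m * complex_of_real (1 / J.q m)) * (fps_X * (etaF m x * etaF m x)))) =
     2 * frechet_derivative (\<lambda>y. tx y m) (at x) v"
  proof (rule variation_real_part[OF fam_etaF fgeo_X fam.fX smooth_bex x _ smooth_tx _ n qp])
    fix y assume y: "y \<in> \<Omega>"
    then interpret Jy: inv_spec ix "sx y" "tx y" "alx y" "bex y" by (rule inv_spec_x[OF ix])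
    show "bex y m * cnj (bex y m) = complex_of_real (tx y m)" by (rule Jy.be_cnj)
  next
    fix y g assume y: "y \<in> \<Omega>" and "fgeo g"
    interpret Jy: inv_spec ix "sx y" "tx y" "alx y" "bex y" by (rule inv_spec_x[OF ix y])
    from Jy.hip_u_eta[OF \<open>fgeo g\<close>, of m]
    show "hip (uF y) (fps_X * (etaF m y * g)) = bex y m * hip (etaF m y) g"
      by (simp add: uF_def Jy.u_def etaF_def Jy.eta_def px_def)
  qed
  then show ?thesis unfolding om_def du_theta[OF x] frechet_tx by simp
qed

lemma om_sum_right:
  assumes x: "x \<in> \<Omega>"
  shows "om x v (w + w') = om x v w + om x v w'" "om x v (c *\<^sub>R w) = c * om x v w"
    "finite A \<Longrightarrow> om x v (\<Sum>i\<in>A. g i) = (\<Sum>i\<in>A. om x v (g i))"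
proof -
  note l = fdiff_linear[OF dfam(2)[OF fam_uF] x]
  note g = fgeo_dfam[OF fam_uF x]
  show 1: "om x v (w + w') = om x v w + om x v w'" for w w' unfolding om_def l by (simp add: hip_add_right g)
  show "om x v (c *\<^sub>R w) = c * om x v w" unfolding om_def l by (simp add: hip_scale_right g)
  have 0: "om x v 0 = 0" using 1[of 0 0] by simp
  show "finite A \<Longrightarrow> om x v (\<Sum>i\<in>A. g i) = (\<Sum>i\<in>A. om x v (g i))"
    by (induction A rule: finite_induct) (auto simp: 1 0)
qed

lemma om_antisym: "x \<in> \<Omega> \<Longrightarrow> om x v w = - om x w v"
  unfolding om_def using hip_cnj[OF fgeo_dfam[OF fam_uF, of x v] fgeo_dfam[OF fam_uF, of x w]] by simp

lemma om_angle:
  assumes x: "x \<in> \<Omega>"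
  shows "om x v ((0, 0), \<tau>) = (\<Sum>j\<in>UNIV. fst (fst v) $ j * fst \<tau> $ j) + (\<Sum>m\<in>UNIV. snd (fst v) $ m * snd \<tau> $ m)"
proof -
  have "((0, 0), \<tau>) = (\<Sum>j\<in>UNIV. fst \<tau> $ j *\<^sub>R vphi j) + (\<Sum>m\<in>UNIV. snd \<tau> $ m *\<^sub>R vtheta m)"
  proof -
    have "(\<Sum>j\<in>UNIV. fst \<tau> $ j *\<^sub>R vphi j) = ((0, 0), (\<Sum>j\<in>UNIV. fst \<tau> $ j *\<^sub>R axis j 1, 0))"
      "(\<Sum>m\<in>UNIV. snd \<tau> $ m *\<^sub>R vtheta m) = ((0, 0), (0, \<Sum>m\<in>UNIV. snd \<tau> $ m *\<^sub>R axis m 1))"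
      by (simp_all add: prod_eq_iff fst_sum snd_sum vphi_def vtheta_def)
    moreover have "(\<Sum>j\<in>UNIV. y $ j *\<^sub>R axis j 1) = y" for y :: "real^'n"
      by (simp add: vec_eq_iff axis_def if_distrib cong: if_cong)
    ultimately show ?thesis by simp
  qed
  then show ?thesis by (simp add: om_sum_right[OF x] om_phi[OF x] om_theta[OF x] mult.commute)
qed

text \<open>By \<open>om_angle\<close> the form with one angle direction has the same value at all
  points, so its derivative vanishes in every direction; the expression is that derivative, expanded
  by the product rule.\<close>

lemma om_closed:
  assumes x: "x \<in> \<Omega>"
  shows "Im (hip (dfam (dfam uF v) w x) (dfam uF ((0, 0), \<tau>) x) + hip (dfam uF v x) (dfam (dfam uF ((0, 0), \<tau>)) w x)) = 0"
proof -
  note f = dfam(1)[OF fam_uF]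
  let ?d = "hip (dfam (dfam uF v) w x) (dfam uF ((0, 0), \<tau>) x) + hip (dfam uF v x) (dfam (dfam uF ((0, 0), \<tau>)) w x)"
  have "((\<lambda>t. hip (dfam uF v (x + t *\<^sub>R w)) (dfam uF ((0, 0), \<tau>) (x + t *\<^sub>R w))) has_vector_derivative ?d) (at 0)"
    by (rule hip_line_derivative[OF f dfam(2)[OF f] dfam(1)[OF f] f dfam(2)[OF f] dfam(1)[OF f] x])
  then have 1: "((\<lambda>t. Im (hip (dfam uF v (x + t *\<^sub>R w)) (dfam uF ((0, 0), \<tau>) (x + t *\<^sub>R w)))) has_vector_derivative Im ?d) (at 0)"
    unfolding has_vector_derivative_def by (rule bounded_linear.has_derivative[OF bounded_linear_Im, THEN has_derivative_eq_rhs]) auto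
  have "((\<lambda>t::real. om x v ((0, 0), \<tau>) / 4) has_vector_derivative 0) (at 0)" by simp
  then have "((\<lambda>t. Im (hip (dfam uF v (x + t *\<^sub>R w)) (dfam uF ((0, 0), \<tau>) (x + t *\<^sub>R w)))) has_vector_derivative 0) (at 0)"
  proof (rule line_derivative_cong[OF x, rotated, where f="\<lambda>y. om x v ((0, 0), \<tau>) / 4"
        and g="\<lambda>y. Im (hip (dfam uF v y) (dfam uF ((0, 0), \<tau>) y))"])
    fix y assume y: "y \<in> \<Omega>"
    have "om y v ((0, 0), \<tau>) = om x v ((0, 0), \<tau>)" unfolding om_angle[OF x] om_angle[OF y] ..
    then show "om x v ((0, 0), \<tau>) / 4 = Im (hip (dfam uF v y) (dfam uF ((0, 0), \<tau>) y))" by (simp add: om_def)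
  qed
  from vector_derivative_unique_at[OF 1 this] show ?thesis .
qed

text \<open>A displacement of the actions alone stays at zero angles, where all coefficients of
  \<open>uF\<close> are real.\<close>

lemma du_real:
  assumes x: "x \<in> \<Omega>" "snd x = 0"
  shows "Im (fps_nth (dfam uF (v, 0) x) n) = 0"
proof -
  have re: "Im (fps_nth (uF y) n) = 0" if y: "y \<in> \<Omega>" "snd y = 0" for y
  proof -
    interpret J: inv_spec ix "sx y" "tx y" "alx y" "bex y" by (rule inv_spec_x[OF ix y(1)])
    have "Im (fps_nth (J.eta m) n) = 0" for m
      by (rule J.eta_real) (simp_all add: alx_def bex_def y(2))
    then show ?thesis by (simp add: uF_def etaF_def J.eta_def px_def fps_sum_nth)
  qed
  have "((\<lambda>y. fps_nth (uF y) n) has_derivative (\<lambda>w. fps_nth (dfam uF w x) n)) (at (x + 0 *\<^sub>R (v, 0)))"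
    unfolding scaleR_zero_left add_0_right using dfam(2)[OF fam_uF] x(1) unfolding fdiff_def by blast
  from has_vector_derivative_along_line[OF this]
  have 1: "((\<lambda>t. Im (fps_nth (uF (x + t *\<^sub>R (v, 0))) n)) has_vector_derivative Im (fps_nth (dfam uF (v, 0) x) n)) (at 0)"
    unfolding has_vector_derivative_def by (rule bounded_linear.has_derivative[OF bounded_linear_Im, THEN has_derivative_eq_rhs]) auto
  obtain \<delta> where \<delta>: "\<delta> > 0" "\<forall>t. \<bar>t\<bar> < \<delta> \<longrightarrow> x + t *\<^sub>R (v, 0) \<in> \<Omega>" using line_in_\<Omega>[OF x(1)] by blast
  have "((\<lambda>t. Im (fps_nth (uF (x + t *\<^sub>R (v, 0))) n)) has_derivative (\<lambda>h. 0)) (at 0)"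
  proof (rule has_derivative_transform_within_open[of "\<lambda>_. 0" _ _ _ "{-\<delta><..<\<delta>}"])
    show "0 = Im (fps_nth (uF (x + t *\<^sub>R (v, 0))) n)" if "t \<in> {-\<delta><..<\<delta>}" for t
      using that \<delta>(2) x(2) by (intro re[symmetric]) (auto simp: abs_less_iff)
  qed (use \<delta> in auto)
  then have "((\<lambda>t. Im (fps_nth (uF (x + t *\<^sub>R (v, 0))) n)) has_vector_derivative 0) (at 0)"
    by (simp add: has_vector_derivative_def)
  from vector_derivative_unique_at[OF 1 this] show ?thesis .
qed

text \<open>On the segment from zero angles to \<open>x\<close> the form on two action directions is
  constant, because its derivative reduces to derivatives of the form on pairs with an angle
  direction. At zero angles it is the imaginary part of a series of real numbers.\<close>

lemma om_action:
  assumes x: "x \<in> \<Omega>"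
  shows "om x (a, 0) (b, 0) = 0"
proof -
  define \<tau> :: "'n angles" where "\<tau> = ((0, 0), snd x)"
  \<comment> \<open>Scaling the angles leaves the actions fixed, so the whole path lies in
    \<Omega>.\<close>
  define y where "y t = (fst x, t *\<^sub>R snd x)" for t :: real
  have y: "y t \<in> \<Omega>" for t using x by (auto simp: y_def)
  have ys: "y (t + r) = y t + r *\<^sub>R \<tau>" for t r by (simp add: y_def \<tau>_def prod_eq_iff algebra_simps)
  let ?a = "(a, 0) :: 'n angles" and ?b = "(b, 0) :: 'n angles"
  note f = dfam(1)[OF fam_uF]
  define c where "c t = hip (dfam uF ?a (y t)) (dfam uF ?b (y t))" for t
  have d0: "((\<lambda>t. Im (c t)) has_real_derivative 0) (at t)" for t
  proof -
    let ?x = "y t"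
    let ?d = "hip (dfam (dfam uF ?a) \<tau> ?x) (dfam uF ?b ?x) + hip (dfam uF ?a ?x) (dfam (dfam uF ?b) \<tau> ?x)"
    have "((\<lambda>r. c (t + r)) has_vector_derivative ?d) (at 0)"
      unfolding c_def ys
      by (rule hip_line_derivative[OF f dfam(2)[OF f] dfam(1)[OF f] f dfam(2)[OF f] dfam(1)[OF f] y])
    then have "((\<lambda>r. Im (c (t + r))) has_vector_derivative Im ?d) (at 0)"
      unfolding has_vector_derivative_def by (rule bounded_linear.has_derivative[OF bounded_linear_Im, THEN has_derivative_eq_rhs]) auto
    \<comment> \<open>Closedness on the triple of directions a, b, \<tau>: the two instances of
      \<open>om_closed\<close> share the term with the second derivative in directions a and b, and
      their difference is the claim.\<close>
    moreover have "Im ?d = 0"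
    proof -
      have g: "fgeo (dfam uF v ?x)" "fgeo (dfam (dfam uF v) w ?x)" for v w
        by (rule fgeo_dfam[OF fam_uF y] fgeo_dfam[OF f y])+
      have 1: "Im (hip (dfam (dfam uF ?b) ?a ?x) (dfam uF \<tau> ?x)) + Im (hip (dfam uF ?b ?x) (dfam (dfam uF \<tau>) ?a ?x)) = 0"
        using om_closed[OF y, of ?b ?a t "snd x"] by (simp add: \<tau>_def)
      have 2: "Im (hip (dfam (dfam uF ?a) ?b ?x) (dfam uF \<tau> ?x)) + Im (hip (dfam uF ?a ?x) (dfam (dfam uF \<tau>) ?b ?x)) = 0"
        using om_closed[OF y, of ?a ?b t "snd x"] by (simp add: \<tau>_def)
      have s: "dfam (dfam uF ?a) ?b ?x = dfam (dfam uF ?b) ?a ?x" "dfam (dfam uF \<tau>) ?a ?x = dfam (dfam uF ?a) \<tau> ?x"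
        "dfam (dfam uF \<tau>) ?b ?x = dfam (dfam uF ?b) \<tau> ?x"
        by (rule dfam_symmetric[OF fam_uF y])+
      have 3: "Im (hip (dfam (dfam uF ?a) \<tau> ?x) (dfam uF ?b ?x)) = - Im (hip (dfam uF ?b ?x) (dfam (dfam uF ?a) \<tau> ?x))"
        using hip_cnj[OF g(2)[of ?a \<tau>] g(1)[of ?b]] by simp
      show ?thesis using 1 2 3 unfolding s by simp
    qed
    ultimately have "((\<lambda>r. Im (c (t + r))) has_real_derivative 0) (at 0)"
      by (simp add: has_real_derivative_iff_has_vector_derivative)
    then show ?thesis using DERIV_at_within_shift[of "\<lambda>t. Im (c t)" 0 t 0 UNIV] by (simp add: add.commute)
  qed
  have "Im (c 1) = Im (c 0)" using DERIV_isconst_all[of "\<lambda>t. Im (c t)" 1 0] d0 by blast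
  moreover have "Im (c 0) = 0"
  proof -
    have y0: "y 0 \<in> \<Omega>" "snd (y 0) = 0" using y by (auto simp: y_def)
    have "Im (c 0) = (\<Sum>n. Im (fps_nth (dfam uF ?a (y 0)) n * cnj (fps_nth (dfam uF ?b (y 0)) n)))"
      unfolding c_def hinner_def
      by (intro bounded_linear.suminf[OF bounded_linear_Im] summable_hip fgeo_dfam fam_uF y)
    then show ?thesis using du_real[OF y0] by simp
  qed
  moreover have "y 1 = x" by (simp add: y_def prod_eq_iff)
  ultimately show ?thesis by (simp add: om_def c_def)
qed

definition std_form :: "'n angles \<Rightarrow> 'n angles \<Rightarrow> real" where
  "std_form v w = (\<Sum>i\<in>UNIV. (fst (fst v) $ i * fst (snd w) $ i - fst (fst w) $ i * fst (snd v) $ i)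
      + (snd (fst v) $ i * snd (snd w) $ i - snd (fst w) $ i * snd (snd v) $ i))"

theorem om_eq:
  assumes x: "x \<in> \<Omega>"
  shows "om x v w = std_form v w"
proof -
  have split: "v = (fst v, 0) + ((0, 0), snd v)" for v :: "'n angles" by (simp add: prod_eq_iff)
  have "om x v w = om x v (fst w, 0) + om x v ((0, 0), snd w)"
    by (subst split[of w]) (rule om_sum_right(1)[OF x])
  also have "om x v (fst w, 0) = - om x (fst w, 0) v" by (rule om_antisym[OF x])
  also have "om x (fst w, 0) v = om x (fst w, 0) (fst v, 0) + om x (fst w, 0) ((0, 0), snd v)"
    by (subst split[of v]) (rule om_sum_right(1)[OF x])
  finally show ?thesis
    unfolding om_action[OF x] om_angle[OF x] std_form_def by (simp add: sum.distrib sum_subtractf)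
qed

end

section \<open>Smooth local inverses\<close>

text \<open>Cramer's rule in orthonormal coordinates: the solution is a quotient of determinants
  with smooth entries. The common index type of the two bases makes the coordinate matrix
  square.\<close>

lemma smooth_linear_solve:
  fixes L :: "'a::euclidean_space \<Rightarrow> 'a \<Rightarrow> 'b::euclidean_space"
    and bX :: "'m::finite \<Rightarrow> 'a" and bY :: "'m \<Rightarrow> 'b"
  assumes S: "open S" and lin: "\<And>x. x \<in> S \<Longrightarrow> linear (L x)" and inj: "\<And>x. x \<in> S \<Longrightarrow> inj (L x)"
    and sm: "\<And>b. smooth_on S (\<lambda>x. L x b)"
    and bX: "bij_betw bX UNIV Basis" and bY: "bij_betw bY UNIV Basis"
  shows "\<exists>G. smooth_on S G \<and> (\<forall>x\<in>S. L x (G x) = v)"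
proof -
  define M :: "'a \<Rightarrow> real^'m^'m" where "M x = (\<chi> a b. L x (bX b) \<bullet> bY a)" for x
  define r :: "real^'m" where "r = (\<chi> a. v \<bullet> bY a)"
  define y :: "'a \<Rightarrow> real^'m" where
    "y x = (\<chi> k. det (\<chi> i j. if j = k then r $ i else M x $ i $ j) / det (M x))" for x
  define comb :: "real^'m \<Rightarrow> 'a" where "comb z = (\<Sum>b\<in>UNIV. (z $ b) *\<^sub>R bX b)" for z
  have XB: "bX b \<in> Basis" and YB: "bY b \<in> Basis" for b
    using bX bY by (auto simp: bij_betw_def)
  have Minner: "(M x *v z) $ a = L x (comb z) \<bullet> bY a" if "x \<in> S" for x z a
    unfolding M_def comb_def matrix_vector_mult_def linear_sum[OF lin[OF that]] linear_scale[OF lin[OF that]]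
    by (simp add: inner_sum_left mult.commute)
  have Yeq: "p = q" if "\<And>a. p \<bullet> bY a = q \<bullet> bY a" for p q :: 'b
  proof (rule euclidean_eqI)
    fix b :: 'b assume "b \<in> Basis"
    then obtain a where "b = bY a" using bY by (auto simp: bij_betw_def)
    then show "p \<bullet> b = q \<bullet> b" using that by simp
  qed
  have combX: "comb z \<bullet> bX c = z $ c" for z c
  proof -
    have "comb z \<bullet> bX c = (\<Sum>b\<in>UNIV. if b = c then z $ b else 0)"
      unfolding comb_def inner_sum_left inner_scaleR_left
      using bX by (intro sum.cong refl) (auto simp: inner_Basis[OF XB XB] bij_betw_def inj_def)
    then show ?thesis by simp
  qed
  have nz: "det (M x) \<noteq> 0" if x: "x \<in> S" for x
  proof -
    have "\<forall>z. M x *v z = 0 \<longrightarrow> z = 0"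
    proof (intro allI impI)
      fix z assume z: "M x *v z = 0"
      have "L x (comb z) = 0" by (rule Yeq) (use Minner[OF x, of z] z in simp)
      then have "comb z = 0" using inj[OF x] linear_injective_0[OF lin[OF x]] by blast
      then show "z = 0" using combX[of z] by (simp add: vec_eq_iff)
    qed
    then obtain B where "B ** M x = mat 1" using matrix_left_invertible_ker[of "M x"] by blast
    then have "det B * det (M x) = 1" using det_mul[of B "M x"] by simp
    then show ?thesis by auto
  qed
  have smM: "smooth_on S (\<lambda>x. M x $ i $ j)" for i j
    unfolding M_def vec_lambda_beta
    by (rule smooth_on_bounded_linear_comp[OF S bounded_linear_inner_left sm])
  have "smooth_on S (\<lambda>x. y x $ k)" for k
    unfolding y_def vec_lambda_beta
  proof (intro smooth_on_divide smooth_on_det S smM nz)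
    show "smooth_on S (\<lambda>x. (\<chi> i j. if j = k then r $ i else M x $ i $ j) $ i $ j)" for i j
      by (cases "j = k") (auto intro: smooth_on_const S smM)
  qed
  then have "smooth_on S (\<lambda>x. comb (y x))"
    unfolding comb_def by (intro smooth_on_sum smooth_on_scaleR smooth_on_const S)
  moreover have "L x (comb (y x)) = v" if x: "x \<in> S" for x
  proof (rule Yeq)
    fix a
    have "M x *v y x = r" using cramer[OF nz[OF x]] unfolding y_def by blast
    then show "L x (comb (y x)) \<bullet> bY a = v \<bullet> bY a" unfolding Minner[OF x, symmetric] by (simp add: r_def)
  qed
  ultimately show ?thesis by blast
qed

text \<open>Let G_v(x) solve Dg(x) G_v(x) = v; it is smooth in x. The derivative of F(k q) in
  direction v is DF(x) G_v(x) at x = k q, again a smooth function composed with \<open>k\<close>.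
  The compositions with \<open>k\<close> thus form a class stable under derivatives, and a merely
  continuous local inverse is smooth.\<close>

lemma smooth_on_inverse_comp:
  fixes g :: "'a::euclidean_space \<Rightarrow> 'b::euclidean_space" and F :: "'a \<Rightarrow> 'c::real_normed_vector"
    and bX :: "'m::finite \<Rightarrow> 'a" and bY :: "'m \<Rightarrow> 'b"
  assumes S: "open S" and g: "smooth_on S g" and inj: "\<And>x. x \<in> S \<Longrightarrow> inj (frechet_derivative g (at x))"
    and bX: "bij_betw bX UNIV Basis" and bY: "bij_betw bY UNIV Basis"
    and V: "open V" "k ` V \<subseteq> S" "continuous_on V k" "\<And>q. q \<in> V \<Longrightarrow> g (k q) = q"
    and F: "smooth_on S F"
  shows "smooth_on V (\<lambda>q. F (k q))"
proof (rule smooth_on_coinduct[where P="\<lambda>h. \<exists>F. smooth_on S F \<and> h = (\<lambda>q. F (k q))"])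
  show "\<exists>F'. smooth_on S F' \<and> (\<lambda>q. F (k q)) = (\<lambda>q. F' (k q))" using F by blast
  fix h :: "'b \<Rightarrow> 'c" assume "\<exists>F. smooth_on S F \<and> h = (\<lambda>q. F (k q))"
  then obtain F where F: "smooth_on S F" and h: "h = (\<lambda>q. F (k q))" by blast
  let ?L = "\<lambda>x. frechet_derivative g (at x)"
  have lin: "linear (?L x)" if "x \<in> S" for x
    using linear_frechet_derivative[OF smooth_on_imp_differentiable[OF g that]] .
  have "\<forall>v. \<exists>G. smooth_on S G \<and> (\<forall>x\<in>S. ?L x (G x) = v)"
    using smooth_linear_solve[OF S lin inj smooth_on_frechet_derivative[OF g] bX bY] by blast
  then obtain G where G0: "\<forall>v. smooth_on S (G v) \<and> (\<forall>x\<in>S. ?L x (G v x) = v)" by (rule choice[THEN exE])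
  then have G: "smooth_on S (G v)" and LG: "x \<in> S \<Longrightarrow> ?L x (G v x) = v" for v x by blast+
  have dk: "(k has_derivative (\<lambda>v. G v (k q))) (at q)" if q: "q \<in> V" for q
  proof -
    have kq: "k q \<in> S" using V(2) q by blast
    have GL: "G v (k q) = \<xi>" if "?L (k q) \<xi> = v" for v \<xi>
      using injD[OF inj[OF kq], of "G v (k q)" \<xi>] LG[OF kq, of v] that by simp
    have "linear (\<lambda>v. G v (k q))"
      by (rule linearI; rule GL) (simp_all add: linear_add[OF lin[OF kq]] linear_scale[OF lin[OF kq]] LG[OF kq])
    then have "bounded_linear (\<lambda>v. G v (k q))" by (simp add: linear_conv_bounded_linear)
    moreover have "(\<lambda>v. G v (k q)) \<circ> ?L (k q) = id" using GL by (auto simp: fun_eq_iff)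
    moreover have "continuous (at q) k" using V(1,3) q continuous_on_eq_continuous_at by blast
    ultimately show ?thesis
      by (rule has_derivative_inverse_basic[OF smooth_on_imp_has_derivative[OF g kq] _ _ _ V(1) q V(4)])
  qed
  have dh: "(h has_derivative (\<lambda>v. frechet_derivative F (at (k q)) (G v (k q)))) (at q)" if q: "q \<in> V" for q
    unfolding h
    by (rule has_derivative_compose[OF dk[OF q] smooth_on_imp_has_derivative[OF F]]) (use V(2) q in blast)
  have "smooth_on S (\<lambda>x. frechet_derivative F (at x) (G v x))" for v
  proof (rule smooth_on_cong[OF S])
    show "smooth_on S (\<lambda>x. \<Sum>b\<in>Basis. (G v x \<bullet> b) *\<^sub>R frechet_derivative F (at x) b)"
      by (intro smooth_on_sum smooth_on_scaleR S smooth_on_frechet_derivative F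
          smooth_on_bounded_linear_comp[OF S bounded_linear_inner_left G])
    fix x assume "x \<in> S"
    then have l: "linear (frechet_derivative F (at x))"
      using linear_frechet_derivative[OF smooth_on_imp_differentiable[OF F]] by blast
    show "(\<Sum>b\<in>Basis. (G v x \<bullet> b) *\<^sub>R frechet_derivative F (at x) b) = frechet_derivative F (at x) (G v x)"
      unfolding linear_scale[OF l, symmetric] linear_sum[OF l, symmetric] euclidean_representation ..
  qed
  then show "(\<forall>x\<in>V. h differentiable (at x)) \<and>
      (\<forall>v. \<exists>g. (\<exists>F. smooth_on S F \<and> g = (\<lambda>q. F (k q))) \<and> (\<forall>x\<in>V. frechet_derivative h (at x) v = g x))"
    using dh frechet_derivative_eqI[OF dh] by (auto simp: differentiable_def)
qed (rule V(1))

lemma frechet_derivative_chain: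
  assumes "open S" "x \<in> S" "g differentiable (at x)" "f differentiable (at (g x))" "\<And>y. y \<in> S \<Longrightarrow> f (g y) = h y"
  shows "frechet_derivative f (at (g x)) (frechet_derivative g (at x) v) = frechet_derivative h (at x) v"
proof -
  have "((\<lambda>y. f (g y)) has_derivative (\<lambda>v. frechet_derivative f (at (g x)) (frechet_derivative g (at x) v))) (at x)"
    using assms(3,4) unfolding frechet_derivative_works by (rule has_derivative_compose)
  then have "(h has_derivative (\<lambda>v. frechet_derivative f (at (g x)) (frechet_derivative g (at x) v))) (at x)"
    using has_derivative_cong_open[of S x "\<lambda>y. f (g y)" h] assms(1,2,5) by blast
  from frechet_derivative_eqI[OF this] show ?thesis by simp
qed

lemma cis_eq_imp_eq:
  assumes "cis a = cis b" "\<bar>a - b\<bar> < 2"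
  shows "a = b"
proof -
  have "cis (a - b) = 1" using assms(1) by (simp flip: cis_divide)
  then have "cos (a - b) = 1" by (metis cis.simps(1) one_complex.simps(1))
  then obtain n :: int where n: "a - b = of_int n * 2 * pi" unfolding cos_one_2pi_int by blast
  have "n = 0"
  proof (rule ccontr)
    assume "n \<noteq> 0"
    then have "1 \<le> \<bar>real_of_int n\<bar>" by linarith
    then have "2 * pi \<le> \<bar>a - b\<bar>" unfolding n by (simp add: abs_mult)
    then show False using assms(2) pi_gt3 by linarith
  qed
  then show ?thesis using n by simp
qed

context szego
begin

lemma coords_abs_le:
  fixes v :: "'n angles"
  shows "\<bar>fst (snd v) $ i\<bar> \<le> norm v" "\<bar>snd (snd v) $ i\<bar> \<le> norm v"
proof -
  have "\<bar>fst (snd v) $ i\<bar> \<le> norm (fst (snd v))" by (rule component_le_norm_cart)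
  also have "\<dots> \<le> norm (snd v)" using norm_fst_le[of "fst (snd v)" "snd (snd v)"] by simp
  also have "\<dots> \<le> norm v" using norm_snd_le[of "snd v" "fst v"] by simp
  finally show "\<bar>fst (snd v) $ i\<bar> \<le> norm v" .
  have "\<bar>snd (snd v) $ i\<bar> \<le> norm (snd (snd v))" by (rule component_le_norm_cart)
  also have "\<dots> \<le> norm (snd v)" using norm_snd_le[of "snd (snd v)" "fst (snd v)"] by simp
  also have "\<dots> \<le> norm v" using norm_snd_le[of "snd v" "fst v"] by simp
  finally show "\<bar>snd (snd v) $ i\<bar> \<le> norm v" .
qed

text \<open>Two points of a ball of radius 1 have angles differing by less than 2, which is below
  the period of \<open>cis\<close>.\<close>

lemma cover_locally_inj: "inj_on cover (ball (x0 :: 'n angles) 1)"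
proof (rule inj_onI)
  fix x y :: "'n angles" assume xy: "x \<in> ball x0 1" "y \<in> ball x0 1" and c: "cover x = cover y"
  have d: "norm (x - y) < 2"
    using xy dist_triangle[of x y x0] by (simp add: dist_commute dist_norm)
  have 1: "cis (fst (snd x) $ i) = cis (fst (snd y) $ i)" "cis (snd (snd x) $ i) = cis (snd (snd y) $ i)" for i
    using c by (auto simp: cover_def vec_eq_iff)
  have "fst (snd x) $ i = fst (snd y) $ i" "snd (snd x) $ i = snd (snd y) $ i" for i
    using coords_abs_le[of "x - y" i] d by (auto intro!: cis_eq_imp_eq 1)
  moreover have "fst x = fst y" using c by (simp add: cover_def)
  ultimately show "x = y" by (simp add: prod_eq_iff vec_eq_iff)
qed

lemma smooth_cover: "smooth_on UNIV (cover :: 'n angles \<Rightarrow> _)"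
proof -
  have 1: "smooth_on UNIV (\<lambda>x::'n angles. cis (l x))" if "bounded_linear l" for l
    by (rule smooth_on_compose[OF open_UNIV smooth_on_bounded_linear[OF open_UNIV that] smooth_on_cis]) simp
  show ?thesis unfolding cover_def
    by (intro smooth_on_Pair smooth_on_vec_lambda open_UNIV 1 bounded_linear_coords
        smooth_on_bounded_linear bounded_linear_fst)
qed

lemma frechet_cis:
  fixes l :: "'n angles \<Rightarrow> real"
  assumes "bounded_linear l"
  shows "frechet_derivative (\<lambda>y. cis (l y)) (at x) v = of_real (l v) * \<i> * cis (l x)"
proof (rule frechet_derivative_line)
  have "smooth_on UNIV (\<lambda>x::'n angles. cis (l x))"
    by (rule smooth_on_compose[OF open_UNIV smooth_on_bounded_linear[OF open_UNIV assms] smooth_on_cis]) simp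
  then show "(\<lambda>y. cis (l y)) differentiable (at x)" by (rule smooth_on_imp_differentiable) simp
  show "((\<lambda>t. cis (l (x + t *\<^sub>R v))) has_vector_derivative of_real (l v) * \<i> * cis (l x)) (at 0)"
    unfolding linear_add[OF bounded_linear.linear[OF assms]] linear_scale[OF bounded_linear.linear[OF assms]]
      real_scaleR_def by (rule cis_line)
qed

lemma smooth_ratfun: "smooth_on UNIV (\<lambda>p. ratfun ix p n)"
proof -
  have lin: "bounded_linear (\<lambda>p::(complex^'n) \<times> (complex^'n). fst p $ i)"
    "bounded_linear (\<lambda>p::(complex^'n) \<times> (complex^'n). snd p $ i)" for i
    by (intro bounded_linear_compose[OF bounded_linear_vec_nth] bounded_linear_fst bounded_linear_snd)+
  have smm: "smooth_on UNIV (\<lambda>p::(complex^'n) \<times> (complex^'n). coeff (monom (f p) m) k)"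
    if "bounded_linear f" for f :: "(complex^'n) \<times> (complex^'n) \<Rightarrow> complex" and m k
    unfolding coeff_monom
    by (cases "m = k") (auto intro: smooth_on_const smooth_on_bounded_linear that)
  have A: "smooth_on UNIV (\<lambda>p::(complex^'n) \<times> (complex^'n). coeff (polyA ix (fst p)) k)" for k
    unfolding polyA_def coeff_sum by (intro smooth_on_sum open_UNIV smm[OF lin(1)])
  have B: "smooth_on UNIV (\<lambda>p::(complex^'n) \<times> (complex^'n). coeff (polyB ix (snd p)) k)" for k
    unfolding polyB_def coeff_sum coeff_add
    by (intro smooth_on_add smooth_on_const smooth_on_sum open_UNIV smm[OF lin(2)])
  have lt: "ix i < CARD('n)" for i using ix by (auto simp: bij_betw_def)
  have dA: "degree (polyA ix a) \<le> CARD('n)" for a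
    unfolding polyA_def
    by (intro degree_sum_le order_trans[OF degree_monom_le]) (use lt less_imp_le in auto)
  have dB: "degree (polyB ix a) \<le> CARD('n)" for a
    unfolding polyB_def
    by (intro degree_add_le degree_sum_le order_trans[OF degree_monom_le]) (use lt in \<open>auto simp: Suc_le_eq\<close>)
  interpret F: polyfam UNIV "\<lambda>p::(complex^'n) \<times> (complex^'n). polyB ix (snd p)" "CARD('n)"
    by unfold_locales (use B dB coeff_polyB(2)[OF ix] in auto)
  show ?thesis unfolding ratfun_fps[OF ix]
    by (intro F.fam_smooth_nth fam.fmult fam.finv F.fam_poly[where e="CARD('n)"] A dA)
qed

abbreviation "Dg \<equiv> \<lambda>x. frechet_derivative (gmap ix) (at x)"

lemma ratfun_gmap: "x \<in> \<Omega> \<Longrightarrow> ratfun ix (gmap ix x) = fps_nth (uF x)"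
proof -
  assume "x \<in> \<Omega>"
  then interpret J: inv_spec ix "sx x" "tx x" "alx x" "bex x" by (rule inv_spec_x[OF ix])
  show ?thesis using J.ratfun_params by (simp add: gmap_def px_def uF_def etaF_def J.u_def J.eta_def)
qed

lemma omega_pull_gmap:
  assumes x: "x \<in> \<Omega>"
  shows "omega_pull ix (gmap ix x) (Dg x v) (Dg x w) = std_form v w"
proof -
  have "frechet_derivative (\<lambda>q. ratfun ix q n) (at (gmap ix x)) (Dg x v) = fps_nth (dfam uF v x) n" for n v
    unfolding dfam_nth[OF fam_uF x]
    by (rule frechet_derivative_chain[OF open_Om x smooth_on_imp_differentiable[OF smooth_gmap x]
          smooth_on_imp_differentiable[OF smooth_ratfun UNIV_I]]) (simp add: ratfun_gmap)
  then show ?thesis unfolding om_eq[OF x, symmetric] om_def omega_pull_def by simp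
qed

lemma std_form_nondegenerate:
  assumes "\<And>w. std_form v w = 0"
  shows "v = 0"
proof -
  have ax: "c * (axis i 1 :: real^'n) $ k = (if k = i then c else 0)"
    "(axis i 1 :: real^'n) $ k * c = (if k = i then c else 0)" for c i k
    by (simp_all add: axis_def)
  have "fst (fst v) $ i = 0" "snd (fst v) $ i = 0" "fst (snd v) $ i = 0" "snd (snd v) $ i = 0" for i
    using assms[of "((0, 0), (axis i 1, 0))"] assms[of "((0, 0), (0, axis i 1))"]
      assms[of "((axis i 1, 0), (0, 0))"] assms[of "((0, axis i 1), (0, 0))"]
    by (simp_all add: std_form_def ax sum_negf)
  then show ?thesis by (simp add: prod_eq_iff vec_eq_iff)
qed

lemma linear_Dg: "x \<in> \<Omega> \<Longrightarrow> linear (Dg x)"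
  using linear_frechet_derivative[OF smooth_on_imp_differentiable[OF smooth_gmap]] .

text \<open>\<open>Dg x\<close> pulls \<open>\<omega>\<close> back to a nondegenerate form, so it has no kernel.\<close>

lemma inj_Dg:
  assumes x: "x \<in> \<Omega>"
  shows "inj (Dg x)"
proof (subst linear_injective_0[OF linear_Dg[OF x]], intro allI impI)
  fix v assume v: "Dg x v = 0"
  have "std_form v w = 0" for w
  proof -
    have "std_form v w = omega_pull ix (gmap ix x) (Dg x v) (Dg x w)" by (rule omega_pull_gmap[OF x, symmetric])
    also have "\<dots> = omega_pull ix (gmap ix x) (Dg x 0) (Dg x w)" by (simp add: v linear_0[OF linear_Dg[OF x]])
    also have "\<dots> = std_form 0 w" by (rule omega_pull_gmap[OF x])
    finally show ?thesis by (simp add: std_form_def)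
  qed
  then show "v = 0" by (rule std_form_nondegenerate)
qed

text \<open>Both spaces have real dimension 4N, which is the number of elements of the index
  type.\<close>

lemma Basis_enum:
  "\<exists>bX :: ('n + 'n) + ('n + 'n) \<Rightarrow> 'n angles. bij_betw bX UNIV Basis"
  "\<exists>bY :: ('n + 'n) + ('n + 'n) \<Rightarrow> (complex^'n) \<times> (complex^'n). bij_betw bY UNIV Basis"
  by (rule finite_same_card_bij; simp)+

lemma surj_Dg:
  assumes x: "x \<in> \<Omega>"
  shows "\<exists>v. Dg x v = h"
proof -
  obtain bX :: "('n + 'n) + ('n + 'n) \<Rightarrow> 'n angles" where bX: "bij_betw bX UNIV Basis" using Basis_enum(1) by blast
  obtain bY :: "('n + 'n) + ('n + 'n) \<Rightarrow> (complex^'n) \<times> (complex^'n)" where bY: "bij_betw bY UNIV Basis"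
    using Basis_enum(2) by blast
  from smooth_linear_solve[OF open_Om linear_Dg inj_Dg smooth_on_frechet_derivative[OF smooth_gmap] bX bY, of h]
  show ?thesis using x by blast
qed

text \<open>Local injectivity comes from \<open>chi_gmap\<close>: wherever \<open>cover\<close> is
  injective, so is \<open>gmap\<close>. The local inverse obtained here is only continuous;
  \<open>smooth_on_inverse_comp\<close> upgrades it.\<close>

lemma gmap_local_section:
  assumes p: "p \<in> gen_params ix"
  shows "\<exists>V k. open V \<and> p \<in> V \<and> V \<subseteq> gen_params ix \<and> k ` V \<subseteq> \<Omega> \<and> continuous_on V k \<and> (\<forall>q\<in>V. gmap ix (k q) = q)"
proof -
  from gmap_surj[OF ix p] obtain x0 where x0: "x0 \<in> \<Omega>" and px0: "p = gmap ix x0" by blast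
  let ?S = "\<Omega> \<inter> ball x0 1"
  have S: "open ?S" by (intro open_Int open_Om open_ball)
  have cont: "continuous_on ?S (gmap ix)"
    by (rule continuous_on_subset[OF smooth_on_imp_continuous_on[OF smooth_gmap]]) simp
  have inj: "inj_on (gmap ix) ?S"
  proof (rule inj_onI)
    fix x y assume xy: "x \<in> ?S" "y \<in> ?S" and eq: "gmap ix x = gmap ix y"
    have "cover x = cover y" using chi_gmap[OF ix, of x] chi_gmap[OF ix, of y] eq xy by simp
    then show "x = y" using inj_onD[OF cover_locally_inj[of x0]] xy by blast
  qed
  have dim: "DIM((complex^'n) \<times> (complex^'n)) \<le> DIM('n angles)" by simp
  from invariance_of_domain_homeomorphism[OF S cont dim inj]
  obtain k where k: "homeomorphism ?S (gmap ix ` ?S) (gmap ix) k" by blast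
  show ?thesis
  proof (intro exI conjI)
    show "open (gmap ix ` ?S)" by (rule invariance_of_domain_gen[OF S cont inj dim])
    show "p \<in> gmap ix ` ?S" using x0 px0 by auto
    show "gmap ix ` ?S \<subseteq> gen_params ix" using gmap_in_gen[OF ix] by blast
    show "k ` gmap ix ` ?S \<subseteq> \<Omega>" "continuous_on (gmap ix ` ?S) k" "\<forall>q\<in>gmap ix ` ?S. gmap ix (k q) = q"
      using k by (auto simp: homeomorphism_def)
  qed
qed

lemma open_gen_params: "open (gen_params ix)"
proof (subst open_subopen, intro ballI)
  fix p assume "p \<in> gen_params ix"
  from gmap_local_section[OF this] show "\<exists>T. open T \<and> p \<in> T \<and> T \<subseteq> gen_params ix"
    by (elim exE conjE) (intro exI conjI)
qed

lemma smooth_chi: "smooth_on (gen_params ix) (chi_coord ix)"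
proof (rule smooth_on_local)
  fix p assume "p \<in> gen_params ix"
  from gmap_local_section[OF this] obtain V k where V: "open V" "k ` V \<subseteq> \<Omega>" "continuous_on V k"
    "\<And>q. q \<in> V \<Longrightarrow> gmap ix (k q) = q" and p: "p \<in> V" by blast
  obtain bX :: "('n + 'n) + ('n + 'n) \<Rightarrow> 'n angles" where bX: "bij_betw bX UNIV Basis" using Basis_enum(1) by blast
  obtain bY :: "('n + 'n) + ('n + 'n) \<Rightarrow> (complex^'n) \<times> (complex^'n)" where bY: "bij_betw bY UNIV Basis"
    using Basis_enum(2) by blast
  have "smooth_on V (\<lambda>q. cover (k q))"
    by (rule smooth_on_inverse_comp[OF open_Om smooth_gmap inj_Dg bX bY V smooth_on_subset[OF smooth_cover]]) auto
  then have "smooth_on V (chi_coord ix)"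
  proof (rule smooth_on_cong[OF V(1)])
    fix q assume q: "q \<in> V"
    then have "k q \<in> \<Omega>" using V(2) by blast
    from chi_gmap[OF ix this] show "cover (k q) = chi_coord ix q" unfolding V(4)[OF q] by simp
  qed
  with p show "\<exists>T. p \<in> T \<and> smooth_on T (chi_coord ix)" by blast
qed

text \<open>\<open>gmap\<close> sees the angles only through \<open>cis\<close>, so points with the
  same image under \<open>cover\<close> give the same parameters.\<close>

lemma inj_chi: "inj_on (chi_coord ix) (gen_params ix)"
proof (rule inj_onI)
  fix p q assume p: "p \<in> gen_params ix" and q: "q \<in> gen_params ix" and eq: "chi_coord ix p = chi_coord ix q"
  from gmap_surj[OF ix p] obtain x where x: "x \<in> \<Omega>" "p = gmap ix x" by blast
  from gmap_surj[OF ix q] obtain y where y: "y \<in> \<Omega>" "q = gmap ix y" by blast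
  have c: "cover x = cover y" using eq chi_gmap[OF ix x(1)] chi_gmap[OF ix y(1)] x(2) y(2) by simp
  then have f: "fst x = fst y" by (simp add: cover_def)
  have 1: "cis (fst (snd x) $ i) = cis (fst (snd y) $ i)" "cis (snd (snd x) $ i) = cis (snd (snd y) $ i)" for i
    using c by (auto simp: cover_def vec_eq_iff)
  have "sx x = sx y" "tx x = tx y" by (simp_all add: sx_def tx_def f fun_eq_iff)
  moreover from this have "alx x = alx y" "bex x = bex y"
    by (simp_all add: alx_def bex_def 1 fun_eq_iff flip: cis_cnj)
  ultimately show "p = q" unfolding x y gmap_def px_def by simp
qed

lemma chi_image: "chi_coord ix ` gen_params ix = OmegaN ix \<times> torusN"
proof
  show "chi_coord ix ` gen_params ix \<subseteq> OmegaN ix \<times> torusN"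
  proof (rule image_subsetI)
    fix p assume "p \<in> gen_params ix"
    from gmap_surj[OF ix this] obtain x where x: "x \<in> \<Omega>" "p = gmap ix x" by blast
    show "chi_coord ix p \<in> OmegaN ix \<times> torusN"
      unfolding x(2) chi_gmap[OF ix x(1)] using x(1) by (auto simp: cover_def torusN_def)
  qed
  show "OmegaN ix \<times> torusN \<subseteq> chi_coord ix ` gen_params ix"
  proof clarify
    fix I L :: "real^'n" and w z :: "complex^'n"
    assume IL: "(I, L) \<in> OmegaN ix" and wz: "(w, z) \<in> torusN"
    define x :: "'n angles" where "x = ((I, L), (\<chi> i. Arg (w $ i), \<chi> i. Arg (z $ i)))"
    have x: "x \<in> \<Omega>" using IL by (simp add: x_def)
    have c: "cis (Arg u) = u" if "cmod u = 1" for u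
      using that cis_Arg[of u] by (cases "u = 0") (auto simp: sgn_eq)
    have "cover x = ((I, L), (w, z))"
      using wz by (simp add: cover_def x_def torusN_def vec_eq_iff c)
    then show "((I, L), (w, z)) \<in> chi_coord ix ` gen_params ix"
      using chi_gmap[OF ix x] gmap_in_gen[OF ix x] by force
  qed
qed

lemma sympl_pull_gmap:
  assumes x: "x \<in> \<Omega>"
  shows "sympl_pull ix (gmap ix x) (Dg x v) (Dg x w) = std_form v w"
proof -
  let ?p = "gmap ix x"
  have dg: "gmap ix differentiable (at x)" by (rule smooth_on_imp_differentiable[OF smooth_gmap x])
  have dc: "chi_coord ix differentiable (at ?p)"
    by (rule smooth_on_imp_differentiable[OF smooth_chi gmap_in_gen[OF ix x]])
  have dl: "(\<lambda>q. l (chi_coord ix q)) differentiable (at ?p)" if "bounded_linear l" for l :: "_ \<Rightarrow> 'z::real_normed_vector"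
    using dc bounded_linear.has_derivative[OF that] unfolding differentiable_def by blast
  have lin: "bounded_linear (\<lambda>c. fst (fst c) $ i)" "bounded_linear (\<lambda>c. snd (fst c) $ i)"
     for i and c :: "((real^'n) \<times> (real^'n)) \<times> ((complex^'n) \<times> (complex^'n))"
    by (intro bounded_linear_compose[OF bounded_linear_vec_nth] bounded_linear_compose[OF bounded_linear_fst]
      bounded_linear_compose[OF bounded_linear_snd] bounded_linear_fst bounded_linear_snd)+
  have linc: "bounded_linear (\<lambda>c. fst (snd c) $ i)" "bounded_linear (\<lambda>c. snd (snd c) $ i)"
     for i and c :: "((real^'n) \<times> (real^'n)) \<times> ((complex^'n) \<times> (complex^'n))"
    by (intro bounded_linear_compose[OF bounded_linear_vec_nth] bounded_linear_compose[OF bounded_linear_fst]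
      bounded_linear_compose[OF bounded_linear_snd] bounded_linear_fst bounded_linear_snd)+
  have fl: "frechet_derivative l (at x) v = l v" if "bounded_linear l" for l :: "'n angles \<Rightarrow> real" and v
    by (rule frechet_derivative_eqI[OF bounded_linear_imp_has_derivative[OF that]])
  have I: "dreal (\<lambda>q. fst (fst (chi_coord ix q)) $ i) ?p (Dg x v) = fst (fst v) $ i" for i v
    unfolding dreal_def
    by (subst frechet_derivative_chain[OF open_Om x dg dl[OF lin(1)], where h="\<lambda>y. fst (fst y) $ i"])
      (simp_all add: chi_gmap[OF ix] cover_def fl[OF bounded_linear_coords(1)])
  have L: "dreal (\<lambda>q. snd (fst (chi_coord ix q)) $ i) ?p (Dg x v) = snd (fst v) $ i" for i v
    unfolding dreal_def
    by (subst frechet_derivative_chain[OF open_Om x dg dl[OF lin(2)], where h="\<lambda>y. snd (fst y) $ i"])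
      (simp_all add: chi_gmap[OF ix] cover_def fl[OF bounded_linear_coords(2)])
  have P: "dangle (\<lambda>q. fst (snd (chi_coord ix q)) $ i) ?p (Dg x v) = fst (snd v) $ i" for i v
    unfolding dangle_def
    by (subst frechet_derivative_chain[OF open_Om x dg dl[OF linc(1)], where h="\<lambda>y. cis (fst (snd y) $ i)"])
      (use x in \<open>simp_all add: chi_gmap[OF ix] cover_def frechet_cis[OF bounded_linear_coords(3)]\<close>)
  have T: "dangle (\<lambda>q. snd (snd (chi_coord ix q)) $ i) ?p (Dg x v) = snd (snd v) $ i" for i v
    unfolding dangle_def
    by (subst frechet_derivative_chain[OF open_Om x dg dl[OF linc(2)], where h="\<lambda>y. cis (snd (snd y) $ i)"])
      (use x in \<open>simp_all add: chi_gmap[OF ix] cover_def frechet_cis[OF bounded_linear_coords(4)]\<close>)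
  show ?thesis unfolding sympl_pull_def Let_def I L P T std_form_def ..
qed

end

text \<open>Smoothness of the inverse is expressed on the universal cover of the torus, where the
  angles are real variables: the inverse of \<open>chi_coord\<close> composed with
  \<open>cover\<close> is a smooth map on an open subset of a vector space.\<close>

theorem theorem1:
  fixes ix :: "'n::finite \<Rightarrow> nat"
  assumes "bij_betw ix UNIV {..<CARD('n)}"
  shows "open (gen_params ix) \<and>
         smooth_on (gen_params ix) (chi_coord ix) \<and>
         inj_on (chi_coord ix) (gen_params ix) \<and>
         chi_coord ix ` gen_params ix = OmegaN ix \<times> torusN \<and>
         (\<exists>g. smooth_on (OmegaN ix \<times> UNIV) g \<and>
              (\<forall>x\<in>OmegaN ix \<times> UNIV. g x \<in> gen_params ix \<and> chi_coord ix (g x) = cover x)) \<and>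
         (\<forall>p\<in>gen_params ix. \<forall>h k. omega_pull ix p h k = sympl_pull ix p h k)"
proof -
  interpret szego ix by unfold_locales (rule assms)
  have "omega_pull ix p h k = sympl_pull ix p h k" if p: "p \<in> gen_params ix" for p h k
  proof -
    from gmap_surj[OF ix p] obtain x where x: "x \<in> \<Omega>" "p = gmap ix x" by blast
    \<comment> \<open>Every tangent vector is an image under the differential of
      \<open>gmap\<close>, so both forms can be compared in action-angle coordinates, where each of
      them is \<open>std_form\<close>.\<close>
    obtain v w where "h = Dg x v" "k = Dg x w" using surj_Dg[OF x(1)] by metis
    then show ?thesis unfolding x(2) using omega_pull_gmap[OF x(1)] sympl_pull_gmap[OF x(1)] by simp
  qed
  moreover have "\<exists>g. smooth_on \<Omega> g \<and> (\<forall>x\<in>\<Omega>. g x \<in> gen_params ix \<and> chi_coord ix (g x) = cover x)"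
    using smooth_gmap gmap_in_gen[OF ix] chi_gmap[OF ix] by blast
  ultimately show ?thesis using open_gen_params smooth_chi inj_chi chi_image by blast
qed

end
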